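(* Let $L_\infty=\mathbb{P}^2\setminus\mathbb{C}^2$, $O\in L_\infty$, and let $(u,v)$ be coordinates near $O$ such that $O$ has coordinates $(0,0)$ and $(x,y):=(1/u,v/u)$ is a system of coordinates on $\mathbb{P}^2\setminus L_\infty\cong\mathbb{C}^2$. Let $\psi(u)$ be a Puiseux series in $u$ and $r$ a positive rational number. Put $\phi(x):=x\psi(1/x)$, let $[\phi(x)]_{>1-r}$ be the sum of all terms of $\phi$ of degree $>1-r$ in $x$, and let $\tilde\phi(x,\xi):=[\phi(x)]_{>1-r}+\xi x^{1-r}$, where $\xi$ is an indeterminate. Let $\delta$ be the semidegree on $\mathbb{C}[x,y]$ with generic descending Puiseux series $\tilde\phi$, and let $g_0,\ldots,g_{n+1}\in\mathbb{C}[x,x^{-1},y]$ be the key forms of $\delta$. Then the following are equivalent: (1) there exists a nonconstant polynomial $f\in\mathbb{C}[x,y]$ such that each analytic branch $C$ of the curve $f=0$ at infinity intersects $L_\infty$ at $O$ and has a Puiseux expansion $v=\theta(u)$ at $O$ such that $\operatorname{ord}_u(\theta-\psi)\ge r$; (2) $g_j$ is a polynomial (i.e. $g_j\in\mathbb{C}[x,y]$) for every $j$, $0\le j\le n+1$; (3) $g_{n+1}$ is a polynomial. Moreover, if any of these conditions holds, then $f=g_{n+1}$ satisfies the properties in (1).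
   Context: A Puiseux series in $u$ is a series in fractional powers $u^{m/p}$ (fixed $p\ge1$) with complex coefficients all of whose exponents are positive. A descending Puiseux series in $x$ is a series $\sum_{m\le M}a_mx^{m/p}$ ($M\in\mathbb{Z}$, $p\ge1$, $a_m\in\mathbb{C}$); $\deg_x$ denotes the largest exponent, $\operatorname{ord}_u$ the smallest exponent in $u$. A Puiseux expansion of a branch is determined up to conjugation, and "has a Puiseux expansion $v=\theta(u)$ such that..." means that one of the conjugates has the property. Semidegree: a map $\delta=-\nu$ on $\mathbb{C}[x,y]\setminus\{0\}$, where $\nu$ is a divisorial discrete valuation on $\mathbb{C}(x,y)$ (the order of vanishing along an irreducible curve on a normal algebraic surface birational to $\mathbb{C}^2$) centered at infinity with respect to $\mathbb{C}^2$; it extends to $\mathbb{C}[x,x^{-1},y]\setminus\{0\}$ by the same formula. A semidegree $\delta$ with $\delta(x)>0$ has generic descending Puiseux series $\tilde\phi(x,\xi)=\phi_\delta(x)+\xi x^{r_\delta}$ (where $\phi_\delta$ is a descending Puiseux series with finitely many terms, all of exponent $>r_\delta\in\mathbb{Q}$) if $\delta(f)=\delta(x)\deg_x f(x,\tilde\phi(x,\xi))$ for every nonzero $f\in\mathbb{C}[x,y]$; $\tilde\phi$ determines $\delta$, with $\delta(x)$ equal to the least positive integer $p$ such that all exponents of $x$ in $\tilde\phi(x,\xi)$ belong to $\frac1p\mathbb{Z}$. Key forms: let $\delta$ be a semidegree on $\mathbb{C}[x,y]$ with $\delta(x)>0$. The sequence of key forms of $\delta$ is the (unique, finite) sequence $g_0,\ldots,g_{n+1}\in\mathbb{C}[x,x^{-1},y]$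 such that, with $\eta_j:=\delta(g_j)$: (P0) $\eta_{j+1}<\alpha_j\eta_j=\sum_{i=0}^{j-1}\beta_{j,i}\eta_i$ for $1\le j\le n$, where $\alpha_j=\min\{\alpha\in\mathbb{Z}_{>0}:\alpha\eta_j\in\mathbb{Z}\eta_0+\cdots+\mathbb{Z}\eta_{j-1}\}$ and the $\beta_{j,i}$ are integers with $0\le\beta_{j,i}<\alpha_i$ for $1\le i<j\le n$ (only $\beta_{j,0}$ may be negative); (P1) $g_0=x$, $g_1=y$; (P2) for $1\le j\le n$ there is $\theta_j\in\mathbb{C}^*$ with $g_{j+1}=g_j^{\alpha_j}-\theta_j g_0^{\beta_{j,0}}\cdots g_{j-1}^{\beta_{j,j-1}}$; (P3) if $z_1,\ldots,z_{n+1}$ are indeterminates and $\eta$ is the weighted degree on $B:=\mathbb{C}[x,x^{-1},z_1,\ldots,z_{n+1}]$ with weights $\eta_0$ for $x$ and $\eta_j$ for $z_j$ (the value on an element being the maximum weight of its monomials), then for every $g\in\mathbb{C}[x,x^{-1},y]$, $\delta(g)=\min\{\eta(G):G\in B,\ G(x,g_1,\ldots,g_{n+1})=g\}$. *)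

theory Defs
  imports
    "HOL-Complex_Analysis.Complex_Analysis"
    "HOL-Computational_Algebra.Computational_Algebra"
    "HOL-Library.Poly_Mapping"
begin

section \<open>Bivariate polynomials and rational functions\<close>

text \<open>
  \<^typ>\<open>complex poly poly\<close> is \<open>\<complex>[x][y]\<close>: the inner variable is \<open>x\<close>, the outer one is \<open>y\<close>.
  The rings \<open>\<complex>[x, y]\<close> and \<open>\<complex>[x, 1/x, y]\<close> are viewed as subsets of the field \<open>\<complex>(x, y)\<close>.
\<close>

type_synonym ratfun = "complex poly poly fract"

definition const :: "complex \<Rightarrow> ratfun" where
  "const c = to_fract [:[:c:]:]"

definition x_var :: ratfun where
  "x_var = to_fract [:[:0, 1:]:]"

definition y_var :: ratfun where
  "y_var = to_fract [:0, 1:]"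

definition poly_ring :: "ratfun set" where
  "poly_ring = range (to_fract :: complex poly poly \<Rightarrow> ratfun)"

definition laurent_ring :: "ratfun set" where
  "laurent_ring = {h * x_var powi i | h i. h \<in> poly_ring}"

definition eval2 :: "complex poly poly \<Rightarrow> complex \<Rightarrow> complex \<Rightarrow> complex" where
  "eval2 f a b = poly (poly f [:b:]) a"

definition nonconstant :: "complex poly poly \<Rightarrow> bool" where
  "nonconstant f \<longleftrightarrow> (\<nexists>c. f = [:[:c:]:])"


section \<open>Divisorial valuations and semidegrees\<close>

definition subalgebra :: "ratfun set \<Rightarrow> bool" where
  "subalgebra A \<longleftrightarrow> range const \<subseteq> A \<and> (\<forall>a\<in>A. \<forall>b\<in>A. a + b \<in> A \<and> a * b \<in> A)"

definition integrally_closed :: "ratfun set \<Rightarrow> bool" where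
  "integrally_closed A \<longleftrightarrow>
     (\<forall>z p. lead_coeff p = 1 \<and> (\<forall>i. coeff p i \<in> A) \<and> poly p z = 0 \<longrightarrow> z \<in> A)"

text \<open>
  Coordinate rings \<open>A\<close> of affine normal surfaces with function field identified with
  \<open>\<complex>(x, y)\<close>, that is, of affine charts of normal surfaces birational to the plane.
\<close>

definition normal_surface_ring :: "ratfun set \<Rightarrow> bool" where
  "normal_surface_ring A \<longleftrightarrow>
     (\<exists>S. finite S \<and> A = subalgebra hull S) \<and>
     (\<forall>z. \<exists>a\<in>A. \<exists>b\<in>A. b \<noteq> 0 \<and> z = a / b) \<and>
     integrally_closed A"

definition prime_ideal_in :: "ratfun set \<Rightarrow> ratfun set \<Rightarrow> bool" where
  "prime_ideal_in A P \<longleftrightarrow>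
     P \<subseteq> A \<and> P \<noteq> A \<and> 0 \<in> P \<and>
     (\<forall>a\<in>P. \<forall>b\<in>P. a + b \<in> P) \<and> (\<forall>a\<in>A. \<forall>b\<in>P. a * b \<in> P) \<and>
     (\<forall>a\<in>A. \<forall>b\<in>A. a * b \<in> P \<longrightarrow> a \<in> P \<or> b \<in> P)"

definition height_one_prime :: "ratfun set \<Rightarrow> ratfun set \<Rightarrow> bool" where
  "height_one_prime A P \<longleftrightarrow>
     prime_ideal_in A P \<and> P \<noteq> {0} \<and>
     (\<forall>Q. prime_ideal_in A Q \<and> Q \<noteq> {0} \<and> Q \<subseteq> P \<longrightarrow> Q = P)"

definition localization_at :: "ratfun set \<Rightarrow> ratfun set \<Rightarrow> ratfun set" where
  "localization_at A P = {a / b | a b. a \<in> A \<and> b \<in> A - P}"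

text \<open>Valuations are functions on the whole field; their value at \<open>0\<close> is irrelevant.\<close>

definition discrete_valuation :: "(ratfun \<Rightarrow> int) \<Rightarrow> bool" where
  "discrete_valuation \<nu> \<longleftrightarrow>
     (\<forall>a b. a \<noteq> 0 \<and> b \<noteq> 0 \<longrightarrow> \<nu> (a * b) = \<nu> a + \<nu> b) \<and>
     (\<forall>a b. a \<noteq> 0 \<and> b \<noteq> 0 \<and> a + b \<noteq> 0 \<longrightarrow> min (\<nu> a) (\<nu> b) \<le> \<nu> (a + b)) \<and>
     \<nu> ` (- {0}) = UNIV"

text \<open>
  An irreducible curve \<open>E\<close> on a normal surface meets some affine chart \<open>Spec A\<close>, where it is
  the zero set of a height-one prime \<open>P\<close>; the order of vanishing along \<open>E\<close> is the normalized
  discrete valuation whose valuation ring is the local ring of the surface at \<open>E\<close>.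
\<close>

definition divisorial_valuation :: "(ratfun \<Rightarrow> int) \<Rightarrow> bool" where
  "divisorial_valuation \<nu> \<longleftrightarrow>
     discrete_valuation \<nu> \<and>
     (\<exists>A P. normal_surface_ring A \<and> height_one_prime A P \<and>
        {z. z = 0 \<or> 0 \<le> \<nu> z} = localization_at A P)"

text \<open>
  The center of \<open>\<nu>\<close> lies in the affine plane iff the valuation ring contains \<open>\<complex>[x, y]\<close>.
\<close>

definition centered_at_infinity :: "(ratfun \<Rightarrow> int) \<Rightarrow> bool" where
  "centered_at_infinity \<nu> \<longleftrightarrow> (\<exists>h\<in>poly_ring. h \<noteq> 0 \<and> \<nu> h < 0)"

text \<open>
  A semidegree is taken together with its extension \<open>\<delta> = - \<nu>\<close> to the nonzero elements of
  \<open>\<complex>(x, y)\<close>, which is determined by its values on nonzero polynomials.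
\<close>

definition semidegree :: "(ratfun \<Rightarrow> int) \<Rightarrow> bool" where
  "semidegree \<delta> \<longleftrightarrow>
     (\<exists>\<nu>. divisorial_valuation \<nu> \<and> centered_at_infinity \<nu> \<and> (\<forall>z. \<delta> z = - \<nu> z))"


section \<open>Puiseux series\<close>

text \<open>A Puiseux series is given by its coefficient function on rational exponents.\<close>

definition puiseux_series :: "(rat \<Rightarrow> complex) \<Rightarrow> bool" where
  "puiseux_series \<theta> \<longleftrightarrow>
     (\<exists>p::nat. p > 0 \<and> (\<forall>q. \<theta> q \<noteq> 0 \<longrightarrow> q > 0 \<and> of_nat p * q \<in> \<int>))"

text \<open>\<open>ord (\<theta> - \<psi>) \<ge> r\<close>, with the order of the zero series being infinite.\<close>

definition ord_diff_ge :: "(rat \<Rightarrow> complex) \<Rightarrow> (rat \<Rightarrow> complex) \<Rightarrow> rat \<Rightarrow> bool" where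
  "ord_diff_ge \<theta> \<psi> r \<longleftrightarrow> (\<forall>q. \<theta> q - \<psi> q \<noteq> 0 \<longrightarrow> q \<ge> r)"

text \<open>Coefficients of \<open>\<phi>(x) = x \<psi>(1/x)\<close>: the term \<open>c u\<^sup>e\<close> of \<open>\<psi>\<close> becomes \<open>c x\<^bsup>1 - e\<^esup>\<close>.\<close>

definition to_descending :: "(rat \<Rightarrow> complex) \<Rightarrow> rat \<Rightarrow> complex" where
  "to_descending \<psi> q = \<psi> (1 - q)"

text \<open>The sum of the terms of exponent \<open>> s\<close>; for a descending Puiseux series it is finite.\<close>

definition terms_above :: "rat \<Rightarrow> (rat \<Rightarrow> complex) \<Rightarrow> (rat \<Rightarrow>\<^sub>0 complex)" where
  "terms_above s \<phi> = (\<Sum>q | q > s \<and> \<phi> q \<noteq> 0. Poly_Mapping.single q (\<phi> q))"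

text \<open>
  Finite sums of fractional powers of \<open>x\<close> with coefficients in \<open>\<complex>[\<xi>]\<close> form the ring
  \<^typ>\<open>rat \<Rightarrow>\<^sub>0 complex poly\<close>.
\<close>

definition with_generic_term :: "(rat \<Rightarrow>\<^sub>0 complex) \<Rightarrow> rat \<Rightarrow> (rat \<Rightarrow>\<^sub>0 complex poly)" where
  "with_generic_term \<phi> s =
     Poly_Mapping.map (\<lambda>c. [:c:]) \<phi> + Poly_Mapping.single s [:0, 1:]"

definition subst_y :: "complex poly poly \<Rightarrow> (rat \<Rightarrow>\<^sub>0 complex poly) \<Rightarrow> (rat \<Rightarrow>\<^sub>0 complex poly)" where
  "subst_y f h =
     (\<Sum>i\<le>degree f. \<Sum>k\<le>degree (coeff f i).
        Poly_Mapping.single (of_nat k) [:coeff (coeff f i) k:] * h ^ i)"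

definition deg_x :: "(rat \<Rightarrow>\<^sub>0 complex poly) \<Rightarrow> rat" where
  "deg_x h = Max (Poly_Mapping.keys h)"

text \<open>\<open>\<delta>\<close> has the generic descending Puiseux series \<open>\<phi>(x) + \<xi> x\<^sup>s\<close>.\<close>

definition generic_descending_puiseux ::
    "(ratfun \<Rightarrow> int) \<Rightarrow> (rat \<Rightarrow>\<^sub>0 complex) \<Rightarrow> rat \<Rightarrow> bool" where
  "generic_descending_puiseux \<delta> \<phi> s \<longleftrightarrow>
     \<delta> x_var > 0 \<and> (\<forall>q\<in>Poly_Mapping.keys \<phi>. q > s) \<and>
     (\<forall>f. f \<noteq> 0 \<longrightarrow>
        of_int (\<delta> (to_fract f)) = of_int (\<delta> x_var) * deg_x (subst_y f (with_generic_term \<phi> s)))"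


section \<open>Key forms\<close>

text \<open>
  An element of \<open>\<complex>[x, 1/x, z\<^sub>1, z\<^sub>2, \<dots>]\<close> maps \<open>(i, m)\<close> to the coefficient of the monomial
  \<open>x\<^sup>i \<Prod>\<^sub>j z\<^sub>j\<^bsup>m(j)\<^esup>\<close>.
\<close>

type_synonym zpoly = "(int \<times> (nat \<Rightarrow>\<^sub>0 nat)) \<Rightarrow>\<^sub>0 complex"

definition zpolys :: "nat \<Rightarrow> zpoly set" where
  "zpolys N = {G. \<forall>(i, m)\<in>Poly_Mapping.keys G. Poly_Mapping.keys m \<subseteq> {1..N}}"

definition weighted_degree :: "(nat \<Rightarrow> int) \<Rightarrow> zpoly \<Rightarrow> int" where
  "weighted_degree \<eta> G =
     Max ((\<lambda>(i, m). i * \<eta> 0 + (\<Sum>j\<in>Poly_Mapping.keys m. int (Poly_Mapping.lookup m j) * \<eta> j))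
            ` Poly_Mapping.keys G)"

definition zpoly_eval :: "(nat \<Rightarrow> ratfun) \<Rightarrow> zpoly \<Rightarrow> ratfun" where
  "zpoly_eval g G =
     (\<Sum>(i, m)\<in>Poly_Mapping.keys G.
        const (Poly_Mapping.lookup G (i, m)) * x_var powi i *
        (\<Prod>j\<in>Poly_Mapping.keys m. g j ^ Poly_Mapping.lookup m j))"

definition key_alpha :: "(nat \<Rightarrow> int) \<Rightarrow> nat \<Rightarrow> nat" where
  "key_alpha \<eta> j =
     (LEAST a. a > 0 \<and> (\<exists>c::nat \<Rightarrow> int. int a * \<eta> j = (\<Sum>i<j. c i * \<eta> i)))"

text \<open>
  \<open>g 0, \<dots>, g (n + 1)\<close> is the sequence of key forms of \<open>\<delta>\<close>; the values of \<open>g\<close> at larger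
  indices are irrelevant.
\<close>

definition key_forms :: "(ratfun \<Rightarrow> int) \<Rightarrow> nat \<Rightarrow> (nat \<Rightarrow> ratfun) \<Rightarrow> bool" where
  "key_forms \<delta> n g \<longleftrightarrow>
     (let \<eta> = (\<lambda>j. \<delta> (g j)); \<alpha> = key_alpha \<eta> in
      (\<forall>j\<le>n + 1. g j \<in> laurent_ring) \<and>
      g 0 = x_var \<and> g 1 = y_var \<and>
      (\<exists>\<beta> :: nat \<Rightarrow> nat \<Rightarrow> int. \<forall>j\<in>{1..n}.
         \<eta> (j + 1) < int (\<alpha> j) * \<eta> j \<and>
         int (\<alpha> j) * \<eta> j = (\<Sum>i<j. \<beta> j i * \<eta> i) \<and>
         (\<forall>i\<in>{1..<j}. 0 \<le> \<beta> j i \<and> \<beta> j i < int (\<alpha> i)) \<and>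
         (\<exists>\<theta>. \<theta> \<noteq> 0 \<and>
            g (j + 1) = g j ^ \<alpha> j - const \<theta> * (\<Prod>i<j. g i powi \<beta> j i))) \<and>
      (\<forall>h\<in>laurent_ring. h \<noteq> 0 \<longrightarrow>
         (\<exists>G\<in>zpolys (n + 1). zpoly_eval g G = h \<and> weighted_degree \<eta> G = \<delta> h) \<and>
         (\<forall>G\<in>zpolys (n + 1). zpoly_eval g G = h \<longrightarrow> \<delta> h \<le> weighted_degree \<eta> G)))"


section \<open>Branches at infinity\<close>

text \<open>
  An analytic branch at infinity of \<open>f = 0\<close> is given by an injective holomorphic
  parametrization \<open>t \<mapsto> (X t, Y t)\<close> of the branch minus its point on the line at infinity.
  The values \<open>X 0\<close> and \<open>Y 0\<close> are irrelevant.
\<close>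

definition branch_at_infinity ::
    "complex poly poly \<Rightarrow> (complex \<Rightarrow> complex) \<Rightarrow> (complex \<Rightarrow> complex) \<Rightarrow> bool" where
  "branch_at_infinity f X Y \<longleftrightarrow>
     X meromorphic_on {0} \<and> Y meromorphic_on {0} \<and>
     (is_pole X 0 \<or> is_pole Y 0) \<and>
     (\<exists>\<epsilon>>0. inj_on (\<lambda>t. (X t, Y t)) (ball 0 \<epsilon> - {0}) \<and>
            (\<forall>t\<in>ball 0 \<epsilon> - {0}. eval2 f (X t) (Y t) = 0))"

text \<open>
  Convergence to \<open>O\<close>, the origin of the chart \<open>(u, v) = (1/x, y/x)\<close>. The condition \<open>u \<rightarrow> 0\<close> is
  stated as \<open>x \<rightarrow> \<infinity>\<close> because \<open>1/0 = 0\<close> in HOL.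
\<close>

definition meets_at_O :: "(complex \<Rightarrow> complex) \<Rightarrow> (complex \<Rightarrow> complex) \<Rightarrow> bool" where
  "meets_at_O X Y \<longleftrightarrow> is_pole X 0 \<and> ((\<lambda>t. Y t / X t) \<longlongrightarrow> 0) (at 0)"

text \<open>
  \<open>v = \<theta>(u)\<close> is a Puiseux expansion at \<open>O\<close> of the branch: in a suitable local parameter
  \<open>s\<close> of the branch, \<open>u = s\<^sup>p\<close> and \<open>v = \<Sum>\<^sub>m \<theta>\<^bsub>m/p\<^esub> s\<^sup>m\<close>. The different choices of \<open>s\<close> (a \<open>p\<close>-th
  root of \<open>u\<close>) yield the different conjugates.
\<close>

definition puiseux_expansion_at_O ::
    "(complex \<Rightarrow> complex) \<Rightarrow> (complex \<Rightarrow> complex) \<Rightarrow> (rat \<Rightarrow> complex) \<Rightarrow> bool" where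
  "puiseux_expansion_at_O X Y \<theta> \<longleftrightarrow>
     puiseux_series \<theta> \<and>
     (\<exists>(p::nat) s. p > 0 \<and> (\<forall>q. \<theta> q \<noteq> 0 \<longrightarrow> of_nat p * q \<in> \<int>) \<and>
        s analytic_on {0} \<and> s 0 = 0 \<and> deriv s 0 \<noteq> 0 \<and>
        (\<forall>\<^sub>F t in at 0. 1 / X t = s t ^ p \<and>
           (\<lambda>m. \<theta> (of_nat m / of_nat p) * s t ^ m) sums (Y t / X t)))"

definition branches_close_to :: "complex poly poly \<Rightarrow> (rat \<Rightarrow> complex) \<Rightarrow> rat \<Rightarrow> bool" where
  "branches_close_to f \<psi> r \<longleftrightarrow>
     (\<forall>X Y. branch_at_infinity f X Y \<longrightarrow>
        meets_at_O X Y \<and> (\<exists>\<theta>. puiseux_expansion_at_O X Y \<theta> \<and> ord_diff_ge \<theta> \<psi> r))"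

end

theory Submission
  imports Defs "HOL-Computational_Algebra.Field_as_Ring"
begin

text \<open>
  Write \<open>u = 1/x\<close>. Choose a common denominator \<open>N\<close> of the exponents in
  play, put \<open>x = t\<^bsup>-N\<^esup>\<close>, and substitute for \<open>y\<close> the
  generic series \<open>\<phi>(t) + \<xi> t\<^sup>e\<close> with \<open>e = N (r - 1)\<close>. Up
  to the positive factor \<open>\<delta>(x)/N\<close>, the semidegree is minus the order in
  \<open>t\<close> of the result. Besides the order one reads off a second additive quantity, the
  degree in \<open>\<xi>\<close> of the lowest coefficient. Over Laurent series in
  \<open>t\<close> a polynomial is a product of factors \<open>y - Y\<close>, and such a factor
  has \<open>\<xi>\<close>-degree \<open>1\<close> if \<open>Y\<close> agrees with
  \<open>\<phi>\<close> below \<open>t\<^sup>e\<close>, and \<open>0\<close> otherwise. So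
  \<open>\<xi>\<close>-degrees detect exactly the roots that are close to \<open>\<phi>\<close>,
  which is what condition (1) is about.

  The last key form. For \<open>j \<le> n\<close> the lowest coefficient of
  \<open>g\<^sub>j\<close> is constant in \<open>\<xi>\<close>: the value drops from
  \<open>g\<^sub>j\<^bsup>\<alpha>\<^esup>\<close> to \<open>g\<^sub>j\<^sub>+\<^sub>1\<close>, so
  the lowest coefficients of \<open>g\<^sub>j\<^bsup>\<alpha>\<^esup>\<close> and of the monomial
  subtracted from it coincide (\<open>xi_deg_SubG_0\<close>). Monomials in the key forms whose
  exponents are digits in the mixed radix system \<open>\<alpha>\<^sub>1, \<alpha>\<^sub>2,
  \<dots>\<close> have each degree in \<open>y\<close> exactly once, and two such terms never
  share both invariants, so nothing cancels in a standard expansion (\<open>standard_sum\<close>).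
  Consequently polynomials of smaller degree than \<open>g\<^sub>n\<^sub>+\<^sub>1\<close> have
  \<open>\<xi>\<close>-degree \<open>0\<close>, while \<open>g\<^sub>n\<^sub>+\<^sub>1\<close>
  itself does not: otherwise property (P3) would force \<open>\<xi>\<close>-degree
  \<open>0\<close> for the product of all \<open>y - \<phi>'\<close>, with \<open>\<phi>'\<close>
  running through the conjugates of \<open>\<phi>\<close> (\<open>xi_deg_SubG_top\<close>). The
  roots of \<open>g\<^sub>n\<^sub>+\<^sub>1\<close> with a conjugate close to
  \<open>\<phi>\<close> are permuted by conjugation, so they form a factor that is again a
  polynomial in \<open>y\<close> over Laurent series in \<open>u\<close>; it has positive
  \<open>\<xi>\<close>-degree, hence full degree. So all roots of
  \<open>g\<^sub>n\<^sub>+\<^sub>1\<close> are conjugate to close ones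
  (\<open>roots_of_last_key\<close>), and if \<open>g\<^sub>n\<^sub>+\<^sub>1\<close> is a
  polynomial, it satisfies (1).

  From (1) to (2). A curve all of whose branches at infinity pass through \<open>O\<close> has no
  branch with bounded \<open>x\<close>; therefore its equation \<open>f\<close> is monic in
  \<open>y\<close> up to a constant (\<open>monic_if_branches_close\<close>). All roots of
  \<open>f\<close>, like all roots of \<open>g\<^sub>n\<^sub>+\<^sub>1\<close>, are conjugate to
  series close to \<open>\<phi>\<close>. Averaging over conjugates shows that order and
  \<open>\<xi>\<close>-degree of such a polynomial are fixed multiples of its degree
  (\<open>average\<close>), whence \<open>deg f = E deg g\<^sub>n\<^sub>+\<^sub>1\<close> and
  \<open>\<delta>(f) = E \<delta>(g\<^sub>n\<^sub>+\<^sub>1)\<close>. Thus \<open>f\<close> is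
  \<open>g\<^sub>n\<^sub>+\<^sub>1\<^bsup>E\<^esup>\<close> plus standard terms of no larger
  weight. Expand everything in \<open>g\<^sub>1, \<dots>, g\<^sub>j\<close> only. In the
  corresponding weight \<open>f\<close> agrees to top order with a power of
  \<open>g\<^sub>j\<^sub>+\<^sub>1 = g\<^sub>j\<^bsup>\<alpha>\<^esup> - \<theta>
  x\<^bsup>\<beta>\<^esup> \<dots>\<close>, and the term of the binomial expansion that is linear
  in the tail shows up as a standard monomial whose coefficient has leading term a nonzero
  constant times \<open>x\<^bsup>\<beta>\<^esup>\<close>. If \<open>g\<^sub>1, \<dots>,
  g\<^sub>j\<close> are polynomials, the standard coefficients of \<open>f\<close> are polynomials
  in \<open>x\<close>, so \<open>\<beta> \<ge> 0\<close> and
  \<open>g\<^sub>j\<^sub>+\<^sub>1\<close> is a polynomial too (\<open>nonneg_exponents\<close>,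
  \<open>key_forms_polynomial\<close>). That (3) implies (2) follows by passing through (1).

  Branches and roots. Over a punctured disc that avoids the discriminant, the roots of a family of
  monic polynomials form a covering. Pulled back along the exponential map to a half plane it
  becomes trivial; its sections have a period \<open>2 \<pi> \<i> n\<close> with \<open>n\<close>
  at most the degree, so they are meromorphic functions of \<open>u\<^bsup>1/n\<^esup>\<close>
  (\<open>puiseux_branches\<close>). These are the analytic branches, and their Laurent series
  split the polynomial (\<open>splits_all\<close>). Conversely, every branch with \<open>x
  \<rightarrow> \<infinity>\<close> can be parametrized by a root of \<open>1/x\<close>
  (\<open>branch_normal_form\<close>).
\<close>

section \<open>Bases with one monic polynomial in each degree\<close>

locale monic_basis =
  fixes b :: "nat \<Rightarrow> 'a::comm_ring_1 poly"
  assumes deg_b: "degree (b k) = k" and lead_b: "coeff (b k) k = 1"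
begin

definition expands :: "'a poly \<Rightarrow> (nat \<Rightarrow> 'a) \<Rightarrow> bool" where
  "expands f c \<longleftrightarrow> (\<exists>d. (\<forall>k>d. c k = 0) \<and> f = (\<Sum>k\<le>d. smult (c k) (b k)))"

lemma expands_mono:
  assumes "\<forall>k>d. c k = 0" "d \<le> d'"
  shows "(\<Sum>k\<le>d. smult (c k) (b k)) = (\<Sum>k\<le>d'. smult (c k) (b k))"
  by (rule sum.mono_neutral_left) (use assms in auto)

text \<open>
  Division by monic polynomials needs no denominators, so coefficients stay in any subset
  \<open>A\<close> closed under subtraction and multiplication.
\<close>

lemma expands_exists_in:
  assumes A: "\<And>x y. x \<in> A \<Longrightarrow> y \<in> A \<Longrightarrow> x - y \<in> A" "\<And>x y. x \<in> A \<Longrightarrow> y \<in> A \<Longrightarrow> x * y \<in> A"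
    and bA: "\<And>k i. k \<le> d \<Longrightarrow> coeff (b k) i \<in> A"
    and fA: "\<And>i. coeff f i \<in> A" and "degree f \<le> d"
  shows "\<exists>c. (\<forall>k>d. c k = 0) \<and> (\<forall>k. c k \<in> A) \<and> f = (\<Sum>k\<le>d. smult (c k) (b k))"
  using bA fA assms(5)
proof (induction d arbitrary: f)
  case 0
  have "0 \<in> A" using A(1)[OF 0(2) 0(2), of 0 0] by simp
  moreover have "b 0 = [:1:]" using deg_b[of 0] lead_b[of 0] by (metis degree_eq_zeroE coeff_pCons_0)
  ultimately show ?case using 0
    by (intro exI[of _ "\<lambda>k. if k = 0 then coeff f 0 else 0"]) (auto simp: poly_eq_iff coeff_pCons coeff_eq_0 split: nat.split)
next
  case (Suc d)
  have z: "0 \<in> A" using A(1)[OF Suc.prems(2) Suc.prems(2), of 0 0] by simp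
  define a where "a = coeff f (Suc d)"
  define f' where "f' = f - smult a (b (Suc d))"
  have "degree f' \<le> d"
  proof (rule degree_le, intro allI impI)
    fix i assume i: "i > d"
    show "coeff f' i = 0"
    proof (cases "i = Suc d")
      case True then show ?thesis using lead_b[of "Suc d"] by (simp add: f'_def a_def)
    next
      case False
      then have "i > Suc d" using i by auto
      then show ?thesis using Suc.prems(3) deg_b[of "Suc d"] by (simp add: f'_def coeff_eq_0)
    qed
  qed
  moreover have "coeff f' i \<in> A" for i
    unfolding f'_def a_def using A Suc.prems by auto
  ultimately obtain c where c: "\<forall>k>d. c k = 0" "\<forall>k. c k \<in> A" "f' = (\<Sum>k\<le>d. smult (c k) (b k))"
    using Suc.IH[of f'] Suc.prems(1) by force
  have "f = (\<Sum>k\<le>Suc d. smult ((c(Suc d := a)) k) (b k))"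
  proof -
    have "f = f' + smult a (b (Suc d))" by (simp add: f'_def)
    also have "f' = (\<Sum>k\<le>d. smult ((c(Suc d := a)) k) (b k))"
      unfolding c(3) by (rule sum.cong) auto
    finally show ?thesis by simp
  qed
  moreover have "\<forall>k. (c(Suc d := a)) k \<in> A" using c Suc.prems a_def by auto
  moreover have "\<forall>k>Suc d. (c(Suc d := a)) k = 0" using c by auto
  ultimately show ?case by blast
qed

lemma expands_exists: "\<exists>c. expands f c \<and> (\<forall>k>degree f. c k = 0)"
proof -
  obtain c where c: "\<forall>k>degree f. c k = 0" "f = (\<Sum>k\<le>degree f. smult (c k) (b k))"
    using expands_exists_in[of UNIV "degree f" f] by auto
  then show ?thesis unfolding expands_def by (intro exI[of _ c] conjI exI[of _ "degree f"]) auto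
qed

lemma expands_0_unique: assumes "expands 0 c" shows "c k = 0"
proof -
  obtain d where d: "\<forall>k>d. c k = 0" "0 = (\<Sum>k\<le>d. smult (c k) (b k))" using assms expands_def by auto
  have "k \<le> d \<longrightarrow> c k = 0" for k
  proof (induction "d - k" arbitrary: k rule: less_induct)
    case less
    show ?case
    proof
      assume k: "k \<le> d"
      have *: "c i = 0" if "i > k" for i
        using that less[of i] d(1) by (cases "i \<le> d") (auto simp: not_le)
      have "0 = coeff (\<Sum>i\<le>d. smult (c i) (b i)) k" using d(2) by (metis coeff_0)
      also have "\<dots> = (\<Sum>i\<le>d. c i * coeff (b i) k)" by (simp add: coeff_sum)
      also have "\<dots> = (\<Sum>i\<in>{k}. c i * coeff (b i) k)"
      proof (rule sum.mono_neutral_right)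
        show "\<forall>i\<in>{..d} - {k}. c i * coeff (b i) k = 0"
        proof
          fix i assume "i \<in> {..d} - {k}"
          then show "c i * coeff (b i) k = 0"
            using *[of i] coeff_eq_0[of "b i" k] deg_b[of i] by (cases "i > k") auto
        qed
      qed (use k in auto)
      also have "\<dots> = c k" using lead_b[of k] by simp
      finally show "c k = 0" by simp
    qed
  qed
  then show ?thesis using d(1) by (cases "k \<le> d") auto
qed

lemma expands_add: assumes "expands f c" "expands g e" shows "expands (f + g) (\<lambda>k. c k + e k)"
proof -
  obtain d where d: "\<forall>k>d. c k = 0" "f = (\<Sum>k\<le>d. smult (c k) (b k))" using assms expands_def by auto
  obtain d' where d': "\<forall>k>d'. e k = 0" "g = (\<Sum>k\<le>d'. smult (e k) (b k))" using assms expands_def by auto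
  show ?thesis unfolding expands_def
    apply (rule exI[of _ "max d d'"])
    using d d' expands_mono[OF d(1), of "max d d'"] expands_mono[OF d'(1), of "max d d'"]
    by (auto simp: smult_add_left sum.distrib)
qed

lemma expands_smult: assumes "expands f c" shows "expands (smult a f) (\<lambda>k. a * c k)"
proof -
  have "smult a (\<Sum>k\<le>d. smult (c k) (b k)) = (\<Sum>k\<le>d. smult (a * c k) (b k))" for d
    by (induction d) (simp_all add: smult_add_right)
  then show ?thesis using assms unfolding expands_def by force
qed

lemma expands_unique: assumes "expands f c" "expands f e" shows "c = e"
proof
  fix k
  have "expands (f + smult (-1) f) (\<lambda>k. c k + (-1) * e k)"
    by (intro expands_add expands_smult assms)
  then show "c k = e k" using expands_0_unique[of "\<lambda>k. c k + (-1) * e k" k] by simp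
qed

definition bcoef :: "'a poly \<Rightarrow> nat \<Rightarrow> 'a" where
  "bcoef f = (THE c. expands f c)"

lemma expands_bcoef: "expands f (bcoef f)"
proof -
  obtain c where "expands f c" using expands_exists[of f] by blast
  then have "\<exists>!c. expands f c" using expands_unique by blast
  then show ?thesis unfolding bcoef_def by (rule theI')
qed

lemma bcoef_eqI: "expands f c \<Longrightarrow> bcoef f = c"
  by (rule expands_unique[OF expands_bcoef])

lemma bcoef_add: "bcoef (f + g) k = bcoef f k + bcoef g k"
  using bcoef_eqI[OF expands_add[OF expands_bcoef[of f] expands_bcoef[of g]]] by simp

lemma bcoef_smult: "bcoef (smult a f) k = a * bcoef f k"
  using bcoef_eqI[OF expands_smult[OF expands_bcoef[of f]]] by simp

lemma bcoef_0: "bcoef 0 k = 0"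
  using bcoef_smult[of 0 0] by simp

lemma bcoef_basis: "bcoef (b i) k = (if k = i then 1 else 0)"
proof -
  have "expands (b i) (\<lambda>k. if k = i then 1 else 0)" unfolding expands_def
  proof (intro exI[of _ i] conjI)
    have "(\<Sum>k\<le>i. smult (if k = i then 1 else 0) (b k)) = (\<Sum>k\<in>{i}. smult (if k = i then 1 else 0) (b k))"
      by (rule sum.mono_neutral_right) auto
    then show "b i = (\<Sum>k\<le>i. smult (if k = i then 1 else 0) (b k))" by simp
  qed auto
  then show ?thesis by (simp add: bcoef_eqI)
qed

lemma bcoef_gt_degree: "k > degree f \<Longrightarrow> bcoef f k = 0"
  using expands_exists[of f] bcoef_eqI by auto

lemma sum_bcoef: "degree f \<le> d \<Longrightarrow> f = (\<Sum>k\<le>d. smult (bcoef f k) (b k))"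
proof -
  assume d: "degree f \<le> d"
  obtain d0 where d0: "\<forall>k>d0. bcoef f k = 0" "f = (\<Sum>k\<le>d0. smult (bcoef f k) (b k))"
    using expands_bcoef[of f] expands_def by auto
  have "(\<Sum>k\<le>d. smult (bcoef f k) (b k)) = (\<Sum>k\<le>max d d0. smult (bcoef f k) (b k))"
    by (rule expands_mono) (use bcoef_gt_degree d in auto)
  also have "\<dots> = (\<Sum>k\<le>d0. smult (bcoef f k) (b k))"
    by (rule expands_mono[symmetric]) (use d0 in auto)
  finally show ?thesis using d0 by simp
qed

lemma bcoef_degree: "bcoef f (degree f) = lead_coeff f"
proof -
  let ?d = "degree f"
  have "lead_coeff f = coeff (\<Sum>k\<le>?d. smult (bcoef f k) (b k)) ?d"
    using sum_bcoef[of f ?d] by simp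
  also have "\<dots> = (\<Sum>k\<le>?d. bcoef f k * coeff (b k) ?d)" by (simp add: coeff_sum)
  also have "\<dots> = (\<Sum>k\<in>{?d}. bcoef f k * coeff (b k) ?d)"
  proof (rule sum.mono_neutral_right)
    show "\<forall>i\<in>{..?d} - {?d}. bcoef f i * coeff (b i) ?d = 0"
    proof
      fix i assume "i \<in> {..?d} - {?d}"
      then have "degree (b i) < ?d" using deg_b[of i] by auto
      then show "bcoef f i * coeff (b i) ?d = 0" by (simp add: coeff_eq_0)
    qed
  qed auto
  finally show ?thesis using lead_b by simp
qed

text \<open>
  Applied to the coefficients that are polynomials in \<open>x\<close>, this is what makes
  expansions in polynomial key forms informative about negative powers of \<open>x\<close>.
\<close>

lemma bcoef_in:
  assumes A: "\<And>x y. x \<in> A \<Longrightarrow> y \<in> A \<Longrightarrow> x - y \<in> A" "\<And>x y. x \<in> A \<Longrightarrow> y \<in> A \<Longrightarrow> x * y \<in> A"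
    and "\<And>k i. coeff (b k) i \<in> A" and "\<And>i. coeff f i \<in> A"
  shows "bcoef f k \<in> A"
proof -
  obtain c where c: "\<forall>k>degree f. c k = 0" "\<forall>k. c k \<in> A" "f = (\<Sum>k\<le>degree f. smult (c k) (b k))"
    using expands_exists_in[of A "degree f" f, OF A assms(3,4) order_refl] by auto
  then have "bcoef f = c" by (intro bcoef_eqI) (auto simp: expands_def)
  then show ?thesis using c by simp
qed

end

section \<open>Standard expansions with respect to key polynomials\<close>

text \<open>
  The variable of the Laurent series is \<open>u = 1/x\<close>, so a series without positive
  powers is a polynomial in \<open>x\<close>.
\<close>

definition npos :: "complex fls \<Rightarrow> bool" where
  "npos a \<longleftrightarrow> (\<forall>k>0. fls_nth a k = 0)"

definition pnpos :: "complex fls poly \<Rightarrow> bool" where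
  "pnpos p \<longleftrightarrow> (\<forall>i. npos (coeff p i))"

lemma npos_mult: assumes "npos x" "npos y" shows "npos (x * y)"
  unfolding npos_def
proof (intro allI impI)
  fix k :: int assume k: "k > 0"
  have "fls_nth x a * fls_nth y b = 0" if "a + b > 0" for a b
    using assms that unfolding npos_def by (cases "a > 0") auto
  then show "fls_nth (x * y) k = 0" unfolding fls_times_nth(1) using k by (intro sum.neutral) auto
qed

lemma pnpos_mult: assumes "pnpos p" "pnpos q" shows "pnpos (p * q)"
  unfolding pnpos_def
proof
  fix i
  have *: "npos (coeff p l * coeff q (i - l))" for l using assms by (auto simp: pnpos_def npos_mult)
  show "npos (coeff (p * q) i)" unfolding coeff_mult using * by (auto simp: fls_nth_sum npos_def)
qed

lemma pnpos_1: "pnpos 1" by (auto simp: pnpos_def npos_def)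

lemma pnpos_power: "pnpos p \<Longrightarrow> pnpos (p ^ r)"
  by (induction r) (auto intro: pnpos_mult pnpos_1)

lemma pnpos_prod: "finite S \<Longrightarrow> (\<And>l. l \<in> S \<Longrightarrow> pnpos (H l)) \<Longrightarrow> pnpos (\<Prod>l\<in>S. H l)"
  by (induction S rule: finite_induct) (auto intro: pnpos_mult pnpos_1)

text \<open>
  The recursion (P2) and the relations (P0) for the key forms \<open>g\<^sub>1, \<dots>,
  g\<^sub>n\<^sub>+\<^sub>1\<close>, seen as polynomials in \<open>y\<close> over Laurent series
  in \<open>u = 1/x\<close>. The exponent \<open>\<beta> j 0\<close> of \<open>x\<close> becomes
  \<open>- \<beta> j 0\<close>.
\<close>

locale key_polys =
  fixes n :: nat and \<eta> :: "nat \<Rightarrow> int" and \<alpha> :: "nat \<Rightarrow> nat" and \<beta> :: "nat \<Rightarrow> nat \<Rightarrow> int"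
    and \<theta> :: "nat \<Rightarrow> complex" and G :: "nat \<Rightarrow> complex fls poly"
  assumes eta0: "\<eta> 0 > 0"
    and G1: "G 1 = [:0, 1:]"
    and alpha_pos: "j \<in> {1..n} \<Longrightarrow> \<alpha> j > 0"
    and drop: "j \<in> {1..n} \<Longrightarrow> \<eta> (j + 1) < int (\<alpha> j) * \<eta> j"
    and rel: "j \<in> {1..n} \<Longrightarrow> int (\<alpha> j) * \<eta> j = (\<Sum>i<j. \<beta> j i * \<eta> i)"
    and beta: "j \<in> {1..n} \<Longrightarrow> i \<in> {1..<j} \<Longrightarrow> 0 \<le> \<beta> j i \<and> \<beta> j i < int (\<alpha> i)"
    and theta: "j \<in> {1..n} \<Longrightarrow> \<theta> j \<noteq> 0"
    and step: "j \<in> {1..n} \<Longrightarrow> G (j + 1) = G j ^ \<alpha> j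
       - smult (fls_const (\<theta> j) * fls_X_intpow (- \<beta> j 0)) (\<Prod>i\<in>{1..<j}. G i ^ nat (\<beta> j i))"
begin

text \<open>
  The degree in \<open>y\<close> of the \<open>j\<close>-th key polynomial, and the place value of
  the \<open>j\<close>-th digit in the mixed radix system \<open>\<alpha> 1, \<alpha> 2,
  \<dots>\<close>.
\<close>

definition D :: "nat \<Rightarrow> nat" where "D j = (\<Prod>i\<in>{1..<j}. \<alpha> i)"

lemma D_1 [simp]: "D 1 = 1" "D (Suc 0) = 1" by (simp_all add: D_def)
lemma D_Suc: "j \<ge> 1 \<Longrightarrow> D (Suc j) = D j * \<alpha> j" by (simp add: D_def atLeastLessThanSuc mult.commute)
lemma D_pos: "j \<le> n + 1 \<Longrightarrow> D j > 0" unfolding D_def using alpha_pos by (intro prod_pos) auto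
lemma D_dvd: "i \<le> j \<Longrightarrow> D i dvd D j"
  unfolding D_def by (rule prod_dvd_prod_subset) auto

lemma digit_sum_less:
  assumes "1 \<le> j" "j \<le> n + 1" "\<And>i. i \<in> {1..<j} \<Longrightarrow> m i < \<alpha> i"
  shows "(\<Sum>i\<in>{1..<j}. m i * D i) < D j"
  using assms
proof (induction j rule: nat_induct_at_least)
  case base then show ?case by simp
next
  case (Suc j)
  have "(\<Sum>i\<in>{1..<Suc j}. m i * D i) = (\<Sum>i\<in>{1..<j}. m i * D i) + m j * D j"
    using Suc.hyps by simp
  also have "\<dots> < D j + m j * D j" using Suc by simp
  also have "\<dots> = (m j + 1) * D j" by simp
  also have "\<dots> \<le> \<alpha> j * D j" using Suc.prems(2)[of j] Suc.hyps by (intro mult_right_mono) auto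
  finally show ?case using D_Suc Suc.hyps by (simp add: mult.commute)
qed

lemma lead_prod_monic:
  fixes H :: "nat \<Rightarrow> complex fls poly"
  assumes "finite S" "\<And>i. i \<in> S \<Longrightarrow> lead_coeff (H i) = 1"
  shows "lead_coeff (\<Prod>i\<in>S. H i ^ m i) = 1 \<and> degree (\<Prod>i\<in>S. H i ^ m i) = (\<Sum>i\<in>S. m i * degree (H i))"
  using assms
proof (induction S rule: finite_induct)
  case empty then show ?case by simp
next
  case (insert i S)
  define Q where "Q = (\<Prod>i\<in>S. H i ^ m i)"
  have Q: "lead_coeff Q = 1" "degree Q = (\<Sum>i\<in>S. m i * degree (H i))"
    using insert unfolding Q_def by auto
  have H: "lead_coeff (H i ^ m i) = 1" using insert.prems[of i] unfolding lead_coeff_power by simp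
  have nz: "H i \<noteq> 0" "H i ^ m i \<noteq> 0" "Q \<noteq> 0" using insert.prems[of i] Q by auto
  have "lead_coeff (H i ^ m i * Q) = 1" unfolding lead_coeff_mult H Q(1) by simp
  moreover have "degree (H i ^ m i * Q) = m i * degree (H i) + (\<Sum>i\<in>S. m i * degree (H i))"
    using nz by (simp add: degree_mult_eq degree_power_eq Q(2))
  moreover have "(\<Prod>i\<in>insert i S. H i ^ m i) = H i ^ m i * Q"
    using insert.hyps by (simp add: Q_def)
  moreover have "(\<Sum>i\<in>insert i S. m i * degree (H i)) = m i * degree (H i) + (\<Sum>i\<in>S. m i * degree (H i))"
    using insert.hyps by simp
  ultimately show ?case by metis
qed

text \<open>
  In the recursion the tail has smaller degree than \<open>G i ^ \<alpha> i\<close> because its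
  exponents are digits.
\<close>

lemma G_monic: "1 \<le> j \<Longrightarrow> j \<le> n + 1 \<Longrightarrow> lead_coeff (G j) = 1 \<and> degree (G j) = D j"
proof (induction j rule: less_induct)
  case (less j)
  show ?case
  proof (cases "j = 1")
    case True then show ?thesis using G1 by simp
  next
    case False
    then obtain i where i: "j = Suc i" "1 \<le> i" using less.prems by (cases j) auto
    define T where "T = smult (fls_const (\<theta> i) * fls_X_intpow (- \<beta> i 0)) (\<Prod>l\<in>{1..<i}. G l ^ nat (\<beta> i l))"
    have iN: "i \<in> {1..n}" using i less.prems by auto
    have IH: "lead_coeff (G l) = 1" "degree (G l) = D l" if "l \<in> {1..i}" for l
      using less.IH[of l] that i less.prems by auto
    have "degree T \<le> degree (\<Prod>l\<in>{1..<i}. G l ^ nat (\<beta> i l))" unfolding T_def by (rule degree_smult_le)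
    also have "\<dots> = (\<Sum>l\<in>{1..<i}. nat (\<beta> i l) * degree (G l))"
      using lead_prod_monic[of "{1..<i}" G] IH by simp
    also have "\<dots> = (\<Sum>l\<in>{1..<i}. nat (\<beta> i l) * D l)" using IH by (intro sum.cong) auto
    also have "\<dots> < D i"
      using beta[OF iN] i less.prems by (intro digit_sum_less) (auto simp: nat_less_iff)
    finally have dT: "degree T < D i" .
    have Gi: "lead_coeff (G i) = 1" "degree (G i) = D i" "G i \<noteq> 0" using IH[of i] i by auto
    have p: "degree (G i ^ \<alpha> i) = D j" using Gi i D_Suc by (simp add: degree_power_eq mult.commute)
    have p2: "lead_coeff (G i ^ \<alpha> i) = 1" unfolding lead_coeff_power Gi(1) by simp
    have "D i \<le> D j" using D_Suc[of i] i alpha_pos[OF iN] by simp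
    then have lt: "degree T < degree (G i ^ \<alpha> i)" using dT p by simp
    have "G j = G i ^ \<alpha> i - T" using step[OF iN] i by (simp add: T_def)
    then have e: "G j = - T + G i ^ \<alpha> i" by simp
    have "degree (G j) = D j" unfolding e using lt p by (subst degree_add_eq_right) auto
    moreover have "lead_coeff (G j) = lead_coeff (G i ^ \<alpha> i)" unfolding e
      by (rule lead_coeff_add_le) (use lt in simp)
    then have "lead_coeff (G j) = 1" using p2 by metis
    ultimately show ?thesis by blast
  qed
qed

text \<open>
  Digits of \<open>k\<close>, where the digit at place \<open>j\<close> is not reduced: the
  exponent of \<open>G j\<close> in a standard monomial in \<open>G 1, \<dots>, G j\<close> is
  unbounded.
\<close>

definition dig :: "nat \<Rightarrow> nat \<Rightarrow> nat \<Rightarrow> nat" where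
  "dig j k l = (if l < j then (k div D l) mod \<alpha> l else k div D j)"

lemma dig_less: "j \<le> n + 1 \<Longrightarrow> 1 \<le> l \<Longrightarrow> l < j \<Longrightarrow> dig j k l < \<alpha> l"
  using alpha_pos[of l] by (auto simp: dig_def)

lemma dig_sum: "1 \<le> j \<Longrightarrow> (\<Sum>l\<in>{1..j}. dig j k l * D l) = k"
proof (induction j rule: nat_induct_at_least)
  case base then show ?case by (simp add: dig_def)
next
  case (Suc j)
  have "(\<Sum>l\<in>{1..Suc j}. dig (Suc j) k l * D l) =
        (\<Sum>l\<in>{1..<j}. dig (Suc j) k l * D l) + (dig (Suc j) k j * D j + dig (Suc j) k (Suc j) * D (Suc j))"
    using Suc.hyps by (simp add: atLeastLessThanSuc_atLeastAtMost[symmetric])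
  also have "(\<Sum>l\<in>{1..<j}. dig (Suc j) k l * D l) = (\<Sum>l\<in>{1..<j}. dig j k l * D l)"
    by (rule sum.cong) (auto simp: dig_def)
  also have "dig (Suc j) k j * D j + dig (Suc j) k (Suc j) * D (Suc j) = dig j k j * D j"
  proof -
    define q where "q = k div D j"
    have "q mod \<alpha> j * D j + q div \<alpha> j * (D j * \<alpha> j) = (q mod \<alpha> j + \<alpha> j * (q div \<alpha> j)) * D j"
      by (simp only: algebra_simps)
    also have "\<dots> = q * D j" by simp
    finally show ?thesis
      using Suc.hyps by (simp add: dig_def D_Suc div_mult2_eq q_def)
  qed
  also have "(\<Sum>l\<in>{1..<j}. dig j k l * D l) + dig j k j * D j = (\<Sum>l\<in>{1..j}. dig j k l * D l)"
    using Suc.hyps by (simp add: atLeastLessThanSuc_atLeastAtMost[symmetric])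
  finally show ?case using Suc by (simp add: add.assoc)
qed

lemma dig_unique:
  assumes j: "1 \<le> j" "j \<le> n + 1" and m: "\<And>l. l \<in> {1..<j} \<Longrightarrow> m l < \<alpha> l" and l: "l \<in> {1..j}"
  shows "dig j (\<Sum>l\<in>{1..j}. m l * D l) l = m l"
proof -
  let ?k = "\<Sum>l\<in>{1..j}. m l * D l"
  have "?k = (\<Sum>i\<in>{1..<l}. m i * D i) + m l * D l + (\<Sum>i\<in>{l<..j}. m i * D i)"
  proof -
    have "{1..j} = {1..<l} \<union> {l..j}" using l by auto
    then have "?k = (\<Sum>i\<in>{1..<l}. m i * D i) + (\<Sum>i\<in>{l..j}. m i * D i)"
      by (simp only:) (rule sum.union_disjoint; auto)
    also have "(\<Sum>i\<in>{l..j}. m i * D i) = m l * D l + (\<Sum>i\<in>{l<..j}. m i * D i)"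
      using l by (subst sum.head) auto
    finally show ?thesis by simp
  qed
  moreover have "(\<Sum>i\<in>{1..<l}. m i * D i) < D l"
    using l j m by (intro digit_sum_less) auto
  ultimately obtain A R where AR: "A < D l" "R = (\<Sum>i\<in>{l<..j}. m i * D i)" "?k = A + m l * D l + R" by blast
  show ?thesis
  proof (cases "l = j")
    case True
    then have "R = 0" using AR by simp
    then show ?thesis using AR True by (simp add: dig_def)
  next
    case False
    then have lj: "l < j" using l by auto
    have "D (Suc l) dvd R" unfolding AR(2) by (intro dvd_sum dvd_mult D_dvd) auto
    then obtain S where S: "R = D l * \<alpha> l * S" using l D_Suc by (auto simp: dvd_def)
    have "?k = A + D l * (m l + \<alpha> l * S)" unfolding AR(3) S by (simp add: algebra_simps)
    then have "?k div D l = m l + \<alpha> l * S" using AR(1) by simp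
    moreover have "m l < \<alpha> l" using m[of l] l lj by auto
    ultimately show ?thesis using lj by (simp add: dig_def)
  qed
qed

definition mon :: "nat \<Rightarrow> (nat \<Rightarrow> nat) \<Rightarrow> complex fls poly" where
  "mon j m = (\<Prod>l\<in>{1..j}. G l ^ m l)"

definition wtm :: "nat \<Rightarrow> (nat \<Rightarrow> nat) \<Rightarrow> int" where
  "wtm j m = (\<Sum>l\<in>{1..j}. int (m l) * \<eta> l)"

text \<open>
  The degree in \<open>x\<close> of a coefficient, scaled by the weight \<open>\<eta> 0\<close> of
  \<open>x\<close>.
\<close>

definition wt :: "complex fls \<Rightarrow> int" where
  "wt a = - \<eta> 0 * fls_subdegree a"

lemma wt_mult: "a \<noteq> 0 \<Longrightarrow> b \<noteq> 0 \<Longrightarrow> wt (a * b) = wt a + wt b"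
  by (simp add: wt_def algebra_simps)

lemma wt_add: "a + b \<noteq> 0 \<Longrightarrow> a = 0 \<or> wt a \<le> d \<Longrightarrow> b = 0 \<or> wt b \<le> d \<Longrightarrow> wt (a + b) \<le> d"
proof -
  assume a: "a + b \<noteq> 0" "a = 0 \<or> wt a \<le> d" "b = 0 \<or> wt b \<le> d"
  consider "a = 0" | "b = 0" | "a \<noteq> 0" "b \<noteq> 0" by auto
  then show ?thesis
  proof cases
    case 3
    have "fls_subdegree (a + b) \<ge> min (fls_subdegree a) (fls_subdegree b)"
      using a(1) by (rule fls_plus_subdegree)
    then have "fls_subdegree (a + b) \<ge> fls_subdegree a \<or> fls_subdegree (a + b) \<ge> fls_subdegree b" by linarith
    then have "wt (a + b) \<le> wt a \<or> wt (a + b) \<le> wt b" unfolding wt_def using eta0 by auto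
    then show ?thesis using a 3 by auto
  qed (use a in auto)
qed

lemma mon_mult: "mon j m * mon j m' = mon j (\<lambda>l. m l + m' l)"
  by (simp add: mon_def prod.distrib power_add)
lemma mon_power: "mon j m ^ i = mon j (\<lambda>l. i * m l)"
  by (simp add: mon_def prod_power_distrib power_mult[symmetric] mult.commute)
lemma wtm_add: "wtm j (\<lambda>l. m l + m' l) = wtm j m + wtm j m'"
  by (simp add: wtm_def sum.distrib algebra_simps)

lemma mon_single: "l \<in> {1..j} \<Longrightarrow> mon j (\<lambda>i. if i = l then e else 0) = G l ^ e"
proof -
  assume l: "l \<in> {1..j}"
  have "mon j (\<lambda>i. if i = l then e else 0) = (\<Prod>i\<in>{1..j}. if i = l then G i ^ e else 1)"
    unfolding mon_def by (rule prod.cong) auto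
  then show ?thesis using l by simp
qed

lemma wtm_single: "l \<in> {1..j} \<Longrightarrow> wtm j (\<lambda>i. if i = l then e else 0) = int e * \<eta> l"
proof -
  assume l: "l \<in> {1..j}"
  have "wtm j (\<lambda>i. if i = l then e else 0) = (\<Sum>i\<in>{1..j}. if i = l then int e * \<eta> i else 0)"
    unfolding wtm_def by (rule sum.cong) auto
  then show ?thesis using l by simp
qed

lemma mon_degree:
  assumes "j \<le> n + 1"
  shows "lead_coeff (mon j m) = 1" "degree (mon j m) = (\<Sum>l\<in>{1..j}. m l * D l)"
proof -
  have *: "lead_coeff (G i) = 1" "degree (G i) = D i" if "i \<in> {1..j}" for i using G_monic[of i] assms that by auto
  show "lead_coeff (mon j m) = 1" unfolding mon_def by (rule conjunct1[OF lead_prod_monic]) (use *(1) in auto)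
  have "(\<Sum>l\<in>{1..j}. m l * degree (G l)) = (\<Sum>l\<in>{1..j}. m l * D l)" using * by (intro sum.cong) auto
  then show "degree (mon j m) = (\<Sum>l\<in>{1..j}. m l * D l)"
    unfolding mon_def using lead_prod_monic[of "{1..j}" G m] * by simp
qed

text \<open>
  The standard monomial of degree \<open>k\<close> in \<open>G 1, \<dots>, G j\<close>.
\<close>

definition B :: "nat \<Rightarrow> nat \<Rightarrow> complex fls poly" where "B j k = mon j (dig j k)"

lemma B_basis: "1 \<le> j \<Longrightarrow> j \<le> n + 1 \<Longrightarrow> monic_basis (B j)"
proof
  fix k assume "1 \<le> j" "j \<le> n + 1"
  then show "degree (B j k) = k" using dig_sum mon_degree(2) by (simp add: B_def)
  moreover have "lead_coeff (B j k) = 1" unfolding B_def using mon_degree(1) \<open>j \<le> n + 1\<close> .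
  ultimately show "coeff (B j k) k = 1" by simp
qed

abbreviation bc :: "nat \<Rightarrow> complex fls poly \<Rightarrow> nat \<Rightarrow> complex fls" where
  "bc j \<equiv> monic_basis.bcoef (B j)"

definition W :: "nat \<Rightarrow> nat \<Rightarrow> int" where "W j k = wtm j (dig j k)"

text \<open>
  Degree, weight and the termination measure of a monomial are all linear in its exponents. The
  next lemmas treat them at once; the semiring is generic because degrees are natural numbers and
  weights are integers.
\<close>

lemma lin_upd:
  fixes c :: "nat \<Rightarrow> 'b::comm_semiring_1"
  assumes "l \<in> {1..j}" "a \<le> m l"
  shows "(\<Sum>i\<in>{1..j}. of_nat (m i) * c i) = (\<Sum>i\<in>{1..j}. of_nat ((m(l := m l - a)) i) * c i) + of_nat a * c l"
proof -
  have "(\<Sum>i\<in>{1..j}. of_nat (m i) * c i) = of_nat (m l) * c l + (\<Sum>i\<in>{1..j}-{l}. of_nat (m i) * c i)"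
    using assms by (subst sum.remove[of _ l]) auto
  moreover have "(\<Sum>i\<in>{1..j}. of_nat ((m(l := m l - a)) i) * c i) =
      of_nat (m l - a) * c l + (\<Sum>i\<in>{1..j}-{l}. of_nat (m i) * c i)"
    using assms by (subst sum.remove[of _ l]) (auto intro!: sum.cong)
  moreover have "of_nat (m l) = (of_nat (m l - a) + of_nat a :: 'b)"
    using assms(2) by (metis le_add_diff_inverse2 of_nat_add)
  ultimately show ?thesis by (simp add: algebra_simps)
qed

lemma lin_add:
  fixes c :: "nat \<Rightarrow> 'b::comm_semiring_1"
  shows "(\<Sum>i\<in>S. of_nat (m i + m' i) * c i) = (\<Sum>i\<in>S. of_nat (m i) * c i) + (\<Sum>i\<in>S. of_nat (m' i) * c i)"
  by (simp add: sum.distrib algebra_simps)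

lemma lin_single:
  fixes c :: "nat \<Rightarrow> 'b::comm_semiring_1"
  assumes "l \<in> {1..j}"
  shows "(\<Sum>i\<in>{1..j}. of_nat (if i = l then e else 0) * c i) = of_nat e * c l"
proof -
  have "(\<Sum>i\<in>{1..j}. of_nat (if i = l then e else 0) * c i) = (\<Sum>i\<in>{1..j}. if i = l then of_nat e * c i else 0)"
    by (rule sum.cong) auto
  then show ?thesis using assms by simp
qed

lemma lin_below:
  fixes c :: "nat \<Rightarrow> 'b::comm_semiring_1"
  assumes "l \<le> j"
  shows "(\<Sum>i\<in>{1..j}. of_nat (if i < l then f i else 0) * c i) = (\<Sum>i\<in>{1..<l}. of_nat (f i) * c i)"
proof -
  have "(\<Sum>i\<in>{1..<l}. of_nat (f i) * c i) = (\<Sum>i\<in>{1..<l}. of_nat (if i < l then f i else 0) * c i)"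
    by (rule sum.cong) auto
  also have "\<dots> = (\<Sum>i\<in>{1..j}. of_nat (if i < l then f i else 0) * c i)"
    by (rule sum.mono_neutral_left) (use assms in auto)
  finally show ?thesis by simp
qed

lemma mon_below:
  assumes "l \<le> j"
  shows "mon j (\<lambda>i. if i < l then f i else 0) = (\<Prod>i\<in>{1..<l}. G i ^ f i)"
proof -
  have "(\<Prod>i\<in>{1..<l}. G i ^ f i) = (\<Prod>i\<in>{1..<l}. G i ^ (if i < l then f i else 0))"
    by (rule prod.cong) auto
  also have "\<dots> = (\<Prod>i\<in>{1..j}. G i ^ (if i < l then f i else 0))"
    by (rule prod.mono_neutral_left) (use assms in auto)
  finally show ?thesis by (simp add: mon_def)
qed

text \<open>
  The coefficient of the tail \<open>\<Prod>\<^sub>i\<^sub><\<^sub>l G i ^ \<beta> l i\<close> in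
  the recursion for \<open>G (l + 1)\<close>.
\<close>

definition tail_coeff :: "nat \<Rightarrow> complex fls" where
  "tail_coeff l = fls_const (\<theta> l) * fls_X_intpow (- \<beta> l 0)"

lemma tail_coeff: "l \<in> {1..n} \<Longrightarrow> tail_coeff l \<noteq> 0 \<and> wt (tail_coeff l) = \<beta> l 0 * \<eta> 0"
proof -
  assume l: "l \<in> {1..n}"
  have "fls_const (\<theta> l) \<noteq> 0" using theta[OF l] by simp
  moreover have "(fls_X_intpow (- \<beta> l 0) :: complex fls) \<noteq> 0" by (simp add: fls_shift_eq0_iff)
  ultimately show ?thesis unfolding tail_coeff_def wt_def by (simp add: fls_subdegree_mult)
qed

lemma rel': "l \<in> {1..n} \<Longrightarrow> int (\<alpha> l) * \<eta> l = wt (tail_coeff l) + (\<Sum>i\<in>{1..<l}. of_nat (nat (\<beta> l i)) * \<eta> i)"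
proof -
  assume l: "l \<in> {1..n}"
  have "{..<l} = insert 0 {1..<l}" using l by auto
  then have "(\<Sum>i<l. \<beta> l i * \<eta> i) = \<beta> l 0 * \<eta> 0 + (\<Sum>i\<in>{1..<l}. \<beta> l i * \<eta> i)" by simp
  moreover have "(\<Sum>i\<in>{1..<l}. \<beta> l i * \<eta> i) = (\<Sum>i\<in>{1..<l}. of_nat (nat (\<beta> l i)) * \<eta> i)"
    using beta[OF l] by (intro sum.cong) auto
  ultimately show ?thesis using rel[OF l] tail_coeff[OF l] by simp
qed

lemma step': "l \<in> {1..n} \<Longrightarrow> G l ^ \<alpha> l = G (l + 1) + smult (tail_coeff l) (\<Prod>i\<in>{1..<l}. G i ^ nat (\<beta> l i))"
  using step[of l] by (simp add: tail_coeff_def)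

text \<open>
  All terms of the standard expansion in \<open>G 1, \<dots>, G j\<close> have weight at most
  \<open>d\<close>, and those of weight exactly \<open>d\<close> contain \<open>G j\<close> to the
  power \<open>e\<close>.
\<close>

definition tops_at :: "nat \<Rightarrow> int \<Rightarrow> nat \<Rightarrow> complex fls poly \<Rightarrow> bool" where
  "tops_at j d e h \<longleftrightarrow> (\<forall>k. bc j h k = 0 \<or> wt (bc j h k) + W j k < d
      \<or> (wt (bc j h k) + W j k = d \<and> k div D j = e))"

definition weight_le :: "nat \<Rightarrow> int \<Rightarrow> complex fls poly \<Rightarrow> bool" where
  "weight_le j d h \<longleftrightarrow> (\<forall>k. bc j h k = 0 \<or> wt (bc j h k) + W j k \<le> d)"

lemma weight_le_tops_at: "weight_le j d h \<Longrightarrow> d < d' \<Longrightarrow> tops_at j d' e h"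
  unfolding weight_le_def tops_at_def by (elim all_forward) linarith
lemma tops_at_weight_le: "tops_at j d e h \<Longrightarrow> weight_le j d h"
  unfolding weight_le_def tops_at_def by (elim all_forward) linarith
lemma weight_le_mono: "weight_le j d h \<Longrightarrow> d \<le> d' \<Longrightarrow> weight_le j d' h"
  unfolding weight_le_def by (elim all_forward) linarith

context
  fixes j assumes j: "1 \<le> j" "j \<le> n + 1"
begin

interpretation mb: monic_basis "B j" by (rule B_basis[OF j])

lemma weight_le_add: assumes "weight_le j d h" "weight_le j d h'" shows "weight_le j d (h + h')"
  unfolding weight_le_def
proof
  fix k
  show "bc j (h + h') k = 0 \<or> wt (bc j (h + h') k) + W j k \<le> d"
    using assms[unfolded weight_le_def, rule_format, of k] wt_add[of "bc j h k" "bc j h' k" "d - W j k"]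
    unfolding mb.bcoef_add by linarith
qed

lemma weight_le_0: "weight_le j d 0" unfolding weight_le_def by (simp add: mb.bcoef_0)

lemma weight_le_sum: "finite S \<Longrightarrow> (\<And>i. i \<in> S \<Longrightarrow> weight_le j d (h i)) \<Longrightarrow> weight_le j d (\<Sum>i\<in>S. h i)"
  by (induction S rule: finite_induct) (auto intro: weight_le_add weight_le_0)

lemma weight_le_smult: "weight_le j d h \<Longrightarrow> a = 0 \<or> wt a + d \<le> d' \<Longrightarrow> weight_le j d' (smult a h)"
  unfolding weight_le_def
proof
  fix k
  assume *: "\<forall>k. bc j h k = 0 \<or> wt (bc j h k) + W j k \<le> d" "a = 0 \<or> wt a + d \<le> d'"
  show "bc j (smult a h) k = 0 \<or> wt (bc j (smult a h) k) + W j k \<le> d'"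
    using *(1)[rule_format, of k] *(2) wt_mult[of a "bc j h k"]
    unfolding mb.bcoef_smult by (cases "a = 0"; cases "bc j h k = 0") auto
qed

lemma weight_le_minus: "weight_le j d h \<Longrightarrow> weight_le j d (- h)"
  using weight_le_smult[of d h "-1" d] by (simp add: wt_def)

lemma weight_le_diff: "weight_le j d h \<Longrightarrow> weight_le j d h' \<Longrightarrow> weight_le j d (h - h')"
  using weight_le_add[of d h "- h'"] weight_le_minus[of d h'] by simp

lemma tops_at_add: assumes "tops_at j d e h" "tops_at j d e h'" shows "tops_at j d e (h + h')"
  unfolding tops_at_def
proof
  fix k
  show "bc j (h + h') k = 0 \<or> wt (bc j (h + h') k) + W j k < d \<or>
        wt (bc j (h + h') k) + W j k = d \<and> k div D j = e"
  proof (cases "k div D j = e")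
    case True
    have "weight_le j d (h + h')" by (rule weight_le_add[OF tops_at_weight_le[OF assms(1)] tops_at_weight_le[OF assms(2)]])
    then have "bc j (h + h') k = 0 \<or> wt (bc j (h + h') k) + W j k \<le> d" unfolding weight_le_def by blast
    then show ?thesis using True by linarith
  next
    case False
    then show ?thesis
      using assms[unfolded tops_at_def, rule_format, of k] wt_add[of "bc j h k" "bc j h' k" "d - W j k - 1"]
      unfolding mb.bcoef_add by linarith
  qed
qed

lemma tops_at_smult: assumes "tops_at j d e h" "a \<noteq> 0" shows "tops_at j (wt a + d) e (smult a h)"
  unfolding tops_at_def
proof
  fix k
  show "bc j (smult a h) k = 0 \<or> wt (bc j (smult a h) k) + W j k < wt a + d \<or>
        wt (bc j (smult a h) k) + W j k = wt a + d \<and> k div D j = e"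
    using assms(1)[unfolded tops_at_def, rule_format, of k] assms(2) wt_mult[of a "bc j h k"]
    unfolding mb.bcoef_smult by (cases "bc j h k = 0") auto
qed

lemma std_index:
  assumes "\<And>l. l \<in> {1..<j} \<Longrightarrow> m l < \<alpha> l"
  defines "k \<equiv> \<Sum>l\<in>{1..j}. m l * D l"
  shows "mon j m = B j k" "W j k = wtm j m" "k div D j = m j"
proof -
  have *: "dig j k l = m l" if "l \<in> {1..j}" for l using dig_unique[OF j assms(1)] that by (simp add: k_def)
  show "mon j m = B j k" unfolding B_def mon_def using * by (intro prod.cong) auto
  show "W j k = wtm j m" unfolding W_def wtm_def using * by (intro sum.cong) auto
  show "k div D j = m j" using *[of j] j by (simp add: dig_def)
qed

lemma tops_at_B: "tops_at j (W j k) (k div D j) (B j k)"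
  unfolding tops_at_def mb.bcoef_basis by (auto simp: wt_def)

text \<open>
  A monomial with too large an exponent of some \<open>G l\<close> is rewritten by \<open>G l ^
  \<alpha> l = G (l + 1) + tail\<close>. The summand with \<open>G (l + 1)\<close> has smaller
  weight. The one with the tail has the same weight and, as \<open>l < j\<close>, the same
  exponent of \<open>G j\<close>. The rewriting terminates: the tail lowers the degree in
  \<open>y\<close>, and passing to \<open>G (l + 1)\<close> keeps it but moves exponents to the
  right.
\<close>

lemma tops_at_mon: "tops_at j (wtm j m) (m j) (mon j m)"
proof (induction m rule: wf_induct_rule[OF wf_measures[of
    "[\<lambda>m. \<Sum>i\<in>{1..j}. m i * D i, \<lambda>m. \<Sum>i\<in>{1..j}. m i * (j + 1 - i)]"]])
  (* The measures are the degree in y and, with equal degree, the exponents weighted by their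
     distance from the right end. *)
  case (1 m)
  show ?case
  proof (cases "\<forall>l\<in>{1..<j}. m l < \<alpha> l")
    case True
    then show ?thesis using std_index[of m] tops_at_B by metis
  next
    case False
    then obtain l where l: "l \<in> {1..<j}" "\<alpha> l \<le> m l" by force
    have ln: "l \<in> {1..n}" and lj: "l \<in> {1..j}" "l + 1 \<in> {1..j}" "l \<le> j" using l j by auto
    define m0 where "m0 = m(l := m l - \<alpha> l)"
    define m1 where "m1 = (\<lambda>i. m0 i + (if i = l + 1 then 1 else 0))"
    define m2 where "m2 = (\<lambda>i. m0 i + (if i < l then nat (\<beta> l i) else 0))"
    have m: "m = (\<lambda>i. m0 i + (if i = l then \<alpha> l else 0))" using l by (auto simp: m0_def)
    have "mon j m = mon j m0 * G l ^ \<alpha> l"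
      by (subst m) (simp only: mon_mult[symmetric] mon_single[OF lj(1)])
    also have "\<dots> = mon j m0 * G (l + 1) ^ 1 + smult (tail_coeff l) (mon j m0 * (\<Prod>i\<in>{1..<l}. G i ^ nat (\<beta> l i)))"
      unfolding step'[OF ln] by (simp add: algebra_simps)
    also have "mon j m0 * G (l + 1) ^ 1 = mon j m1"
      unfolding m1_def by (simp only: mon_mult[symmetric] mon_single[OF lj(2)])
    also have "mon j m0 * (\<Prod>i\<in>{1..<l}. G i ^ nat (\<beta> l i)) = mon j m2"
      unfolding m2_def by (simp only: mon_mult[symmetric] mon_below[OF lj(3)])
    finally have eq: "mon j m = mon j m1 + smult (tail_coeff l) (mon j m2)" .
    have lin: "(\<Sum>i\<in>{1..j}. of_nat (m i) * c i) = (\<Sum>i\<in>{1..j}. of_nat (m0 i) * c i) + of_nat (\<alpha> l) * c l"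
      for c :: "nat \<Rightarrow> 'c::comm_semiring_1"
      unfolding m0_def using l lj by (intro lin_upd) auto
    have lin1: "(\<Sum>i\<in>{1..j}. of_nat (m1 i) * c i) = (\<Sum>i\<in>{1..j}. of_nat (m0 i) * c i) + c (l + 1)"
      for c :: "nat \<Rightarrow> 'c::comm_semiring_1"
      unfolding m1_def using lin_add[of m0 "\<lambda>i. if i = l + 1 then 1 else 0" c "{1..j}"] lin_single[OF lj(2), of 1 c] by simp
    have lin2: "(\<Sum>i\<in>{1..j}. of_nat (m2 i) * c i) = (\<Sum>i\<in>{1..j}. of_nat (m0 i) * c i) + (\<Sum>i\<in>{1..<l}. of_nat (nat (\<beta> l i)) * c i)"
      for c :: "nat \<Rightarrow> 'c::comm_semiring_1"
      unfolding m2_def lin_add lin_below[OF lj(3)] ..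
    have D1: "(\<Sum>i\<in>{1..j}. m1 i * D i) = (\<Sum>i\<in>{1..j}. m i * D i)"
      using lin[of D] lin1[of D] D_Suc[of l] l by simp
    have S1: "(\<Sum>i\<in>{1..j}. m1 i * (j + 1 - i)) < (\<Sum>i\<in>{1..j}. m i * (j + 1 - i))"
    proof -
      have "j + 1 - (l + 1) < 1 * (j + 1 - l)" using l by (simp add: Suc_diff_le)
      also have "\<dots> \<le> \<alpha> l * (j + 1 - l)" using alpha_pos[OF ln] by (intro mult_right_mono) auto
      finally show ?thesis using lin[of "\<lambda>i. j + 1 - i"] lin1[of "\<lambda>i. j + 1 - i"] by simp
    qed
    have D2: "(\<Sum>i\<in>{1..j}. m2 i * D i) < (\<Sum>i\<in>{1..j}. m i * D i)"
    proof -
      have "(\<Sum>i\<in>{1..<l}. nat (\<beta> l i) * D i) < D l"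
        using beta[OF ln] l j by (intro digit_sum_less) (auto simp: nat_less_iff)
      also have "\<dots> \<le> \<alpha> l * D l" using alpha_pos[OF ln] by simp
      finally show ?thesis using lin[of D] lin2[of D] by simp
    qed
    have w1: "wtm j m1 < wtm j m" unfolding wtm_def lin lin1 using drop[OF ln] by simp
    have w2: "wtm j m = wt (tail_coeff l) + wtm j m2" unfolding wtm_def lin lin2 using rel'[OF ln] by simp
    have "tops_at j (wtm j m1) (m1 j) (mon j m1)" by (rule 1) (use D1 S1 in auto)
    then have "tops_at j (wtm j m) (m j) (mon j m1)" by (rule weight_le_tops_at[OF tops_at_weight_le w1])
    moreover have "tops_at j (wtm j m2) (m2 j) (mon j m2)" by (rule 1) (use D2 in auto)
    then have "tops_at j (wtm j m) (m2 j) (smult (tail_coeff l) (mon j m2))"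
      unfolding w2 using tail_coeff[OF ln] by (intro tops_at_smult) auto
    moreover have m2j: "m2 j = m j" using l by (simp add: m2_def m0_def)
    ultimately show ?thesis unfolding eq by (simp add: tops_at_add)
  qed
qed

lemma weight_le_mon: "wtm j m \<le> d \<Longrightarrow> weight_le j d (mon j m)"
  by (rule weight_le_mono[OF tops_at_weight_le[OF tops_at_mon]])

text \<open>
  The reduction of monomials does not raise weights, so the weights filter the ring.
\<close>

lemma weight_le_mult: assumes "weight_le j d h" "weight_le j d' h'" shows "weight_le j (d + d') (h * h')"
proof -
  have "h * h' = (\<Sum>k\<le>degree h. smult (bc j h k) (B j k)) * (\<Sum>k\<le>degree h'. smult (bc j h' k) (B j k))"
    using mb.sum_bcoef[of h "degree h"] mb.sum_bcoef[of h' "degree h'"] by simp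
  also have "\<dots> = (\<Sum>k\<le>degree h. \<Sum>l\<le>degree h'. smult (bc j h k * bc j h' l) (mon j (\<lambda>i. dig j k i + dig j l i)))"
    unfolding sum_product by (simp add: B_def mon_mult mult_ac)
  finally have eq: "h * h' = \<dots>" .
  show ?thesis unfolding eq
  proof (intro weight_le_sum)
    fix k l
    show "weight_le j (d + d') (smult (bc j h k * bc j h' l) (mon j (\<lambda>i. dig j k i + dig j l i)))"
    proof (cases "bc j h k = 0 \<or> bc j h' l = 0")
      case True then show ?thesis using weight_le_0 by auto
    next
      case False
      then have "wt (bc j h k) + W j k \<le> d" "wt (bc j h' l) + W j l \<le> d'"
        using assms unfolding weight_le_def by auto
      then show ?thesis
        using False by (intro weight_le_smult[OF weight_le_mon[OF order_refl]]) (auto simp: wtm_add W_def wt_mult)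
    qed
  qed auto
qed

lemma weight_le_1: "weight_le j 0 1"
  using weight_le_mon[of "\<lambda>_. 0" 0] by (simp add: mon_def wtm_def)

lemma weight_le_power: "weight_le j d h \<Longrightarrow> weight_le j (int r * d) (h ^ r)"
proof (induction r)
  case (Suc r)
  then show ?case using weight_le_mult[of d h "int r * d" "h ^ r"] by (simp add: algebra_simps)
qed (simp add: weight_le_1)

lemma weight_le_prod: "finite S \<Longrightarrow> (\<And>i. i \<in> S \<Longrightarrow> weight_le j (d i) (h i)) \<Longrightarrow> weight_le j (\<Sum>i\<in>S. d i) (\<Prod>i\<in>S. h i)"
proof (induction S rule: finite_induct)
  case (insert i S)
  then have "weight_le j (d i + (\<Sum>i\<in>S. d i)) (h i * (\<Prod>i\<in>S. h i))" by (intro weight_le_mult) auto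
  then show ?case using insert.hyps by simp
qed (simp add: weight_le_1)

lemma weight_le_power_diff:
  assumes "weight_le j d h" "weight_le j d h'" "weight_le j (d - 1) (h - h')"
  shows "weight_le j (int r * d - 1) (h ^ r - h' ^ r)"
proof (induction r)
  case (Suc r)
  have e: "int (Suc r) * d - 1 = d + (int r * d - 1)" "int (Suc r) * d - 1 = (d - 1) + int r * d"
    by (simp_all add: algebra_simps)
  have "weight_le j (int (Suc r) * d - 1) (h * (h ^ r - h' ^ r))" unfolding e(1) using assms Suc by (intro weight_le_mult)
  moreover have "weight_le j (int (Suc r) * d - 1) ((h - h') * h' ^ r)" unfolding e(2) using assms Suc by (intro weight_le_mult weight_le_power)
  ultimately have "weight_le j (int (Suc r) * d - 1) (h * (h ^ r - h' ^ r) + (h - h') * h' ^ r)"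
    by (rule weight_le_add)
  moreover have "h ^ Suc r - h' ^ Suc r = h * (h ^ r - h' ^ r) + (h - h') * h' ^ r" by (simp add: algebra_simps)
  ultimately show ?case by (simp only:)
qed (simp add: weight_le_0)

section \<open>Why negative powers of the first key form cannot occur\<close>

text \<open>
  The binomial expansion of \<open>G (j + 1) ^ E\<close> consists of terms of equal weight that
  contain different powers of \<open>G j\<close>. By \<open>tops_at_mon\<close> the top weight
  parts of their reductions are therefore disjoint, and the term linear in the tail of \<open>G (j
  + 1)\<close> is a standard monomial as it stands. So \<open>f\<close> has a standard coefficient
  with the leading power \<open>x\<^bsup>\<beta> j 0\<^esup>\<close>, which must be a polynomial
  in \<open>x\<close>.
\<close>

lemma nonneg_exponent:
  assumes jn: "j \<le> n" and E: "E > 0"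
    and f: "weight_le j (int (E * \<alpha> j) * \<eta> j - 1) (f - G (j + 1) ^ E)"
    and A: "pnpos f" "\<And>l. l \<in> {1..j} \<Longrightarrow> pnpos (G l)"
  shows "\<beta> j 0 \<ge> 0"
proof -
  have jn': "j \<in> {1..n}" using j jn by auto
  let ?w = "int (E * \<alpha> j) * \<eta> j"
  (* The exponents and the coefficient of the i-th term of the binomial expansion of G (j + 1) ^
     E. *)
  define mi where "mi = (\<lambda>i l. i * (if l < j then nat (\<beta> j l) else 0) + (if l = j then \<alpha> j * (E - i) else 0))"
  define t where "t = (\<lambda>i. of_nat (E choose i) * (- tail_coeff j) ^ i)"
  have "G (j + 1) = - smult (tail_coeff j) (mon j (\<lambda>i. if i < j then nat (\<beta> j i) else 0)) + G j ^ \<alpha> j"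
    using step'[OF jn'] mon_below[of j j "\<lambda>i. nat (\<beta> j i)"] by simp
  also have "\<dots> = smult (- tail_coeff j) (mon j (\<lambda>i. if i < j then nat (\<beta> j i) else 0)) + mon j (\<lambda>l. if l = j then \<alpha> j else 0)"
    using mon_single[of j j] j by simp
  finally have "G (j + 1) ^ E = (\<Sum>i\<le>E. of_nat (E choose i) * smult (- tail_coeff j) (mon j (\<lambda>i. if i < j then nat (\<beta> j i) else 0)) ^ i
     * mon j (\<lambda>l. if l = j then \<alpha> j else 0) ^ (E - i))" by (simp only: binomial_ring)
  also have "\<dots> = (\<Sum>i\<le>E. smult (t i) (mon j (mi i)))"
  proof (rule sum.cong[OF refl])
    fix i
    have "smult (- tail_coeff j) (mon j (\<lambda>i. if i < j then nat (\<beta> j i) else 0)) ^ i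
     * mon j (\<lambda>l. if l = j then \<alpha> j else 0) ^ (E - i) = smult ((- tail_coeff j) ^ i) (mon j (mi i))"
      unfolding smult_power mon_power mult_smult_left mon_mult mi_def
      by (intro arg_cong2[where f = smult] arg_cong2[where f = mon] refl ext) auto
    then show "of_nat (E choose i) * smult (- tail_coeff j) (mon j (\<lambda>i. if i < j then nat (\<beta> j i) else 0)) ^ i
     * mon j (\<lambda>l. if l = j then \<alpha> j else 0) ^ (E - i) = smult (t i) (mon j (mi i))"
      by (simp add: t_def mult.assoc of_nat_poly)
  qed
  finally have GE: "G (j + 1) ^ E = (\<Sum>i\<le>E. smult (t i) (mon j (mi i)))" .
  have t0: "t i \<noteq> 0" "wt (t i) = int i * wt (tail_coeff j)" if "i \<le> E" for i
  proof -
    have c: "(of_nat (E choose i) :: complex fls) \<noteq> 0" using that by (simp add: zero_less_binomial_iff)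
    then show "t i \<noteq> 0" using tail_coeff[OF jn'] by (simp add: t_def)
    have "fls_subdegree (of_nat (E choose i) :: complex fls) = 0" by (simp flip: fls_of_nat)
    then show "wt (t i) = int i * wt (tail_coeff j)" using c conjunct1[OF tail_coeff[OF jn']]
      by (simp add: t_def wt_def fls_subdegree_mult fls_subdegree_pow)
  qed
  have wmi: "wt (t i) + wtm j (mi i) = ?w" if "i \<le> E" for i
  proof -
    have "wtm j (\<lambda>l. i * (if l < j then nat (\<beta> j l) else 0)) = int i * (\<Sum>l\<in>{1..<j}. of_nat (nat (\<beta> j l)) * \<eta> l)"
      unfolding lin_below[of j j "\<lambda>l. nat (\<beta> j l)" \<eta>, OF order_refl, symmetric] wtm_def
      by (simp add: sum_distrib_left mult_ac)
    moreover have "wtm j (\<lambda>l. if l = j then \<alpha> j * (E - i) else 0) = int (\<alpha> j * (E - i)) * \<eta> j"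
      using wtm_single[of j j] j by simp
    ultimately have "wt (t i) + wtm j (mi i) = int i * (wt (tail_coeff j) + (\<Sum>l\<in>{1..<j}. of_nat (nat (\<beta> j l)) * \<eta> l))
        + int (\<alpha> j * (E - i)) * \<eta> j"
      unfolding mi_def wtm_add t0(2)[OF that] by (simp add: algebra_simps)
    also have "\<dots> = int i * (int (\<alpha> j) * \<eta> j) + int (\<alpha> j * (E - i)) * \<eta> j"
      using rel'[OF jn'] by simp
    also have "\<dots> = ?w" using that by (simp add: of_nat_diff algebra_simps)
    finally show ?thesis .
  qed
  have mij: "mi i j = \<alpha> j * (E - i)" for i by (simp add: mi_def)
  (* The degree of the term linear in the tail, which is a standard monomial. *)
  define k where "k = (\<Sum>l\<in>{1..j}. mi 1 l * D l)"
  have k: "mon j (mi 1) = B j k" "W j k = wtm j (mi 1)" "k div D j = mi 1 j"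
    using beta[OF jn'] unfolding k_def by (intro std_index; force simp: mi_def)+
  have low: "bc j (smult (t i) (mon j (mi i))) k = 0 \<or> wt (bc j (smult (t i) (mon j (mi i))) k) + W j k < ?w"
    if i: "i \<le> E" "i \<noteq> 1" for i
  proof -
    have "tops_at j ?w (mi i j) (smult (t i) (mon j (mi i)))"
      unfolding wmi[OF i(1), symmetric] by (intro tops_at_smult tops_at_mon t0 i)
    moreover have "k div D j \<noteq> mi i j" unfolding k(3) mij using i E alpha_pos[OF jn'] by auto
    ultimately show ?thesis unfolding tops_at_def by blast
  qed
  define R where "R = (\<Sum>i\<in>{..E}-{1}. smult (t i) (mon j (mi i))) + (f - G (j + 1) ^ E)"
  have lowsum: "bc j (\<Sum>i\<in>S. smult (t i) (mon j (mi i))) k = 0 \<or> wt (bc j (\<Sum>i\<in>S. smult (t i) (mon j (mi i))) k) \<le> ?w - 1 - W j k"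
    if "finite S" "S \<subseteq> {..E} - {1}" for S using that
  proof (induction S rule: finite_induct)
    case empty then show ?case by (simp add: mb.bcoef_0)
  next
    case (insert i S)
    show ?case using insert low[of i] wt_add[of "bc j (smult (t i) (mon j (mi i))) k" "bc j (\<Sum>i\<in>S. smult (t i) (mon j (mi i))) k" "?w - 1 - W j k"]
      by (simp add: mb.bcoef_add del: One_nat_def) linarith
  qed
  have lowR: "bc j R k = 0 \<or> wt (bc j R k) \<le> ?w - 1 - W j k"
    using lowsum[of "{..E}-{1}"] f[unfolded weight_le_def, rule_format, of k]
      wt_add[of "bc j (\<Sum>i\<in>{..E}-{1}. smult (t i) (mon j (mi i))) k" "bc j (f - G (j + 1) ^ E) k" "?w - 1 - W j k"]
    unfolding R_def mb.bcoef_add by force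
  have "f = smult (t 1) (B j k) + R"
  proof -
    have "G (j + 1) ^ E = smult (t 1) (mon j (mi 1)) + (\<Sum>i\<in>{..E}-{1}. smult (t i) (mon j (mi i)))"
      unfolding GE using E by (subst sum.remove[of _ 1]) auto
    then show ?thesis unfolding R_def k(1) by simp
  qed
  then have fk: "bc j f k = t 1 + bc j R k" by (simp add: mb.bcoef_add mb.bcoef_smult mb.bcoef_basis)
  have t1: "t 1 \<noteq> 0" "wt (t 1) = wt (tail_coeff j)" using t0[of 1] E by auto
  have lt: "bc j R k = 0 \<or> wt (bc j R k) < wt (t 1)" using lowR wmi[of 1] k(2) E by auto
  then have sd: "bc j R k = 0 \<or> fls_subdegree (t 1) < fls_subdegree (bc j R k)"
    unfolding wt_def using eta0 by auto
  then have nz: "fls_nth (bc j f k) (fls_subdegree (t 1)) \<noteq> 0"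
    unfolding fk using t1(1) by auto
  have "bc j f k \<in> Collect npos"
  proof (rule mb.bcoef_in)
    have "pnpos (B j k)" for k
      unfolding B_def mon_def using A(2) by (intro pnpos_prod pnpos_power) auto
    then show "coeff (B j k) i \<in> Collect npos" for k i by (auto simp: pnpos_def)
    show "coeff f i \<in> Collect npos" for i using A(1) by (auto simp: pnpos_def)
  qed (auto simp: npos_mult, auto simp: npos_def)
  then have "fls_subdegree (t 1) \<le> 0" using nz by (force simp: npos_def)
  then have "wt (t 1) \<ge> 0" unfolding wt_def using eta0 by (simp add: mult_le_0_iff)
  then have "wt (tail_coeff j) \<ge> 0" unfolding t1(2) .
  then show ?thesis using tail_coeff[OF jn'] eta0 by (simp add: zero_le_mult_iff)
qed

end

context
  fixes j assumes j: "j \<in> {1..n}"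
begin

lemma jj: "1 \<le> j" "j \<le> n + 1" using j by auto

interpretation mb: monic_basis "B j" by (rule B_basis[OF jj])

text \<open>
  The weight of \<open>G k\<close>, for \<open>k > j\<close>, when it is expanded in \<open>G 1,
  \<dots>, G j\<close> only: that of the power of \<open>G (j + 1)\<close> of the same degree. It
  exceeds \<open>\<eta> k\<close> because the cancellations in the later steps are not seen.
\<close>

definition q :: "nat \<Rightarrow> int" where "q k = int (D k div D (j + 1)) * (int (\<alpha> j) * \<eta> j)"

lemma D_div: "j + 1 \<le> k \<Longrightarrow> D (k + 1) div D (j + 1) = \<alpha> k * (D k div D (j + 1))"
  using D_Suc[of k] D_dvd[of "j + 1" k] by (simp add: div_mult_swap mult.commute)

lemma q_base: "q (j + 1) = int (\<alpha> j) * \<eta> j"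
  using D_pos[of "j + 1"] j by (simp add: q_def)

lemma q_Suc: "j + 1 \<le> k \<Longrightarrow> q (k + 1) = int (\<alpha> k) * q k"
  using D_div[of k] by (simp add: q_def)

lemma excess_pos: "j + 1 \<le> k \<Longrightarrow> k \<le> n + 1 \<Longrightarrow> q k > \<eta> k"
proof (induction k rule: nat_induct_at_least)
  case base
  show ?case using q_base drop[OF j] by simp
next
  case (Suc k)
  have kn: "k \<in> {1..n}" using Suc j by auto
  have "int (\<alpha> k) * \<eta> k < int (\<alpha> k) * q k" using Suc alpha_pos[OF kn] by simp
  then show ?case using drop[OF kn] q_Suc[of k] Suc by simp
qed

text \<open>
  A sum over digits is smaller than the next place value; here the role of the place values is
  played by the excess weights \<open>q i - \<eta> i\<close>, which grow at least by the factors
  \<open>\<alpha> i\<close>.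
\<close>

lemma excess: "j + 1 \<le> k \<Longrightarrow> k \<le> n + 1 \<Longrightarrow> (\<And>i. i \<in> {j+1..<k} \<Longrightarrow> m i < \<alpha> i) \<Longrightarrow>
    (\<Sum>i\<in>{j+1..<k}. int (m i) * (q i - \<eta> i)) < q k - \<eta> k"
proof (induction k rule: nat_induct_at_least)
  case base
  show ?case using excess_pos[of "j + 1"] j by simp
next
  case (Suc k)
  have kn: "k \<in> {1..n}" using Suc j by auto
  have lt: "(\<Sum>i\<in>{j+1..<k}. int (m i) * (q i - \<eta> i)) < q k - \<eta> k" using Suc by auto
  have pos: "q k - \<eta> k > 0" using excess_pos[of k] Suc by simp
  have "(\<Sum>i\<in>{j+1..<Suc k}. int (m i) * (q i - \<eta> i)) = (\<Sum>i\<in>{j+1..<k}. int (m i) * (q i - \<eta> i)) + int (m k) * (q k - \<eta> k)"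
    using Suc.hyps by simp
  also have "\<dots> < (int (m k) + 1) * (q k - \<eta> k)" using lt by (simp add: algebra_simps)
  also have "\<dots> \<le> int (\<alpha> k) * (q k - \<eta> k)"
    using Suc.prems(2)[of k] Suc.hyps pos by (intro mult_right_mono) auto
  also have "\<dots> = q (k + 1) - int (\<alpha> k) * \<eta> k" using q_Suc[of k] Suc.hyps by (simp add: algebra_simps)
  also have "\<dots> < q (k + 1) - \<eta> (k + 1)" using drop[OF kn] by simp
  finally show ?case by simp
qed

lemma weight_le_monomial:
  assumes k: "j + 1 \<le> k" "k \<le> n + 2"
    and G: "\<And>i. i \<in> {j+1..<k} \<Longrightarrow> weight_le j (q i) (G i)"
  shows "weight_le j ((\<Sum>i\<in>{1..<k}. int (m i) * \<eta> i) + (\<Sum>i\<in>{j+1..<k}. int (m i) * (q i - \<eta> i))) (\<Prod>i\<in>{1..<k}. G i ^ m i)"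
proof -
  have un: "{1..<k} = {1..j} \<union> {j+1..<k}" "{1..j} \<inter> {j+1..<k} = {}" using k jj by auto
  have "(\<Prod>i\<in>{1..<k}. G i ^ m i) = mon j m * (\<Prod>i\<in>{j+1..<k}. G i ^ m i)"
    unfolding mon_def un(1) by (rule prod.union_disjoint) (use un(2) in auto)
  moreover have "(\<Sum>i\<in>{1..<k}. int (m i) * \<eta> i) = wtm j m + (\<Sum>i\<in>{j+1..<k}. int (m i) * \<eta> i)"
    unfolding wtm_def un(1) by (rule sum.union_disjoint) (use un(2) in auto)
  moreover have "weight_le j (wtm j m + (\<Sum>i\<in>{j+1..<k}. int (m i) * q i)) (mon j m * (\<Prod>i\<in>{j+1..<k}. G i ^ m i))"
    by (intro weight_le_mult[OF jj] weight_le_mon[OF jj] weight_le_prod[OF jj] weight_le_power[OF jj] G) auto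
  ultimately show ?thesis by (simp add: algebra_simps sum_subtractf)
qed

text \<open>
  In the step from \<open>G i\<close> to \<open>G (i + 1)\<close> with \<open>i > j\<close> the
  tail is of smaller weight than \<open>G i ^ \<alpha> i\<close>: its true weight is the same, and
  by the bound on digits its excess is less than that of \<open>G i\<close>. So each later key
  polynomial agrees with a power of \<open>G (j + 1)\<close> up to terms of lower weight.
\<close>

lemma later_key_weight_le: "j + 1 \<le> k \<Longrightarrow> k \<le> n + 1 \<Longrightarrow>
   weight_le j (q k) (G k) \<and> weight_le j (q k - 1) (G k - G (j + 1) ^ (D k div D (j + 1)))"
proof (induction k rule: less_induct)
  case (less k)
  show ?case
  proof (cases "k = j + 1")
    case True
    have "weight_le j (int (\<alpha> j) * \<eta> j) (G j ^ \<alpha> j)"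
      using weight_le_power[OF jj weight_le_mon[OF jj, of "\<lambda>i. if i = j then 1 else 0" "\<eta> j"]] jj
      by (simp add: mon_single wtm_single)
    moreover have "weight_le j (int (\<alpha> j) * \<eta> j) (smult (tail_coeff j) (\<Prod>i\<in>{1..<j}. G i ^ nat (\<beta> j i)))"
    proof -
      have "wtm j (\<lambda>i. if i < j then nat (\<beta> j i) else 0) = (\<Sum>i\<in>{1..<j}. of_nat (nat (\<beta> j i)) * \<eta> i)"
        unfolding wtm_def by (rule lin_below) simp
      then show ?thesis unfolding rel'[OF j] mon_below[of j j "\<lambda>i. nat (\<beta> j i)", OF order_refl, symmetric]
        by (intro weight_le_smult[OF jj weight_le_mon[OF jj order_refl]]) simp
    qed
    ultimately have "weight_le j (int (\<alpha> j) * \<eta> j) (G j ^ \<alpha> j - smult (tail_coeff j) (\<Prod>i\<in>{1..<j}. G i ^ nat (\<beta> j i)))"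
      by (rule weight_le_diff[OF jj])
    then have "weight_le j (q k) (G k)" unfolding step'[OF j] using True q_base by simp
    moreover have "G k - G (j + 1) ^ (D k div D (j + 1)) = 0"
      using True D_pos[of "j + 1"] j by simp
    ultimately show ?thesis using weight_le_0[OF jj] by simp
  next
    case False
    then obtain i where i: "k = i + 1" "j + 1 \<le> i" using less.prems by (cases k) auto
    have iN: "i \<in> {1..n}" using i j less.prems by auto
    have IH: "weight_le j (q l) (G l)" "weight_le j (q l - 1) (G l - G (j + 1) ^ (D l div D (j + 1)))"
      if "l \<in> {j+1..i}" for l using less.IH[of l] that i less.prems by auto
    let ?P = "\<Prod>l\<in>{1..<i}. G l ^ nat (\<beta> i l)"
    let ?w = "(\<Sum>l\<in>{1..<i}. int (nat (\<beta> i l)) * \<eta> l) + (\<Sum>l\<in>{j+1..<i}. int (nat (\<beta> i l)) * (q l - \<eta> l))"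
    have "weight_le j ?w ?P" using i less.prems IH by (intro weight_le_monomial) auto
    moreover have ex: "(\<Sum>l\<in>{j+1..<i}. int (nat (\<beta> i l)) * (q l - \<eta> l)) < q i - \<eta> i"
      using i less.prems beta[OF iN] by (intro excess) (auto simp: nat_less_iff)
    have wlt: "wt (tail_coeff i) + ?w \<le> q k - 1"
    proof -
      have "wt (tail_coeff i) + ?w < int (\<alpha> i) * \<eta> i + (q i - \<eta> i)" using rel'[OF iN] ex by simp
      also have "\<dots> \<le> int (\<alpha> i) * \<eta> i + int (\<alpha> i) * (q i - \<eta> i)"
      proof -
        have "1 * (q i - \<eta> i) \<le> int (\<alpha> i) * (q i - \<eta> i)"
          using alpha_pos[OF iN] excess_pos[of i] i less.prems by (intro mult_right_mono) auto
        then show ?thesis by simp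
      qed
      also have "\<dots> = q k" using q_Suc[of i] i by (simp add: algebra_simps)
      finally show ?thesis by simp
    qed
    ultimately have T: "weight_le j (q k - 1) (smult (tail_coeff i) ?P)"
      by (intro weight_le_smult[OF jj]) auto
    let ?e = "D i div D (j + 1)"
    have qi: "q i = int ?e * q (j + 1)" unfolding q_base by (simp add: q_def)
    have "weight_le j (q (j + 1)) (G (j + 1))" using IH(1)[of "j + 1"] i by simp
    then have p: "weight_le j (q i) (G (j + 1) ^ ?e)" unfolding qi by (rule weight_le_power[OF jj])
    have "weight_le j (int (\<alpha> i) * q i - 1) (G i ^ \<alpha> i - (G (j + 1) ^ ?e) ^ \<alpha> i)"
      using IH[of i] i by (intro weight_le_power_diff[OF jj] p) auto
    moreover have "(G (j + 1) ^ ?e) ^ \<alpha> i = G (j + 1) ^ (D k div D (j + 1))"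
      using D_div[of i] i by (simp add: power_mult[symmetric] mult.commute)
    ultimately have d: "weight_le j (q k - 1) (G i ^ \<alpha> i - G (j + 1) ^ (D k div D (j + 1)))"
      using q_Suc[of i] i by simp
    have Gk: "G k = G i ^ \<alpha> i - smult (tail_coeff i) ?P" using step'[OF iN] i by simp
    have "weight_le j (q k - 1) (G i ^ \<alpha> i - G (j + 1) ^ (D k div D (j + 1)) - smult (tail_coeff i) ?P)"
      by (rule weight_le_diff[OF jj d T])
    then have r2: "weight_le j (q k - 1) (G k - G (j + 1) ^ (D k div D (j + 1)))"
      unfolding Gk by (simp add: algebra_simps)
    have "weight_le j (int (\<alpha> i) * q i) (G i ^ \<alpha> i)" using IH[of i] i by (intro weight_le_power[OF jj]) auto
    then have "weight_le j (q k) (G i ^ \<alpha> i)" using q_Suc[of i] i by simp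
    then have "weight_le j (q k) (G k)" unfolding Gk
      by (rule weight_le_diff[OF jj _ weight_le_mono[OF T]]) simp
    then show ?thesis using r2 by blast
  qed
qed

text \<open>
  By the weight bound, \<open>f\<close> differs from \<open>G (n + 1) ^ E\<close> by standard
  terms of smaller degree, whose excess weight is smaller than that of \<open>G (n + 1) ^
  E\<close>. So with respect to \<open>G 1, \<dots>, G j\<close> the polynomial \<open>f\<close>
  is a power of \<open>G (j + 1)\<close> up to lower weight.
\<close>

lemma nonneg_exponent_of_poly:
  assumes E: "E > 0" and f: "lead_coeff f = 1" "degree f = E * D (n + 1)" "pnpos f"
    and w: "weight_le (n + 1) (int E * \<eta> (n + 1)) f"
    and G: "\<And>l. l \<in> {1..j} \<Longrightarrow> pnpos (G l)"
  shows "\<beta> j 0 \<ge> 0"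
proof -
  interpret N: monic_basis "B (n + 1)" by (rule B_basis) auto
  let ?d = "E * D (n + 1)"
  (* The power of G (j + 1) that agrees with G (n + 1) to top weight. *)
  let ?e = "D (n + 1) div D (j + 1)"
  have Bd: "B (n + 1) ?d = G (n + 1) ^ E"
  proof -
    let ?m = "\<lambda>i. if i = n + 1 then E else 0"
    have "(\<Sum>l\<in>{1..n+1}. ?m l * D l) = ?d"
      using lin_single[of "n + 1" "n + 1" E D] by simp
    moreover have "mon (n + 1) ?m = B (n + 1) (\<Sum>l\<in>{1..n+1}. ?m l * D l)"
      using alpha_pos by (intro std_index) auto
    ultimately show ?thesis using mon_single[of "n + 1" "n + 1" E] by simp
  qed
  have "f = (\<Sum>k\<le>?d. smult (bc (n + 1) f k) (B (n + 1) k))" using N.sum_bcoef[of f ?d] f by simp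
  also have "\<dots> = smult (bc (n + 1) f ?d) (B (n + 1) ?d) + (\<Sum>k<?d. smult (bc (n + 1) f k) (B (n + 1) k))"
    by (simp add: lessThan_Suc_atMost[symmetric])
  also have "bc (n + 1) f ?d = 1" using N.bcoef_degree[of f] f by simp
  finally have "f = G (n + 1) ^ E + (\<Sum>k<?d. smult (bc (n + 1) f k) (B (n + 1) k))" unfolding Bd by simp
  then have "f - G (n + 1) ^ E = (\<Sum>k<?d. smult (bc (n + 1) f k) (B (n + 1) k))"
    by (metis add_diff_cancel_left')
  moreover have "weight_le j (int E * q (n + 1) - 1) (smult (bc (n + 1) f k) (B (n + 1) k))" if k: "k < ?d" for k
  proof (cases "bc (n + 1) f k = 0")
    case True then show ?thesis using weight_le_0[OF jj] by simp
  next
    case False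
    let ?m = "dig (n + 1) k"
    have Bk: "B (n + 1) k = (\<Prod>i\<in>{1..<n+2}. G i ^ ?m i)"
      unfolding B_def mon_def by (rule prod.cong) auto
    let ?w = "(\<Sum>i\<in>{1..<n+2}. int (?m i) * \<eta> i) + (\<Sum>i\<in>{j+1..<n+2}. int (?m i) * (q i - \<eta> i))"
    have fB: "weight_le j ?w (B (n + 1) k)" unfolding Bk using j later_key_weight_le by (intro weight_le_monomial) auto
    have w1: "(\<Sum>i\<in>{1..<n+2}. int (?m i) * \<eta> i) = W (n + 1) k"
      unfolding W_def wtm_def by (rule sum.cong) auto
    have "(\<Sum>i\<in>{j+1..<n+2}. int (?m i) * (q i - \<eta> i)) =
        (\<Sum>i\<in>{j+1..<n+1}. int (?m i) * (q i - \<eta> i)) + int (?m (n + 1)) * (q (n + 1) - \<eta> (n + 1))"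
      using j by simp
    moreover have "(\<Sum>i\<in>{j+1..<n+1}. int (?m i) * (q i - \<eta> i)) < q (n + 1) - \<eta> (n + 1)"
      using j by (intro excess dig_less) auto
    moreover have "int (?m (n + 1)) * (q (n + 1) - \<eta> (n + 1)) \<le> (int E - 1) * (q (n + 1) - \<eta> (n + 1))"
    proof (intro mult_right_mono)
      have "?m (n + 1) < E" using k D_pos[of "n + 1"] by (simp add: dig_def less_mult_imp_div_less)
      then show "int (?m (n + 1)) \<le> int E - 1" by simp
      show "0 \<le> q (n + 1) - \<eta> (n + 1)" using excess_pos[of "n + 1"] j by simp
    qed
    ultimately have w2: "(\<Sum>i\<in>{j+1..<n+2}. int (?m i) * (q i - \<eta> i)) < int E * (q (n + 1) - \<eta> (n + 1))"
      by (simp add: algebra_simps)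
    have "wt (bc (n + 1) f k) + W (n + 1) k \<le> int E * \<eta> (n + 1)" using w False unfolding weight_le_def by blast
    then have "wt (bc (n + 1) f k) + ?w \<le> int E * q (n + 1) - 1" using w1 w2 by (simp add: algebra_simps)
    then show ?thesis by (intro weight_le_smult[OF jj fB]) simp
  qed
  ultimately have d1: "weight_le j (int E * q (n + 1) - 1) (f - G (n + 1) ^ E)"
    by (simp only:) (intro weight_le_sum[OF jj], auto)
  have ln: "weight_le j (q (n + 1)) (G (n + 1))" "weight_le j (q (n + 1) - 1) (G (n + 1) - G (j + 1) ^ ?e)"
    using later_key_weight_le[of "n + 1"] j by auto
  have qn: "q (n + 1) = int ?e * q (j + 1)" unfolding q_base by (simp add: q_def)
  have "weight_le j (q (j + 1)) (G (j + 1))" using later_key_weight_le[of "j + 1"] j by simp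
  then have p: "weight_le j (q (n + 1)) (G (j + 1) ^ ?e)" unfolding qn by (rule weight_le_power[OF jj])
  have d2: "weight_le j (int E * q (n + 1) - 1) (G (n + 1) ^ E - (G (j + 1) ^ ?e) ^ E)"
    by (rule weight_le_power_diff[OF jj ln(1) p ln(2)])
  have "weight_le j (int E * q (n + 1) - 1) ((f - G (n + 1) ^ E) + (G (n + 1) ^ E - (G (j + 1) ^ ?e) ^ E))"
    by (rule weight_le_add[OF jj d1 d2])
  moreover have "(f - G (n + 1) ^ E) + (G (n + 1) ^ E - (G (j + 1) ^ ?e) ^ E) = f - G (j + 1) ^ (?e * E)"
    by (simp add: power_mult)
  moreover have "int E * q (n + 1) = int (?e * E * \<alpha> j) * \<eta> j" unfolding qn q_base by (simp add: algebra_simps)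
  ultimately have "weight_le j (int (?e * E * \<alpha> j) * \<eta> j - 1) (f - G (j + 1) ^ (?e * E))" by (simp only:)
  moreover have "?e * E > 0" using E D_dvd[of "j + 1" "n + 1"] D_pos[of "n + 1"] j
    by (auto simp: dvd_div_eq_0_iff)
  ultimately show ?thesis using nonneg_exponent[OF jj, of "?e * E" f] j f(3) G by auto
qed

end

text \<open>
  Induction along the key polynomials: as long as \<open>\<beta> i 0 \<ge> 0\<close> for all
  \<open>i < j\<close>, the polynomials \<open>G 1, \<dots>, G j\<close> have coefficients in
  \<open>\<complex>[x]\<close>, which is what the previous lemma requires.
\<close>

theorem nonneg_exponents:
  assumes E: "E > 0" and f: "lead_coeff f = 1" "degree f = E * D (n + 1)" "pnpos f"
    and w: "weight_le (n + 1) (int E * \<eta> (n + 1)) f"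
  shows "j \<in> {1..n} \<Longrightarrow> \<beta> j 0 \<ge> 0"
proof (induction j rule: less_induct)
  case (less j)
  note IHj = less.IH and jn = less.prems
  have "pnpos (G l)" if "l \<in> {1..j}" for l
    using that
  proof (induction l rule: less_induct)
    case (less l)
    show ?case
    proof (cases "l = 1")
      case True
      have "G l = [:0, 1:]" using G1 True by simp
      then show ?thesis by (auto simp: pnpos_def npos_def coeff_pCons split: nat.split)
    next
      case False
      then obtain i where i: "l = i + 1" "1 \<le> i" using less.prems by (cases l) auto
      have iN: "i \<in> {1..n}" "i < j" using i less.prems jn by auto
      have "pnpos (G i ^ \<alpha> i)" "pnpos (\<Prod>l\<in>{1..<i}. G l ^ nat (\<beta> i l))"
        using less.IH i iN by (auto intro!: pnpos_power pnpos_prod)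
      moreover have "npos (tail_coeff i)" using IHj[of i] iN by (simp add: npos_def tail_coeff_def)
      then have "pnpos (smult (tail_coeff i) p)" if "pnpos p" for p using that by (auto simp: pnpos_def npos_mult)
      moreover have "pnpos (p - p')" if "pnpos p" "pnpos p'" for p p' using that by (auto simp: pnpos_def npos_def)
      ultimately show ?thesis using step'[OF iN(1)] i by (metis add_diff_cancel_right')
    qed
  qed
  then show ?case using nonneg_exponent_of_poly[OF less.prems E f w] by blast
qed

end

section \<open>Order and degree in the generic coefficient\<close>

locale rhom =
  fixes h :: "'a::comm_ring_1 \<Rightarrow> 'b::comm_ring_1"
  assumes add: "h (x + y) = h x + h y" and mult: "h (x * y) = h x * h y" and one: "h 1 = 1"
begin
lemma zero: "h 0 = 0" using add[of 0 0] by simp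
lemma uminus: "h (- x) = - h x" using add[of x "- x"] zero by (simp add: eq_neg_iff_add_eq_0 add.commute)
lemma diff: "h (x - y) = h x - h y" using add[of x "- y"] uminus by simp
lemma sum: "h (\<Sum>i\<in>S. f i) = (\<Sum>i\<in>S. h (f i))"
  by (induction S rule: infinite_finite_induct) (auto simp: zero add)
lemma prod: "h (\<Prod>i\<in>S. f i) = (\<Prod>i\<in>S. h (f i))"
  by (induction S rule: infinite_finite_induct) (auto simp: one mult)
lemma power: "h (x ^ n) = h x ^ n" by (induction n) (auto simp: one mult)
lemma mp_add: "map_poly h (p + q) = map_poly h p + map_poly h q"
  by (intro poly_eqI) (simp add: coeff_map_poly zero add)
lemma mp_mult: "map_poly h (p * q) = map_poly h p * map_poly h q"
  by (intro poly_eqI) (simp add: coeff_map_poly zero coeff_mult sum mult)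
lemma mp_linear: "map_poly h [:a, b:] = [:h a, h b:]"
  by (intro poly_eqI) (simp add: coeff_map_poly zero coeff_pCons split: nat.split)
lemma mp_const: "map_poly h [:a:] = [:h a:]"
  by (intro poly_eqI) (simp add: coeff_map_poly zero coeff_pCons split: nat.split)
lemma mp_smult: "map_poly h (smult a p) = smult (h a) (map_poly h p)"
  by (intro poly_eqI) (simp add: coeff_map_poly zero mult)
lemma mp_rhom: "rhom (map_poly h)"
  by unfold_locales (auto simp: mp_add mp_mult map_poly_1 one zero)
lemma eval_rhom: "rhom (\<lambda>p. poly (map_poly h p) c)"
  by unfold_locales (auto simp: mp_add mp_mult map_poly_1 one zero)
end

lemma rhom_comp: "rhom f \<Longrightarrow> rhom g \<Longrightarrow> rhom (\<lambda>x. f (g x))"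
  unfolding rhom_def by simp

text \<open>
  For a Laurent series in \<open>t\<close> with coefficients in \<open>\<complex>[\<xi>]\<close>:
  its order, and the degree in \<open>\<xi>\<close> of the lowest coefficient. On the zero series
  both are meaningless.
\<close>

definition ord_t :: "'a::idom poly fls \<Rightarrow> int" where "ord_t A = fls_subdegree A"
definition xi_deg :: "'a::idom poly fls \<Rightarrow> nat" where "xi_deg A = degree (fls_nth A (fls_subdegree A))"

lemma ord_t_mult: "A \<noteq> 0 \<Longrightarrow> B \<noteq> 0 \<Longrightarrow> ord_t (A * B) = ord_t A + ord_t B" by (simp add: ord_t_def)
lemma xi_deg_mult: "A \<noteq> 0 \<Longrightarrow> B \<noteq> 0 \<Longrightarrow> xi_deg (A * B) = xi_deg A + xi_deg B"
  by (simp add: xi_deg_def degree_mult_eq)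
lemma ord_t_1 [simp]: "ord_t 1 = 0" and xi_deg_1 [simp]: "xi_deg 1 = 0" by (simp_all add: ord_t_def xi_deg_def)
lemma ord_t_power: "A \<noteq> 0 \<Longrightarrow> ord_t (A ^ n) = int n * ord_t A" by (simp add: ord_t_def fls_subdegree_pow)
lemma xi_deg_power: "A \<noteq> 0 \<Longrightarrow> xi_deg (A ^ n) = n * xi_deg A" by (induction n) (auto simp: xi_deg_mult)
lemma ord_t_prod: "finite S \<Longrightarrow> (\<And>i. i \<in> S \<Longrightarrow> A i \<noteq> 0) \<Longrightarrow> ord_t (\<Prod>i\<in>S. A i) = (\<Sum>i\<in>S. ord_t (A i))"
  by (induction S rule: finite_induct) (auto simp: ord_t_mult)
lemma xi_deg_prod: "finite S \<Longrightarrow> (\<And>i. i \<in> S \<Longrightarrow> A i \<noteq> 0) \<Longrightarrow> xi_deg (\<Prod>i\<in>S. A i) = (\<Sum>i\<in>S. xi_deg (A i))"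
  by (induction S rule: finite_induct) (auto simp: xi_deg_mult)

text \<open>
  If the pairs (order, \<open>\<xi>\<close>-degree) of the summands are distinct, then among the
  summands of minimal order one has the largest \<open>\<xi>\<close>-degree, and its leading
  coefficient in \<open>\<xi>\<close> survives.
\<close>

lemma ord_t_xi_deg_sum:
  fixes T :: "'i \<Rightarrow> 'a::idom poly fls"
  assumes fin: "finite S" and ne: "S \<noteq> {}" and nz: "\<And>i. i \<in> S \<Longrightarrow> T i \<noteq> 0"
    and dist: "\<And>i j. i \<in> S \<Longrightarrow> j \<in> S \<Longrightarrow> ord_t (T i) = ord_t (T j) \<Longrightarrow> xi_deg (T i) = xi_deg (T j) \<Longrightarrow> i = j"
  shows "(\<Sum>i\<in>S. T i) \<noteq> 0 \<and> (\<exists>i\<in>S. ord_t (\<Sum>i\<in>S. T i) = ord_t (T i) \<and> xi_deg (\<Sum>i\<in>S. T i) = xi_deg (T i)) \<and>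
    (\<forall>i\<in>S. ord_t (\<Sum>i\<in>S. T i) \<le> ord_t (T i))"
proof -
  define v where "v = Min ((\<lambda>i. ord_t (T i)) ` S)"
  define M where "M = {i\<in>S. ord_t (T i) = v}"
  have vmin: "v \<le> ord_t (T i)" if "i \<in> S" for i using that fin by (simp add: v_def)
  have "v \<in> (\<lambda>i. ord_t (T i)) ` S" unfolding v_def using fin ne by (intro Min_in) auto
  then have Mne: "M \<noteq> {}" by (auto simp: M_def)
  have Mfin: "finite M" using fin by (simp add: M_def)
  have "Max (xi_deg ` T ` M) \<in> xi_deg ` T ` M" using Mfin Mne by (intro Max_in) auto
  then obtain i0 where i0: "i0 \<in> M" "xi_deg (T i0) = Max (xi_deg ` T ` M)" by auto
  have i0max: "xi_deg (T i) < xi_deg (T i0)" if "i \<in> M" "i \<noteq> i0" for i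
  proof -
    have "xi_deg (T i) \<le> xi_deg (T i0)" unfolding i0(2) using Mfin that by simp
    moreover have "xi_deg (T i) \<noteq> xi_deg (T i0)" using dist[of i i0] that i0 by (auto simp: M_def)
    ultimately show ?thesis by simp
  qed
  let ?s = "\<Sum>i\<in>S. T i"
  have low: "fls_nth ?s k = 0" if "k < v" for k
    unfolding fls_nth_sum using that vmin by (intro sum.neutral) (force simp: ord_t_def)
  have at: "fls_nth ?s v = fls_nth (T i0) v + (\<Sum>i\<in>M-{i0}. fls_nth (T i) v)"
  proof -
    have "fls_nth ?s v = (\<Sum>i\<in>M. fls_nth (T i) v)"
      unfolding fls_nth_sum
    proof (rule sum.mono_neutral_right[OF fin])
      show "\<forall>i\<in>S - M. fls_nth (T i) v = 0"
        using vmin by (force simp: M_def ord_t_def)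
    qed (auto simp: M_def)
    then show ?thesis using sum.remove[OF Mfin i0(1)] by metis
  qed
  have di0: "degree (fls_nth (T i0) v) = xi_deg (T i0)" using i0 by (simp add: M_def xi_deg_def ord_t_def)
  have nz0: "fls_nth (T i0) v \<noteq> 0" using i0 nz[of i0] by (auto simp: M_def ord_t_def)
  have "degree (fls_nth ?s v) = xi_deg (T i0) \<and> fls_nth ?s v \<noteq> 0"
  proof (cases "M - {i0} = {}")
    case True
    have "fls_nth ?s v = fls_nth (T i0) v" unfolding at by (simp only: True) simp
    then show ?thesis using di0 nz0 by simp
  next
    case False
    then obtain i1 where i1: "i1 \<in> M" "i1 \<noteq> i0" by auto
    have "degree (\<Sum>i\<in>M-{i0}. fls_nth (T i) v) \<le> xi_deg (T i0) - 1"
    proof (rule degree_sum_le)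
      fix i assume "i \<in> M - {i0}"
      then show "degree (fls_nth (T i) v) \<le> xi_deg (T i0) - 1"
        using i0max[of i] by (auto simp: M_def xi_deg_def ord_t_def)
    qed (use Mfin in auto)
    then have "degree (\<Sum>i\<in>M-{i0}. fls_nth (T i) v) < degree (fls_nth (T i0) v)"
      using i0max[OF i1] di0 by simp
    then have "degree (fls_nth ?s v) = degree (fls_nth (T i0) v)" unfolding at by (rule degree_add_eq_left)
    moreover have "degree (fls_nth (T i0) v) > 0" using i0max[OF i1] di0 by simp
    ultimately show ?thesis using di0 by auto
  qed
  then have deg: "degree (fls_nth ?s v) = xi_deg (T i0)" and nzv: "fls_nth ?s v \<noteq> 0" by blast+
  have sv: "fls_subdegree ?s = v" by (rule fls_subdegree_eqI[OF nzv low])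
  have "?s \<noteq> 0" using nzv by (metis fls_zero_nth)
  moreover have "ord_t ?s = v" "xi_deg ?s = xi_deg (T i0)" using sv deg by (simp_all add: ord_t_def xi_deg_def)
  moreover have "i0 \<in> S" "ord_t (T i0) = v" using i0 by (auto simp: M_def)
  ultimately show ?thesis using vmin by (auto intro!: bexI[of _ i0])
qed

section \<open>Conjugate series and invariants\<close>

definition cmap :: "('a::zero \<Rightarrow> 'b::zero) \<Rightarrow> 'a fls \<Rightarrow> 'b fls" where
  "cmap h a = Abs_fls (\<lambda>n. h (fls_nth a n))"

lemma cmap_nth: "h 0 = 0 \<Longrightarrow> fls_nth (cmap h a) n = h (fls_nth a n)"
  unfolding cmap_def by (rule nth_Abs_fls_lower_bound[of "fls_subdegree a"]) simp

definition lft :: "'a::zero fls \<Rightarrow> 'a poly fls" where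
  "lft = cmap (\<lambda>x. [:x:])"

lemma lft_nth [simp]: "fls_nth (lft a) n = [:fls_nth a n:]"
  by (simp add: lft_def cmap_nth)

text \<open>
  The conjugation \<open>a(t) \<mapsto> a(z t)\<close>.
\<close>

definition rot :: "complex \<Rightarrow> complex fls \<Rightarrow> complex fls" where
  "rot z a = Abs_fls (\<lambda>n. z powi n * fls_nth a n)"

lemma rot_nth [simp]: "fls_nth (rot z a) n = z powi n * fls_nth a n"
  unfolding rot_def by (rule nth_Abs_fls_lower_bound[of "fls_subdegree a"]) simp

lemma fls_mult_nth_ge:
  fixes f g :: "'a::comm_ring_1 fls"
  assumes "df \<le> fls_subdegree f" "dg \<le> fls_subdegree g"
  shows "fls_nth (f * g) n = (\<Sum>i=df..n-dg. fls_nth f i * fls_nth g (n - i))"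
  unfolding fls_times_nth(2) using assms
  by (intro sum.mono_neutral_left) (auto simp: not_le)

lemma subdegree_lft [simp]: "fls_subdegree (lft a) = fls_subdegree a" for a :: "'a::comm_ring_1 fls"
proof (cases "a = 0")
  case True
  then have "lft a = 0" by (intro fls_eqI) simp
  then show ?thesis using True by simp
next
  case False
  then show ?thesis by (intro fls_subdegree_eqI) auto
qed

lemma subdegree_rot [simp]: "z \<noteq> 0 \<Longrightarrow> fls_subdegree (rot z a) = fls_subdegree a"
proof (cases "a = 0")
  case True
  then have "rot z a = 0" by (intro fls_eqI) simp
  then show ?thesis using True by simp
next
  case False
  assume "z \<noteq> 0"
  then show ?thesis using False by (intro fls_subdegree_eqI) auto
qed

lemma rhom_cmap:
  assumes "rhom h" and sd: "\<And>a. fls_subdegree (cmap h a) \<ge> fls_subdegree a"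
  shows "rhom (cmap h)"
proof -
  interpret h: rhom h by fact
  note nth = cmap_nth[of h, OF h.zero]
  show ?thesis
  proof
    fix x y
    show "cmap h (x + y) = cmap h x + cmap h y" by (intro fls_eqI) (simp add: nth h.add)
    show "cmap h 1 = 1" by (intro fls_eqI) (simp add: nth h.one h.zero)
    show "cmap h (x * y) = cmap h x * cmap h y"
    proof (intro fls_eqI)
      fix n
      have "fls_nth (cmap h x * cmap h y) n =
          (\<Sum>i=fls_subdegree x..n-fls_subdegree y. fls_nth (cmap h x) i * fls_nth (cmap h y) (n - i))"
        by (rule fls_mult_nth_ge) (rule sd)+
      then show "fls_nth (cmap h (x * y)) n = fls_nth (cmap h x * cmap h y) n"
        by (simp add: nth fls_times_nth(2) h.sum h.mult)
    qed
  qed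
qed

lemma rhom_lft: "rhom (lft :: 'a::comm_ring_1 fls \<Rightarrow> _)"
  unfolding lft_def
proof (rule rhom_cmap)
  show "rhom (\<lambda>a :: 'a. [:a:])" by unfold_locales (auto simp: one_pCons)
  show "fls_subdegree a \<le> fls_subdegree (cmap (\<lambda>x. [:x:]) a)" for a :: "'a fls"
    using subdegree_lft[of a] by (simp add: lft_def)
qed

interpretation lft: rhom "lft :: complex fls \<Rightarrow> _" by (rule rhom_lft)

lemma rhom_rot: assumes "z \<noteq> 0" shows "rhom (rot z)"
proof
  fix x y :: "complex fls"
  show "rot z (x + y) = rot z x + rot z y" by (intro fls_eqI) (simp add: algebra_simps)
  show "rot z 1 = 1" by (intro fls_eqI) simp
  show "rot z (x * y) = rot z x * rot z y"
  proof (intro fls_eqI)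
    fix n
    have *: "z powi n = z powi i * z powi (n - i)" for i using assms by (simp flip: power_int_add)
    show "fls_nth (rot z (x * y)) n = fls_nth (rot z x * rot z y) n"
      using assms by (simp add: fls_times_nth(2) sum_distrib_left)
        (intro sum.cong refl, metis * mult.assoc mult.left_commute)
  qed
qed

lemma rot_rot: "rot z (rot w a) = rot (z * w) a"
  by (intro fls_eqI) (simp add: power_int_mult_distrib mult_ac)
lemma rot_1 [simp]: "rot 1 a = a" by (intro fls_eqI) simp

text \<open>
  The substitution \<open>u = t\<^sup>N\<close>.
\<close>

abbreviation cp :: "nat \<Rightarrow> complex fls \<Rightarrow> complex fls" where "cp N a \<equiv> fls_compose_power a N"

lemma rhom_cp: "N > 0 \<Longrightarrow> rhom (cp N)" by unfold_locales auto

lemma cp_inj: assumes "N > 0" "cp N a = cp N b" shows "a = b"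
proof (intro fls_eqI)
  fix n
  have "fls_nth (cp N a) (int N * n) = fls_nth (cp N b) (int N * n)" using assms by simp
  then show "fls_nth a n = fls_nth b n" using assms(1) by (simp add: fls_nth_compose_power)
qed

lemma subdegree_cp: assumes "N > 0" shows "fls_subdegree (cp N a) = int N * fls_subdegree a"
proof (cases "a = 0")
  case False
  show ?thesis
  proof (rule fls_subdegree_eqI)
    fix k assume k: "k < int N * fls_subdegree a"
    show "fls_nth (cp N a) k = 0"
    proof (cases "int N dvd k")
      case True
      then obtain m where "k = int N * m" by auto
      then show ?thesis using k assms by (simp add: fls_nth_compose_power)
    qed (use assms in \<open>simp add: fls_nth_compose_power\<close>)
  qed (use assms False in \<open>simp add: fls_nth_compose_power\<close>)
qed simp

definition unity_roots :: "nat \<Rightarrow> complex set" where "unity_roots N = {z. z ^ N = 1}"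

lemma unity_roots_nz: "N > 0 \<Longrightarrow> z \<in> unity_roots N \<Longrightarrow> z \<noteq> 0" by (auto simp: unity_roots_def power_0_left)
lemma unity_roots_fin: "N > 0 \<Longrightarrow> finite (unity_roots N)" unfolding unity_roots_def by (rule finite_nth_roots) 
lemma unity_roots_card: "N > 0 \<Longrightarrow> card (unity_roots N) = N" unfolding unity_roots_def by (rule card_roots_unity_eq)
lemma unity_roots_1: "1 \<in> unity_roots N" by (simp add: unity_roots_def)
lemma unity_roots_mult: "z \<in> unity_roots N \<Longrightarrow> w \<in> unity_roots N \<Longrightarrow> z * w \<in> unity_roots N" by (simp add: unity_roots_def power_mult_distrib)
lemma unity_roots_inverse: "z \<in> unity_roots N \<Longrightarrow> inverse z \<in> unity_roots N" by (simp add: unity_roots_def power_inverse)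
lemma unity_roots_bij: "N > 0 \<Longrightarrow> w \<in> unity_roots N \<Longrightarrow> bij_betw (\<lambda>z. z * w) (unity_roots N) (unity_roots N)"
  by (rule bij_betwI[where g = "\<lambda>z. z * inverse w"])
     (auto simp: unity_roots_mult unity_roots_inverse unity_roots_nz)

lemma rot_cp: assumes "N > 0" "z \<in> unity_roots N" shows "rot z (cp N a) = cp N a"
proof (intro fls_eqI)
  fix n
  show "fls_nth (rot z (cp N a)) n = fls_nth (cp N a) n"
  proof (cases "int N dvd n")
    case True
    then obtain m where "n = int N * m" by auto
    then have "z powi n = 1" using assms by (simp add: power_int_mult unity_roots_def)
    then show ?thesis by simp
  qed (use assms in \<open>simp add: fls_nth_compose_power\<close>)
qed

text \<open>
  Invariance under a primitive \<open>N\<close>-th root of unity kills all coefficients at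
  exponents not divisible by \<open>N\<close>.
\<close>

lemma invariant_imp_cp:
  assumes N: "N > 0" and inv: "\<And>z. z \<in> unity_roots N \<Longrightarrow> rot z a = a"
  shows "\<exists>b. cp N b = a"
proof -
  define z where "z = cis (2 * pi / real N)"
  have "z ^ N = cis (real N * (2 * pi / real N))" unfolding z_def by (rule Complex.DeMoivre)
  then have z: "z \<in> unity_roots N" using N by (simp add: unity_roots_def)
  have supp: "int N dvd k" if "fls_nth a k \<noteq> 0" for k
  proof -
    have "z powi k * fls_nth a k = fls_nth a k" using inv[OF z] by (metis rot_nth)
    then have "z powi k = 1" using that by simp
    moreover have "z powi k = cis (real_of_int k * (2 * pi / real N))"
      unfolding z_def by (simp add: cis_power_int)
    ultimately have "cos (real_of_int k * (2 * pi / real N)) = 1" by (metis cis.sel(1) one_complex.sel(1))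
    then obtain m :: int where "real_of_int k * (2 * pi / real N) = 2 * pi * of_int m"
      by (auto simp: cos_one_2pi_int mult_ac)
    then have "real_of_int k = of_int (m * int N)" using N by (simp add: field_simps)
    then show ?thesis by (metis dvd_triv_right of_int_eq_iff)
  qed
  define b where "b = Abs_fls (\<lambda>n. fls_nth a (int N * n))"
  have b: "fls_nth b n = fls_nth a (int N * n)" for n
    unfolding b_def
  proof (rule nth_Abs_fls_lower_bound[of "min 0 (fls_subdegree a)"], intro allI impI)
    fix n assume n: "n < min 0 (fls_subdegree a)"
    then have "int N * n \<le> 1 * n" using N by (intro mult_right_mono_neg) auto
    then have "int N * n < fls_subdegree a" using n by linarith
    then show "fls_nth a (int N * n) = 0" by simp
  qed
  have "cp N b = a" by (intro fls_eqI) (use N supp b in \<open>force simp: fls_nth_compose_power\<close>)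
  then show ?thesis by blast
qed

definition Up :: "nat \<Rightarrow> complex fls poly \<Rightarrow> complex fls poly" where "Up N H = map_poly (cp N) H"

lemma rhom_Up: "N > 0 \<Longrightarrow> rhom (Up N)" unfolding Up_def by (intro rhom.mp_rhom rhom_cp)

lemma coeff_Up: "N > 0 \<Longrightarrow> coeff (Up N H) i = cp N (coeff H i)" by (simp add: Up_def coeff_map_poly)

lemma degree_Up: "N > 0 \<Longrightarrow> degree (Up N H) = degree H"
  unfolding Up_def using cp_inj[of N "lead_coeff H" 0]
  by (cases "H = 0") (auto intro!: map_poly_degree_eq)

lemma Up_inj: "N > 0 \<Longrightarrow> Up N H = Up N H' \<Longrightarrow> H = H'"
  by (intro poly_eqI) (metis coeff_Up cp_inj)

lemma invariant_imp_Up: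
  assumes N: "N > 0" and inv: "\<And>z. z \<in> unity_roots N \<Longrightarrow> map_poly (rot z) P = P"
  shows "\<exists>Q. Up N Q = P"
proof -
  have "\<exists>b. cp N b = coeff P i" for i
  proof (rule invariant_imp_cp[OF N])
    fix z assume z: "z \<in> unity_roots N"
    interpret r: rhom "rot z" using rhom_rot unity_roots_nz[OF N z] .
    show "rot z (coeff P i) = coeff P i" using inv[OF z] by (metis coeff_map_poly r.zero)
  qed
  then obtain b where b: "\<And>i. cp N (b i) = coeff P i" by metis
  have b0: "b i = 0" if "i > degree P" for i
    using b[of i] that cp_inj[OF N, of "b i" 0] by (simp add: coeff_eq_0)
  define Q where "Q = (\<Sum>i\<le>degree P. monom (b i) i)"
  have "coeff Q i = b i" for i using b0[of i] by (auto simp: Q_def coeff_sum)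
  then have "Up N Q = P" using b N by (intro poly_eqI) (simp add: coeff_Up)
  then show ?thesis by blast
qed

section \<open>Substituting a generic series\<close>

text \<open>
  The series \<open>\<phi> + \<xi> t\<^sup>e\<close> is substituted for \<open>y\<close> in a
  polynomial with coefficients in \<open>\<complex>((u))\<close>, where \<open>u =
  t\<^sup>N\<close>.
\<close>

locale generic =
  fixes N :: nat and \<phi> :: "complex fls" and e :: int
  assumes N: "N > 0"
begin

definition XI :: "complex poly fls" where "XI = fls_shift (- e) (fls_const [:0, 1:])"
definition Phi :: "complex poly fls" where "Phi = lft \<phi> + XI"

text \<open>
  What becomes of the linear factor \<open>y - Y\<close> under the substitution.
\<close>

definition lin :: "complex fls \<Rightarrow> complex poly fls" where "lin Y = Phi - lft Y"
definition Sub :: "complex fls poly \<Rightarrow> complex poly fls" where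
  "Sub H = poly (map_poly lft (Up N H)) Phi"

text \<open>
  These predicates describe the condition \<open>ord(\<theta> - \<psi>) \<ge> r\<close> for a
  series and for one of its conjugates, in terms of \<open>t\<close>.
\<close>

definition close :: "complex fls \<Rightarrow> bool" where "close Y \<longleftrightarrow> (\<forall>k<e. fls_nth Y k = fls_nth \<phi> k)"
definition conj_close :: "complex fls \<Rightarrow> bool" where "conj_close Y \<longleftrightarrow> (\<exists>z\<in>unity_roots N. close (rot z Y))"

lemma XI_nth: "fls_nth XI n = (if n = e then [:0, 1:] else 0)" by (auto simp: XI_def)
lemma lin_nth: "fls_nth (lin Y) n = [:fls_nth \<phi> n - fls_nth Y n:] + (if n = e then [:0, 1:] else 0)"
  by (simp add: lin_def Phi_def XI_nth)
lemma lin_nth_e: "fls_nth (lin Y) e = [:fls_nth \<phi> e - fls_nth Y e, 1:]" by (simp add: lin_nth)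
lemma lin_nz: "lin Y \<noteq> 0" using lin_nth_e[of Y] by auto

text \<open>
  In \<open>\<phi> + \<xi> t\<^sup>e - Y\<close> the indeterminate occurs in the lowest term
  exactly if \<open>Y\<close> cancels \<open>\<phi>\<close> below \<open>t\<^sup>e\<close>.
\<close>

lemma close_ord_t: assumes "close Y" shows "ord_t (lin Y) = e" "xi_deg (lin Y) = 1"
proof -
  show *: "ord_t (lin Y) = e" unfolding ord_t_def
    by (rule fls_subdegree_eqI) (use assms in \<open>auto simp: lin_nth close_def\<close>)
  then show "xi_deg (lin Y) = 1" by (simp add: ord_t_def xi_deg_def lin_nth_e)
qed

lemma not_close_ord_t: assumes "\<not> close Y" shows "ord_t (lin Y) < e" "xi_deg (lin Y) = 0"
proof -
  obtain k where k: "k < e" "fls_nth Y k \<noteq> fls_nth \<phi> k" using assms by (auto simp: close_def)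
  then have "fls_nth (lin Y) k \<noteq> 0" by (simp add: lin_nth)
  then have "ord_t (lin Y) \<le> k" unfolding ord_t_def by (rule fls_subdegree_leI)
  then show *: "ord_t (lin Y) < e" using k by simp
  then show "xi_deg (lin Y) = 0" by (simp add: xi_deg_def ord_t_def lin_nth)
qed

lemma lin_agree:
  assumes "\<And>k. k < e \<Longrightarrow> fls_nth Y k = fls_nth Y' k"
  shows "ord_t (lin Y) = ord_t (lin Y')" "xi_deg (lin Y) = xi_deg (lin Y')"
proof -
  have c: "close Y \<longleftrightarrow> close Y'" using assms by (auto simp: close_def)
  show "ord_t (lin Y) = ord_t (lin Y')"
  proof (cases "close Y'")
    case True then show ?thesis using c close_ord_t by simp
  next
    case False
    have v: "ord_t (lin Y') < e" using not_close_ord_t(1)[OF False] .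
    show ?thesis unfolding ord_t_def
    proof (rule fls_subdegree_eqI)
      have "fls_nth (lin Y') (fls_subdegree (lin Y')) \<noteq> 0" using lin_nz by simp
      then show "fls_nth (lin Y) (fls_subdegree (lin Y')) \<noteq> 0" using v assms by (simp add: lin_nth ord_t_def)
      fix k assume "k < fls_subdegree (lin Y')"
      then have "fls_nth (lin Y') k = 0" "k < e" using v by (auto simp: ord_t_def)
      then show "fls_nth (lin Y) k = 0" using assms by (simp add: lin_nth)
    qed
  qed
  show "xi_deg (lin Y) = xi_deg (lin Y')" using c close_ord_t not_close_ord_t by metis
qed

lemma rhom_Sub: "rhom Sub"
  unfolding Sub_def by (rule rhom_comp[OF lft.eval_rhom rhom_Up[OF N]])
sublocale Sub: rhom Sub by (rule rhom_Sub)

lemma Sub_const: "Sub [:a:] = lft (cp N a)"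
proof -
  interpret c: rhom "cp N" by (rule rhom_cp[OF N])
  show ?thesis by (simp add: Sub_def Up_def c.mp_const lft.mp_const)
qed
lemma Sub_smult: "Sub (smult a H) = lft (cp N a) * Sub H"
  using Sub.mult[of "[:a:]" H] Sub_const by simp
lemma Sub_split:
  assumes "Up N H = (\<Prod>i\<in>I. [:- Y i, 1:])"
  shows "Sub H = (\<Prod>i\<in>I. lin (Y i))"
proof -
  interpret m: rhom "map_poly (lft :: complex fls \<Rightarrow> _)" by (rule lft.mp_rhom)
  show ?thesis unfolding Sub_def assms m.prod poly_prod
    by (rule prod.cong) (auto simp: lft.mp_linear lft.uminus lft.one lin_def)
qed

text \<open>
  If the substitution gives zero, then each of the infinitely many specializations of
  \<open>\<xi>\<close> to a complex number gives another root.
\<close>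

lemma Sub_eq_0: assumes "Sub H = 0" shows "H = 0"
proof -
  define ev where "ev = (\<lambda>c :: complex. cmap (\<lambda>p. poly p c))"
  have evn: "fls_nth (ev c A) n = poly (fls_nth A n) c" for c A n by (simp add: ev_def cmap_nth)
  have ev: "poly (Up N H) (\<phi> + fls_shift (- e) (fls_const c)) = 0" for c
  proof -
    interpret p: rhom "\<lambda>p. poly p c" by unfold_locales auto
    have nlow: "fls_nth (cmap (\<lambda>p. poly p c) a) k = 0" if "k < fls_subdegree a" for a k
      using that by (simp add: cmap_nth)
    have ext: "ev c (lft a) = a" for a by (intro fls_eqI) (simp add: evn)
    have evPhi: "ev c Phi = \<phi> + fls_shift (- e) (fls_const c)" by (intro fls_eqI) (auto simp: evn Phi_def XI_nth)
    have ev_add: "ev c (A + B) = ev c A + ev c B" for A B by (intro fls_eqI) (simp add: evn)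
    have ev_mult: "ev c (A * B) = ev c A * ev c B" for A B
    proof (intro fls_eqI)
      fix n
      (* Specializing \<xi> may raise the order, so both products are summed from a common lower
         bound. *)
      define d where "d = (\<lambda>A. min (fls_subdegree A) (fls_subdegree (ev c A)))"
      have "fls_nth (A * B) n = (\<Sum>i=d A..n-d B. fls_nth A i * fls_nth B (n - i))"
        by (rule fls_mult_nth_ge) (auto simp: d_def)
      moreover have "fls_nth (ev c A * ev c B) n = (\<Sum>i=d A..n-d B. fls_nth (ev c A) i * fls_nth (ev c B) (n - i))"
        by (rule fls_mult_nth_ge) (auto simp: d_def)
      ultimately show "fls_nth (ev c (A * B)) n = fls_nth (ev c A * ev c B) n"
        by (simp add: evn p.sum)
    qed
    have "ev c (poly (map_poly lft P) Phi) = poly P (ev c Phi)" for P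
    proof (induction P)
      case 0 show ?case by (intro fls_eqI) (simp add: evn)
    next
      case (pCons a P)
      then show ?case by (subst map_poly_pCons) (auto simp: lft.zero ev_add ev_mult ext)
    qed
    then have "ev c (Sub H) = poly (Up N H) (ev c Phi)" by (simp add: Sub_def)
    moreover have "ev c 0 = 0" by (intro fls_eqI) (simp add: evn)
    ultimately show ?thesis using assms evPhi by simp
  qed
  have "inj (\<lambda>c. \<phi> + fls_shift (- e) (fls_const c))"
  proof (rule injI)
    fix c c' assume "\<phi> + fls_shift (- e) (fls_const c) = \<phi> + fls_shift (- e) (fls_const c')"
    then have "fls_nth (fls_shift (- e) (fls_const c)) e = fls_nth (fls_shift (- e) (fls_const c')) e" by simp
    then show "c = c'" by simp
  qed
  then have "infinite (range (\<lambda>c :: complex. \<phi> + fls_shift (- e) (fls_const c)))"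
    using finite_imageD infinite_UNIV_char_0 by blast
  moreover have "range (\<lambda>c. \<phi> + fls_shift (- e) (fls_const c)) \<subseteq> {x. poly (Up N H) x = 0}" using ev by auto
  ultimately have "infinite {x. poly (Up N H) x = 0}" using finite_subset by blast
  then have "Up N H = 0" using poly_roots_finite by blast
  then show "H = 0" using Up_inj[OF N, of H 0] by (simp add: Up_def)
qed

lemma ord_t_lft_cp: "a \<noteq> 0 \<Longrightarrow> ord_t (lft (cp N a)) = int N * fls_subdegree a"
  by (simp add: ord_t_def subdegree_cp N)
lemma lft_cp_nz: "a \<noteq> 0 \<Longrightarrow> lft (cp N a) \<noteq> 0"
proof
  assume "a \<noteq> 0" "lft (cp N a) = 0"
  then have "fls_nth (lft (cp N a)) (int N * fls_subdegree a) = 0" by simp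
  then show False using \<open>a \<noteq> 0\<close> N by (simp add: fls_nth_compose_power)
qed
lemma xi_deg_lft_cp: "xi_deg (lft a) = 0" by (simp add: xi_deg_def)

lemma rot_split:
  assumes "Up N H = (\<Prod>i\<in>I. [:- Y i, 1:])" "z \<in> unity_roots N"
  shows "Up N H = (\<Prod>i\<in>I. [:- rot z (Y i), 1:])"
proof -
  interpret r: rhom "rot z" using rhom_rot unity_roots_nz[OF N assms(2)] .
  interpret m: rhom "map_poly (rot z)" by (rule r.mp_rhom)
  have "map_poly (rot z) (Up N H) = Up N H"
    by (intro poly_eqI) (simp add: coeff_map_poly r.zero coeff_Up N rot_cp assms(2))
  then have "Up N H = map_poly (rot z) (\<Prod>i\<in>I. [:- Y i, 1:])" using assms(1) by simp
  then show ?thesis by (simp add: m.prod r.mp_linear r.uminus r.one)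
qed

text \<open>
  The contributions to order and \<open>\<xi>\<close>-degree of all conjugates of one close root
  together.
\<close>

definition kappa :: int where "kappa = (\<Sum>z\<in>unity_roots N. ord_t (lin (rot z \<phi>)))"
definition kappa' :: nat where "kappa' = (\<Sum>z\<in>unity_roots N. xi_deg (lin (rot z \<phi>)))"

lemma conj_close_sums:
  assumes "conj_close Y"
  shows "(\<Sum>z\<in>unity_roots N. ord_t (lin (rot z Y))) = kappa" "(\<Sum>z\<in>unity_roots N. xi_deg (lin (rot z Y))) = kappa'"
proof -
  obtain w where w: "w \<in> unity_roots N" "close (rot w Y)" using assms conj_close_def by auto
  have w': "inverse w \<in> unity_roots N" using unity_roots_inverse w by auto
  have *: "fls_nth (rot z Y) k = fls_nth (rot (z * inverse w) \<phi>) k" if "k < e" for z k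
  proof -
    have "fls_nth (rot w Y) k = fls_nth \<phi> k" using w(2) that by (simp add: close_def)
    then have "fls_nth \<phi> k = w powi k * fls_nth Y k" by simp
    then show ?thesis using unity_roots_nz[OF N w(1)]
      by (simp add: power_int_mult_distrib power_int_inverse)
  qed
  have b: "bij_betw (\<lambda>z. z * inverse w) (unity_roots N) (unity_roots N)" by (rule unity_roots_bij[OF N w'])
  have "(\<Sum>z\<in>unity_roots N. ord_t (lin (rot z Y))) = (\<Sum>z\<in>unity_roots N. ord_t (lin (rot (z * inverse w) \<phi>)))"
    using * by (intro sum.cong refl lin_agree)
  then show "(\<Sum>z\<in>unity_roots N. ord_t (lin (rot z Y))) = kappa"
    unfolding kappa_def using sum.reindex_bij_betw[OF b, of "\<lambda>z. ord_t (lin (rot z \<phi>))"] by simp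
  have "(\<Sum>z\<in>unity_roots N. xi_deg (lin (rot z Y))) = (\<Sum>z\<in>unity_roots N. xi_deg (lin (rot (z * inverse w) \<phi>)))"
    using * by (intro sum.cong refl lin_agree)
  then show "(\<Sum>z\<in>unity_roots N. xi_deg (lin (rot z Y))) = kappa'"
    unfolding kappa'_def using sum.reindex_bij_betw[OF b, of "\<lambda>z. xi_deg (lin (rot z \<phi>))"] by simp
qed

text \<open>
  Conjugation leaves a polynomial over \<open>\<complex>((u))\<close> unchanged and acts on its
  linear factors over \<open>\<complex>((t))\<close>. Computing order and
  \<open>\<xi>\<close>-degree once from each of these factorizations and summing, every root
  contributes the same constant.
\<close>

lemma average:
  assumes I: "finite I" and H: "Up N H = (\<Prod>i\<in>I. [:- Y i, 1:])" and conj_close: "\<And>i. i \<in> I \<Longrightarrow> conj_close (Y i)"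
  shows "int N * ord_t (Sub H) = int (card I) * kappa" "N * xi_deg (Sub H) = card I * kappa'"
proof -
  have "ord_t (Sub H) = (\<Sum>i\<in>I. ord_t (lin (rot z (Y i))))" "xi_deg (Sub H) = (\<Sum>i\<in>I. xi_deg (lin (rot z (Y i))))"
    if "z \<in> unity_roots N" for z
    unfolding Sub_split[OF rot_split[OF H that]] using I lin_nz by (auto simp: ord_t_prod xi_deg_prod)
  then have "(\<Sum>z\<in>unity_roots N. ord_t (Sub H)) = (\<Sum>z\<in>unity_roots N. \<Sum>i\<in>I. ord_t (lin (rot z (Y i))))"
    "(\<Sum>z\<in>unity_roots N. xi_deg (Sub H)) = (\<Sum>z\<in>unity_roots N. \<Sum>i\<in>I. xi_deg (lin (rot z (Y i))))"
    by (simp_all)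
  then have "int N * ord_t (Sub H) = (\<Sum>i\<in>I. \<Sum>z\<in>unity_roots N. ord_t (lin (rot z (Y i))))"
    "N * xi_deg (Sub H) = (\<Sum>i\<in>I. \<Sum>z\<in>unity_roots N. xi_deg (lin (rot z (Y i))))"
    using unity_roots_card[OF N] by (simp_all add: sum.swap[of _ I])
  then show "int N * ord_t (Sub H) = int (card I) * kappa" "N * xi_deg (Sub H) = card I * kappa'"
    using conj_close_sums[OF conj_close] by simp_all
qed

lemma proots_linear_prod:
  fixes Y :: "'i \<Rightarrow> complex fls"
  assumes "finite I"
  shows "proots (\<Prod>i\<in>I. [:- Y i, 1:]) = image_mset Y (mset_set I)"
  using assms
proof (induction I rule: finite_induct)
  case (insert i I)
  have "(\<Prod>i\<in>I. [:- Y i, 1:]) \<noteq> 0" using insert.hyps by simp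
  then have "proots ([:- Y i, 1:] * (\<Prod>i\<in>I. [:- Y i, 1:])) = proots [:- Y i, 1:] + proots (\<Prod>i\<in>I. [:- Y i, 1:])"
    by (intro proots_mult) auto
  then show ?case using insert by simp
qed simp

lemma conj_close_rot: assumes "z \<in> unity_roots N" shows "conj_close (rot z Y) \<longleftrightarrow> conj_close Y"
proof
  assume "conj_close (rot z Y)"
  then show "conj_close Y" unfolding conj_close_def rot_rot using unity_roots_mult assms by auto
next
  assume "conj_close Y"
  then obtain w where w: "w \<in> unity_roots N" "close (rot w Y)" by (auto simp: conj_close_def)
  have "rot (w * inverse z) (rot z Y) = rot w Y" using unity_roots_nz[OF N assms] by (simp add: rot_rot mult.assoc)
  then show "conj_close (rot z Y)" unfolding conj_close_def using w unity_roots_mult unity_roots_inverse assms by metis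
qed

text \<open>
  The factors \<open>y - Y\<close> of positive \<open>\<xi>\<close>-degree are among those with
  \<open>Y\<close> conjugate to a close series. The product of the latter is invariant under
  conjugation, hence a polynomial over \<open>\<complex>((u))\<close> of the same
  \<open>\<xi>\<close>-degree as \<open>H\<close>; by minimality it has the degree of
  \<open>H\<close>.
\<close>

lemma all_roots_conj_close:
  assumes I: "finite I" and H: "Up N H = (\<Prod>i\<in>I. [:- Y i, 1:])" and nc: "xi_deg (Sub H) \<noteq> 0"
    and min: "\<And>Q. Q \<noteq> 0 \<Longrightarrow> degree Q < degree H \<Longrightarrow> xi_deg (Sub Q) = 0"
    and i: "i \<in> I"
  shows "conj_close (Y i)"
proof (rule ccontr)
  assume ncc: "\<not> conj_close (Y i)"
  (* The roots conjugate to close ones; as a multiset they are permuted by conjugation. *)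
  define A where "A = {i\<in>I. conj_close (Y i)}"
  have A: "finite A" "A \<subset> I" using I i ncc by (auto simp: A_def)
  have ldH: "xi_deg (Sub H) = (\<Sum>i\<in>I. xi_deg (lin (Y i)))" unfolding Sub_split[OF H] using I lin_nz by (simp add: xi_deg_prod)
  have "\<not> (\<forall>i\<in>I. xi_deg (lin (Y i)) = 0)"
  proof
    assume "\<forall>i\<in>I. xi_deg (lin (Y i)) = 0"
    then have "(\<Sum>i\<in>I. xi_deg (lin (Y i))) = 0" by (intro sum.neutral)
    then show False using nc ldH by simp
  qed
  then obtain i0 where i0: "i0 \<in> I" "xi_deg (lin (Y i0)) \<noteq> 0" by blast
  then have "close (Y i0)" using not_close_ord_t(2)[of "Y i0"] by auto
  then have "conj_close (Y i0)" unfolding conj_close_def by (intro bexI[of _ 1]) (simp_all add: unity_roots_1)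
  then have i0A: "i0 \<in> A" using i0 by (simp add: A_def)
  define P where "P = (\<Prod>i\<in>A. [:- Y i, 1:])"
  have "map_poly (rot z) P = P" if z: "z \<in> unity_roots N" for z
  proof -
    interpret r: rhom "rot z" using rhom_rot unity_roots_nz[OF N z] .
    interpret m: rhom "map_poly (rot z)" by (rule r.mp_rhom)
    have e: "map_poly (rot z) P = (\<Prod>i\<in>A. [:- rot z (Y i), 1:])" by (simp add: P_def m.prod r.mp_linear r.uminus r.one)
    have "image_mset Y (mset_set I) = image_mset (\<lambda>i. rot z (Y i)) (mset_set I)"
      using proots_linear_prod[OF I] H rot_split[OF H z] by metis
    then have "filter_mset conj_close (image_mset Y (mset_set I)) = filter_mset conj_close (image_mset (\<lambda>i. rot z (Y i)) (mset_set I))"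
      by simp
    then have "image_mset Y (mset_set A) = image_mset (\<lambda>i. rot z (Y i)) (mset_set A)"
      unfolding filter_mset_image_mset conj_close_rot[OF z] using I by (simp add: A_def filter_mset_mset_set)
    then have "prod_mset (image_mset (\<lambda>y. [:-y, 1:]) (image_mset Y (mset_set A))) =
        prod_mset (image_mset (\<lambda>y. [:-y, 1:]) (image_mset (\<lambda>i. rot z (Y i)) (mset_set A)))" by simp
    then show ?thesis unfolding e by (simp add: P_def prod_unfold_prod_mset multiset.map_comp comp_def)
  qed
  then obtain Q where Q: "Up N Q = P" using invariant_imp_Up[OF N] by blast
  have dP: "degree P = card A" unfolding P_def by (subst degree_prod_eq_sum_degree) auto
  have dH: "degree (Up N H) = card I" unfolding H by (subst degree_prod_eq_sum_degree) auto
  have "degree Q < degree H" using degree_Up[OF N] Q dP dH psubset_card_mono[OF I A(2)] by metis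
  moreover have "Q \<noteq> 0"
  proof
    assume "Q = 0"
    then have "P = 0" using Q by (simp add: Up_def)
    then show False using A by (simp add: P_def)
  qed
  ultimately have "xi_deg (Sub Q) = 0" by (rule min[rotated])
  moreover have "xi_deg (Sub Q) = (\<Sum>i\<in>A. xi_deg (lin (Y i)))" unfolding Sub_split[OF Q[unfolded P_def]] using A lin_nz by (simp add: xi_deg_prod)
  ultimately show False using i0A i0(2) A by simp
qed

text \<open>
  The product of \<open>y - \<phi>'\<close> over all conjugates \<open>\<phi>'\<close> of
  \<open>\<phi>\<close> acquires the factor \<open>\<xi> t\<^sup>e\<close> by the substitution.
  Since \<open>\<phi>\<close> is finite, so are the coefficients of the product, which makes it an
  element of \<open>\<complex>[x, 1/x, y]\<close>.
\<close>

lemma exists_nonconstant: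
  assumes fin: "\<And>k. k \<ge> e \<Longrightarrow> fls_nth \<phi> k = 0"
  shows "\<exists>Q M. xi_deg (Sub Q) \<noteq> 0 \<and> (\<forall>i k. k > M \<longrightarrow> fls_nth (coeff Q i) k = 0)"
proof -
  define P where "P = (\<Prod>w\<in>unity_roots N. [:- rot w \<phi>, 1:])"
  have inv: "map_poly (rot z) P = P" if z: "z \<in> unity_roots N" for z
  proof -
    interpret r: rhom "rot z" using rhom_rot unity_roots_nz[OF N z] .
    interpret m: rhom "map_poly (rot z)" by (rule r.mp_rhom)
    have "map_poly (rot z) P = (\<Prod>w\<in>unity_roots N. [:- rot (w * z) \<phi>, 1:])"
      by (simp add: P_def m.prod r.mp_linear r.uminus r.one rot_rot mult.commute)
    also have "\<dots> = P" unfolding P_def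
      by (rule prod.reindex_bij_betw[OF unity_roots_bij[OF N z], of "\<lambda>w. [:- rot w \<phi>, 1:]"])
    finally show ?thesis .
  qed
  then obtain Q where Q: "Up N Q = P" using invariant_imp_Up[OF N] by blast
  have "xi_deg (Sub Q) = (\<Sum>w\<in>unity_roots N. xi_deg (lin (rot w \<phi>)))"
    unfolding Sub_split[OF Q[unfolded P_def]] using unity_roots_fin[OF N] lin_nz by (simp add: xi_deg_prod)
  moreover have "xi_deg (lin (rot 1 \<phi>)) = 1" by (intro close_ord_t) (simp add: close_def)
  ultimately have ldQ: "xi_deg (Sub Q) \<noteq> 0" using unity_roots_1[of N] unity_roots_fin[OF N] by (auto simp: sum_eq_0_iff intro!: bexI[of _ 1])
  define bd where "bd = (\<lambda>(p :: complex fls poly) M. \<forall>i k. k > M \<longrightarrow> fls_nth (coeff p i) k = 0)"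
  have bd_mult: "bd (p * q) (M + M')" if "bd p M" "bd q M'" for p q M M'
    unfolding bd_def
  proof (intro allI impI)
    fix i k assume k: "k > M + M'"
    have z: "fls_nth (coeff p a) l * fls_nth (coeff q b) l' = 0" if "l + l' > M + M'" for a b l l'
      using that \<open>bd p M\<close> \<open>bd q M'\<close> unfolding bd_def by (cases "l > M") auto
    have "fls_nth (coeff p a * coeff q b) k = 0" for a b
      unfolding fls_times_nth(2) using z k by (intro sum.neutral) auto
    then show "fls_nth (coeff (p * q) i) k = 0" unfolding coeff_mult by (simp add: fls_nth_sum)
  qed
  have "\<exists>M. bd (\<Prod>w\<in>S. [:- rot w \<phi>, 1:]) M" if "finite S" for S
    using that
  proof (induction S rule: finite_induct)
    case empty
    have "bd 1 0" by (auto simp: bd_def)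
    then show ?case by auto
  next
    case (insert w S)
    then obtain M where M: "bd (\<Prod>w\<in>S. [:- rot w \<phi>, 1:]) M" by auto
    have "bd [:- rot w \<phi>, 1:] (max e 0)"
      unfolding bd_def using fin by (auto simp: coeff_pCons split: nat.split)
    from bd_mult[OF this M] insert.hyps show ?case by auto
  qed
  then obtain M where M: "bd P M" using unity_roots_fin[OF N] P_def by blast
  have "fls_nth (coeff Q i) k = 0" if k: "k > max M 0" for i k
  proof -
    have "1 * k \<le> int N * k" using N k by (intro mult_right_mono) auto
    then have "int N * k > M" using k by linarith
    then have "fls_nth (coeff P i) (int N * k) = 0" using M unfolding bd_def by blast
    then show ?thesis unfolding Q[symmetric] coeff_Up[OF N] using N by (simp add: fls_nth_compose_power)
  qed
  then show ?thesis using ldQ by blast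
qed

end

section \<open>Laurent polynomials as polynomials over Laurent series\<close>

definition emb :: "complex poly \<Rightarrow> complex fls" where
  "emb p = poly (map_poly fls_const p) fls_X_inv"

lemma rhom_fls_const: "rhom (fls_const :: 'a::comm_ring_1 \<Rightarrow> _)"
  by unfold_locales (auto simp: fls_plus_const fls_const_mult_const)

lemma rhom_emb: "rhom emb"
  unfolding emb_def by (rule rhom.eval_rhom[OF rhom_fls_const])
interpretation emb: rhom emb by (rule rhom_emb)

lemma emb_pCons: "emb (pCons a p) = fls_const a + fls_X_inv * emb p"
  unfolding emb_def by (subst map_poly_pCons) auto

lemma emb_nth: "fls_nth (emb p) k = (if k \<le> 0 then coeff p (nat (- k)) else 0)"
proof (induction p arbitrary: k)
  case 0 show ?case by (simp add: emb_def)
next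
  case (pCons a p)
  have X: "fls_nth (fls_X_inv * emb p) k = fls_nth (emb p) (k + 1)" for k
    by (simp add: fls_X_inv_times_conv_shift)
  show ?case
  proof (cases "k \<le> 0")
    case False
    then show ?thesis using pCons.IH[of "k + 1"] by (simp add: emb_pCons X)
  next
    case True
    then obtain i where i: "k = - int i" by (metis nonneg_int_cases neg_0_le_iff_le minus_minus)
    show ?thesis
    proof (cases i)
      case 0
      then show ?thesis using pCons.IH[of "k + 1"] i by (simp add: emb_pCons X)
    next
      case (Suc m)
      then have "nat (- (k + 1)) = m" "nat (- k) = Suc m" "k + 1 \<le> 0" "k \<noteq> 0" using i by auto
      then show ?thesis using pCons.IH[of "k + 1"] True by (simp add: emb_pCons X del: minus_add_distrib)
    qed
  qed
qed

lemma npos_emb: "npos (emb p)" by (simp add: npos_def emb_nth)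

lemma emb_inj: "emb p = emb q \<Longrightarrow> p = q"
proof (intro poly_eqI)
  fix i assume "emb p = emb q"
  then have "fls_nth (emb p) (- int i) = fls_nth (emb q) (- int i)" by simp
  then show "coeff p i = coeff q i" by (simp add: emb_nth)
qed

definition embP :: "complex poly poly \<Rightarrow> complex fls poly" where "embP = map_poly emb"

lemma rhom_embP: "rhom embP" unfolding embP_def by (rule emb.mp_rhom)
interpretation embP: rhom embP by (rule rhom_embP)

lemma coeff_embP: "coeff (embP f) i = emb (coeff f i)" by (simp add: embP_def coeff_map_poly emb.zero)

lemma embP_inj: "embP f = embP g \<Longrightarrow> f = g"
  by (intro poly_eqI emb_inj) (metis coeff_embP)

lemma pnpos_embP: "pnpos (embP f)" by (simp add: pnpos_def coeff_embP npos_emb)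

lemma degree_embP: "degree (embP f) = degree f"
  using emb_inj[of "lead_coeff f" 0] unfolding embP_def
  by (cases "f = 0") (auto intro!: map_poly_degree_eq simp: emb.zero)

lemma emb_X: "emb [:0, 1:] = fls_X_inv"
  by (simp add: emb_pCons emb.zero)

lemma X_intpow_add: "fls_X_intpow i * fls_X_intpow j = (fls_X_intpow (i + j) :: complex fls)"
  by (simp add: fls_X_intpow_times_fls_X_intpow)

text \<open>
  A relation rather than a function because an element of \<open>\<complex>[x, 1/x, y]\<close> is
  given inside the field \<open>\<complex>(x, y)\<close>, and its representation by a polynomial
  and a power of \<open>x\<close> is not unique. The image is (\<open>as_fls_unique\<close>).
\<close>

definition as_fls :: "ratfun \<Rightarrow> complex fls poly \<Rightarrow> bool" where
  "as_fls h H \<longleftrightarrow> (\<exists>f i. h = to_fract f * x_var powi i \<and> H = smult (fls_X_intpow (- i)) (embP f))"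

lemma x_var_nz: "x_var \<noteq> 0" by (simp add: x_var_def)

lemma embP_x: "embP [:[:0, 1:]:] = [:fls_X_inv:]"
  by (simp add: embP_def emb.mp_const emb_X)

lemma as_fls_shift:
  assumes "h = to_fract f * x_var powi i" "H = smult (fls_X_intpow (- i)) (embP f)" "m \<le> i"
  shows "\<exists>f'. h = to_fract f' * x_var powi m \<and> H = smult (fls_X_intpow (- m)) (embP f')"
proof -
  define k where "k = nat (i - m)"
  let ?k = k
  let ?f' = "f * [:[:0, 1:]:] ^ ?k"
  have i: "i = int k + m" using assms(3) by (simp add: k_def)
  have last_index: "to_fract (p ^ k) = (to_fract p :: ratfun) ^ k" for p k by (induction k) auto
  have "x_var powi i = x_var ^ ?k * x_var powi m"
    by (subst i) (simp add: power_int_add x_var_nz)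
  then have h: "h = to_fract ?f' * x_var powi m" using assms(1) by (simp add: last_index x_var_def)
  have "fls_X_inv ^ ?k = (fls_X_intpow (- int ?k) :: complex fls)"
    by (simp add: fls_X_inv_power_conv_shift_1)
  then have "embP ?f' = smult (fls_X_intpow (- int ?k)) (embP f)"
  proof -
    have "embP ?f' = embP f * [:fls_X_inv:] ^ k" by (simp only: embP.mult embP.power embP_x)
    then show ?thesis using \<open>fls_X_inv ^ k = _\<close> by (simp add: poly_const_pow)
  qed
  then have "smult (fls_X_intpow (- m)) (embP ?f') = smult (fls_X_intpow (- m) * fls_X_intpow (- int ?k)) (embP f)"
    by (simp only: smult_smult)
  also have "fls_X_intpow (- m) * fls_X_intpow (- int ?k) = (fls_X_intpow (- i) :: complex fls)"
    unfolding X_intpow_add by (subst i) (simp add: add.commute)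
  finally have "H = smult (fls_X_intpow (- m)) (embP ?f')" using assms(2) by simp
  then show ?thesis using h by blast
qed

lemma as_fls_add: assumes "as_fls h H" "as_fls h' H'" shows "as_fls (h + h') (H + H')" "as_fls (h - h') (H - H')"
proof -
  obtain f i where 1: "h = to_fract f * x_var powi i" "H = smult (fls_X_intpow (- i)) (embP f)"
    using assms as_fls_def by auto
  obtain f' i' where 2: "h' = to_fract f' * x_var powi i'" "H' = smult (fls_X_intpow (- i')) (embP f')"
    using assms as_fls_def by auto
  define m where "m = min i i'"
  obtain p where p: "h = to_fract p * x_var powi m" "H = smult (fls_X_intpow (- m)) (embP p)"
    using as_fls_shift[OF 1, of m] m_def by auto
  obtain p' where p': "h' = to_fract p' * x_var powi m" "H' = smult (fls_X_intpow (- m)) (embP p')"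
    using as_fls_shift[OF 2, of m] m_def by auto
  show "as_fls (h + h') (H + H')" unfolding as_fls_def p p'
    by (intro exI[of _ "p + p'"] exI[of _ m]) (simp add: embP.add smult_add_right algebra_simps)
  show "as_fls (h - h') (H - H')" unfolding as_fls_def p p'
    by (intro exI[of _ "p - p'"] exI[of _ m]) (simp add: embP.diff smult_diff_right algebra_simps)
qed

lemma as_fls_mult: assumes "as_fls h H" "as_fls h' H'" shows "as_fls (h * h') (H * H')"
proof -
  obtain f i where 1: "h = to_fract f * x_var powi i" "H = smult (fls_X_intpow (- i)) (embP f)"
    using assms as_fls_def by auto
  obtain f' i' where 2: "h' = to_fract f' * x_var powi i'" "H' = smult (fls_X_intpow (- i')) (embP f')"
    using assms as_fls_def by auto
  have "h * h' = to_fract (f * f') * x_var powi (i + i')"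
    by (simp add: 1 2 power_int_add x_var_nz mult_ac)
  moreover have "H * H' = smult (fls_X_intpow (- (i + i'))) (embP (f * f'))"
  proof -
    have "H * H' = smult (fls_X_intpow (- i) * fls_X_intpow (- i')) (embP f * embP f')"
      by (simp only: 1 2 mult_smult_left mult_smult_right smult_smult mult.commute)
    then show ?thesis unfolding X_intpow_add embP.mult by (simp only: minus_add_distrib add.commute)
  qed
  ultimately show ?thesis unfolding as_fls_def by blast
qed

lemma as_fls_poly: "as_fls (to_fract f) (embP f)"
  unfolding as_fls_def by (intro exI[of _ f] exI[of _ 0]) simp
lemma as_fls_0: "as_fls 0 0" using as_fls_poly[of 0] by (simp add: embP.zero)
lemma as_fls_1: "as_fls 1 1" using as_fls_poly[of 1] by (simp add: embP.one)
lemma as_fls_const: "as_fls (const c) [:fls_const c:]"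
proof -
  have "embP [:[:c:]:] = [:fls_const c:]" by (simp add: embP_def emb.mp_const emb_pCons emb.zero)
  then show ?thesis using as_fls_poly[of "[:[:c:]:]"] by (simp add: const_def)
qed
lemma as_fls_y: "as_fls y_var [:0, 1:]"
  using as_fls_poly[of "[:0, 1:]"] by (simp add: y_var_def embP_def emb.mp_linear emb.zero emb.one)
lemma as_fls_x_powi: "as_fls (x_var powi i) [:fls_X_intpow (- i):]"
proof -
  have "x_var powi i = to_fract 1 * x_var powi i" by simp
  moreover have "[:fls_X_intpow (- i):] = smult (fls_X_intpow (- i)) (embP 1)" by (simp add: embP.one)
  ultimately show ?thesis unfolding as_fls_def by blast
qed
lemma as_fls_power: "as_fls h H \<Longrightarrow> as_fls (h ^ k) (H ^ k)" by (induction k) (auto intro: as_fls_mult as_fls_1)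
lemma as_fls_prod: "finite S \<Longrightarrow> (\<And>i. i \<in> S \<Longrightarrow> as_fls (h i) (H i)) \<Longrightarrow> as_fls (\<Prod>i\<in>S. h i) (\<Prod>i\<in>S. H i)"
  by (induction S rule: finite_induct) (auto intro: as_fls_mult as_fls_1)
lemma as_fls_sum: "finite S \<Longrightarrow> (\<And>i. i \<in> S \<Longrightarrow> as_fls (h i) (H i)) \<Longrightarrow> as_fls (\<Sum>i\<in>S. h i) (\<Sum>i\<in>S. H i)"
  by (induction S rule: finite_induct) (auto intro: as_fls_add as_fls_0)

lemma as_fls_eq_0: assumes "as_fls h H" shows "h = 0 \<longleftrightarrow> H = 0"
proof -
  obtain f i where 1: "h = to_fract f * x_var powi i" "H = smult (fls_X_intpow (- i)) (embP f)"
    using assms as_fls_def by auto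
  have "(fls_X_intpow (- i) :: complex fls) \<noteq> 0" by (simp add: fls_shift_eq0_iff)
  moreover have "embP f = 0 \<longleftrightarrow> f = 0" using embP_inj[of f 0] by (auto simp: embP.zero)
  ultimately show ?thesis by (simp add: 1 x_var_nz)
qed

lemma as_fls_unique: assumes "as_fls h H" "as_fls h H'" shows "H = H'"
  using as_fls_eq_0[OF as_fls_add(2)[OF assms]] by simp

lemma as_fls_ex: "h \<in> laurent_ring \<Longrightarrow> \<exists>H. as_fls h H"
  unfolding laurent_ring_def poly_ring_def as_fls_def by blast
lemma as_fls_laurent: "as_fls h H \<Longrightarrow> h \<in> laurent_ring"
  unfolding laurent_ring_def poly_ring_def as_fls_def by blast

text \<open>
  The coefficients of \<open>Q\<close> are finite sums of powers of \<open>u\<close>, since they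
  are bounded on both sides.
\<close>

lemma as_fls_of_bounded:
  assumes "\<And>i k. k > M \<Longrightarrow> fls_nth (coeff Q i) k = 0"
  shows "\<exists>h. as_fls h Q"
proof -
  define c where "c = (\<lambda>i k. fls_nth (coeff Q i) (M - int k))"
  have fin: "\<exists>p. \<forall>k. coeff p k = c i k" for i
  proof -
    have "c i k = 0" if "k > nat (M - fls_subdegree (coeff Q i))" for k
      unfolding c_def by (rule fls_eq0_below_subdegree) (use that in linarith)
    then have "\<forall>\<^sub>\<infinity>k. c i k = 0" unfolding MOST_nat by blast
    then show ?thesis by (metis Abs_poly_inverse mem_Collect_eq)
  qed
  then obtain p where p: "\<And>i k. coeff (p i) k = c i k" by metis
  define f where "f = (\<Sum>i\<le>degree Q. monom (p i) i)"
  have p0: "p i = 0" if "i > degree Q" for i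
    using that by (intro poly_eqI) (simp add: p c_def coeff_eq_0)
  have cf: "coeff f i = p i" for i using p0[of i] by (auto simp: f_def coeff_sum)
  have "Q = smult (fls_X_intpow M) (embP f)"
  proof (intro poly_eqI fls_eqI)
    fix i k
    have "fls_nth (coeff (smult (fls_X_intpow M) (embP f)) i) k = fls_nth (emb (p i)) (k - M)"
      by (simp add: coeff_embP cf fls_shifted_times_simps)
    also have "\<dots> = fls_nth (coeff Q i) k"
      using assms[of k i] by (auto simp: emb_nth p c_def)
    finally show "fls_nth (coeff Q i) k = fls_nth (coeff (smult (fls_X_intpow M) (embP f)) i) k" by simp
  qed
  then have "as_fls (to_fract f * x_var powi (- M)) Q"
    unfolding as_fls_def by (intro exI[of _ f] exI[of _ "- M"]) simp
  then show ?thesis by blast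
qed

section \<open>Clearing denominators of exponents\<close>

definition exponents_over :: "nat \<Rightarrow> (rat \<Rightarrow>\<^sub>0 'a::zero) \<Rightarrow> bool" where
  "exponents_over N h \<longleftrightarrow> (\<forall>q\<in>Poly_Mapping.keys h. of_nat N * q \<in> \<int>)"

text \<open>
  The substitution \<open>x = t\<^bsup>-N\<^esup>\<close> in a finite sum of fractional powers of
  \<open>x\<close>. It is multiplicative on sums all of whose exponents have denominators dividing
  \<open>N\<close>.
\<close>

definition to_fls :: "nat \<Rightarrow> (rat \<Rightarrow>\<^sub>0 'a::zero) \<Rightarrow> 'a fls" where
  "to_fls N h = Abs_fls (\<lambda>n. Poly_Mapping.lookup h (- of_int n / of_nat N))"

lemma to_fls_nth:
  assumes "N > 0"
  shows "fls_nth (to_fls N h) n = Poly_Mapping.lookup h (- of_int n / of_nat N)"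
proof -
  let ?S = "insert 0 ((\<lambda>q. \<lfloor>- (of_nat N * q)\<rfloor>) ` Poly_Mapping.keys h)"
  define b where "b = Min ?S"
  have b: "b \<le> \<lfloor>- (of_nat N * q)\<rfloor>" if "q \<in> Poly_Mapping.keys h" for q
    unfolding b_def using that by (intro Min_le) auto
  show ?thesis unfolding to_fls_def
  proof (rule nth_Abs_fls_lower_bound[of b], intro allI impI, rule ccontr)
    fix n assume n: "n < b" "Poly_Mapping.lookup h (- of_int n / of_nat N) \<noteq> 0"
    then have "(- of_int n / of_nat N) \<in> Poly_Mapping.keys h" by (simp add: in_keys_iff)
    then have "b \<le> \<lfloor>- (of_nat N * (- of_int n / of_nat N)) :: rat\<rfloor>" by (rule b)
    also have "- (of_nat N * (- of_int n / of_nat N)) = (of_int n :: rat)" using assms by simp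
    finally show False using n(1) by simp
  qed
qed

lemma to_fls_add: "N > 0 \<Longrightarrow> to_fls N (h + h') = to_fls N h + to_fls N h'"
  by (intro fls_eqI) (simp add: to_fls_nth lookup_add)
lemma to_fls_0: "N > 0 \<Longrightarrow> to_fls N 0 = 0" by (intro fls_eqI) (simp add: to_fls_nth)
lemma to_fls_sum: "N > 0 \<Longrightarrow> to_fls N (\<Sum>i\<in>S. h i) = (\<Sum>i\<in>S. to_fls N (h i))"
  by (induction S rule: infinite_finite_induct) (auto simp: to_fls_add to_fls_0)

lemma to_fls_single:
  assumes "N > 0" "of_nat N * q = of_int m"
  shows "to_fls N (Poly_Mapping.single q c) = fls_shift m (fls_const c)"
proof (intro fls_eqI)
  fix n
  have q: "q = of_int m / of_nat N" using assms by (simp add: field_simps)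
  have "(q = - of_int n / of_nat N) \<longleftrightarrow> n = - m"
    unfolding q using assms(1) by (simp add: field_simps) (metis of_int_eq_iff of_int_minus minus_minus)
  then show "fls_nth (to_fls N (Poly_Mapping.single q c)) n = fls_nth (fls_shift m (fls_const c)) n"
    using assms(1) by (auto simp: to_fls_nth lookup_single when_def)
qed

lemma sum_single: "h = (\<Sum>q\<in>Poly_Mapping.keys h. Poly_Mapping.single q (Poly_Mapping.lookup h q))"
  by (intro poly_mapping_eqI) (auto simp: lookup_sum lookup_single when_def in_keys_iff)

lemma to_fls_mult:
  fixes h h' :: "rat \<Rightarrow>\<^sub>0 'a::comm_ring_1"
  assumes N: "N > 0" and "exponents_over N h" "exponents_over N h'"
  shows "to_fls N (h * h') = to_fls N h * to_fls N h'"
proof -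
  let ?s = "\<lambda>h q. Poly_Mapping.single q (Poly_Mapping.lookup h q)"
  have 1: "to_fls N (?s h q * ?s h' q') = to_fls N (?s h q) * to_fls N (?s h' q')"
    if q: "q \<in> Poly_Mapping.keys h" "q' \<in> Poly_Mapping.keys h'" for q q'
  proof -
    obtain m m' where m: "of_nat N * q = of_int m" "of_nat N * q' = of_int m'"
      using q assms by (metis Ints_cases exponents_over_def)
    then have "of_nat N * (q + q') = of_int (m + m')" by (simp add: algebra_simps)
    then show ?thesis unfolding mult_single to_fls_single[OF N m(1)] to_fls_single[OF N m(2)]
      by (subst to_fls_single[OF N]) (auto simp: fls_shifted_times_simps fls_const_mult_const add.commute)
  qed
  have "h * h' = (\<Sum>q\<in>Poly_Mapping.keys h. \<Sum>q'\<in>Poly_Mapping.keys h'. ?s h q * ?s h' q')"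
    unfolding sum_product[symmetric] sum_single[symmetric] ..
  then have "to_fls N (h * h') = (\<Sum>q\<in>Poly_Mapping.keys h. \<Sum>q'\<in>Poly_Mapping.keys h'. to_fls N (?s h q) * to_fls N (?s h' q'))"
    using 1 by (simp add: to_fls_sum[OF N])
  also have "\<dots> = to_fls N (\<Sum>q\<in>Poly_Mapping.keys h. ?s h q) * to_fls N (\<Sum>q'\<in>Poly_Mapping.keys h'. ?s h' q')"
    unfolding to_fls_sum[OF N] sum_product ..
  finally show ?thesis unfolding sum_single[symmetric] .
qed

lemma exponents_over_add: "exponents_over N h \<Longrightarrow> exponents_over N h' \<Longrightarrow> exponents_over N (h + h')"
  unfolding exponents_over_def using keys_add[of h h'] by blast
lemma exponents_over_0: "exponents_over N 0" by (simp add: exponents_over_def)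
lemma exponents_over_sum: "finite S \<Longrightarrow> (\<And>i. i \<in> S \<Longrightarrow> exponents_over N (h i)) \<Longrightarrow> exponents_over N (\<Sum>i\<in>S. h i)"
  by (induction S rule: finite_induct) (auto intro: exponents_over_add exponents_over_0)
lemma exponents_over_mult:
  fixes h h' :: "rat \<Rightarrow>\<^sub>0 'a::comm_ring_1"
  assumes "exponents_over N h" "exponents_over N h'" shows "exponents_over N (h * h')"
  unfolding exponents_over_def
proof
  fix q assume "q \<in> Poly_Mapping.keys (h * h')"
  then obtain a b where "q = a + b" "a \<in> Poly_Mapping.keys h" "b \<in> Poly_Mapping.keys h'"
    using keys_mult[of h h'] by blast
  then show "of_nat N * q \<in> \<int>" using assms by (auto simp: exponents_over_def algebra_simps intro: Ints_add)
qed
lemma exponents_over_single: "of_nat N * q \<in> \<int> \<Longrightarrow> exponents_over N (Poly_Mapping.single q c)"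
  by (simp add: exponents_over_def)
lemma exponents_over_1: "exponents_over N (1 :: rat \<Rightarrow>\<^sub>0 'a::comm_ring_1)" using exponents_over_single[of N 0 "1::'a"] by simp
lemma exponents_over_power:
  fixes h :: "rat \<Rightarrow>\<^sub>0 'a::comm_ring_1"
  shows "exponents_over N h \<Longrightarrow> exponents_over N (h ^ k)"
  by (induction k) (auto intro: exponents_over_mult exponents_over_1)
lemma to_fls_power:
  fixes h :: "rat \<Rightarrow>\<^sub>0 'a::comm_ring_1"
  shows "N > 0 \<Longrightarrow> exponents_over N h \<Longrightarrow> to_fls N (h ^ k) = to_fls N h ^ k"
proof (induction k)
  case 0
  then show ?case using to_fls_single[of N 0 0 "1::'a"] by simp
qed (simp add: to_fls_mult exponents_over_power)

lemma deg_x_to_fls: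
  assumes N: "N > 0" and f: "exponents_over N h" and nz: "to_fls N h \<noteq> 0"
  shows "of_nat N * deg_x h = - of_int (ord_t (to_fls N h))"
proof -
  have "h \<noteq> 0" using nz to_fls_0[OF N] by auto
  then have "deg_x h \<in> Poly_Mapping.keys h" unfolding deg_x_def by (intro Max_in) auto
  moreover obtain m where m: "of_nat N * deg_x h = of_int m"
    using f calculation by (metis Ints_cases exponents_over_def)
  ultimately have q: "deg_x h = - of_int (- m) / of_nat N" using N by (simp add: field_simps)
  have "fls_subdegree (to_fls N h) = - m"
  proof (rule fls_subdegree_eqI)
    show "fls_nth (to_fls N h) (- m) \<noteq> 0"
      using \<open>deg_x h \<in> _\<close> q by (simp add: to_fls_nth[OF N] in_keys_iff)
    fix k assume k: "k < - m"
    have "deg_x h < - of_int k / of_nat N"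
      unfolding q using k N by (intro divide_strict_right_mono) auto
    then have "- of_int k / of_nat N \<notin> Poly_Mapping.keys h"
      unfolding deg_x_def using Max_ge[of "Poly_Mapping.keys h"] by fastforce
    then show "fls_nth (to_fls N h) k = 0" by (simp add: to_fls_nth[OF N] in_keys_iff)
  qed
  then show ?thesis using m by (simp add: ord_t_def)
qed

section \<open>Key forms under the generic substitution\<close>

text \<open>
  A semidegree with its generic descending Puiseux series and its key forms, together with a
  common denominator \<open>N\<close> of \<open>r\<close> and of the exponents of
  \<open>\<psi>\<close>. The series \<open>\<phi>(t)\<close> is the part of \<open>x
  \<psi>(1/x)\<close> above \<open>x\<^bsup>1 - r\<^esup>\<close> after the substitution \<open>x
  = t\<^bsup>-N\<^esup>\<close>, so that the term \<open>c u\<^sup>q\<close> of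
  \<open>\<psi>\<close> becomes \<open>c t\<^bsup>N (q - 1)\<^esup>\<close>.
\<close>

locale key_data = generic N \<phi> e for N :: nat and \<phi> :: "complex fls" and e :: int +
  fixes \<psi> :: "rat \<Rightarrow> complex" and r :: rat and \<delta> :: "ratfun \<Rightarrow> int" and n :: nat
    and g :: "nat \<Rightarrow> ratfun" and \<beta> :: "nat \<Rightarrow> nat \<Rightarrow> int" and \<theta> :: "nat \<Rightarrow> complex"
    and \<eta> :: "nat \<Rightarrow> int"
  assumes e: "of_int e = of_nat N * (r - 1)"
    and phi: "\<And>k. fls_nth \<phi> k = (if k < e then \<psi> (1 + of_int k / of_nat N) else 0)"
    and psi_frac: "\<And>q. \<psi> q \<noteq> 0 \<Longrightarrow> of_nat N * q \<in> \<int>" and psi_pos: "\<And>q. \<psi> q \<noteq> 0 \<Longrightarrow> q > 0"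
    and gdp: "generic_descending_puiseux \<delta> (terms_above (1 - r) (to_descending \<psi>)) (1 - r)"
    and val_mult: "\<And>a b. a \<noteq> 0 \<Longrightarrow> b \<noteq> 0 \<Longrightarrow> \<delta> (a * b) = \<delta> a + \<delta> b"
    and eta: "\<eta> = (\<lambda>j. \<delta> (g j))"
    and g_laurent: "\<And>j. j \<le> n + 1 \<Longrightarrow> g j \<in> laurent_ring"
    and g0: "g 0 = x_var" and g1: "g 1 = y_var"
    and k_drop: "\<And>j. j \<in> {1..n} \<Longrightarrow> \<eta> (j + 1) < int (key_alpha \<eta> j) * \<eta> j"
    and k_rel: "\<And>j. j \<in> {1..n} \<Longrightarrow> int (key_alpha \<eta> j) * \<eta> j = (\<Sum>i<j. \<beta> j i * \<eta> i)"
    and k_beta: "\<And>i j. j \<in> {1..n} \<Longrightarrow> i \<in> {1..<j} \<Longrightarrow> 0 \<le> \<beta> j i \<and> \<beta> j i < int (key_alpha \<eta> i)"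
    and k_theta: "\<And>j. j \<in> {1..n} \<Longrightarrow> \<theta> j \<noteq> 0"
    and k_step: "\<And>j. j \<in> {1..n} \<Longrightarrow>
        g (j + 1) = g j ^ key_alpha \<eta> j - const (\<theta> j) * (\<Prod>i<j. g i powi \<beta> j i)"
    and k_min: "\<And>h. h \<in> laurent_ring \<Longrightarrow> h \<noteq> 0 \<Longrightarrow>
        \<exists>Z\<in>zpolys (n + 1). zpoly_eval g Z = h \<and> weighted_degree \<eta> Z = \<delta> h"
begin

definition p0 :: int where "p0 = \<delta> x_var"

lemma p0: "p0 > 0" using gdp by (simp add: generic_descending_puiseux_def p0_def)

abbreviation "trunc \<equiv> terms_above (1 - r) (to_descending \<psi>)"

lemma trunc_lookup: "Poly_Mapping.lookup trunc q = (if q > 1 - r then \<psi> (1 - q) else 0)"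
proof -
  let ?S = "{q. q > 1 - r \<and> to_descending \<psi> q \<noteq> 0}"
  have "?S \<subseteq> (\<lambda>k. 1 - of_int k / of_nat N) ` {0..\<lceil>of_nat N * r\<rceil>}"
  proof
    fix q assume "q \<in> ?S"
    then have q: "q > 1 - r" "\<psi> (1 - q) \<noteq> 0" by (auto simp: to_descending_def)
    obtain k where k: "of_nat N * (1 - q) = of_int k" using psi_frac[OF q(2)] by (metis Ints_cases)
    have "of_nat N * (1 - q) > 0" using psi_pos[OF q(2)] N by simp
    then have "k \<ge> 0" unfolding k by simp
    moreover have "of_nat N * (1 - q) \<le> of_nat N * r" using q(1) by (intro mult_left_mono) auto
    then have "k \<le> \<lceil>of_nat N * r\<rceil>" unfolding k by (simp add: le_ceiling_iff)
    moreover have "q = 1 - of_int k / of_nat N" using k N by (simp add: field_simps)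
    ultimately show "q \<in> (\<lambda>k. 1 - of_int k / of_nat N) ` {0..\<lceil>of_nat N * r\<rceil>}" by auto
  qed
  then have fin: "finite ?S" by (rule finite_subset) auto
  have "Poly_Mapping.lookup trunc q = (\<Sum>x\<in>?S. if x = q then to_descending \<psi> x else 0)"
    unfolding terms_above_def by (simp add: lookup_sum lookup_single when_def)
  also have "\<dots> = (if q \<in> ?S then to_descending \<psi> q else 0)" using fin by simp
  finally show ?thesis by (auto simp: to_descending_def)
qed

abbreviation "generic_sum \<equiv> with_generic_term trunc (1 - r)"

lemma generic_sum_lookup: "Poly_Mapping.lookup generic_sum q =
   (if q > 1 - r then [:\<psi> (1 - q):] else 0) + (if q = 1 - r then [:0, 1:] else 0)"
  unfolding with_generic_term_def lookup_add
  by (auto simp: map.rep_eq trunc_lookup when_def lookup_single)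

lemma e_iff: "- of_int k / of_nat N > 1 - r \<longleftrightarrow> k < e" "- of_int k / of_nat N = 1 - r \<longleftrightarrow> k = e"
proof -
  have N': "(of_nat N :: rat) > 0" using N by simp
  have r: "1 - r = - of_int e / of_nat N" using e N by (simp add: field_simps)
  show "- of_int k / of_nat N > 1 - r \<longleftrightarrow> k < e"
    unfolding r using N' by (simp add: divide_less_cancel)
  show "- of_int k / of_nat N = 1 - r \<longleftrightarrow> k = e"
    unfolding r using N' by (simp add: divide_cancel_right)
qed

lemma to_fls_generic_sum: "to_fls N generic_sum = Phi"
proof (intro fls_eqI)
  fix k
  have "fls_nth (to_fls N generic_sum) k = (if k < e then [:\<psi> (1 - (- of_int k / of_nat N)):] else 0) + (if k = e then [:0, 1:] else 0)"
    by (simp only: to_fls_nth[OF N] generic_sum_lookup e_iff)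
  then show "fls_nth (to_fls N generic_sum) k = fls_nth Phi k" by (simp add: Phi_def XI_nth phi)
qed

lemma exponents_over_generic_sum: "exponents_over N generic_sum"
  unfolding exponents_over_def
proof
  fix q assume "q \<in> Poly_Mapping.keys generic_sum"
  then have "Poly_Mapping.lookup generic_sum q \<noteq> 0" by (simp add: in_keys_iff)
  then consider "\<psi> (1 - q) \<noteq> 0" | "q = 1 - r" unfolding generic_sum_lookup by (auto split: if_splits)
  then show "of_nat N * q \<in> \<int>"
  proof cases
    case 1
    have "of_nat N * q = of_nat N - of_nat N * (1 - q)" by (simp add: algebra_simps)
    then show ?thesis using psi_frac[OF 1] by (metis Ints_diff Ints_of_nat)
  next
    case 2
    have "of_nat N * q = - of_int e" unfolding 2 e by (simp add: algebra_simps)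
    then show ?thesis by simp
  qed
qed

lemma subst_y_to_fls: "exponents_over N (subst_y f generic_sum)" "to_fls N (subst_y f generic_sum) = Sub (embP f)"
proof -
  have t: "of_nat N * of_nat k = (of_int (int (N * k)) :: rat)" for k by simp
  have fr: "exponents_over N (Poly_Mapping.single (of_nat k) c * generic_sum ^ i)" for k i and c :: "complex poly"
    by (intro exponents_over_mult exponents_over_single exponents_over_power exponents_over_generic_sum) (simp flip: of_nat_mult)
  show "exponents_over N (subst_y f generic_sum)" unfolding subst_y_def by (intro exponents_over_sum fr) auto
  have lc: "lft (fls_const c) = fls_const [:c:]" for c :: complex by (intro fls_eqI) simp
  interpret c: rhom "cp N" by (rule rhom_cp[OF N])
  have X: "lft (cp N (fls_const c * fls_X_inv ^ k)) = fls_shift (int (N * k)) (fls_const [:c:])" for c k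
  proof -
    have "cp N (fls_const c * fls_X_inv ^ k) = fls_shift (int (N * k)) (fls_const c)"
      using N by (simp add: fls_X_inv_power_conv_shift_1 fls_shifted_times_simps)
    also have "lft \<dots> = fls_shift (int (N * k)) (fls_const [:c:])" by (intro fls_eqI) simp
    finally show ?thesis .
  qed
  have em: "emb p = (\<Sum>k\<le>degree p. fls_const (coeff p k) * fls_X_inv ^ k)" for p
  proof -
    have d: "degree (map_poly (fls_const :: complex \<Rightarrow> _) p) = degree p"
      by (cases "p = 0") (auto intro!: map_poly_degree_eq)
    show ?thesis unfolding emb_def poly_altdef d by (simp add: coeff_map_poly)
  qed
  have "Sub (embP f) = (\<Sum>i\<le>degree f. lft (cp N (emb (coeff f i))) * Phi ^ i)"
  proof -
    have "degree (map_poly lft (Up N (embP f))) = degree f"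
    proof (cases "f = 0")
      case True then show ?thesis by (simp add: embP.zero Up_def)
    next
      case False
      have "lft (lead_coeff (Up N (embP f))) \<noteq> 0"
      proof -
        have "embP f \<noteq> 0" using False embP_inj[of f 0] embP.zero by auto
        then have "lead_coeff (embP f) \<noteq> 0" by simp
        then show ?thesis using lft_cp_nz by (simp add: degree_Up[OF N] coeff_Up[OF N])
      qed
      then show ?thesis by (simp add: map_poly_degree_eq degree_Up[OF N] degree_embP)
    qed
    then show ?thesis unfolding Sub_def poly_altdef
      by (simp add: coeff_map_poly lft.zero coeff_Up[OF N] coeff_embP)
  qed
  also have "\<dots> = (\<Sum>i\<le>degree f. \<Sum>k\<le>degree (coeff f i). fls_shift (int (N * k)) (fls_const [:coeff (coeff f i) k:]) * Phi ^ i)"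
    by (simp only: em c.sum lft.sum X sum_distrib_right)
  also have "\<dots> = to_fls N (subst_y f generic_sum)"
    unfolding subst_y_def to_fls_sum[OF N]
    by (intro sum.cong refl, subst to_fls_mult[OF N])
       (auto simp: to_fls_power[OF N exponents_over_generic_sum] to_fls_generic_sum to_fls_single[OF N t] simp flip: of_nat_mult
         intro!: exponents_over_single exponents_over_power exponents_over_generic_sum)
  finally show "to_fls N (subst_y f generic_sum) = Sub (embP f)" by simp
qed

lemma delta_poly: assumes "f \<noteq> 0" shows "int N * \<delta> (to_fract f) = - p0 * ord_t (Sub (embP f))"
proof -
  have nz: "Sub (embP f) \<noteq> 0" using assms Sub_eq_0 embP_inj[of f 0] embP.zero by metis
  have "of_int (\<delta> (to_fract f)) = (of_int p0 :: rat) * deg_x (subst_y f generic_sum)"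
    using gdp assms unfolding generic_descending_puiseux_def p0_def by blast
  then have "of_nat N * of_int (\<delta> (to_fract f)) = (of_int p0 :: rat) * (of_nat N * deg_x (subst_y f generic_sum))" by simp
  also have "of_nat N * deg_x (subst_y f generic_sum) = - of_int (ord_t (Sub (embP f)))"
    using deg_x_to_fls[OF N subst_y_to_fls(1)] nz by (simp add: subst_y_to_fls(2))
  finally have "(of_int (int N * \<delta> (to_fract f)) :: rat) = of_int (- p0 * ord_t (Sub (embP f)))" by simp
  then show ?thesis by (simp only: of_int_eq_iff)
qed

lemma delta_1: "\<delta> 1 = 0" using val_mult[of 1 1] by simp

lemma delta_inverse: "a \<noteq> 0 \<Longrightarrow> \<delta> (inverse a) = - \<delta> a"
  using val_mult[of a "inverse a"] delta_1 by simp
lemma delta_power: "a \<noteq> 0 \<Longrightarrow> \<delta> (a ^ k) = int k * \<delta> a"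
  by (induction k) (auto simp: delta_1 val_mult algebra_simps)
lemma delta_powi: "a \<noteq> 0 \<Longrightarrow> \<delta> (a powi i) = i * \<delta> a"
  by (cases i rule: int_cases4) (auto simp: power_int_minus delta_power delta_inverse)

lemma Sub_nz: "H \<noteq> 0 \<Longrightarrow> Sub H \<noteq> 0" using Sub_eq_0 by auto

text \<open>
  The defining property of the generic series, transported to orders in \<open>t\<close> and
  extended from polynomials to \<open>\<complex>[x, 1/x, y]\<close> by multiplicativity of
  \<open>\<delta>\<close>.
\<close>

lemma delta_as_fls: assumes "as_fls h H" "h \<noteq> 0" shows "int N * \<delta> h = - p0 * ord_t (Sub H)"
proof -
  obtain f i where 1: "h = to_fract f * x_var powi i" "H = smult (fls_X_intpow (- i)) (embP f)"
    using assms as_fls_def by auto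
  have f: "f \<noteq> 0" using 1 assms by auto
  then have nz: "embP f \<noteq> 0" using embP_inj[of f 0] embP.zero by auto
  have X: "(fls_X_intpow (- i) :: complex fls) \<noteq> 0" by (simp add: fls_shift_eq0_iff)
  have A: "\<delta> h = \<delta> (to_fract f) + i * p0"
    unfolding 1 using f x_var_nz by (subst val_mult) (auto simp: delta_powi p0_def)
  have B: "ord_t (Sub H) = - (int N * i) + ord_t (Sub (embP f))"
    unfolding 1(2) Sub_smult using ord_t_mult[OF lft_cp_nz[OF X] Sub_nz[OF nz]] ord_t_lft_cp[OF X] by simp
  have "- p0 * ord_t (Sub H) = int N * (i * p0) + (- p0 * ord_t (Sub (embP f)))" unfolding B by (simp add: algebra_simps)
  moreover have "int N * \<delta> h = int N * (i * p0) + int N * \<delta> (to_fract f)" unfolding A by (simp add: algebra_simps)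
  ultimately show ?thesis using delta_poly[OF f] by simp
qed

definition G :: "nat \<Rightarrow> complex fls poly" where "G j = (SOME H. as_fls (g j) H)"

lemma as_fls_G: "j \<le> n + 1 \<Longrightarrow> as_fls (g j) (G j)"
  unfolding G_def using as_fls_ex[OF g_laurent] by (rule someI_ex)

definition al :: "nat \<Rightarrow> nat" where "al = key_alpha \<eta>"

lemma eta_p0: "\<eta> 0 = p0" by (simp add: eta g0 p0_def)

lemma al: assumes "j \<ge> 1"
  shows "al j > 0" "\<And>a c. 0 < a \<Longrightarrow> a < al j \<Longrightarrow> int a * \<eta> j \<noteq> (\<Sum>i<j. c i * \<eta> i)"
proof -
  let ?P = "\<lambda>a. a > 0 \<and> (\<exists>c::nat \<Rightarrow> int. int a * \<eta> j = (\<Sum>i<j. c i * \<eta> i))"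
  have a: "al j = (LEAST a. ?P a)" by (simp add: al_def key_alpha_def)
  have "(\<Sum>i<j. (if i = 0 then \<eta> j else 0) * \<eta> i) = (\<Sum>i\<in>{0}. (if i = 0 then \<eta> j else 0) * \<eta> i)"
    using assms by (intro sum.mono_neutral_right) auto
  then have "?P (nat p0)" using p0 eta_p0
    by (intro conjI exI[of _ "\<lambda>i. if i = 0 then \<eta> j else 0"]) auto
  then have "?P (al j)" unfolding a by (rule LeastI)
  then show "al j > 0" by blast
  fix a :: nat and c :: "nat \<Rightarrow> int" assume "0 < a" "a < al j"
  then show "int a * \<eta> j \<noteq> (\<Sum>i<j. c i * \<eta> i)" unfolding a using not_less_Least[of a ?P] by blast
qed

lemma g_powi: "i \<ge> 1 \<Longrightarrow> k \<ge> 0 \<Longrightarrow> g i powi k = g i ^ nat k"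
  by (simp add: power_int_def)

lemma prod_g: assumes "j \<in> {1..n}"
  shows "(\<Prod>i<j. g i powi \<beta> j i) = x_var powi \<beta> j 0 * (\<Prod>i\<in>{1..<j}. g i ^ nat (\<beta> j i))"
proof -
  have s: "{..<j} = insert 0 {1..<j}" using assms by auto
  have "(\<Prod>i\<in>{1..<j}. g i powi \<beta> j i) = (\<Prod>i\<in>{1..<j}. g i ^ nat (\<beta> j i))"
    using k_beta[OF assms] by (intro prod.cong) (auto simp: g_powi)
  then show ?thesis unfolding s by (simp add: g0)
qed

sublocale key_polys n \<eta> al \<beta> \<theta> G
proof
  show "\<eta> 0 > 0" using p0 eta_p0 by simp
  show "G 1 = [:0, 1:]" using as_fls_unique[OF as_fls_G[of 1]] as_fls_y g1 by simp
  fix j assume j: "j \<in> {1..n}"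
  show "al j > 0" using al(1)[of j] j by simp
  show "\<eta> (j + 1) < int (al j) * \<eta> j" using k_drop[OF j] by (simp add: al_def)
  show "int (al j) * \<eta> j = (\<Sum>i<j. \<beta> j i * \<eta> i)" using k_rel[OF j] by (simp add: al_def)
  show "\<theta> j \<noteq> 0" by (rule k_theta[OF j])
  show "0 \<le> \<beta> j i \<and> \<beta> j i < int (al i)" if "i \<in> {1..<j}" for i using k_beta[OF j that] by (simp add: al_def)
  have "as_fls (g (j + 1)) (G j ^ al j - [:fls_const (\<theta> j):] * ([:fls_X_intpow (- \<beta> j 0):] * (\<Prod>i\<in>{1..<j}. G i ^ nat (\<beta> j i))))"
    unfolding k_step[OF j] prod_g[OF j] al_def[symmetric]
    using j by (intro as_fls_add(2) as_fls_power as_fls_mult as_fls_prod as_fls_const as_fls_x_powi as_fls_G) auto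
  then show "G (j + 1) = G j ^ al j - smult (fls_const (\<theta> j) * fls_X_intpow (- \<beta> j 0)) (\<Prod>i\<in>{1..<j}. G i ^ nat (\<beta> j i))"
    using as_fls_unique[OF as_fls_G[of "j + 1"]] j by (simp add: mult.commute)
qed

lemma G_nz: "j \<in> {1..n+1} \<Longrightarrow> G j \<noteq> 0" using G_monic[of j] by auto
lemma g_nz: "j \<in> {1..n+1} \<Longrightarrow> g j \<noteq> 0" using G_nz[of j] as_fls_eq_0[OF as_fls_G[of j]] by auto

definition SubG :: "nat \<Rightarrow> complex poly fls" where "SubG j = Sub (G j)"

lemma SubG_nz: "j \<in> {1..n+1} \<Longrightarrow> SubG j \<noteq> 0" using Sub_nz[OF G_nz] by (simp add: SubG_def)

lemma ord_t_SubG: "j \<in> {1..n+1} \<Longrightarrow> p0 * ord_t (SubG j) = - (int N * \<eta> j)"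
  using delta_as_fls[OF as_fls_G g_nz, of j] by (simp add: SubG_def eta)

lemma ord_t_coef: "a \<noteq> 0 \<Longrightarrow> p0 * ord_t (lft (cp N a)) = - (int N * wt a)"
  using ord_t_lft_cp[of a] by (simp add: wt_def eta_p0)

lemma Sub_mon: assumes "j \<le> n + 1"
  shows "Sub (mon j m) \<noteq> 0" "p0 * ord_t (Sub (mon j m)) = - (int N * wtm j m)"
    "xi_deg (Sub (mon j m)) = (\<Sum>l\<in>{1..j}. m l * xi_deg (SubG l))"
proof -
  have S: "Sub (mon j m) = (\<Prod>l\<in>{1..j}. SubG l ^ m l)" by (simp add: mon_def Sub.prod Sub.power SubG_def)
  have nz: "SubG l ^ m l \<noteq> 0" if "l \<in> {1..j}" for l using SubG_nz[of l] that assms by auto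
  show "Sub (mon j m) \<noteq> 0" unfolding S using nz by simp
  have "ord_t (Sub (mon j m)) = (\<Sum>l\<in>{1..j}. int (m l) * ord_t (SubG l))"
    unfolding S using nz SubG_nz assms by (subst ord_t_prod) (auto intro!: sum.cong simp: ord_t_power)
  then have "p0 * ord_t (Sub (mon j m)) = (\<Sum>l\<in>{1..j}. int (m l) * (p0 * ord_t (SubG l)))"
    by (simp add: sum_distrib_left mult_ac)
  also have "\<dots> = (\<Sum>l\<in>{1..j}. - (int N * (int (m l) * \<eta> l)))"
    using ord_t_SubG assms by (intro sum.cong) (auto simp: mult_ac)
  finally show "p0 * ord_t (Sub (mon j m)) = - (int N * wtm j m)"
    by (simp add: wtm_def sum_distrib_left sum_negf)
  show "xi_deg (Sub (mon j m)) = (\<Sum>l\<in>{1..j}. m l * xi_deg (SubG l))"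
    unfolding S using nz SubG_nz assms by (subst xi_deg_prod) (auto intro!: sum.cong simp: xi_deg_power)
qed

lemma Sub_term: assumes "a \<noteq> 0" "j \<le> n + 1"
  shows "Sub (smult a (mon j m)) \<noteq> 0" "p0 * ord_t (Sub (smult a (mon j m))) = - (int N * (wt a + wtm j m))"
    "xi_deg (Sub (smult a (mon j m))) = (\<Sum>l\<in>{1..j}. m l * xi_deg (SubG l))"
  unfolding Sub_smult using Sub_mon[OF assms(2)] lft_cp_nz[OF assms(1)] ord_t_coef[OF assms(1)]
  by (auto simp: ord_t_mult xi_deg_mult xi_deg_lft_cp algebra_simps)

text \<open>
  Both \<open>G j ^ \<alpha> j\<close> and the tail have smaller order than their difference
  \<open>G (j + 1)\<close>, so their lowest coefficients coincide; by induction that of the tail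
  is free of \<open>\<xi>\<close>.
\<close>

lemma xi_deg_SubG_0: "j \<in> {1..n} \<Longrightarrow> xi_deg (SubG j) = 0"
proof (induction j rule: less_induct)
  case (less j)
  let ?m = "\<lambda>i. if i < j then nat (\<beta> j i) else 0"
  let ?S = "Sub (smult (tail_coeff j) (mon j ?m))"
  have jn: "j \<le> n + 1" using less.prems by auto
  have tz: "tail_coeff j \<noteq> 0" using tail_coeff[OF less.prems] by blast
  have "SubG j ^ al j = SubG (j + 1) + ?S"
    using step'[OF less.prems] mon_below[of j j "\<lambda>i. nat (\<beta> j i)"]
    by (simp add: SubG_def Sub.add[symmetric] Sub.power[symmetric])
  then have S: "?S = SubG j ^ al j - SubG (j + 1)" by simp
  have Anz: "SubG j \<noteq> 0" "SubG (j + 1) \<noteq> 0" using SubG_nz less.prems by auto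
  have "p0 * ord_t (SubG j ^ al j) < p0 * ord_t (SubG (j + 1))"
  proof -
    have "p0 * ord_t (SubG j ^ al j) = - (int N * (int (al j) * \<eta> j))"
      using arg_cong[OF ord_t_SubG[of j], of "\<lambda>x. int (al j) * x"] less.prems Anz by (simp add: ord_t_power mult_ac)
    moreover have "p0 * ord_t (SubG (j + 1)) = - (int N * \<eta> (j + 1))" using ord_t_SubG[of "j + 1"] less.prems by simp
    ultimately show ?thesis using drop[OF less.prems] N by simp
  qed
  then have lt: "fls_subdegree (SubG j ^ al j) < fls_subdegree (SubG (j + 1))" using p0 by (simp add: ord_t_def)
  have sd: "fls_subdegree ?S = fls_subdegree (SubG j ^ al j)"
    unfolding S using Anz lt by (intro fls_subdegree_diff_eq1) auto
  have "xi_deg ?S = xi_deg (SubG j ^ al j)" unfolding xi_deg_def sd using lt by (simp add: S)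
  moreover have "xi_deg ?S = 0"
  proof -
    have "(\<Sum>l\<in>{1..j}. ?m l * xi_deg (SubG l)) = 0" using less by (intro sum.neutral) auto
    then show ?thesis using Sub_term(3)[OF tz jn] by simp
  qed
  ultimately have "al j * xi_deg (SubG j) = 0" using Anz by (simp add: xi_deg_power)
  then show ?case using alpha_pos[OF less.prems] by simp
qed

abbreviation "last_index \<equiv> n + 1"

text \<open>
  At the highest place \<open>l \<le> n\<close> where the digits differ, equality of weights would
  put a multiple of \<open>\<eta> l\<close> by less than \<open>\<alpha> l\<close> into the group
  generated by \<open>\<eta> 0, \<dots>, \<eta> (l - 1)\<close>.
\<close>

lemma digits_determined:
  assumes eq: "wt a + W last_index k = wt b + W last_index k'" and t: "dig last_index k last_index = dig last_index k' last_index"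
  shows "k = k'"
proof (rule ccontr)
  assume "k \<noteq> k'"
  let ?d = "\<lambda>l. int (dig last_index k l) - int (dig last_index k' l)"
  have ex: "\<exists>l\<in>{1..n}. ?d l \<noteq> 0"
  proof (rule ccontr)
    assume "\<not> ?thesis"
    then have "dig last_index k l = dig last_index k' l" if "l \<in> {1..last_index}" for l using that t by (cases "l = last_index") auto
    then have "(\<Sum>l\<in>{1..last_index}. dig last_index k l * D l) = (\<Sum>l\<in>{1..last_index}. dig last_index k' l * D l)" by (intro sum.cong) auto
    then show False using dig_sum[of last_index k] dig_sum[of last_index k'] \<open>k \<noteq> k'\<close> by simp
  qed
  define l where "l = Max {l\<in>{1..n}. ?d l \<noteq> 0}"
  have "l \<in> {l\<in>{1..n}. ?d l \<noteq> 0}" unfolding l_def by (rule Max_in) (use ex in auto)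
  then have l: "l \<in> {1..n}" "?d l \<noteq> 0" by auto
  have lmax: "?d i = 0" if "i \<in> {1..n}" "i > l" for i
  proof (rule ccontr)
    assume "?d i \<noteq> 0"
    then have "i \<le> l" unfolding l_def using that by (intro Max_ge) auto
    then show False using that by simp
  qed
  have "W last_index k - W last_index k' = (\<Sum>i\<in>{1..last_index}. ?d i * \<eta> i)"
    by (simp add: W_def wtm_def sum_subtractf algebra_simps)
  also have "\<dots> = (\<Sum>i\<in>{1..l}. ?d i * \<eta> i)"
  proof (rule sum.mono_neutral_right)
    show "\<forall>i\<in>{1..last_index} - {1..l}. ?d i * \<eta> i = 0"
    proof
      fix i assume i: "i \<in> {1..last_index} - {1..l}"
      then have "?d i = 0" using lmax[of i] t by (cases "i = last_index") auto
      then show "?d i * \<eta> i = 0" by simp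
    qed
  qed (use l in auto)
  also have "\<dots> = ?d l * \<eta> l + (\<Sum>i\<in>{1..<l}. ?d i * \<eta> i)"
    using l by (simp add: atLeastLessThanSuc_atLeastAtMost[symmetric] del: of_nat_diff)
  finally have key: "?d l * \<eta> l = (fls_subdegree a - fls_subdegree b) * \<eta> 0 - (\<Sum>i\<in>{1..<l}. ?d i * \<eta> i)"
    using eq by (simp add: wt_def algebra_simps)
  have sp: "(\<Sum>i<l. c i * \<eta> i) = c 0 * \<eta> 0 + (\<Sum>i\<in>{1..<l}. c i * \<eta> i)" for c :: "nat \<Rightarrow> int"
  proof -
    have "{..<l} = insert 0 {1..<l}" using l by auto
    then show ?thesis by simp
  qed
  have dl: "dig last_index k l < al l" "dig last_index k' l < al l" using dig_less[of last_index l] l by auto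
  (* The sign turns the difference of the digits at place l into a positive multiple below
     \<alpha> l. *)
  define sg where "sg = (if ?d l > 0 then 1 else - 1 :: int)"
  define c where "c = (\<lambda>i. if i = 0 then sg * (fls_subdegree a - fls_subdegree b) else - (sg * ?d i))"
  have "(\<Sum>i<l. c i * \<eta> i) = sg * (fls_subdegree a - fls_subdegree b) * \<eta> 0 - sg * (\<Sum>i\<in>{1..<l}. ?d i * \<eta> i)"
    unfolding sp by (simp add: c_def sum_distrib_left sum_negf mult_ac)
  also have "\<dots> = sg * (?d l * \<eta> l)" unfolding key by (simp add: algebra_simps)
  also have "\<dots> = int (nat \<bar>?d l\<bar>) * \<eta> l" using l(2) by (auto simp: sg_def)
  finally have "int (nat \<bar>?d l\<bar>) * \<eta> l = (\<Sum>i<l. c i * \<eta> i)" by simp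
  moreover have "0 < nat \<bar>?d l\<bar>" "nat \<bar>?d l\<bar> < al l" using dl l(2) by auto
  ultimately show False using al(2)[of l "nat \<bar>?d l\<bar>" c] l by auto
qed

interpretation mbt: monic_basis "B last_index" by (rule B_basis) auto

lemma xi_deg_B: "(\<Sum>l\<in>{1..last_index}. dig last_index k l * xi_deg (SubG l)) = dig last_index k last_index * xi_deg (SubG last_index)"
proof -
  have "(\<Sum>l\<in>{1..last_index}. dig last_index k l * xi_deg (SubG l)) = (\<Sum>l\<in>{last_index}. dig last_index k l * xi_deg (SubG l))"
    using xi_deg_SubG_0 by (intro sum.mono_neutral_right) auto
  then show ?thesis by simp
qed

text \<open>
  The pair (order, \<open>\<xi>\<close>-degree) of a standard term determines its weight and, if
  the last key form has positive \<open>\<xi>\<close>-degree, its last digit, hence the term; in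
  degrees below that of the last key form the last digit is \<open>0\<close>. So nothing cancels,
  and the invariants of a sum are those of one of its terms.
\<close>

lemma standard_sum:
  assumes H: "H \<noteq> 0" and c: "xi_deg (SubG last_index) \<noteq> 0 \<or> degree H < D last_index"
  shows "weight_le last_index d H \<longleftrightarrow> - (int N * d) \<le> p0 * ord_t (Sub H)"
    "\<exists>k\<le>degree H. xi_deg (Sub H) = dig last_index k last_index * xi_deg (SubG last_index)"
proof -
  define S where "S = {k. k \<le> degree H \<and> bc last_index H k \<noteq> 0}"
  define T where "T = (\<lambda>k. Sub (smult (bc last_index H k) (B last_index k)))"
  have fin: "finite S" by (simp add: S_def)
  have HS: "H = (\<Sum>k\<in>S. smult (bc last_index H k) (B last_index k))"
  proof -
    have "H = (\<Sum>k\<le>degree H. smult (bc last_index H k) (B last_index k))" by (rule mbt.sum_bcoef) simp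
    also have "\<dots> = (\<Sum>k\<in>S. smult (bc last_index H k) (B last_index k))"
      by (rule sum.mono_neutral_right) (auto simp: S_def)
    finally show ?thesis .
  qed
  have ne: "S \<noteq> {}" using HS H by (metis sum.empty)
  have SubH: "Sub H = (\<Sum>k\<in>S. T k)" by (subst HS) (simp add: Sub.sum T_def)
  have T: "T k \<noteq> 0" "p0 * ord_t (T k) = - (int N * (wt (bc last_index H k) + W last_index k))"
    "xi_deg (T k) = dig last_index k last_index * xi_deg (SubG last_index)" if "k \<in> S" for k
    using Sub_term[of "bc last_index H k" last_index "dig last_index k"] that xi_deg_B[of k]
    by (auto simp: T_def S_def B_def W_def)
  have main: "Sub H \<noteq> 0 \<and> (\<exists>i\<in>S. ord_t (Sub H) = ord_t (T i) \<and> xi_deg (Sub H) = xi_deg (T i)) \<and>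
    (\<forall>i\<in>S. ord_t (Sub H) \<le> ord_t (T i))"
    unfolding SubH
  proof (rule ord_t_xi_deg_sum[OF fin ne])
    fix i j assume ij: "i \<in> S" "j \<in> S" "ord_t (T i) = ord_t (T j)" "xi_deg (T i) = xi_deg (T j)"
    have "int N * (wt (bc last_index H i) + W last_index i) = int N * (wt (bc last_index H j) + W last_index j)"
      using T(2)[OF ij(1)] T(2)[OF ij(2)] unfolding ij(3) by linarith
    then have w: "wt (bc last_index H i) + W last_index i = wt (bc last_index H j) + W last_index j" using N by simp
    have "dig last_index i last_index = dig last_index j last_index"
    proof (cases "xi_deg (SubG last_index) = 0")
      case False
      then show ?thesis using T(3) ij by simp
    next
      case True
      then have "i < D last_index" "j < D last_index" using c ij by (auto simp: S_def)
      then show ?thesis by (simp add: dig_def)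
    qed
    with w show "i = j" by (rule digits_determined)
  qed (use T in auto)
  have "weight_le last_index d H \<longleftrightarrow> (\<forall>k\<in>S. wt (bc last_index H k) + W last_index k \<le> d)"
    unfolding weight_le_def S_def using mbt.bcoef_gt_degree[of H] by (auto simp: not_le) (metis not_le)
  also have "\<dots> \<longleftrightarrow> (\<forall>k\<in>S. - (int N * d) \<le> p0 * ord_t (T k))"
    using T(2) N by (intro ball_cong) auto
  also have "\<dots> \<longleftrightarrow> - (int N * d) \<le> p0 * ord_t (Sub H)"
  proof
    assume "\<forall>k\<in>S. - (int N * d) \<le> p0 * ord_t (T k)"
    then show "- (int N * d) \<le> p0 * ord_t (Sub H)" using main by metis
  next
    assume *: "- (int N * d) \<le> p0 * ord_t (Sub H)"
    show "\<forall>k\<in>S. - (int N * d) \<le> p0 * ord_t (T k)"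
    proof
      fix k assume "k \<in> S"
      then have "p0 * ord_t (Sub H) \<le> p0 * ord_t (T k)" using main p0 by (intro mult_left_mono) auto
      then show "- (int N * d) \<le> p0 * ord_t (T k)" using * by simp
    qed
  qed
  finally show "weight_le last_index d H \<longleftrightarrow> - (int N * d) \<le> p0 * ord_t (Sub H)" .
  obtain i where "i \<in> S" "xi_deg (Sub H) = xi_deg (T i)" using main by blast
  then show "\<exists>k\<le>degree H. xi_deg (Sub H) = dig last_index k last_index * xi_deg (SubG last_index)"
    using T(3)[of i] by (auto simp: S_def)
qed

lemma xi_deg_small_degree: assumes "Q \<noteq> 0" "degree Q < D last_index" shows "xi_deg (Sub Q) = 0"
proof -
  obtain k where "k \<le> degree Q" "xi_deg (Sub Q) = dig last_index k last_index * xi_deg (SubG last_index)"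
    using standard_sum(2)[of Q] assms by auto
  then show ?thesis using assms by (simp add: dig_def)
qed

text \<open>
  Suppose all key forms have \<open>\<xi>\<close>-degree \<open>0\<close>. By (P3) every
  \<open>h\<close> is a sum of monomials in the key forms of weight at most
  \<open>\<delta>(h)\<close>, that is, of order at least that of \<open>h\<close>. Then the lowest
  coefficient of \<open>h\<close> is free of \<open>\<xi>\<close>, contradicting
  \<open>exists_nonconstant\<close>.
\<close>

lemma xi_deg_SubG_top: "xi_deg (SubG last_index) \<noteq> 0"
proof
  assume 0: "xi_deg (SubG last_index) = 0"
  obtain Q M where Q: "xi_deg (Sub Q) \<noteq> 0" "\<And>i k. k > M \<Longrightarrow> fls_nth (coeff Q i) k = 0"
    using exists_nonconstant phi by (metis not_less)
  obtain h where h: "as_fls h Q" using as_fls_of_bounded[OF Q(2)] by blast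
  have Qnz: "Q \<noteq> 0" using Q(1) by (auto simp: Sub.zero xi_deg_def)
  have hz: "h \<noteq> 0" using as_fls_eq_0[OF h] Qnz by simp
  obtain Z where Z: "Z \<in> zpolys last_index" "zpoly_eval g Z = h" "weighted_degree \<eta> Z = \<delta> h"
    using k_min[OF as_fls_laurent[OF h] hz] by auto
  define t where "t = (\<lambda>(i, m). smult (fls_const (Poly_Mapping.lookup Z (i, m)) * fls_X_intpow (- i))
     (mon last_index (Poly_Mapping.lookup m)))"
  have sub: "Poly_Mapping.keys m \<subseteq> {1..last_index}" if "(i, m) \<in> Poly_Mapping.keys Z" for i m
    using Z(1) that by (auto simp: zpolys_def)
  have mt: "mon last_index (Poly_Mapping.lookup m) = (\<Prod>j\<in>Poly_Mapping.keys m. G j ^ Poly_Mapping.lookup m j)"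
    if "(i, m) \<in> Poly_Mapping.keys Z" for i m
    unfolding mon_def using sub[OF that] by (intro prod.mono_neutral_right) (auto simp: in_keys_iff)
  have wm: "wtm last_index (Poly_Mapping.lookup m) = (\<Sum>j\<in>Poly_Mapping.keys m. int (Poly_Mapping.lookup m j) * \<eta> j)"
    if "(i, m) \<in> Poly_Mapping.keys Z" for i m
    unfolding wtm_def using sub[OF that] by (intro sum.mono_neutral_right) (auto simp: in_keys_iff)
  have "as_fls h (\<Sum>x\<in>Poly_Mapping.keys Z. t x)"
    unfolding Z(2)[symmetric] zpoly_eval_def
  proof (rule as_fls_sum)
    fix x assume x: "x \<in> Poly_Mapping.keys Z"
    obtain i m where im: "x = (i, m)" by (cases x)
    have "as_fls (const (Poly_Mapping.lookup Z (i, m)) * x_var powi i * (\<Prod>j\<in>Poly_Mapping.keys m. g j ^ Poly_Mapping.lookup m j))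
      ([:fls_const (Poly_Mapping.lookup Z (i, m)):] * [:fls_X_intpow (- i):] * (\<Prod>j\<in>Poly_Mapping.keys m. G j ^ Poly_Mapping.lookup m j))"
      using sub[of i m] x im by (intro as_fls_mult as_fls_const as_fls_x_powi as_fls_prod as_fls_power as_fls_G) auto
    also have "[:fls_const (Poly_Mapping.lookup Z (i, m)):] * [:fls_X_intpow (- i):] * (\<Prod>j\<in>Poly_Mapping.keys m. G j ^ Poly_Mapping.lookup m j) = t x"
      using mt[of i m] x im by (simp add: t_def mult.commute)
    finally show "as_fls (case x of (i, m) \<Rightarrow> const (Poly_Mapping.lookup Z (i, m)) * x_var powi i *
        (\<Prod>j\<in>Poly_Mapping.keys m. g j ^ Poly_Mapping.lookup m j)) (t x)" by (simp add: im)
  qed simp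
  then have QZ: "Q = (\<Sum>x\<in>Poly_Mapping.keys Z. t x)" using as_fls_unique[OF h] by blast
  let ?v = "fls_subdegree (Sub Q)"
  have small: "degree (fls_nth (Sub (t x)) ?v) \<le> 0" if x: "x \<in> Poly_Mapping.keys Z" for x
  proof -
    obtain i m where im: "x = (i, m)" by (cases x)
    let ?a = "fls_const (Poly_Mapping.lookup Z (i, m)) * fls_X_intpow (- i) :: complex fls"
    have c: "Poly_Mapping.lookup Z (i, m) \<noteq> 0" using x im by (simp add: in_keys_iff)
    have X: "(fls_X_intpow (- i) :: complex fls) \<noteq> 0" by (simp add: fls_shift_eq0_iff)
    have a: "?a \<noteq> 0" using c X by simp
    have wa: "wt ?a = i * \<eta> 0"
      using c X unfolding wt_def by (subst fls_subdegree_mult) auto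
    have "wt ?a + wtm last_index (Poly_Mapping.lookup m) \<le> \<delta> h"
      unfolding Z(3)[symmetric] weighted_degree_def wa wm[OF x[unfolded im]]
      by (rule Max_ge) (use x im in force)+
    then have "int N * (wt ?a + wtm last_index (Poly_Mapping.lookup m)) \<le> int N * \<delta> h" by (intro mult_left_mono) auto
    then have "p0 * ord_t (Sub Q) \<le> p0 * ord_t (Sub (t x))"
      using Sub_term(2)[OF a order_refl, of "Poly_Mapping.lookup m"] delta_as_fls[OF h hz] by (simp add: t_def im)
    then have le: "?v \<le> fls_subdegree (Sub (t x))" using p0 by (simp add: ord_t_def)
    have "xi_deg (Sub (t x)) = (\<Sum>l\<in>{1..last_index}. Poly_Mapping.lookup m l * xi_deg (SubG l))"
      using Sub_term(3)[OF a order_refl, of "Poly_Mapping.lookup m"] by (simp add: t_def im)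
    also have "\<dots> = 0"
    proof (rule sum.neutral, rule ballI)
      fix l assume "l \<in> {1..last_index}"
      then show "Poly_Mapping.lookup m l * xi_deg (SubG l) = 0" using xi_deg_SubG_0[of l] 0 by (cases "l = last_index") auto
    qed
    finally have "xi_deg (Sub (t x)) = 0" .
    then show ?thesis using le by (cases "?v = fls_subdegree (Sub (t x))") (auto simp: xi_deg_def)
  qed
  have "fls_nth (Sub Q) ?v = (\<Sum>x\<in>Poly_Mapping.keys Z. fls_nth (Sub (t x)) ?v)"
    by (subst QZ) (simp add: Sub.sum fls_nth_sum)
  also have "degree \<dots> \<le> 0" by (rule degree_sum_le) (use small in auto)
  finally show False using Q(1) by (simp add: xi_deg_def)
qed

lemma degree_G_top: "degree (G last_index) = D last_index" "lead_coeff (G last_index) = 1" using G_monic[of last_index] by auto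

lemma roots_of_last_key:
  assumes "finite J" "Up N (G last_index) = (\<Prod>i\<in>J. [:- Y i, 1:])" "i \<in> J"
  shows "conj_close (Y i)"
  using assms xi_deg_SubG_top xi_deg_small_degree degree_G_top by (intro all_roots_conj_close[of J "G last_index" Y]) (auto simp: SubG_def)

lemma card_split: "finite I \<Longrightarrow> Up N H = (\<Prod>i\<in>I. [:- Y i, 1:]) \<Longrightarrow> card I = degree H"
  using degree_Up[OF N, of H] by (simp add: degree_prod_eq_sum_degree)

text \<open>
  Both \<open>f\<close> and the last key form have only roots conjugate to close ones, so their
  orders and their \<open>\<xi>\<close>-degrees are in the ratio of their degrees. By
  \<open>standard_sum\<close> the \<open>\<xi>\<close>-degree of \<open>f\<close> is a multiple of
  that of the last key form, so the ratio is an integer \<open>E\<close>.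
\<close>

theorem key_forms_polynomial:
  assumes I: "finite I" "Up N (embP f) = (\<Prod>i\<in>I. [:- Y i, 1:])" "\<And>i. i \<in> I \<Longrightarrow> conj_close (Y i)"
    and J: "finite J" "Up N (G last_index) = (\<Prod>i\<in>J. [:- Z i, 1:])"
    and f: "lead_coeff f = 1" "degree f > 0"
  shows "\<forall>j\<le>n + 1. g j \<in> poly_ring"
proof -
  let ?H = "embP f" and ?d = "degree f"
  have H: "?H \<noteq> 0" "degree ?H = ?d" "lead_coeff ?H = 1" using f degree_embP[of f] by (auto simp: coeff_embP emb.one)
  have cI: "card I = ?d" "card J = D last_index" using card_split[OF I(1,2)] card_split[OF J] H degree_G_top by auto
  have aI: "int N * ord_t (Sub ?H) = int ?d * kappa" "N * xi_deg (Sub ?H) = ?d * kappa'"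
    using average[OF I] cI by auto
  have aJ: "int N * ord_t (SubG last_index) = int (D last_index) * kappa" "N * xi_deg (SubG last_index) = D last_index * kappa'"
    using average[OF J roots_of_last_key[OF J]] cI by (auto simp: SubG_def)
  obtain k where k: "xi_deg (Sub ?H) = dig last_index k last_index * xi_deg (SubG last_index)"
    using standard_sum(2)[OF H(1)] xi_deg_SubG_top by auto
  define E where "E = dig last_index k last_index"
  have kp: "kappa' > 0" using aJ(2) xi_deg_SubG_top N by (metis gr0I mult_0_right mult_eq_0_iff neq0_conv)
  have "N * xi_deg (Sub ?H) = E * (N * xi_deg (SubG last_index))" unfolding k by (simp add: E_def mult_ac)
  then have "?d * kappa' = E * (D last_index * kappa')" unfolding aI(2) aJ(2) .
  then have d: "?d = E * D last_index" using kp by simp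
  then have E: "E > 0" using f(2) by (cases E) auto
  have "int N * ord_t (Sub ?H) = int N * (int E * ord_t (SubG last_index))"
    using aI(1) aJ(1) d by (simp add: mult_ac)
  then have "ord_t (Sub ?H) = int E * ord_t (SubG last_index)" using N by simp
  then have "p0 * ord_t (Sub ?H) = - (int N * (int E * \<eta> last_index))" using ord_t_SubG[of last_index] by (simp add: mult_ac)
  then have "weight_le last_index (int E * \<eta> last_index) ?H" using standard_sum(1)[OF H(1)] xi_deg_SubG_top by simp
  then have b: "\<beta> j 0 \<ge> 0" if "j \<in> {1..n}" for j
    using nonneg_exponents[OF E H(3) _ pnpos_embP] H d that by simp
  have pr: "p * q \<in> poly_ring" "p - q \<in> poly_ring" if "p \<in> poly_ring" "q \<in> poly_ring" for p q
  proof -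
    obtain a b where "p = to_fract a" "q = to_fract b" using \<open>p \<in> poly_ring\<close> \<open>q \<in> poly_ring\<close> by (auto simp: poly_ring_def)
    then have "p * q = to_fract (a * b)" "p - q = to_fract (a - b)" by simp_all
    then show "p * q \<in> poly_ring" "p - q \<in> poly_ring" unfolding poly_ring_def by blast+
  qed
  have one: "1 \<in> poly_ring" unfolding poly_ring_def using to_fract_1 by (metis rangeI)
  have pw: "p ^ k \<in> poly_ring" if "p \<in> poly_ring" for p k by (induction k) (auto simp: one pr that)
  have x: "x_var \<in> poly_ring" by (simp add: x_var_def poly_ring_def)
  have pp: "(\<Prod>i\<in>S. h i) \<in> poly_ring" if "finite S" "\<And>i. i \<in> S \<Longrightarrow> h i \<in> poly_ring" for S and h :: "nat \<Rightarrow> ratfun"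
    using that by (induction S rule: finite_induct) (auto simp: one pr)
  have "g j \<in> poly_ring" if "j \<le> n + 1" for j
    using that
  proof (induction j rule: less_induct)
    case (less j)
    consider "j = 0" | "j = 1" | i where "j = i + 1" "i \<in> {1..n}"
      using less.prems by (cases j) (auto, fastforce)
    then show ?case
    proof cases
      case 1 then show ?thesis using g0 x by simp
    next
      case 2 then show ?thesis using g1 by (simp add: y_var_def poly_ring_def)
    next
      case 3
      have "x_var powi \<beta> i 0 = x_var ^ nat (\<beta> i 0)" using b[OF 3(2)] by (simp add: power_int_def)
      then show ?thesis unfolding 3(1) k_step[OF 3(2)] prod_g[OF 3(2)]
        using less 3 by (auto intro!: pr pw pp x simp: const_def) (simp_all add: poly_ring_def)
    qed
  qed
  then show ?thesis by blast
qed

end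

section \<open>The covering formed by the roots of a family of polynomials\<close>

lemma poly_eq_prod_roots:
  fixes p :: "'a::idom poly"
  assumes Z: "finite Z" "\<And>z. z \<in> Z \<Longrightarrow> poly p z = 0" "card Z = degree p"
  shows "p = smult (lead_coeff p) (\<Prod>z\<in>Z. [:- z, 1:])"
proof (rule ccontr)
  let ?q = "smult (lead_coeff p) (\<Prod>z\<in>Z. [:- z, 1:])"
  let ?d = "degree p"
  assume ne: "p \<noteq> ?q"
  have dp: "degree (\<Prod>z\<in>Z. [:- z, 1:]) = ?d" using Z by (simp add: degree_prod_eq_sum_degree)
  have dq: "degree ?q \<le> ?d" using degree_smult_le[of "lead_coeff p" "\<Prod>z\<in>Z. [:- z, 1:]"] dp by simp
  have "lead_coeff (\<Prod>z\<in>Z. [:- z, 1:]) = 1" by (simp add: lead_coeff_prod)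
  then have "coeff ?q ?d = lead_coeff p" using dp by simp
  then have c: "coeff (p - ?q) ?d = 0" by simp
  have nz: "p - ?q \<noteq> 0" using ne by simp
  have "degree (p - ?q) \<le> ?d" using dq by (rule degree_diff_le[OF order_refl])
  then have lt: "degree (p - ?q) < ?d"
    using c nz by (metis le_neq_implies_less leading_coeff_0_iff)
  have "poly (p - ?q) z = 0" if "z \<in> Z" for z using Z that by (auto simp: poly_prod)
  then have "Z \<subseteq> {z. poly (p - ?q) z = 0}" by auto
  then have "card Z \<le> card {z. poly (p - ?q) z = 0}" by (intro card_mono poly_roots_finite nz)
  also have "\<dots> \<le> degree (p - ?q)" by (rule card_poly_roots_bound[OF nz])
  finally show False using lt Z by simp
qed

text \<open>
  The value of a monic polynomial at \<open>y0\<close> is the product of the distances to its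
  roots.
\<close>

lemma monic_root_near:
  fixes p :: "complex poly"
  assumes m: "lead_coeff p = 1" and c: "card {y. poly p y = 0} = degree p"
    and s: "norm (poly p y0) < e ^ degree p" "e > 0"
  shows "\<exists>y. poly p y = 0 \<and> norm (y0 - y) < e"
proof (rule ccontr)
  assume *: "\<not> ?thesis"
  let ?Z = "{y. poly p y = 0}"
  have "p \<noteq> 0" using m by auto
  then have fin: "finite ?Z" by (rule poly_roots_finite)
  have "p = smult (lead_coeff p) (\<Prod>z\<in>?Z. [:- z, 1:])" using fin c by (intro poly_eq_prod_roots) auto
  then have "poly p y0 = poly (\<Prod>z\<in>?Z. [:- z, 1:]) y0" using m by (metis smult_1_left)
  then have "norm (poly p y0) = (\<Prod>z\<in>?Z. norm (y0 - z))" by (simp add: poly_prod prod_norm)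
  also have "\<dots> \<ge> (\<Prod>z\<in>?Z. e)" using * s(2) by (intro prod_mono) (auto simp: not_less)
  finally show False using s(1) c by simp
qed

lemma monic_root_bound:
  fixes p :: "complex poly"
  assumes m: "lead_coeff p = 1" and r: "poly p y = 0" and d: "degree p > 0"
  shows "norm y \<le> 1 + (\<Sum>i<degree p. norm (coeff p i))"
proof (cases "norm y \<le> 1")
  case True
  have "0 \<le> (\<Sum>i<degree p. norm (coeff p i))" by (intro sum_nonneg) auto
  then show ?thesis using True by linarith
next
  case False
  let ?d = "degree p"
  obtain k where k: "?d = Suc k" using d by (cases ?d) auto
  have "0 = (\<Sum>i\<le>?d. coeff p i * y ^ i)" using r by (simp add: poly_altdef)
  also have "\<dots> = y ^ ?d + (\<Sum>i<?d. coeff p i * y ^ i)" using m by (simp add: lessThan_Suc_atMost[symmetric])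
  finally have "y ^ ?d = - (\<Sum>i<?d. coeff p i * y ^ i)" by (simp add: eq_neg_iff_add_eq_0)
  then have "norm y ^ ?d = norm (\<Sum>i<?d. coeff p i * y ^ i)" by (metis norm_minus_cancel norm_power)
  also have "\<dots> \<le> (\<Sum>i<?d. norm (coeff p i) * norm y ^ k)"
  proof (rule order_trans[OF norm_sum], rule sum_mono)
    fix i assume "i \<in> {..<?d}"
    then have "norm y ^ i \<le> norm y ^ k" using False k by (intro power_increasing) auto
    then show "norm (coeff p i * y ^ i) \<le> norm (coeff p i) * norm y ^ k"
      by (simp add: norm_mult norm_power mult_left_mono)
  qed
  also have "\<dots> = (\<Sum>i<?d. norm (coeff p i)) * norm y ^ k" by (simp add: sum_distrib_right)
  finally have "norm y * norm y ^ k \<le> (\<Sum>i<?d. norm (coeff p i)) * norm y ^ k" by (simp add: k)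
  moreover have "norm y ^ k > 0" using False by (intro zero_less_power) linarith
  ultimately have "norm y \<le> (\<Sum>i<?d. norm (coeff p i))" by (simp only: mult_le_cancel_right_pos)
  then show ?thesis by simp
qed

text \<open>
  A holomorphic family of monic polynomials with simple roots over a convex open set.
\<close>

locale root_cover =
  fixes P :: "complex \<Rightarrow> complex poly" and d :: nat and H :: "complex set"
  assumes openH: "open H" and convH: "convex H"
    and deg: "\<And>w. w \<in> H \<Longrightarrow> degree (P w) = d" and lead: "\<And>w. w \<in> H \<Longrightarrow> coeff (P w) d = 1"
    and card_roots: "\<And>w. w \<in> H \<Longrightarrow> card {y. poly (P w) y = 0} = d" and dpos: "d > 0"
    and hol: "\<And>i. (\<lambda>w. coeff (P w) i) holomorphic_on H"
begin

abbreviation "Z w \<equiv> {y. poly (P w) y = 0}"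

lemma fin_Z: "w \<in> H \<Longrightarrow> finite (Z w)" using lead[of w] by (intro poly_roots_finite) auto

lemma cont_poly: "continuous_on H (\<lambda>w. poly (P w) y)"
proof -
  have "continuous_on H (\<lambda>w. \<Sum>i\<le>d. coeff (P w) i * y ^ i)"
    by (intro continuous_intros holomorphic_on_imp_continuous_on hol)
  moreover have "poly (P w) y = (\<Sum>i\<le>d. coeff (P w) i * y ^ i)" if "w \<in> H" for w
    using deg[OF that] by (simp add: poly_altdef)
  ultimately show ?thesis by (subst continuous_on_cong) auto
qed

lemma root_near: "w \<in> H \<Longrightarrow> norm (poly (P w) y) < e ^ d \<Longrightarrow> e > 0 \<Longrightarrow> \<exists>x\<in>Z w. norm (y - x) < e"
  using monic_root_near[of "P w" y e] deg[of w] lead[of w] card_roots[of w] by auto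

lemma near_roots:
  assumes w0: "w0 \<in> H" and e: "e > 0"
  shows "\<exists>\<rho>>0. ball w0 \<rho> \<subseteq> H \<and> (\<forall>w\<in>ball w0 \<rho>. \<forall>z\<in>Z w0. \<exists>x\<in>Z w. norm (z - x) < e)"
proof -
  have "\<forall>\<^sub>F w in at w0. norm (poly (P w) z) < e ^ d" if "z \<in> Z w0" for z
  proof -
    have "((\<lambda>w. poly (P w) z) \<longlongrightarrow> poly (P w0) z) (at w0)"
      using cont_poly w0 openH by (metis continuous_on_eq_continuous_at isContD)
    then have "((\<lambda>w. norm (poly (P w) z)) \<longlongrightarrow> 0) (at w0)"
      using that tendsto_norm_zero by simp
    then show ?thesis by (rule order_tendstoD) (use e in simp)
  qed
  then have "\<forall>\<^sub>F w in at w0. \<forall>z\<in>Z w0. norm (poly (P w) z) < e ^ d"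
    by (intro eventually_ball_finite fin_Z[OF w0]) blast
  then obtain r1 where r1: "r1 > 0" "\<And>w. w \<noteq> w0 \<Longrightarrow> dist w w0 < r1 \<Longrightarrow> \<forall>z\<in>Z w0. norm (poly (P w) z) < e ^ d"
    unfolding eventually_at by auto
  obtain r2 where r2: "r2 > 0" "ball w0 r2 \<subseteq> H" using openH w0 by (meson openE)
  have "\<exists>x\<in>Z w. norm (z - x) < e" if w: "w \<in> ball w0 (min r1 r2)" and z: "z \<in> Z w0" for w z
  proof (cases "w = w0")
    case True then show ?thesis using z e by (intro bexI[of _ z]) auto
  next
    case False
    then show ?thesis using r1(2)[OF False] w z r2(2) e
      by (intro root_near) (auto simp: dist_commute subset_iff)
  qed
  then show ?thesis using r1(1) r2 by (intro exI[of _ "min r1 r2"]) auto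
qed

text \<open>
  Near \<open>w0\<close> each of the small discs around the roots at \<open>w0\<close> contains at
  least one root, and there are as many roots as discs.
\<close>

lemma local_sections:
  assumes w0: "w0 \<in> H"
  obtains \<rho> e where "\<rho> > 0" "e > 0" "ball w0 \<rho> \<subseteq> H"
    "\<And>z z'. z \<in> Z w0 \<Longrightarrow> z' \<in> Z w0 \<Longrightarrow> z \<noteq> z' \<Longrightarrow> ball z e \<inter> ball z' e = {}"
    "\<And>w. w \<in> ball w0 \<rho> \<Longrightarrow> Z w \<subseteq> (\<Union>z\<in>Z w0. ball z e)"
    "\<And>w z. w \<in> ball w0 \<rho> \<Longrightarrow> z \<in> Z w0 \<Longrightarrow> \<exists>!x. x \<in> Z w \<and> x \<in> ball z e"
proof -
  define DS where "DS = (\<lambda>(z, z'). dist z z') ` {(z, z'). z \<in> Z w0 \<and> z' \<in> Z w0 \<and> z \<noteq> z'}"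
  have "{(z, z'). z \<in> Z w0 \<and> z' \<in> Z w0 \<and> z \<noteq> z'} \<subseteq> Z w0 \<times> Z w0" by auto
  then have finDS: "finite DS" unfolding DS_def using fin_Z[OF w0]
    by (intro finite_imageI) (rule finite_subset, auto)
  define e0 where "e0 = Min (insert 1 DS)"
  have "e0 > 0" unfolding e0_def using finDS by (subst Min_gr_iff) (auto simp: DS_def)
  moreover have "dist z z' \<ge> e0" if "z \<in> Z w0" "z' \<in> Z w0" "z \<noteq> z'" for z z'
    unfolding e0_def using finDS that by (intro Min_le) (auto simp: DS_def intro!: image_eqI[of _ _ "(z, z')"])
  ultimately have e0: "e0 > 0" "\<And>z z'. z \<in> Z w0 \<Longrightarrow> z' \<in> Z w0 \<Longrightarrow> z \<noteq> z' \<Longrightarrow> dist z z' \<ge> e0" by blast+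
  define e where "e = e0 / 2"
  have e: "e > 0" using e0 by (simp add: e_def)
  have disj: "ball z e \<inter> ball z' e = {}" if "z \<in> Z w0" "z' \<in> Z w0" "z \<noteq> z'" for z z'
  proof -
    have "2 * e \<le> dist z z'" using e0(2)[OF that] by (simp add: e_def)
    moreover have "dist z z' < 2 * e" if "x \<in> ball z e" "x \<in> ball z' e" for x
      using that dist_triangle[of z z' x] by (simp add: dist_commute)
    ultimately show ?thesis by fastforce
  qed
  obtain \<rho> where \<rho>: "\<rho> > 0" "ball w0 \<rho> \<subseteq> H" "\<And>w z. w \<in> ball w0 \<rho> \<Longrightarrow> z \<in> Z w0 \<Longrightarrow> \<exists>x\<in>Z w. norm (z - x) < e"
    using near_roots[OF w0 e] by blast
  have main: "Z w \<subseteq> (\<Union>z\<in>Z w0. ball z e) \<and> (\<forall>z\<in>Z w0. \<exists>!x. x \<in> Z w \<and> x \<in> ball z e)" if w: "w \<in> ball w0 \<rho>" for w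
  proof -
    have wH: "w \<in> H" using w \<rho> by auto
    obtain s where s: "\<And>z. z \<in> Z w0 \<Longrightarrow> s z \<in> Z w \<and> s z \<in> ball z e"
      using \<rho>(3)[OF w] by (metis dist_norm mem_ball)
    have inj: "inj_on s (Z w0)"
    proof (rule inj_onI, rule ccontr)
      fix z z' assume "z \<in> Z w0" "z' \<in> Z w0" "s z = s z'" "z \<noteq> z'"
      then show False using s[of z] s[of z'] disj[of z z'] by auto
    qed
    have sub: "s ` Z w0 \<subseteq> Z w" using s by blast
    have "card (s ` Z w0) = card (Z w)" using card_image[OF inj] card_roots[OF w0] card_roots[OF wH] by simp
    then have eq: "s ` Z w0 = Z w" using sub fin_Z[OF wH] by (intro card_subset_eq)
    have "x = s z" if zx: "z \<in> Z w0" "x \<in> Z w" "x \<in> ball z e" for x z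
    proof -
      have "x \<in> s ` Z w0" using zx(2) unfolding eq .
      then obtain z' where z': "z' \<in> Z w0" "x = s z'" by blast
      have "s z' \<in> ball z' e" using s z'(1) by blast
      then have "ball z e \<inter> ball z' e \<noteq> {}" using z'(2) zx(3) by blast
      then have "z' = z" using disj[OF zx(1) z'(1)] by blast
      then show ?thesis using z' by simp
    qed
    then have "\<forall>z\<in>Z w0. \<exists>!x. x \<in> Z w \<and> x \<in> ball z e" using s by blast
    moreover have "Z w \<subseteq> (\<Union>z\<in>Z w0. ball z e)" unfolding eq[symmetric] using s by blast
    ultimately show ?thesis by blast
  qed
  show ?thesis by (rule that[OF \<rho>(1) e \<rho>(2) disj]) (use main in blast)+
qed

definition CC :: "(complex \<times> complex) set" where "CC = {(w, y). w \<in> H \<and> poly (P w) y = 0}"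

lemma cover: "covering_space CC fst H"
proof
  show "continuous_on CC fst" by (intro continuous_intros)
  have "w \<in> fst ` CC" if w: "w \<in> H" for w
  proof -
    have "Z w \<noteq> {}"
    proof
      assume "Z w = {}"
      then show False using card_roots[OF w] dpos by simp
    qed
    then obtain y where "poly (P w) y = 0" by blast
    then have "(w, y) \<in> CC" using w by (simp add: CC_def)
    then show ?thesis by (metis fst_conv image_eqI)
  qed
  moreover have "fst ` CC \<subseteq> H" by (auto simp: CC_def)
  ultimately show "fst ` CC = H" by blast
  fix w0 assume w0: "w0 \<in> H"
  obtain \<rho> e where \<rho>: "\<rho> > 0" "e > 0" "ball w0 \<rho> \<subseteq> H"
    and disj: "\<And>z z'. z \<in> Z w0 \<Longrightarrow> z' \<in> Z w0 \<Longrightarrow> z \<noteq> z' \<Longrightarrow> ball z e \<inter> ball z' e = {}"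
    and un: "\<And>w. w \<in> ball w0 \<rho> \<Longrightarrow> Z w \<subseteq> (\<Union>z\<in>Z w0. ball z e)"
    and ex1: "\<And>w z. w \<in> ball w0 \<rho> \<Longrightarrow> z \<in> Z w0 \<Longrightarrow> \<exists>!x. x \<in> Z w \<and> x \<in> ball z e"
    by (rule local_sections[OF w0]) (rule that)
  define T where "T = ball w0 \<rho>"
  define U where "U = (\<lambda>z. CC \<inter> (T \<times> ball z e))"
  have hom: "\<exists>q. homeomorphism (U z) T fst q" if z: "z \<in> Z w0" for z
  proof -
    define s where "s = (\<lambda>w. THE x. x \<in> Z w \<and> x \<in> ball z e)"
    have s: "s w \<in> Z w" "s w \<in> ball z e" if "w \<in> T" for w
      using theI'[OF ex1[OF _ z, of w]] that by (auto simp: s_def T_def)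
    have su: "x = s w" if "w \<in> T" "x \<in> Z w" "x \<in> ball z e" for w x
      using ex1[OF _ z, of w] s[of w] that by (auto simp: T_def)
    have "continuous_on T s"
      unfolding continuous_on_iff
    proof (intro ballI allI impI)
      fix w1 \<epsilon> assume w1: "w1 \<in> T" and \<epsilon>: "(0::real) < \<epsilon>"
      obtain r1 where r1: "r1 > 0" "ball (s w1) r1 \<subseteq> ball z e" using s(2)[OF w1] by (meson open_ball openE)
      obtain r2 where r2: "r2 > 0" "ball w1 r2 \<subseteq> T" using w1 unfolding T_def by (meson open_ball openE)
      have w1H: "w1 \<in> H" using w1 \<rho> by (auto simp: T_def)
      obtain r3 where r3: "r3 > 0" "\<And>w. w \<in> ball w1 r3 \<Longrightarrow> \<exists>x\<in>Z w. norm (s w1 - x) < min \<epsilon> r1"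
        using near_roots[OF w1H, of "min \<epsilon> r1"] \<epsilon> r1(1) s(1)[OF w1] by (metis min_less_iff_conj)
      show "\<exists>\<delta>>0. \<forall>w\<in>T. dist w w1 < \<delta> \<longrightarrow> dist (s w) (s w1) < \<epsilon>"
      proof (intro exI[of _ r3] conjI ballI impI)
        fix w assume w: "w \<in> T" "dist w w1 < r3"
        then obtain x where x: "x \<in> Z w" "norm (s w1 - x) < min \<epsilon> r1"
          using r3(2)[of w] by (auto simp: dist_commute)
        then have "x \<in> ball z e" using r1(2) by (auto simp: dist_norm subset_iff)
        then have "x = s w" using su[OF w(1) x(1)] by simp
        then show "dist (s w) (s w1) < \<epsilon>" using x by (simp add: dist_norm norm_minus_commute)
      qed (rule r3)
    qed
    then have "continuous_on T (\<lambda>w. (w, s w))" by (intro continuous_intros)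
    moreover have "(w, s w) \<in> U z" if "w \<in> T" for w using s[OF that] that \<rho> by (auto simp: U_def CC_def T_def)
    moreover have "(w, y) \<in> U z \<Longrightarrow> w \<in> T \<and> y = s w" for w y using su[of w y] by (auto simp: U_def CC_def)
    ultimately have "homeomorphism (U z) T fst (\<lambda>w. (w, s w))"
      by (intro homeomorphismI) (auto intro!: continuous_intros)
    then show ?thesis by blast
  qed
  show "\<exists>T. w0 \<in> T \<and> openin (top_of_set H) T \<and> (\<exists>v. \<Union> v = CC \<inter> fst -` T \<and>
     (\<forall>u\<in>v. openin (top_of_set CC) u) \<and> pairwise disjnt v \<and> (\<forall>u\<in>v. \<exists>q. homeomorphism u T fst q))"
  proof (intro exI[of _ T] conjI exI[of _ "U ` Z w0"])
    show "w0 \<in> T" using \<rho> by (simp add: T_def)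
    show "openin (top_of_set H) T" using \<rho> by (intro open_openin_trans) (auto simp: T_def openH)
    show "\<Union> (U ` Z w0) = CC \<inter> fst -` T"
    proof
      show "\<Union> (U ` Z w0) \<subseteq> CC \<inter> fst -` T" by (auto simp: U_def)
      show "CC \<inter> fst -` T \<subseteq> \<Union> (U ` Z w0)"
      proof
        fix x assume "x \<in> CC \<inter> fst -` T"
        then obtain w y where x: "x = (w, y)" "w \<in> T" "y \<in> Z w" "(w, y) \<in> CC" by (cases x) (auto simp: CC_def)
        then have "y \<in> (\<Union>z\<in>Z w0. ball z e)" using un[of w] unfolding T_def by blast
        then obtain z where "z \<in> Z w0" "y \<in> ball z e" by blast
        then have "x \<in> U z" "z \<in> Z w0" using x by (simp_all add: U_def)
        then show "x \<in> \<Union> (U ` Z w0)" by blast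
      qed
    qed
    show "\<forall>u\<in>U ` Z w0. openin (top_of_set CC) u"
      unfolding U_def by (auto simp: T_def intro!: openin_open_Int open_Times)
    show "pairwise disjnt (U ` Z w0)"
    proof (rule pairwiseI)
      fix a b assume "a \<in> U ` Z w0" "b \<in> U ` Z w0" "a \<noteq> b"
      then obtain z z' where zz: "z \<in> Z w0" "z' \<in> Z w0" "z \<noteq> z'" "a = U z" "b = U z'" by auto
      then show "disjnt a b" using disj[OF zz(1-3)] by (auto simp: disjnt_def U_def)
    qed
    show "\<forall>u\<in>U ` Z w0. \<exists>q. homeomorphism u T fst q" using hom by auto
  qed
qed

definition rsec :: "(complex \<Rightarrow> complex) \<Rightarrow> bool" where
  "rsec S \<longleftrightarrow> continuous_on H S \<and> (\<forall>w\<in>H. S w \<in> Z w)"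

text \<open>
  The base is convex, hence simply connected, so its identity map lifts to the covering.
\<close>

lemma rsec_exists:
  assumes "w0 \<in> H" "y \<in> Z w0"
  shows "\<exists>S. rsec S \<and> S w0 = y"
proof -
  have "(w0, y) \<in> CC" using assms by (simp add: CC_def)
  then obtain g where g: "continuous_on H g" "g \<in> H \<rightarrow> CC" "g w0 = (w0, y)" "\<And>w. w \<in> H \<Longrightarrow> fst (g w) = w"
    using covering_space_lift_strong[OF cover, of "(w0, y)" w0 H "\<lambda>w. w"] assms(1)
      convex_imp_simply_connected[OF convH] convex_imp_locally_path_connected[OF convH]
    by (auto simp: continuous_on_id)
  have "rsec (\<lambda>w. snd (g w))"
    unfolding rsec_def
  proof (intro conjI ballI)
    show "continuous_on H (\<lambda>w. snd (g w))" by (intro continuous_intros g)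
    fix w assume w: "w \<in> H"
    then have "g w \<in> CC" using g(2) by auto
    then show "snd (g w) \<in> Z w" using g(4)[OF w] by (auto simp: CC_def)
  qed
  then show ?thesis using g(3) by (intro exI[of _ "\<lambda>w. snd (g w)"]) auto
qed

lemma rsec_unique:
  assumes S: "rsec S" "rsec S'" and w: "w0 \<in> H" "S w0 = S' w0" "w \<in> H"
  shows "S w = S' w"
proof -
  have "(w, S w) = (w, S' w)"
    by (rule covering_space_lift_unique[OF cover, where f = "\<lambda>w. w" and a = w0 and T = H and ?g1.0 = "\<lambda>w. (w, S w)" and ?g2.0 = "\<lambda>w. (w, S' w)"])
       (use assms convex_connected[OF convH] in \<open>auto simp: rsec_def CC_def intro!: continuous_intros\<close>)
  then show ?thesis by simp
qed

text \<open>
  Writing \<open>P w0 = (y - S w0) Q\<close>, the difference quotient of \<open>S\<close> at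
  \<open>w0\<close> is expressed by the difference quotients of the coefficients and by \<open>Q
  (S w)\<close>, which does not vanish near \<open>w0\<close> since the root is simple.
\<close>

lemma rsec_holomorphic:
  assumes S: "rsec S"
  shows "S holomorphic_on H"
  unfolding holomorphic_on_open[OF openH]
proof
  fix w0 assume w0: "w0 \<in> H"
  have S0: "poly (P w0) (S w0) = 0" using S w0 by (auto simp: rsec_def)
  then obtain Q where Q: "P w0 = [:- S w0, 1:] * Q" by (metis dvdE poly_eq_0_iff_dvd)
  have Q0: "poly Q (S w0) \<noteq> 0"
  proof
    assume q: "poly Q (S w0) = 0"
    have nz: "Q \<noteq> 0" using Q lead[OF w0] by auto
    have "degree (P w0) = Suc (degree Q)" using nz by (subst Q, subst degree_mult_eq) auto
    moreover have "Z w0 = {y. poly Q y = 0}" using q by (subst Q) auto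
    ultimately have "card (Z w0) < degree (P w0)" using card_poly_roots_bound[OF nz] by simp
    then show False using card_roots[OF w0] deg[OF w0] by simp
  qed
  have contS: "S \<midarrow>w0\<rightarrow> S w0"
    using S w0 openH by (metis rsec_def continuous_on_eq_continuous_at isContD)
  have nzev: "\<forall>\<^sub>F w in at w0. poly Q (S w) \<noteq> 0"
  proof -
    have "((\<lambda>w. poly Q (S w)) \<longlongrightarrow> poly Q (S w0)) (at w0)"
      by (intro isCont_tendsto_compose[OF _ contS]) (simp add: poly_isCont)
    then show ?thesis using Q0 by (rule tendsto_imp_eventually_ne)
  qed
  define D where "D = (\<Sum>i\<le>d. deriv (\<lambda>w. coeff (P w) i) w0 * S w0 ^ i)"
  have lim: "((\<lambda>w. - (\<Sum>i\<le>d. (coeff (P w) i - coeff (P w0) i) / (w - w0) * S w ^ i) / poly Q (S w))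
      \<longlongrightarrow> - D / poly Q (S w0)) (at w0)"
    unfolding D_def
  proof (intro tendsto_intros contS isCont_tendsto_compose[OF _ contS] Q0)
    fix i
    have "((\<lambda>w. coeff (P w) i) has_field_derivative deriv (\<lambda>w. coeff (P w) i) w0) (at w0)"
      using holomorphic_derivI[OF hol openH w0] .
    then show "((\<lambda>w. (coeff (P w) i - coeff (P w0) i) / (w - w0)) \<longlongrightarrow> deriv (\<lambda>w. coeff (P w) i) w0) (at w0)"
      by (simp add: has_field_derivative_iff)
  qed
  have ev: "\<forall>\<^sub>F w in at w0. w \<in> H \<and> w \<noteq> w0"
    unfolding eventually_at_topological using openH w0 by (intro exI[of _ H]) auto
  have "\<forall>\<^sub>F w in at w0. - (\<Sum>i\<le>d. (coeff (P w) i - coeff (P w0) i) / (w - w0) * S w ^ i) / poly Q (S w) = (S w - S w0) / (w - w0)"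
    using ev nzev
  proof eventually_elim
    case (elim w)
    have w: "w \<in> H" "w - w0 \<noteq> 0" using elim by auto
    have "poly (P w) (S w) = 0" using S w by (auto simp: rsec_def)
    then have "poly (P w0) (S w) = - (poly (P w) (S w) - poly (P w0) (S w))" by simp
    also have "poly (P w) (S w) - poly (P w0) (S w) = (\<Sum>i\<le>d. (coeff (P w) i - coeff (P w0) i) * S w ^ i)"
      using deg[OF w(1)] deg[OF w0] by (simp add: poly_altdef sum_subtractf algebra_simps)
    finally have "(S w - S w0) * poly Q (S w) = - (\<Sum>i\<le>d. (coeff (P w) i - coeff (P w0) i) * S w ^ i)"
      unfolding Q by (simp add: algebra_simps)
    then have "(S w - S w0) = - (\<Sum>i\<le>d. (coeff (P w) i - coeff (P w0) i) * S w ^ i) / poly Q (S w)"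
      using elim by (simp add: field_simps)
    then have "(S w - S w0) / (w - w0) = - ((\<Sum>i\<le>d. (coeff (P w) i - coeff (P w0) i) * S w ^ i) / (w - w0)) / poly Q (S w)"
      by simp
    also have "(\<Sum>i\<le>d. (coeff (P w) i - coeff (P w0) i) * S w ^ i) / (w - w0) =
      (\<Sum>i\<le>d. (coeff (P w) i - coeff (P w0) i) / (w - w0) * S w ^ i)" by (simp add: sum_divide_distrib)
    finally show ?case by simp
  qed
  from Lim_transform_eventually[OF lim this]
  have "(S has_field_derivative - D / poly Q (S w0)) (at w0)" by (simp add: has_field_derivative_iff)
  then show "\<exists>f'. (S has_field_derivative f') (at w0)" by blast
qed

end

section \<open>The Puiseux theorem for analytic branches\<close>

lemma meromorphic_times_power_tendsto_0:
  assumes "a meromorphic_on {0}"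
  shows "\<exists>k. \<forall>m\<ge>k. ((\<lambda>u. u ^ m * a u) \<longlongrightarrow> 0) (at 0)"
proof -
  obtain F where F: "a has_laurent_expansion F" using assms by (auto simp: meromorphic_on_def)
  define k where "k = nat (1 - fls_subdegree F)"
  have "((\<lambda>u. u ^ m * a u) \<longlongrightarrow> 0) (at 0)" if m: "m \<ge> k" for m
  proof -
    have L: "(\<lambda>u. u ^ m * a u) has_laurent_expansion (fls_X ^ m * F)"
      by (intro laurent_expansion_intros F)
    have nth: "fls_nth (fls_X ^ m * F) j = fls_nth F (j - int m)" for j
      by (simp add: fls_X_power_times_conv_shift)
    have low: "fls_nth F (j - int m) = 0" if "j \<le> 0" for j
      by (rule fls_eq0_below_subdegree) (use m that in \<open>simp add: k_def\<close>)
    have "fls_subdegree (fls_X ^ m * F) \<ge> 0"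
      by (rule fls_subdegree_ge0I) (simp add: nth low)
    from has_laurent_expansion_imp_tendsto_0[OF L this] show ?thesis using low[of 0] by (simp add: nth)
  qed
  then show ?thesis by blast
qed

lemma meromorphic_from_tendsto_0:
  assumes "r > 0" "f holomorphic_on ball 0 r - {0}" "((\<lambda>t. t ^ k * f t) \<longlongrightarrow> 0) (at 0)"
  shows "f meromorphic_on {0}"
proof -
  define h where "h = (\<lambda>t. if t = 0 then 0 else t ^ k * f t)"
  have "h holomorphic_on ball 0 r" unfolding h_def
    by (rule removable_singularity) (use assms in \<open>auto intro!: holomorphic_intros\<close>)
  then have "h analytic_on {0}" using assms(1) by (auto simp: analytic_at intro!: exI[of _ "ball 0 r"])
  then have "h meromorphic_on {0}" by (rule analytic_on_imp_meromorphic_on)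
  then have "(\<lambda>t. h t / t ^ k) meromorphic_on {0}" by (intro meromorphic_intros)
  moreover have "\<forall>\<^sub>F t in at 0. h t / t ^ k = f t"
    by (auto simp: h_def eventually_at_filter)
  ultimately show ?thesis
    by (subst meromorphic_on_cong) (auto simp: eventually_at_filter elim: eventually_mono)
qed

context root_cover
begin

abbreviation "shift k w \<equiv> w + of_int k * (2 * of_real pi * \<i>)"

definition per :: "(complex \<Rightarrow> complex) \<Rightarrow> int \<Rightarrow> bool" where
  "per S k \<longleftrightarrow> (\<forall>w\<in>H. S (shift k w) = S w)"

end

text \<open>
  Sections over the half plane \<open>Re w < ln \<epsilon>\<close> of the covering pulled back
  along \<open>u = exp w\<close> are permuted by the translations by multiples of \<open>2 \<pi>
  \<i>\<close>. A section with least period \<open>2 \<pi> \<i> n\<close> is a function \<open>Y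
  t\<close> of \<open>t = exp (w / n)\<close>, \<open>u = t\<^sup>n\<close>. Minimality of
  \<open>n\<close> makes \<open>t \<mapsto> (t\<^sup>n, Y t)\<close> injective, and the bound of
  roots by coefficients leaves at most a pole at \<open>0\<close>. Choosing one section through
  each root over a base point, all \<open>d\<close> roots are obtained.
\<close>

theorem puiseux_branches:
  fixes Q :: "complex \<Rightarrow> complex poly"
  assumes d: "d > 0" and eps: "\<epsilon> > (0::real)"
    and deg: "\<And>u. u \<in> ball 0 \<epsilon> - {0} \<Longrightarrow> degree (Q u) = d"
    and lead: "\<And>u. u \<in> ball 0 \<epsilon> - {0} \<Longrightarrow> coeff (Q u) d = 1"
    and card: "\<And>u. u \<in> ball 0 \<epsilon> - {0} \<Longrightarrow> card {y. poly (Q u) y = 0} = d"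
    and hol: "\<And>i. (\<lambda>u. coeff (Q u) i) holomorphic_on ball 0 \<epsilon> - {0}"
    and mero: "\<And>i. (\<lambda>u. coeff (Q u) i) meromorphic_on {0}"
  obtains N :: nat and n :: "nat \<Rightarrow> nat" and Y :: "nat \<Rightarrow> complex \<Rightarrow> complex" and \<rho> :: real
  where "N > 0" "\<rho> > 0" "\<rho> \<le> 1"
    "\<And>i. i < d \<Longrightarrow> n i > 0 \<and> n i dvd N \<and> Y i meromorphic_on {0}"
    "\<And>i t. i < d \<Longrightarrow> t \<in> ball 0 \<rho> - {0} \<Longrightarrow> t ^ n i \<in> ball 0 \<epsilon> - {0} \<and> poly (Q (t ^ n i)) (Y i t) = 0"
    "\<And>i. i < d \<Longrightarrow> inj_on (\<lambda>t. (t ^ n i, Y i t)) (ball 0 \<rho> - {0})"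
    "\<And>\<tau>. \<tau> \<in> ball 0 \<rho> - {0} \<Longrightarrow> inj_on (\<lambda>i. Y i (\<tau> ^ (N div n i))) {..<d}"
proof -
  note Qdeg = deg and Qlead = lead
  (* The preimage of the punctured disc under the exponential map. *)
  define H where "H = {w. Re w < ln \<epsilon>}"
  have Hiff: "w \<in> H \<longleftrightarrow> norm (exp w) < \<epsilon>" for w
    using eps by (simp add: H_def norm_exp_eq_Re) (metis exp_less_cancel_iff exp_ln)
  have Hexp: "exp w \<in> ball 0 \<epsilon> - {0}" if "w \<in> H" for w using that by (simp add: Hiff)
  interpret root_cover "\<lambda>w. Q (exp w)" d H
  proof
    show "open H" unfolding H_def by (rule open_halfspace_Re_lt)
    show "convex H" unfolding H_def by (rule convex_halfspace_Re_lt)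
    show "(\<lambda>w. coeff (Q (exp w)) i) holomorphic_on H" for i
    proof -
      have "exp ` H \<subseteq> ball 0 \<epsilon> - {0}" by (rule image_subsetI) (rule Hexp)
      then show ?thesis using holomorphic_on_compose_gen[OF holomorphic_on_exp hol[of i], of H] by (simp add: o_def)
    qed
  qed (use deg lead card Hexp d in auto)
  have sH: "shift k w \<in> H \<longleftrightarrow> w \<in> H" for k w by (simp add: H_def)
  have sexp: "exp (shift k w) = exp w" for k w
    by (simp add: exp_add exp_integer_2pi mult_ac)
  have srsec: "rsec (\<lambda>w. S (shift k w))" if "rsec S" for S k
    unfolding rsec_def
  proof (intro conjI ballI)
    have "continuous_on H S" using that by (simp add: rsec_def)
    then show "continuous_on H (\<lambda>w. S (shift k w))"
      by (rule continuous_on_compose2) (auto intro!: continuous_intros simp: sH)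
    fix w assume "w \<in> H"
    then show "S (shift k w) \<in> Z w" using that sH[of w k] sexp[of w k] unfolding rsec_def by fastforce
  qed
  have per1: "per S k" if "rsec S" "w \<in> H" "S (shift k w) = S w" for S k w
    unfolding per_def using rsec_unique[OF srsec[OF that(1), of k] that(1) that(2) that(3)] by blast
  have per_add: "per S (k + l)" if "per S k" "per S l" for S k l
    unfolding per_def
  proof
    fix w assume w: "w \<in> H"
    have "shift (k + l) w = shift k (shift l w)" by (simp add: algebra_simps)
    then show "S (shift (k + l) w) = S w" using that w sH[of w l] unfolding per_def by metis
  qed
  have per_neg: "per S (- k)" if "per S k" for S k
    unfolding per_def
  proof
    fix w assume w: "w \<in> H"
    have "S (shift k (shift (- k) w)) = S (shift (- k) w)" using that w sH[of w "- k"] unfolding per_def by blast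
    then show "S (shift (- k) w) = S w" by simp
  qed
  have per_mult: "per S (int m * k)" if "per S k" for S m k
  proof (induction m)
    case 0 show ?case by (simp add: per_def)
  next
    case (Suc m)
    then show ?case using per_add[OF that Suc.IH] by (simp add: algebra_simps)
  qed
  (* The least positive period of a section, as a multiple of 2 \<pi> \<i>. It is at most d,
     because the translates of a section take at most d values at a point. *)
  define nn where "nn = (\<lambda>S. LEAST m. m > 0 \<and> per S (int m))"
  have nn: "nn S > 0" "per S (int (nn S))" "nn S \<le> d" if S: "rsec S" for S
  proof -
    define wb where "wb = (of_real (ln \<epsilon> - 1) :: complex)"
    have wb: "wb \<in> H" by (simp add: H_def wb_def)
    have "(\<lambda>m. S (shift (int m) wb)) ` {..d} \<subseteq> Z wb" using srsec[OF S] wb unfolding rsec_def by blast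
    then have "card ((\<lambda>m. S (shift (int m) wb)) ` {..d}) \<le> d"
      using card_mono[OF fin_Z[OF wb]] card_roots[OF wb] by metis
    then have "\<not> inj_on (\<lambda>m. S (shift (int m) wb)) {..d}" using card_image by fastforce
    then obtain a b where ab: "a \<le> d" "b \<le> d" "S (shift (int a) wb) = S (shift (int b) wb)" "a \<noteq> b"
      unfolding inj_on_def by auto
    have "\<exists>m. 0 < m \<and> m \<le> d \<and> per S (int m)"
    proof -
      have *: "per S (int (b - a))" if "a < b" "S (shift (int a) wb) = S (shift (int b) wb)" for a b :: nat
      proof (rule per1[OF S])
        show "shift (int a) wb \<in> H" using wb sH by blast
        have eq: "shift (int (b - a)) (shift (int a) wb) = shift (int b) wb" using that(1) by (simp add: of_nat_diff algebra_simps)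
        show "S (shift (int (b - a)) (shift (int a) wb)) = S (shift (int a) wb)" unfolding eq by (rule that(2)[symmetric])
      qed
      show ?thesis
      proof (cases "a < b")
        case True
        then show ?thesis using *[of a b] ab by (intro exI[of _ "b - a"]) auto
      next
        case False
        then show ?thesis using *[of b a] ab by (intro exI[of _ "a - b"]) auto
      qed
    qed
    then obtain m where m: "0 < m \<and> per S (int m)" "m \<le> d" by blast
    have "nn S > 0 \<and> per S (int (nn S))" unfolding nn_def by (rule LeastI[of _ m]) (rule m(1))
    then show "nn S > 0" "per S (int (nn S))" by blast+
    have "nn S \<le> m" unfolding nn_def by (rule Least_le) (rule m(1))
    then show "nn S \<le> d" using m(2) by simp
  qed
  have nn_dvd: "int (nn S) dvd k" if S: "rsec S" and k: "per S k" for S k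
  proof -
    let ?n = "int (nn S)"
    have n: "?n > 0" using nn[OF S] by simp
    have q: "per S (?n * j)" for j
    proof (cases "j \<ge> 0")
      case True
      then show ?thesis using per_mult[OF nn(2)[OF S], of "nat j"] by (simp add: mult.commute)
    next
      case False
      then show ?thesis using per_neg[OF per_mult[OF nn(2)[OF S], of "nat (- j)"]] by (simp add: mult.commute)
    qed
    have "k mod ?n = k + ?n * (- (k div ?n))" by (simp add: minus_mult_div_eq_mod [symmetric])
    then have p: "per S (k mod ?n)" using per_add[OF k q] by metis
    have "k mod ?n = 0"
    proof (rule ccontr)
      assume "k mod ?n \<noteq> 0"
      then have "nat (k mod ?n) > 0" using n pos_mod_sign[OF n, of k] by linarith
      moreover have "per S (int (nat (k mod ?n)))" using p n by simp
      ultimately have "nn S \<le> nat (k mod ?n)" unfolding nn_def by (intro Least_le) blast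
      moreover have "k mod ?n < ?n" "k mod ?n \<ge> 0" using n by simp_all
      ultimately show False by (metis int_nat_eq nat_int nat_le_eq_zle not_less of_nat_0_le_iff order_less_le_trans)
    qed
    then show ?thesis by auto
  qed
  have logs: "S (of_nat (nn S) * a) = S (of_nat (nn S) * b)"
    if S: "rsec S" and e: "exp a = exp b" and H: "of_nat (nn S) * b \<in> H" for S a b
  proof -
    obtain k :: int where k: "a = b + (of_int (2 * k) * pi) * \<i>" using e by (auto simp: exp_eq)
    have "of_nat (nn S) * a = shift (int (nn S) * k) (of_nat (nn S) * b)" by (simp add: k algebra_simps)
    moreover have "per S (int (nn S) * k)"
    proof (cases "k \<ge> 0")
      case True
      then show ?thesis using per_mult[OF nn(2)[OF S], of "nat k"] by (simp add: mult.commute)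
    next
      case False
      then show ?thesis using per_neg[OF per_mult[OF nn(2)[OF S], of "nat (- k)"]] by (simp add: mult.commute)
    qed
    ultimately show ?thesis using H by (simp add: per_def)
  qed
  define YY where "YY = (\<lambda>S t. S (of_nat (nn S) * Ln t))"
  define \<rho> where "\<rho> = min 1 \<epsilon>"
  have \<rho>: "\<rho> > 0" "\<rho> \<le> 1" using eps by (auto simp: \<rho>_def)
  have pow: "t ^ m \<in> ball 0 \<epsilon> - {0}" if "t \<in> ball 0 \<rho> - {0}" "m > 0" for t :: complex and m :: nat
  proof -
    have "norm t ^ m \<le> norm t ^ 1" using that by (intro power_decreasing) (auto simp: \<rho>_def)
    also have "\<dots> < \<epsilon>" using that by (auto simp: \<rho>_def)
    finally show ?thesis using that by (simp add: norm_power)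
  qed
  have logH: "of_nat m * a \<in> H" if "t \<in> ball 0 \<rho> - {0}" "m > 0" "exp a = t" for t a and m :: nat
  proof -
    have "exp (of_nat m * a) = t ^ m" using that(3) by (simp add: exp_of_nat_mult)
    then show ?thesis using pow[OF that(1,2)] by (simp add: Hiff)
  qed
  have YYroot: "poly (Q (t ^ nn S)) (YY S t) = 0" if S: "rsec S" and t: "t \<in> ball 0 \<rho> - {0}" for S t
  proof -
    have e: "exp (Ln t) = t" using t by simp
    have "of_nat (nn S) * Ln t \<in> H" by (rule logH[OF t nn(1)[OF S] e])
    then have "poly (Q (exp (of_nat (nn S) * Ln t))) (YY S t) = 0" using S by (auto simp: rsec_def YY_def)
    then show ?thesis using e by (simp add: exp_of_nat_mult)
  qed
  have YYhol: "YY S holomorphic_on ball 0 \<rho> - {0}" if S: "rsec S" for S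
  proof -
    have SH: "S holomorphic_on H" by (rule rsec_holomorphic[OF S])
    (* Off the negative real axis Ln is holomorphic; near the negative real axis another branch of
       the logarithm yields the same values of Y, as it differs by a multiple of the period. *)
    define A1 where "A1 = ball (0 :: complex) \<rho> - {0} - \<real>\<^sub>\<le>\<^sub>0"
    define A2 where "A2 = {t \<in> ball (0 :: complex) \<rho> - {0}. - t \<notin> \<real>\<^sub>\<le>\<^sub>0}"
    have op: "open A1" "open A2"
    proof -
      show "open A1" unfolding A1_def by (intro open_Diff) (auto simp: closed_nonpos_Reals_complex)
      have "A2 = (ball 0 \<rho> - {0}) - uminus -` \<real>\<^sub>\<le>\<^sub>0" by (auto simp: A2_def)
      moreover have "closed (uminus -` (\<real>\<^sub>\<le>\<^sub>0 :: complex set))"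
        by (intro continuous_closed_vimage) (auto simp: closed_nonpos_Reals_complex)
      ultimately show "open A2" by (auto intro!: open_Diff)
    qed
    have "YY S holomorphic_on A1"
    proof -
      have "(\<lambda>t. of_nat (nn S) * Ln t) holomorphic_on A1" by (intro holomorphic_intros) (auto simp: A1_def)
      moreover have "(\<lambda>t. of_nat (nn S) * Ln t) ` A1 \<subseteq> H"
      proof (rule image_subsetI)
        fix t assume t: "t \<in> A1"
        then have "exp (Ln t) = t" by (auto simp: A1_def)
        then show "of_nat (nn S) * Ln t \<in> H" using t by (intro logH[OF _ nn(1)[OF S]]) (auto simp: A1_def)
      qed
      ultimately show ?thesis using holomorphic_on_compose_gen[OF _ SH] unfolding YY_def o_def by blast
    qed
    moreover have "YY S holomorphic_on A2"
    proof -
      let ?l = "\<lambda>t. Ln (- t) + \<i> * of_real pi"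
      have ex: "exp (?l t) = t" if "t \<in> A2" for t using that by (simp add: A2_def exp_add)
      have "(\<lambda>t. of_nat (nn S) * ?l t) holomorphic_on A2" by (intro holomorphic_intros) (auto simp: A2_def)
      moreover have im: "of_nat (nn S) * ?l t \<in> H" if "t \<in> A2" for t
        using logH[OF _ nn(1)[OF S] ex[OF that]] that by (auto simp: A2_def)
      ultimately have "(\<lambda>t. S (of_nat (nn S) * ?l t)) holomorphic_on A2"
        using holomorphic_on_compose_gen[OF _ SH, of "\<lambda>t. of_nat (nn S) * ?l t" A2] unfolding o_def by blast
      moreover have "S (of_nat (nn S) * ?l t) = YY S t" if "t \<in> A2" for t
      proof -
        have "exp (?l t) = exp (Ln t)" using ex[OF that] that by (simp add: A2_def)
        moreover have "of_nat (nn S) * Ln t \<in> H" using that by (intro logH[OF _ nn(1)[OF S]]) (auto simp: A2_def)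
        ultimately show ?thesis unfolding YY_def by (rule logs[OF S])
      qed
      ultimately show ?thesis by (rule holomorphic_transform)
    qed
    ultimately have "YY S holomorphic_on A1 \<union> A2" using op by (intro holomorphic_on_Un)
    moreover have "A1 \<union> A2 = ball 0 \<rho> - {0}"
    proof -
      have "t = 0" if "t \<in> \<real>\<^sub>\<le>\<^sub>0" "- t \<in> \<real>\<^sub>\<le>\<^sub>0" for t :: complex
        using that by (auto simp: complex_nonpos_Reals_iff complex_eq_iff)
      then show ?thesis by (auto simp: A1_def A2_def)
    qed
    ultimately show ?thesis by simp
  qed
  obtain K where K: "\<And>i m. i < d \<Longrightarrow> m \<ge> K \<Longrightarrow> ((\<lambda>u. u ^ m * coeff (Q u) i) \<longlongrightarrow> 0) (at 0)"
  proof -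
    obtain k where k: "\<And>i m. m \<ge> k i \<Longrightarrow> ((\<lambda>u. u ^ m * coeff (Q u) i) \<longlongrightarrow> 0) (at 0)"
      using meromorphic_times_power_tendsto_0[OF mero] by metis
    show ?thesis
    proof (rule that[of "\<Sum>i<d. k i"])
      fix i m assume "i < d" "(\<Sum>i<d. k i) \<le> m"
      moreover have "k i \<le> (\<Sum>i<d. k i)" using \<open>i < d\<close> by (intro member_le_sum) auto
      ultimately show "((\<lambda>u. u ^ m * coeff (Q u) i) \<longlongrightarrow> 0) (at 0)" by (intro k) linarith
    qed
  qed
  have YYmero: "YY S meromorphic_on {0}" if S: "rsec S" for S
  proof (rule meromorphic_from_tendsto_0[OF \<rho>(1) YYhol[OF S]])
    let ?n = "nn S" and ?K = "Suc K"
    have n: "?n > 0" by (rule nn(1)[OF S])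
    have lim: "((\<lambda>u. norm (u ^ ?K) + (\<Sum>i<d. norm (u ^ ?K * coeff (Q u) i))) \<longlongrightarrow> 0 + (\<Sum>i<d. 0)) (at (0 :: complex))"
    proof (intro tendsto_intros tendsto_norm_zero K)
      show "((\<lambda>u. u ^ ?K) \<longlongrightarrow> 0) (at (0 :: complex))" by (auto intro!: tendsto_eq_intros)
    qed auto
    have ft: "filterlim (\<lambda>t. t ^ ?n) (at 0) (at (0 :: complex))"
      unfolding filterlim_at using n by (auto intro!: tendsto_eq_intros simp: eventually_at_filter power_0_left)
    have "((\<lambda>t. norm ((t ^ ?n) ^ ?K) + (\<Sum>i<d. norm ((t ^ ?n) ^ ?K * coeff (Q (t ^ ?n)) i))) \<longlongrightarrow> 0) (at (0 :: complex))"
      using filterlim_compose[OF lim ft] by simp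
    moreover have "\<forall>\<^sub>F t in at 0. norm (t ^ (?n * ?K) * YY S t) \<le>
        norm ((t ^ ?n) ^ ?K) + (\<Sum>i<d. norm ((t ^ ?n) ^ ?K * coeff (Q (t ^ ?n)) i))"
    proof -
      have "\<forall>\<^sub>F t in at (0::complex). t \<in> ball 0 \<rho> - {0}" using \<rho>(1)
        by (simp add: eventually_at) (metis dist_commute)
      then show ?thesis
      proof eventually_elim
        case (elim t)
        have u: "t ^ ?n \<in> ball 0 \<epsilon> - {0}" by (rule pow[OF elim n])
        have "norm (YY S t) \<le> 1 + (\<Sum>i<d. norm (coeff (Q (t ^ ?n)) i))"
          using monic_root_bound[OF _ YYroot[OF S elim]] Qdeg[OF u] Qlead[OF u] d by simp
        then have "norm ((t ^ ?n) ^ ?K) * norm (YY S t) \<le> norm ((t ^ ?n) ^ ?K) * (1 + (\<Sum>i<d. norm (coeff (Q (t ^ ?n)) i)))"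
          by (intro mult_left_mono) auto
        then show ?case by (simp only: norm_mult power_mult distrib_left sum_distrib_left mult_1_right)
      qed
    qed
    ultimately show "((\<lambda>t. t ^ (?n * ?K) * YY S t) \<longlongrightarrow> 0) (at 0)"
      by (intro Lim_null_comparison[where f = "\<lambda>t. t ^ (?n * ?K) * YY S t"])
  qed
  have YYinj: "inj_on (\<lambda>t. (t ^ nn S, YY S t)) (ball 0 \<rho> - {0})" if S: "rsec S" for S
  proof (rule inj_onI)
    fix t t' assume t: "t \<in> ball 0 \<rho> - {0}" "t' \<in> ball 0 \<rho> - {0}" "(t ^ nn S, YY S t) = (t' ^ nn S, YY S t')"
    let ?n = "nn S"
    have n: "?n > 0" by (rule nn(1)[OF S])
    have e: "exp (Ln t) = t" "exp (Ln t') = t'" using t by auto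
    then have "exp (of_nat ?n * Ln t) = exp (of_nat ?n * Ln t')" using t(3) by (simp add: exp_of_nat_mult)
    then obtain k :: int where k: "of_nat ?n * Ln t = of_nat ?n * Ln t' + (of_int (2 * k) * pi) * \<i>" by (auto simp: exp_eq)
    then have sh: "of_nat ?n * Ln t = shift k (of_nat ?n * Ln t')" by (simp add: algebra_simps)
    have "S (shift k (of_nat ?n * Ln t')) = S (of_nat ?n * Ln t')" using t(3) sh by (simp add: YY_def)
    then have "per S k" using logH[OF t(2) n e(2)] by (intro per1[OF S])
    then have "int ?n dvd k" by (rule nn_dvd[OF S])
    then obtain m where m: "k = int ?n * m" by auto
    have "of_nat ?n * Ln t = of_nat ?n * (shift m (Ln t'))" unfolding sh m by (simp add: algebra_simps)
    then have "Ln t = shift m (Ln t')" using n by simp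
    then have "exp (Ln t) = exp (Ln t')" using sexp by metis
    then show "t = t'" using e by simp
  qed
  (* A base point of the half plane. *)
  define wb where "wb = (of_real (ln \<epsilon> - 1) :: complex)"
  have wb: "wb \<in> H" by (simp add: H_def wb_def)
  obtain z where z: "bij_betw z {..<d} (Z wb)"
    using fin_Z[OF wb] card_roots[OF wb] by (metis bij_betw_from_nat_into_finite)
  have "\<exists>S. rsec S \<and> S wb = z i" if "i < d" for i
    using rsec_exists[OF wb, of "z i"] z that by (auto simp: bij_betw_def)
  then obtain S where S: "\<And>i. i < d \<Longrightarrow> rsec (S i)" "\<And>i. i < d \<Longrightarrow> S i wb = z i" by metis
  show ?thesis
  (* All ramification indices are at most d, so d! is a common multiple. *)
  proof (rule that[of "fact d" \<rho> "\<lambda>i. nn (S i)" "\<lambda>i. YY (S i)"])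
    show "nn (S i) > 0 \<and> nn (S i) dvd fact d \<and> YY (S i) meromorphic_on {0}" if "i < d" for i
      using nn[OF S(1)[OF that]] YYmero[OF S(1)[OF that]] by (auto intro!: dvd_fact)
    show "t ^ nn (S i) \<in> ball 0 \<epsilon> - {0} \<and> poly (Q (t ^ nn (S i))) (YY (S i) t) = 0"
      if "i < d" "t \<in> ball 0 \<rho> - {0}" for i t
      using pow[OF that(2) nn(1)[OF S(1)[OF that(1)]]] YYroot[OF S(1)[OF that(1)] that(2)] by blast
    show "inj_on (\<lambda>t. (t ^ nn (S i), YY (S i) t)) (ball 0 \<rho> - {0})" if "i < d" for i
      by (rule YYinj[OF S(1)[OF that]])
    fix \<tau> :: complex assume \<tau>: "\<tau> \<in> ball 0 \<rho> - {0}"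
    let ?w = "of_nat (fact d) * Ln \<tau> :: complex"
    have e: "exp (Ln \<tau>) = \<tau>" using \<tau> by simp
    have wH: "?w \<in> H" by (rule logH[OF \<tau> _ e]) simp
    have Y: "YY (S i) (\<tau> ^ (fact d div nn (S i))) = S i ?w" if "i < d" for i
    proof -
      let ?n = "nn (S i)"
      let ?m = "fact d div ?n"
      have "?n dvd fact d" using nn[OF S(1)[OF that]] by (auto intro!: dvd_fact)
      then have nm: "?n * ?m = fact d" by simp
      have "of_nat ?n * (of_nat ?m * Ln \<tau>) = of_nat (?n * ?m) * Ln \<tau>" by (simp only: of_nat_mult mult.assoc)
      then have w: "of_nat ?n * (of_nat ?m * Ln \<tau>) = ?w" unfolding nm .
      have "exp (Ln (\<tau> ^ ?m)) = exp (of_nat ?m * Ln \<tau>)" using e \<tau> by (simp add: exp_of_nat_mult)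
      then have "S i (of_nat ?n * Ln (\<tau> ^ ?m)) = S i (of_nat ?n * (of_nat ?m * Ln \<tau>))"
        by (rule logs[OF S(1)[OF that]]) (unfold w, rule wH)
      then show ?thesis unfolding w by (simp add: YY_def)
    qed
    show "inj_on (\<lambda>i. YY (S i) (\<tau> ^ (fact d div nn (S i)))) {..<d}"
    proof (rule inj_onI)
      fix i j assume ij: "i \<in> {..<d}" "j \<in> {..<d}"
        "YY (S i) (\<tau> ^ (fact d div nn (S i))) = YY (S j) (\<tau> ^ (fact d div nn (S j)))"
      then have "S i ?w = S j ?w" using Y by simp
      then have "S i wb = S j wb" using rsec_unique[OF S(1) S(1) wH _ wb, of i j] ij by simp
      then have "z i = z j" using S(2) ij by simp
      then show "i = j" using z ij by (auto simp: bij_betw_def inj_on_def)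
    qed
  qed (use \<rho> in auto)
qed

section \<open>Branches of a plane curve over a punctured disc\<close>

text \<open>
  Over the field \<open>\<complex>(x)\<close> the polynomial \<open>f\<close> is coprime to its
  derivative. Pseudo-division avoids that field: an element of least degree in the ideal generated
  by \<open>f\<close> and its derivative divides both up to factors from
  \<open>\<complex>[x]\<close>.
\<close>

lemma prime_bezout_pderiv:
  fixes f :: "complex poly poly"
  assumes p: "prime_elem f" and d: "degree f > 0"
  shows "\<exists>A B r. r \<noteq> 0 \<and> A * f + B * pderiv f = [:r:]"
proof -
  define I where "I = {h. h \<noteq> 0 \<and> (\<exists>A B. h = A * f + B * pderiv f)}"
  have fnz: "f \<noteq> 0" using d by auto
  have f'nz: "pderiv f \<noteq> 0" using d by (simp add: pderiv_eq_0_iff)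
  have f'deg: "degree (pderiv f) < degree f" using d by (simp add: degree_pderiv)
  have "f \<in> I" unfolding I_def using fnz by (intro CollectI conjI exI[of _ 1] exI[of _ 0]) auto
  then obtain h where h: "h \<in> I" "\<And>k. k \<in> I \<Longrightarrow> degree h \<le> degree k"
    using ex_has_least_nat[of "\<lambda>x. x \<in> I" f degree] by blast
  obtain A B where AB: "h = A * f + B * pderiv f" and hnz: "h \<noteq> 0" using h(1) I_def by auto
  have div: "\<exists>c q. c \<noteq> 0 \<and> smult c k = h * q" if k: "\<exists>A B. k = A * f + B * pderiv f" for k
  proof -
    obtain q s where qs: "pseudo_divmod k h = (q, s)" by (cases "pseudo_divmod k h")
    define c where "c = coeff h (degree h) ^ (Suc (degree k) - degree h)"
    have c: "c \<noteq> 0" using hnz by (simp add: c_def)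
    have e: "smult c k = h * q + s" "s = 0 \<or> degree s < degree h" using pseudo_divmod[OF hnz qs] by (auto simp: c_def)
    obtain A' B' where k': "k = A' * f + B' * pderiv f" using k by auto
    have "s = smult c k - h * q" using e by simp
    also have "\<dots> = (smult c A' - q * A) * f + (smult c B' - q * B) * pderiv f"
      unfolding k' by (subst AB) (simp add: algebra_simps smult_add_right)
    finally have "s = 0 \<or> s \<in> I" unfolding I_def by blast
    then have "s = 0" using e(2) h(2) by (metis not_less)
    then show ?thesis using e c by auto
  qed
  have d0: "degree h = 0"
  proof (rule ccontr)
    assume dh: "degree h \<noteq> 0"
    obtain c q where cq: "c \<noteq> 0" "smult c f = h * q" using div[of f] by (metis mult_1 mult_zero_left add_0_right)
    obtain c' q' where cq': "c' \<noteq> 0" "smult c' (pderiv f) = h * q'" using div[of "pderiv f"] by (metis mult_1 mult_zero_left add_0)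
    have "f dvd h * q" unfolding cq(2)[symmetric] by (simp add: dvd_smult)
    then consider "f dvd h" | "f dvd q" using p by (auto simp: prime_elem_dvd_mult_iff)
    then show False
    proof cases
      case 1
      then have "f dvd [:c':] * pderiv f" using cq'(2) by (simp add: dvd_mult2)
      then have "f dvd [:c':] \<or> f dvd pderiv f" using p by (simp only: prime_elem_dvd_mult_iff)
      then show False
      proof
        assume "f dvd [:c':]"
        then have "degree f \<le> degree [:c':]" by (rule dvd_imp_degree_le) (use cq'(1) in auto)
        then show False using d by simp
      next
        assume "f dvd pderiv f"
        then have "degree f \<le> degree (pderiv f)" by (rule dvd_imp_degree_le) (rule f'nz)
        then show False using f'deg by simp
      qed
    next
      case 2
      then obtain k where k: "q = f * k" by auto
      have "[:c:] * f = (h * k) * f" using cq(2) by (simp add: k mult_ac)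
      then have "[:c:] = h * k" using fnz by (metis mult_right_cancel)
      then have "h dvd [:c:]" by simp
      then have "degree h \<le> degree [:c:]" by (rule dvd_imp_degree_le) (use cq(1) in auto)
      then show False using dh by simp
    qed
  qed
  then obtain r where "h = [:r:]" by (metis degree_eq_zeroE)
  then show ?thesis using AB hnz by (metis pCons_eq_0_iff)
qed

text \<open>
  The polynomial in \<open>y\<close> obtained by fixing \<open>x = a\<close>.
\<close>

definition evx :: "complex \<Rightarrow> complex poly poly \<Rightarrow> complex poly" where
  "evx a f = map_poly (\<lambda>p. poly p a) f"

lemma rhom_evx: "rhom (evx a)"
  unfolding evx_def by (rule rhom.mp_rhom) (unfold_locales, auto)
interpretation evx: rhom "evx a" for a by (rule rhom_evx)

lemma coeff_evx: "coeff (evx a f) i = poly (coeff f i) a" by (simp add: evx_def coeff_map_poly)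

lemma eval2_evx: "eval2 f a b = poly (evx a f) b"
proof -
  have "poly (poly f [:b:]) a = poly (evx a f) b"
    unfolding evx_def by (induction f) (auto simp: map_poly_pCons)
  then show ?thesis by (simp add: eval2_def)
qed

lemma eval2_mult: "eval2 (f * g) a b = eval2 f a b * eval2 g a b" by (simp add: eval2_evx evx.mult)

lemma degree_evx: "poly (lead_coeff f) a \<noteq> 0 \<Longrightarrow> degree (evx a f) = degree f"
  unfolding evx_def by (rule map_poly_degree_eq) simp

lemma evx_pderiv: "evx a (pderiv f) = pderiv (evx a f)"
  by (intro poly_eqI) (simp add: coeff_evx coeff_pderiv)

lemma prime_generic_card_roots:
  fixes f :: "complex poly poly"
  assumes p: "prime_elem f" and d: "degree f > 0"
  shows "\<exists>q. q \<noteq> 0 \<and> (\<forall>a. poly q a \<noteq> 0 \<longrightarrow> poly (lead_coeff f) a \<noteq> 0 \<and> card {y. poly (evx a f) y = 0} = degree f)"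
proof -
  obtain A B r where AB: "r \<noteq> 0" "A * f + B * pderiv f = [:r:]" using prime_bezout_pderiv[OF p d] by blast
  have lnz: "lead_coeff f \<noteq> 0" using d by auto
  have "card {y. poly (evx a f) y = 0} = degree f" if a: "poly (r * lead_coeff f) a \<noteq> 0" for a
  proof -
    have dg: "degree (evx a f) = degree f" using a by (intro degree_evx) auto
    have "rsquarefree (evx a f)"
      unfolding rsquarefree_roots
    proof (intro allI notI)
      fix y assume y: "poly (evx a f) y = 0 \<and> poly (pderiv (evx a f)) y = 0"
      have "evx a (A * f + B * pderiv f) = [:poly r a:]" unfolding AB(2) by (simp add: evx_def map_poly_pCons)
      then have "poly (evx a (A * f + B * pderiv f)) y = poly r a" by simp
      moreover have "poly (evx a (A * f + B * pderiv f)) y = 0"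
        using y by (simp add: evx.add evx.mult evx_pderiv)
      ultimately show False using a by simp
    qed
    from complex_poly_decompose_rsquarefree[OF this]
    have "degree (evx a f) = degree (smult (lead_coeff (evx a f)) (\<Prod>z|poly (evx a f) z = 0. [:-z, 1:]))" by simp
    also have "\<dots> = card {y. poly (evx a f) y = 0}"
    proof -
      have "evx a f \<noteq> 0" using dg d by auto
      then show ?thesis by (simp add: degree_prod_eq_sum_degree)
    qed
    finally show ?thesis using dg by simp
  qed
  then show ?thesis using AB(1) lnz by (intro exI[of _ "r * lead_coeff f"]) auto
qed

text \<open>
  The map \<open>X\<close> will be \<open>u \<mapsto> 1/u\<close> for the branches with \<open>x
  \<rightarrow> \<infinity>\<close> and \<open>u \<mapsto> c + u\<close> for those over a finite
  point \<open>c\<close>. Only finitely many \<open>x\<close> are excluded, so their preimages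
  keep away from \<open>0\<close>.
\<close>

lemma generic_branches:
  fixes f :: "complex poly poly" and X :: "complex \<Rightarrow> complex"
  assumes p: "prime_elem f" and d: "degree f > 0"
    and hX: "X holomorphic_on - {0}" and mX: "X meromorphic_on {0}" and iX: "inj_on X (- {0})"
  obtains N :: nat and n :: "nat \<Rightarrow> nat" and Y :: "nat \<Rightarrow> complex \<Rightarrow> complex" and \<rho> :: real
  where "N > 0" "\<rho> > 0" "\<rho> \<le> 1"
    "\<And>i. i < degree f \<Longrightarrow> n i > 0 \<and> n i dvd N \<and> Y i meromorphic_on {0}"
    "\<And>i t. i < degree f \<Longrightarrow> t \<in> ball 0 \<rho> - {0} \<Longrightarrow> poly (evx (X (t ^ n i)) f) (Y i t) = 0"
    "\<And>i. i < degree f \<Longrightarrow> inj_on (\<lambda>t. (X (t ^ n i), Y i t)) (ball 0 \<rho> - {0})"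
    "\<And>\<tau>. \<tau> \<in> ball 0 \<rho> - {0} \<Longrightarrow> inj_on (\<lambda>i. Y i (\<tau> ^ (N div n i))) {..<degree f}"
proof -
  obtain q where q: "q \<noteq> 0" "\<And>a. poly q a \<noteq> 0 \<Longrightarrow> poly (lead_coeff f) a \<noteq> 0"
    "\<And>a. poly q a \<noteq> 0 \<Longrightarrow> card {y. poly (evx a f) y = 0} = degree f"
    using prime_generic_card_roots[OF p d] by blast
  define F where "F = {u \<in> - {0}. poly q (X u) = 0}"
  have "finite F"
  proof (rule finite_imageD)
    have "X ` F \<subseteq> {a. poly q a = 0}" by (auto simp: F_def)
    then show "finite (X ` F)" using poly_roots_finite[OF q(1)] finite_subset by blast
    show "inj_on X F" by (rule inj_on_subset[OF iX]) (auto simp: F_def)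
  qed
  then have "\<exists>\<epsilon>>0. \<forall>u\<in>F. u \<noteq> 0 \<longrightarrow> \<epsilon> \<le> dist 0 u" by (rule finite_set_avoid)
  then obtain \<epsilon> where eps: "\<epsilon> > 0" "\<And>u. u \<in> F \<Longrightarrow> \<epsilon> \<le> dist 0 u" by (force simp: F_def)
  have good: "poly q (X u) \<noteq> 0" if "u \<in> ball 0 \<epsilon> - {0}" for u
    using eps(2)[of u] that by (auto simp: F_def)
  define Q where "Q = (\<lambda>u. smult (inverse (poly (lead_coeff f) (X u))) (evx (X u) f))"
  have lz: "poly (lead_coeff f) (X u) \<noteq> 0" if "u \<in> ball 0 \<epsilon> - {0}" for u using good[OF that] q(2) by blast
  have cQ: "coeff (Q u) i = inverse (poly (lead_coeff f) (X u)) * poly (coeff f i) (X u)" for u i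
    by (simp add: Q_def coeff_evx)
  have polyX: "(\<lambda>u. poly p (X u)) holomorphic_on ball 0 \<epsilon> - {0}" "(\<lambda>u. poly p (X u)) meromorphic_on {0}" for p
  proof -
    have "X holomorphic_on ball 0 \<epsilon> - {0}" by (rule holomorphic_on_subset[OF hX]) auto
    then show "(\<lambda>u. poly p (X u)) holomorphic_on ball 0 \<epsilon> - {0}"
      unfolding poly_altdef by (intro holomorphic_intros)
    show "(\<lambda>u. poly p (X u)) meromorphic_on {0}"
      unfolding poly_altdef by (intro meromorphic_intros mX)
  qed
  have 1: "degree (Q u) = degree f" if u: "u \<in> ball 0 \<epsilon> - {0}" for u
    using lz[OF u] degree_evx[OF lz[OF u]] by (simp add: Q_def)
  have 2: "coeff (Q u) (degree f) = 1" if u: "u \<in> ball 0 \<epsilon> - {0}" for u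
    using lz[OF u] by (simp add: cQ)
  have 3: "card {y. poly (Q u) y = 0} = degree f" if u: "u \<in> ball 0 \<epsilon> - {0}" for u
    using lz[OF u] q(3)[OF good[OF u]] by (simp add: Q_def)
  have 4: "(\<lambda>u. coeff (Q u) i) holomorphic_on ball 0 \<epsilon> - {0}" for i
    unfolding cQ using lz by (intro holomorphic_intros polyX) auto
  have 5: "(\<lambda>u. coeff (Q u) i) meromorphic_on {0}" for i
    unfolding cQ by (intro meromorphic_intros polyX)
  show ?thesis
  proof (rule puiseux_branches[OF d eps(1) 1 2 3 4 5])
    fix N n Y \<rho>
    assume a: "(N::nat) > 0" "\<rho> > 0" "\<rho> \<le> 1"
      "\<And>i. i < degree f \<Longrightarrow> n i > 0 \<and> n i dvd N \<and> Y i meromorphic_on {0}"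
      "\<And>i t. i < degree f \<Longrightarrow> t \<in> ball 0 \<rho> - {0} \<Longrightarrow> t ^ n i \<in> ball 0 \<epsilon> - {0} \<and> poly (Q (t ^ n i)) (Y i t) = 0"
      "\<And>i. i < degree f \<Longrightarrow> inj_on (\<lambda>t. (t ^ n i, Y i t)) (ball 0 \<rho> - {0})"
      "\<And>\<tau>. \<tau> \<in> ball 0 \<rho> - {0} \<Longrightarrow> inj_on (\<lambda>i. Y i (\<tau> ^ (N div n i))) {..<degree f}"
    show thesis
    proof (rule that[of N \<rho> n Y])
      fix i and t :: complex assume it: "i < degree f" "t \<in> ball 0 \<rho> - {0}"
      then have "t ^ n i \<in> ball 0 \<epsilon> - {0}" "poly (Q (t ^ n i)) (Y i t) = 0" using a(5) by blast+
      then show "poly (evx (X (t ^ n i)) f) (Y i t) = 0" using lz by (auto simp: Q_def)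
    next
      fix i assume i: "i < degree f"
      show "inj_on (\<lambda>t. (X (t ^ n i), Y i t)) (ball 0 \<rho> - {0})"
      proof (rule inj_onI)
        fix t t' assume t: "t \<in> ball 0 \<rho> - {0}" "t' \<in> ball 0 \<rho> - {0}" "(X (t ^ n i), Y i t) = (X (t' ^ n i), Y i t')"
        then have "t ^ n i = t' ^ n i" using inj_onD[OF iX, of "t ^ n i" "t' ^ n i"] by simp
        then show "t = t'" using inj_onD[OF a(6)[OF i], of t t'] t by simp
      qed
    qed (use a in auto)
  qed
qed

section \<open>Curves without vertical branches\<close>

lemma branch_dvd: "branch_at_infinity f X Y \<Longrightarrow> f dvd F \<Longrightarrow> branch_at_infinity F X Y"
proof -
  assume b: "branch_at_infinity f X Y" and "f dvd F"
  then obtain k where "F = f * k" by auto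
  then have z: "eval2 f x y = 0 \<Longrightarrow> eval2 F x y = 0" for x y by (simp add: eval2_mult)
  obtain \<epsilon> where "\<epsilon> > 0" "inj_on (\<lambda>t. (X t, Y t)) (ball 0 \<epsilon> - {0})" "\<forall>t\<in>ball 0 \<epsilon> - {0}. eval2 f (X t) (Y t) = 0"
    using b unfolding branch_at_infinity_def by blast
  then show ?thesis using b z unfolding branch_at_infinity_def by (intro conjI exI[of _ \<epsilon>]) auto
qed

lemma prime_factor_lead:
  fixes F :: "complex poly poly"
  shows "F \<noteq> 0 \<Longrightarrow> degree (lead_coeff F) > 0 \<Longrightarrow> \<exists>p. prime p \<and> p dvd F \<and> degree (lead_coeff p) > 0"
proof (induction F rule: prime_divisors_induct)
  case (unit x)
  then have "lead_coeff x dvd 1" by (metis is_unit_poly_iff lead_coeff_pCons(2))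
  then have "degree (lead_coeff x) = 0" by (metis is_unit_poly_iff degree_pCons_0)
  then show ?case using unit by simp
next
  case (factor p x)
  then have nz: "p \<noteq> 0" "x \<noteq> 0" by auto
  have "degree (lead_coeff (p * x)) = degree (lead_coeff p) + degree (lead_coeff x)"
    unfolding lead_coeff_mult using nz by (intro degree_mult_eq) auto
  then consider "degree (lead_coeff p) > 0" | "degree (lead_coeff x) > 0" using factor.prems by linarith
  then show ?case
  proof cases
    case 1 then show ?thesis using factor.hyps by (metis dvd_triv_left)
  next
    case 2 then show ?thesis using factor.IH nz by (metis dvd_mult)
  qed
qed simp

text \<open>
  At a zero \<open>c\<close> of the leading coefficient some root must tend to infinity: if all
  branches over \<open>c\<close> stayed bounded, the product formula would give \<open>f(c, y) =
  0\<close> for all \<open>y\<close>, and \<open>x - c\<close> would divide the prime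
  \<open>f\<close>.
\<close>

lemma branch_over_point:
  fixes f :: "complex poly poly"
  assumes p: "prime f" and l: "degree (lead_coeff f) > 0"
  shows "\<exists>X Y. branch_at_infinity f X Y \<and> \<not> is_pole X 0"
proof -
  have pe: "prime_elem f" using p by simp
  obtain c where c: "poly (lead_coeff f) c = 0" using l Fundamental_Theorem_Algebra.fundamental_theorem_of_algebra[of "lead_coeff f"]
    by (auto simp: constant_degree)
  show ?thesis
  proof (cases "degree f = 0")
    case True
    then obtain a where a: "f = [:a:]" by (metis degree_eq_zeroE)
    have "poly a c = 0" using c a by simp
    then have "eval2 f c y = 0" for y by (simp add: eval2_evx a evx_def map_poly_pCons)
    moreover have "is_pole (\<lambda>t::complex. 1 / t) 0"
      using is_pole_inverse_power[of 1 0] by simp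
    moreover have "inj_on (\<lambda>t. (c, 1 / t)) (ball 0 1 - {0 :: complex})" by (rule inj_onI) auto
    ultimately have "branch_at_infinity f (\<lambda>_. c) (\<lambda>t. 1 / t)"
      unfolding branch_at_infinity_def by (auto intro!: meromorphic_intros exI[of _ 1])
    then show ?thesis using not_is_pole_const by blast
  next
    case False
    then have d: "degree f > 0" by simp
    have "evx c f \<noteq> 0"
    proof
      assume 0: "evx c f = 0"
      have "[:- c, 1:] dvd coeff f i" for i using arg_cong[OF 0, of "\<lambda>q. coeff q i"] by (simp add: coeff_evx poly_eq_0_iff_dvd)
      then have "[:[:- c, 1:]:] dvd f" by (simp add: const_poly_dvd_iff)
      moreover have "irreducible f" using pe by (rule prime_elem_imp_irreducible)
      ultimately have "[:[:- c, 1:]:] dvd 1 \<or> f dvd [:[:- c, 1:]:]" using irreducibleD' by blast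
      then show False
      proof
        assume "[:[:- c, 1:]:] dvd 1"
        then have "[:- c, 1:] dvd 1" by (metis const_poly_dvd_const_poly_iff one_pCons)
        then have "degree [:- c, 1:] \<le> degree (1 :: complex poly)" by (rule dvd_imp_degree_le) simp
        then show False by simp
      next
        assume "f dvd [:[:- c, 1:]:]"
        then have "degree f \<le> degree [:[:- c, 1:]:]" by (rule dvd_imp_degree_le) simp
        then show False using d by simp
      qed
    qed
    then obtain y0 where y0: "poly (evx c f) y0 \<noteq> 0" using poly_all_0_iff_0 by blast
    have hX: "(\<lambda>u. c + u) holomorphic_on - {0}" "(\<lambda>u. c + u) meromorphic_on {0}" "inj_on (\<lambda>u. c + u) (- {0})"
      by (auto intro!: holomorphic_intros meromorphic_intros)
    obtain N n Y \<rho> where a: "(N::nat) > 0" "\<rho> > 0" "\<rho> \<le> 1"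
      "\<And>i. i < degree f \<Longrightarrow> n i > 0 \<and> n i dvd N \<and> Y i meromorphic_on {0}"
      "\<And>i t. i < degree f \<Longrightarrow> t \<in> ball 0 \<rho> - {0} \<Longrightarrow> poly (evx (c + t ^ n i) f) (Y i t) = 0"
      "\<And>i. i < degree f \<Longrightarrow> inj_on (\<lambda>t. (c + t ^ n i, Y i t)) (ball 0 \<rho> - {0})"
      "\<And>\<tau>. \<tau> \<in> ball 0 \<rho> - {0} \<Longrightarrow> inj_on (\<lambda>i. Y i (\<tau> ^ (N div n i))) {..<degree f}"
      by (rule generic_branches[OF pe d hX]) (rule that)
    have "\<exists>i<degree f. is_pole (Y i) 0"
    proof (rule ccontr)
      assume np: "\<not> ?thesis"
      have "\<exists>L. (Y i \<longlongrightarrow> L) (at 0)" if i: "i < degree f" for i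
        using a(4)[OF i] np i by (auto simp: not_essential_def meromorphic_at_iff)
      then obtain L where L: "\<And>i. i < degree f \<Longrightarrow> (Y i \<longlongrightarrow> L i) (at 0)" by metis
      have ft: "filterlim (\<lambda>t. t ^ m) (at 0) (at (0 :: complex))" if "m > 0" for m :: nat
        unfolding filterlim_at using that by (auto intro!: tendsto_eq_intros simp: eventually_at_filter power_0_left)
      have m: "N div n i > 0" if "i < degree f" for i using a(4)[OF that] a(1) by (auto elim!: dvdE)
      have lim: "((\<lambda>\<tau>. poly (lead_coeff f) (c + \<tau> ^ N) * (\<Prod>i<degree f. y0 - Y i (\<tau> ^ (N div n i)))) \<longlongrightarrow>
          poly (lead_coeff f) (c + 0) * (\<Prod>i<degree f. y0 - L i)) (at 0)"
      proof (intro tendsto_intros)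
        show "((\<lambda>\<tau>. \<tau> ^ N) \<longlongrightarrow> 0) (at (0::complex))" using a(1) by (auto intro!: tendsto_eq_intros simp: power_0_left)
        fix i assume "i \<in> {..<degree f}"
        then show "((\<lambda>\<tau>. Y i (\<tau> ^ (N div n i))) \<longlongrightarrow> L i) (at 0)"
          using filterlim_compose[OF L ft[OF m]] by simp
      qed
      have lim2: "((\<lambda>\<tau>. poly (evx (c + \<tau> ^ N) f) y0) \<longlongrightarrow> poly (evx c f) y0) (at 0)"
      proof -
        have e: "poly (evx z f) y0 = poly (poly f [:y0:]) z" for z using eval2_evx[of f z y0] by (simp add: eval2_def)
        have "((\<lambda>\<tau>. poly (poly f [:y0:]) (c + \<tau> ^ N)) \<longlongrightarrow> poly (poly f [:y0:]) (c + 0)) (at (0::complex))"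
          using a(1) by (intro tendsto_intros) (auto intro!: tendsto_eq_intros simp: power_0_left)
        then show ?thesis by (simp add: e)
      qed
      have "\<forall>\<^sub>F \<tau> in at (0::complex). poly (lead_coeff f) (c + \<tau> ^ N) \<noteq> 0"
      proof -
        have nz: "lead_coeff f \<noteq> 0" using d by auto
        have "\<forall>\<^sub>F x in at c. poly (lead_coeff f) x \<noteq> 0"
          using islimpt_finite[OF poly_roots_finite[OF nz], of c] by (simp add: islimpt_iff_eventually)
        moreover have "filterlim (\<lambda>\<tau>. c + \<tau> ^ N) (at c) (at (0::complex))"
          unfolding filterlim_at using a(1) by (auto intro!: tendsto_eq_intros simp: eventually_at_filter power_0_left)
        ultimately show ?thesis by (rule eventually_compose_filterlim)
      qed
      moreover have "\<forall>\<^sub>F \<tau> in at (0::complex). \<tau> \<in> ball 0 \<rho> - {0}"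
        using a(2) by (simp add: eventually_at) (metis dist_commute)
      ultimately have "\<forall>\<^sub>F \<tau> in at 0. poly (lead_coeff f) (c + \<tau> ^ N) * (\<Prod>i<degree f. y0 - Y i (\<tau> ^ (N div n i))) = poly (evx (c + \<tau> ^ N) f) y0"
      proof eventually_elim
        case (elim \<tau>)
        let ?y = "\<lambda>i. Y i (\<tau> ^ (N div n i))"
        have inj: "inj_on ?y {..<degree f}" by (rule a(7)[OF elim(2)])
        have root: "poly (evx (c + \<tau> ^ N) f) (?y i) = 0" if i: "i < degree f" for i
        proof -
          have nm: "N div n i * n i = N" using a(4)[OF i] by simp
          have "norm (\<tau> ^ (N div n i)) \<le> norm \<tau> ^ 1" unfolding norm_power
            using elim(2) a(3) m[OF i] by (intro power_decreasing) auto
          then have "\<tau> ^ (N div n i) \<in> ball 0 \<rho> - {0}" using elim(2) by simp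
          from a(5)[OF i this] show ?thesis by (simp add: power_mult[symmetric] nm)
        qed
        have dg: "degree (evx (c + \<tau> ^ N) f) = degree f" by (rule degree_evx[OF elim(1)])
        have "evx (c + \<tau> ^ N) f = smult (lead_coeff (evx (c + \<tau> ^ N) f)) (\<Prod>z\<in>?y ` {..<degree f}. [:- z, 1:])"
          by (rule poly_eq_prod_roots) (use root dg card_image[OF inj] in auto)
        also have "(\<Prod>z\<in>?y ` {..<degree f}. [:- z, 1:]) = (\<Prod>i<degree f. [:- ?y i, 1:])"
          by (rule prod.reindex_cong[OF inj]) auto
        finally have "evx (c + \<tau> ^ N) f = smult (poly (lead_coeff f) (c + \<tau> ^ N)) (\<Prod>i<degree f. [:- ?y i, 1:])"
          unfolding dg coeff_evx .
        then have "poly (evx (c + \<tau> ^ N) f) y0 = poly (smult (poly (lead_coeff f) (c + \<tau> ^ N)) (\<Prod>i<degree f. [:- ?y i, 1:])) y0" by metis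
        then show ?case by (simp add: poly_prod)
      qed
      then have "((\<lambda>\<tau>. poly (evx (c + \<tau> ^ N) f) y0) \<longlongrightarrow> poly (lead_coeff f) (c + 0) * (\<Prod>i<degree f. y0 - L i)) (at 0)"
        by (rule Lim_transform_eventually[OF lim])
      then have "poly (evx c f) y0 = poly (lead_coeff f) (c + 0) * (\<Prod>i<degree f. y0 - L i)"
        using lim2 tendsto_unique[OF trivial_limit_at] by blast
      then show False using y0 c by simp
    qed
    then obtain i where i: "i < degree f" "is_pole (Y i) 0" by blast
    have "branch_at_infinity f (\<lambda>t. c + t ^ n i) (Y i)"
      unfolding branch_at_infinity_def eval2_evx
      using i a(2) a(4,6)[OF i(1)] a(5)[OF i(1)]
      by (intro conjI exI[of _ \<rho>]) (auto intro!: meromorphic_intros)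
    moreover have "\<not> is_pole (\<lambda>t. c + t ^ n i) 0"
    proof
      assume "is_pole (\<lambda>t. c + t ^ n i) 0"
      moreover have "((\<lambda>t. c + t ^ n i) \<longlongrightarrow> c + 0 ^ n i) (at (0::complex))" by (intro tendsto_intros)
      ultimately show False unfolding is_pole_def by (metis not_tendsto_and_filterlim_at_infinity trivial_limit_at)
    qed
    ultimately show ?thesis by blast
  qed
qed

lemma monic_if_branches_close:
  assumes "nonconstant F" "branches_close_to F \<psi> r"
  shows "degree F > 0 \<and> degree (lead_coeff F) = 0"
proof (rule ccontr)
  assume *: "\<not> ?thesis"
  have dl: "degree (lead_coeff F) > 0"
  proof (cases "degree F = 0")
    case True
    then obtain a where a: "F = [:a:]" by (metis degree_eq_zeroE)
    have "degree a > 0"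
    proof (rule ccontr)
      assume "\<not> degree a > 0"
      then obtain b where "a = [:b:]" by (metis degree_eq_zeroE gr0I)
      then show False using assms(1) a by (auto simp: nonconstant_def)
    qed
    then show ?thesis using a by simp
  qed (use * in auto)
  then have "F \<noteq> 0" by auto
  then obtain p where p: "prime p" "p dvd F" "degree (lead_coeff p) > 0" using prime_factor_lead dl by blast
  obtain X Y where "branch_at_infinity p X Y" "\<not> is_pole X 0" using branch_over_point[OF p(1,3)] by blast
  then show False using branch_dvd[OF _ p(2)] assms(2) unfolding branches_close_to_def meets_at_O_def by blast
qed

section \<open>Factorization over fractional Laurent series\<close>

lemma laurent_compose_power:
  assumes L: "Y has_laurent_expansion L" and m: "m > 0"
  shows "(\<lambda>t. Y (t ^ m)) has_laurent_expansion cp m L"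
proof -
  obtain k F where LF: "L = fls_X_intpow k * fps_to_fls F"
  proof -
    have "L = fls_shift (- fls_subdegree L) (fps_to_fls (fls_base_factor_to_fps L))"
      by (rule fls_conv_base_factor_to_fps_shift_subdegree)
    then show ?thesis using that[of "fls_subdegree L"] by (simp add: fls_shifted_times_simps)
  qed
  define h where "h = (\<lambda>t. Y t * t powi (- k))"
  have "h has_laurent_expansion (L * fls_X_intpow (- k))"
    unfolding h_def by (intro laurent_expansion_intros L)
  also have "L * fls_X_intpow (- k) = fps_to_fls F"
  proof -
    have "fls_X_intpow k * fls_X_intpow (- k) = (1 :: complex fls)" unfolding X_intpow_add by simp
    then show ?thesis unfolding LF by (metis mult.commute mult.left_commute mult_1)
  qed
  finally have h: "h has_laurent_expansion fps_to_fls F" .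
  have "(\<lambda>t::complex. t ^ m) has_laurent_expansion fps_to_fls (fps_X ^ m)"
    using has_laurent_expansion_fps_X_power[of m] by (simp add: fps_to_fls_power fls_X_power_conv_shift_1)
  from has_laurent_expansion_compose[OF h this]
  have "(\<lambda>t. h (t ^ m)) has_laurent_expansion fps_to_fls (F oo fps_X ^ m)"
    using m by (simp add: o_def)
  then have "(\<lambda>t. t powi (int m * k) * h (t ^ m)) has_laurent_expansion (fls_X_intpow (int m * k) * fps_to_fls (F oo fps_X ^ m))"
    by (intro laurent_expansion_intros)
  also have "fls_X_intpow (int m * k) * fps_to_fls (F oo fps_X ^ m) = cp m L"
    unfolding LF using m by (simp add: fls_compose_power_fps_to_fls)
  finally have L': "(\<lambda>t. t powi (int m * k) * h (t ^ m)) has_laurent_expansion cp m L" .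
  have "\<forall>\<^sub>F t in at 0. t powi (int m * k) * h (t ^ m) = Y (t ^ m)"
    by (auto simp: eventually_at_filter h_def power_int_minus power_int_mult)
  from has_laurent_expansion_cong[OF this refl] L' show ?thesis by blast
qed

lemma laurent_poly_inverse_power:
  assumes "N > 0"
  shows "(\<lambda>t. poly p (1 / t ^ N)) has_laurent_expansion cp N (emb p)"
proof (induction p)
  case 0
  then show ?case by (simp add: emb.zero)
next
  case (pCons a p)
  have inv: "(\<lambda>t. 1 / t ^ N) has_laurent_expansion fls_X_intpow (- int N)"
    using has_laurent_expansion_fps_X_power_int[of "- int N"] by (simp add: power_int_minus field_simps)
  have "(\<lambda>t. a + 1 / t ^ N * poly p (1 / t ^ N)) has_laurent_expansion (fls_const a + fls_X_intpow (- int N) * cp N (emb p))"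
    by (intro laurent_expansion_intros inv pCons)
  also have "fls_const a + fls_X_intpow (- int N) * cp N (emb p) = cp N (emb (pCons a p))"
    using assms by (simp add: emb_pCons)
  finally show ?case by simp
qed

text \<open>
  A branch \<open>x = t\<^bsup>-p\<^esup>\<close>, \<open>y = Y t\<close> gives a root over
  Laurent series in \<open>\<tau>\<close> where \<open>t = \<tau>\<^sup>m\<close>, after the
  substitution \<open>x = \<tau>\<^bsup>-pm\<^esup>\<close>.
\<close>

lemma laurent_root:
  assumes L: "Y has_laurent_expansion L" and p: "p > 0" and m: "m > 0"
    and z: "\<forall>\<^sub>F t in at 0. eval2 f (1 / t ^ p) (Y t) = 0"
  shows "poly (Up (p * m) (embP f)) (cp m L) = 0"
proof -
  let ?N = "p * m"
  have N: "?N > 0" using p m by simp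
  have L1: "(\<lambda>\<tau>. \<Sum>k\<le>degree f. poly (coeff f k) (1 / \<tau> ^ ?N) * Y (\<tau> ^ m) ^ k) has_laurent_expansion
      (\<Sum>k\<le>degree f. cp ?N (emb (coeff f k)) * cp m L ^ k)"
    by (intro laurent_expansion_intros laurent_poly_inverse_power N laurent_compose_power L m)
  have L2: "(\<Sum>k\<le>degree f. cp ?N (emb (coeff f k)) * cp m L ^ k) = poly (Up ?N (embP f)) (cp m L)"
    unfolding poly_altdef degree_Up[OF N] degree_embP by (simp add: coeff_Up[OF N] coeff_embP)
  have "filterlim (\<lambda>t. t ^ m) (at 0) (at (0 :: complex))"
    unfolding filterlim_at using m by (auto intro!: tendsto_eq_intros simp: eventually_at_filter power_0_left)
  from eventually_compose_filterlim[OF z this]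
  have L3: "\<forall>\<^sub>F \<tau> in at 0. (\<Sum>k\<le>degree f. poly (coeff f k) (1 / \<tau> ^ ?N) * Y (\<tau> ^ m) ^ k) = 0"
  proof eventually_elim
    case (elim \<tau>)
    have "poly (evx x f) w = (\<Sum>k\<le>degree f. poly (coeff f k) x * w ^ k)" for x w
    proof -
      have "degree (evx x f) \<le> degree f" unfolding evx_def by (rule map_poly_degree_leq)
      then have "poly (evx x f) w = (\<Sum>k\<le>degree f. coeff (evx x f) k * w ^ k)"
        unfolding poly_altdef by (intro sum.mono_neutral_left) (auto simp: coeff_eq_0)
      then show ?thesis by (simp add: coeff_evx)
    qed
    then show ?case using elim by (simp add: eval2_evx power_mult[symmetric] mult.commute)
  qed
  have "(\<lambda>_. 0) has_laurent_expansion poly (Up ?N (embP f)) (cp m L)"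
    by (rule iffD1[OF has_laurent_expansion_cong[OF L3 refl] L1[unfolded L2]])
  from has_laurent_expansion_unique[OF this has_laurent_expansion_0] show ?thesis .
qed

text \<open>
  A Laurent series in \<open>t = u\<^bsup>1/N\<^esup>\<close> that comes from an analytic branch
  of \<open>F = 0\<close>, possibly with smaller ramification \<open>n\<close>.
\<close>

definition branch_root :: "complex poly poly \<Rightarrow> nat \<Rightarrow> complex fls \<Rightarrow> bool" where
  "branch_root F N y \<longleftrightarrow> (\<exists>n m Yf L. n > 0 \<and> m > 0 \<and> N = n * m \<and> Yf has_laurent_expansion L \<and> y = cp m L
     \<and> branch_at_infinity F (\<lambda>t. 1 / t ^ n) Yf)"

definition splits :: "complex poly poly \<Rightarrow> complex poly poly \<Rightarrow> nat \<Rightarrow> bool" where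
  "splits f F N \<longleftrightarrow> (\<exists>ys. Up N (embP f) = smult (cp N (emb (lead_coeff f))) (\<Prod>y\<leftarrow>ys. [:- y, 1:]) \<and> (\<forall>y\<in>set ys. branch_root F N y))"

lemma cp_cp: "N > 0 \<Longrightarrow> k > 0 \<Longrightarrow> cp k (cp N a) = cp (N * k) a"
proof (intro fls_eqI)
  fix i assume N: "N > 0" "k > 0"
  show "fls_nth (cp k (cp N a)) i = fls_nth (cp (N * k) a) i"
  proof (cases "int k dvd i")
    case False
    then have "\<not> int (N * k) dvd i" using dvd_mult_right[of "int N" "int k" i] by auto
    then show ?thesis using N False by (simp add: fls_nth_compose_power)
  next
    case True
    then obtain j where j: "i = int k * j" by auto
    then show ?thesis using N by (auto simp: fls_nth_compose_power mult.commute)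
  qed
qed

lemma splits_mult: assumes "splits f F N" "N > 0" "k > 0" shows "splits f F (N * k)"
proof -
  obtain ys where ys: "Up N (embP f) = smult (cp N (emb (lead_coeff f))) (\<Prod>y\<leftarrow>ys. [:- y, 1:])" "\<forall>y\<in>set ys. branch_root F N y"
    using assms(1) splits_def by auto
  interpret c: rhom "cp k" by (rule rhom_cp[OF assms(3)])
  interpret m: rhom "map_poly (cp k)" by (rule c.mp_rhom)
  have U: "Up (N * k) H = map_poly (cp k) (Up N H)" for H
    using assms by (intro poly_eqI) (simp add: coeff_Up coeff_map_poly c.zero cp_cp)
  have P: "map_poly (cp k) (\<Prod>y\<leftarrow>ys. [:- y, 1:]) = (\<Prod>y\<leftarrow>map (cp k) ys. [:- y, 1:])" for ys
  proof (induction ys)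
    case (Cons y ys)
    have "map_poly (cp k) ([:- y, 1:] * (\<Prod>y\<leftarrow>ys. [:- y, 1:])) = [:- cp k y, 1:] * (\<Prod>y\<leftarrow>map (cp k) ys. [:- y, 1:])"
      unfolding m.mult Cons.IH c.mp_linear c.uminus c.one ..
    then show ?case by (simp only: list.map prod_list.Cons)
  qed (simp add: m.one)
  have "Up (N * k) (embP f) = smult (cp (N * k) (emb (lead_coeff f))) (\<Prod>y\<leftarrow>map (cp k) ys. [:- y, 1:])"
    unfolding U ys(1) c.mp_smult P using assms by (simp add: cp_cp)
  moreover have "branch_root F (N * k) (cp k y)" if b: "branch_root F N y" for y
  proof -
    obtain n m Yf L where b: "n > 0" "m > 0" "N = n * m" "Yf has_laurent_expansion L" "y = cp m L"
      "branch_at_infinity F (\<lambda>t. 1 / t ^ n) Yf" using b branch_root_def by auto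
    show ?thesis unfolding branch_root_def
      by (rule exI[of _ n], rule exI[of _ "m * k"], rule exI[of _ Yf], rule exI[of _ L])
         (use b assms in \<open>auto simp: cp_cp\<close>)
  qed
  ultimately show ?thesis unfolding splits_def using ys(2) by (intro exI[of _ "map (cp k) ys"]) auto
qed

lemma splits_prod: assumes "splits f F N" "splits h F N" "N > 0" shows "splits (f * h) F N"
proof -
  interpret u: rhom "Up N" by (rule rhom_Up[OF assms(3)])
  obtain ys where ys: "Up N (embP f) = smult (cp N (emb (lead_coeff f))) (\<Prod>y\<leftarrow>ys. [:- y, 1:])" "\<forall>y\<in>set ys. branch_root F N y"
    using assms(1) splits_def by auto
  obtain zs where zs: "Up N (embP h) = smult (cp N (emb (lead_coeff h))) (\<Prod>y\<leftarrow>zs. [:- y, 1:])" "\<forall>y\<in>set zs. branch_root F N y"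
    using assms(2) splits_def by auto
  have "Up N (embP (f * h)) = smult (cp N (emb (lead_coeff (f * h)))) (\<Prod>y\<leftarrow>ys @ zs. [:- y, 1:])"
    by (simp add: embP.mult u.mult ys(1) zs(1) lead_coeff_mult emb.mult mult_ac)
  then show ?thesis unfolding splits_def using ys(2) zs(2) by (intro exI[of _ "ys @ zs"]) auto
qed

lemma splits_const: assumes "degree f = 0" "N > 0" shows "splits f F N"
proof -
  obtain a where a: "f = [:a:]" using assms(1) by (metis degree_eq_zeroE)
  have "Up N (embP f) = [:cp N (emb a):]"
    unfolding a embP_def Up_def using rhom.mp_const[OF rhom_cp[OF assms(2)]] by (simp add: emb.mp_const)
  then show ?thesis unfolding splits_def by (intro exI[of _ "[]"]) (simp add: a)
qed

text \<open>
  The branches of a prime polynomial provide as many distinct roots as its degree.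
\<close>

lemma splits_prime:
  assumes p: "prime_elem f" and F: "f dvd F" and d: "degree f > 0"
  shows "\<exists>N>0. splits f F N"
proof -
  have hX: "(\<lambda>u. 1 / u) holomorphic_on - {0 :: complex}" "(\<lambda>u. 1 / u :: complex) meromorphic_on {0}" "inj_on (\<lambda>u. 1 / u :: complex) (- {0})"
    by (auto intro!: holomorphic_intros meromorphic_intros inj_onI)
  obtain N n Y \<rho> where a: "(N::nat) > 0" "\<rho> > 0" "\<rho> \<le> 1"
    "\<And>i. i < degree f \<Longrightarrow> n i > 0 \<and> n i dvd N \<and> Y i meromorphic_on {0}"
    "\<And>i t. i < degree f \<Longrightarrow> t \<in> ball 0 \<rho> - {0} \<Longrightarrow> poly (evx (1 / t ^ n i) f) (Y i t) = 0"
    "\<And>i. i < degree f \<Longrightarrow> inj_on (\<lambda>t. (1 / t ^ n i, Y i t)) (ball 0 \<rho> - {0})"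
    "\<And>\<tau>. \<tau> \<in> ball 0 \<rho> - {0} \<Longrightarrow> inj_on (\<lambda>i. Y i (\<tau> ^ (N div n i))) {..<degree f}"
    by (rule generic_branches[OF p d hX]) (rule that)
  have "\<exists>L. Y i has_laurent_expansion L" if "i < degree f" for i
    using a(4)[OF that] by (auto simp: meromorphic_on_def)
  then obtain L where L: "\<And>i. i < degree f \<Longrightarrow> Y i has_laurent_expansion L i" by metis
  define m where "m = (\<lambda>i. N div n i)"
  define y where "y = (\<lambda>i. cp (m i) (L i))"
  have m: "m i > 0" "n i * m i = N" if "i < degree f" for i
    using a(4)[OF that] a(1) by (auto simp: m_def elim!: dvdE)
  have yL: "(\<lambda>\<tau>. Y i (\<tau> ^ m i)) has_laurent_expansion y i" if "i < degree f" for i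
    unfolding y_def by (rule laurent_compose_power[OF L[OF that] m(1)[OF that]])
  have evb: "\<forall>\<^sub>F \<tau> in at (0::complex). \<tau> \<in> ball 0 \<rho> - {0}"
    using a(2) by (simp add: eventually_at) (metis dist_commute)
  have br: "branch_at_infinity f (\<lambda>t. 1 / t ^ n i) (Y i)" if i: "i < degree f" for i
  proof -
    have "is_pole (\<lambda>t. 1 / t ^ n i) (0::complex)" using is_pole_inverse_power[of "n i" 0] a(4)[OF i] by simp
    then show ?thesis unfolding branch_at_infinity_def eval2_evx
      using a(2) a(4,6)[OF i] a(5)[OF i] by (intro conjI exI[of _ \<rho>]) (auto intro!: meromorphic_intros)
  qed
  have root: "poly (Up N (embP f)) (y i) = 0" if i: "i < degree f" for i
  proof -
    have "\<forall>\<^sub>F t in at 0. eval2 f (1 / t ^ n i) (Y i t) = 0"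
      using evb by eventually_elim (use a(5)[OF i] in \<open>simp add: eval2_evx\<close>)
    then have "poly (Up (n i * m i) (embP f)) (cp (m i) (L i)) = 0"
      using a(4)[OF i] m[OF i] L[OF i] by (intro laurent_root) auto
    then show ?thesis using m(2)[OF i] by (simp add: y_def)
  qed
  have inj: "inj_on y {..<degree f}"
  proof (rule inj_onI)
    fix i j assume ij: "i \<in> {..<degree f}" "j \<in> {..<degree f}" "y i = y j"
    have "\<forall>\<^sub>F \<tau> in at 0. eval_fls (y i) \<tau> = Y i (\<tau> ^ m i)" "\<forall>\<^sub>F \<tau> in at 0. eval_fls (y i) \<tau> = Y j (\<tau> ^ m j)"
      using yL[of i] yL[of j] ij by (auto simp: has_laurent_expansion_def)
    then have "\<forall>\<^sub>F \<tau> in at 0. Y i (\<tau> ^ m i) = Y j (\<tau> ^ m j) \<and> \<tau> \<in> ball 0 \<rho> - {0}"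
      using evb by eventually_elim simp
    then obtain \<tau> where \<tau>: "Y i (\<tau> ^ m i) = Y j (\<tau> ^ m j)" "\<tau> \<in> ball 0 \<rho> - {0}"
      using eventually_happens'[OF at_neq_bot] by blast
    show "i = j" using inj_onD[OF a(7)[OF \<tau>(2)] _ ij(1,2)] \<tau>(1) by (simp add: m_def)
  qed
  have "Up N (embP f) = smult (lead_coeff (Up N (embP f))) (\<Prod>z\<in>y ` {..<degree f}. [:- z, 1:])"
    by (rule poly_eq_prod_roots) (use root card_image[OF inj] in \<open>auto simp: degree_Up[OF a(1)] degree_embP\<close>)
  also have "lead_coeff (Up N (embP f)) = cp N (emb (lead_coeff f))"
    by (simp add: degree_Up[OF a(1)] degree_embP coeff_Up[OF a(1)] coeff_embP)
  also have "(\<Prod>z\<in>y ` {..<degree f}. [:- z, 1:]) = (\<Prod>z\<leftarrow>map y [0..<degree f]. [:- z, 1:])"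
  proof -
    have "(\<Prod>z\<in>y ` {..<degree f}. [:- z, 1:]) = (\<Prod>i<degree f. [:- y i, 1:])"
      by (rule prod.reindex_cong[OF inj]) auto
    also have "\<dots> = (\<Prod>z\<leftarrow>map y [0..<degree f]. [:- z, 1:])"
    proof -
      have "(\<Prod>i<k. h i) = (\<Prod>i\<leftarrow>[0..<k]. h i)" for k and h :: "nat \<Rightarrow> complex fls poly"
        by (induction k) (auto simp: mult.commute)
      then show ?thesis by (simp only: list.map_comp o_def)
    qed
    finally show ?thesis .
  qed
  finally have "Up N (embP f) = smult (cp N (emb (lead_coeff f))) (\<Prod>z\<leftarrow>map y [0..<degree f]. [:- z, 1:])" .
  moreover have "branch_root F N (y i)" if i: "i < degree f" for i
    unfolding branch_root_def
    by (rule exI[of _ "n i"], rule exI[of _ "m i"], rule exI[of _ "Y i"], rule exI[of _ "L i"])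
       (use a(4)[OF i] m[OF i] L[OF i] branch_dvd[OF br[OF i] F] in \<open>auto simp: y_def\<close>)
  ultimately show ?thesis unfolding splits_def using a(1) by (intro exI[of _ N] conjI exI[of _ "map y [0..<degree f]"]) auto
qed

lemma splits_all: "f \<noteq> 0 \<Longrightarrow> f dvd F \<Longrightarrow> \<exists>N>0. splits f F N"
proof (induction f rule: prime_divisors_induct)
  case (unit x)
  then have "degree x = 0" by (metis is_unit_poly_iff degree_pCons_0)
  then show ?case using splits_const[of x 1] by auto
next
  case (factor p x)
  have d: "p dvd F" "x dvd F" "x \<noteq> 0" using factor.prems dvd_mult_left dvd_mult_right by auto
  obtain N where N: "N > 0" "splits x F N" using factor.IH d by blast
  have "\<exists>M>0. splits p F M"
  proof (cases "degree p = 0")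
    case True then show ?thesis using splits_const[of p 1] by auto
  next
    case False then show ?thesis using splits_prime[of p F] factor.hyps d by auto
  qed
  then obtain M where M: "M > 0" "splits p F M" by blast
  have "splits (p * x) F (N * M)"
    using splits_mult[OF N(2,1) M(1)] splits_mult[OF M(2,1) N(1)] N(1) M(1)
    by (intro splits_prod) (auto simp: mult.commute)
  then show ?case using N(1) M(1) by (intro exI[of _ "N * M"]) auto
qed simp

section \<open>Puiseux expansions and Laurent series\<close>

lemma eval_fps_sums:
  fixes F :: "complex fps"
  assumes "ereal (norm z) < fps_conv_radius F"
  shows "(\<lambda>n. fps_nth F n * z ^ n) sums eval_fps F z"
  unfolding eval_fps_def by (rule summable_sums[OF summable_fps[OF assms]])

lemma shifted_exponent:
  fixes k :: int
  assumes "p > 0"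
  shows "(1 + of_int k / of_nat p :: rat) = of_int (k + int p) / of_nat p"
    "(1 + of_int k / of_nat p :: rat) < 0 \<longleftrightarrow> k + int p < 0"
    "(1 + of_int k / of_nat p :: rat) \<le> 0 \<longleftrightarrow> k + int p \<le> 0"
proof -
  show e: "(1 + of_int k / of_nat p :: rat) = of_int (k + int p) / of_nat p"
    using assms by (simp add: field_simps)
  show "(1 + of_int k / of_nat p :: rat) < 0 \<longleftrightarrow> k + int p < 0"
    unfolding e using assms by (simp add: divide_less_0_iff del: of_int_add)
  show "(1 + of_int k / of_nat p :: rat) \<le> 0 \<longleftrightarrow> k + int p \<le> 0"
    unfolding e using assms by (simp add: divide_le_0_iff del: of_int_add)
qed

text \<open>
  The local parameter \<open>s\<close> in a Puiseux expansion is determined by \<open>s\<^sup>p =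
  t\<^sup>p\<close> up to a root of unity.
\<close>

lemma fps_root_of_X_power:
  fixes S :: "complex fps"
  assumes p: "p > 0" and S: "S ^ p = fps_X ^ p"
  shows "\<exists>\<zeta>\<in>unity_roots p. S = fps_const \<zeta> * fps_X"
proof -
  define P where "P = (monom 1 p - [:fps_X ^ p:] :: complex fps poly)"
  have P2: "P = monom 1 p + [:- (fps_X ^ p):]" unfolding P_def by simp
  have d: "degree P = p" unfolding P2 using p
    by (subst degree_add_eq_left) (auto simp: degree_monom_eq)
  have lc: "lead_coeff P = 1" unfolding d using p by (cases p) (auto simp: P_def)
  let ?z = "\<lambda>\<zeta>. fps_const \<zeta> * fps_X :: complex fps"
  have inj: "inj_on ?z (unity_roots p)"
  proof (rule inj_onI)
    fix a b :: complex assume "?z a = ?z b"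
    then have "fps_nth (?z a) 1 = fps_nth (?z b) 1" by simp
    then show "a = b" by simp
  qed
  have "P = smult (lead_coeff P) (\<Prod>z\<in>?z ` unity_roots p. [:- z, 1:])"
  proof (rule poly_eq_prod_roots)
    fix z assume "z \<in> ?z ` unity_roots p"
    then obtain \<zeta> where z: "\<zeta> \<in> unity_roots p" "z = ?z \<zeta>" by auto
    have "z ^ p = fps_const (\<zeta> ^ p) * fps_X ^ p" by (simp add: z(2) power_mult_distrib fps_const_power)
    also have "\<dots> = fps_X ^ p" using z(1) by (simp add: unity_roots_def)
    finally show "poly P z = 0" by (simp add: P_def poly_monom)
  qed (use unity_roots_fin[OF p] unity_roots_card[OF p] card_image[OF inj] d in auto)
  then have "P = (\<Prod>z\<in>?z ` unity_roots p. [:- z, 1:])" unfolding lc by simp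
  then have "poly P S = (\<Prod>z\<in>?z ` unity_roots p. S - z)" by (simp add: poly_prod)
  moreover have "poly P S = 0" using S by (simp add: P_def poly_monom)
  ultimately have "\<exists>z\<in>?z ` unity_roots p. S - z = 0" using unity_roots_fin[OF p] by simp
  then show ?thesis by auto
qed

text \<open>
  For a branch \<open>x = t\<^bsup>-p\<^esup>\<close>, \<open>y = Y t\<close> with Laurent series
  \<open>L\<close>, the expansions of \<open>v = y/x\<close> in \<open>u\<close> are the
  conjugates of \<open>t\<^sup>p L\<close>. The exponent \<open>k\<close> in \<open>L\<close>
  corresponds to the exponent \<open>1 + k/p\<close> of \<open>u\<close>.
\<close>

lemma puiseux_laurent:
  assumes pe: "puiseux_expansion_at_O (\<lambda>t. 1 / t ^ p) Y \<theta>" and p: "p > 0"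
    and L: "Y has_laurent_expansion L"
  shows "\<exists>\<zeta>\<in>unity_roots p. (\<forall>q. \<theta> q \<noteq> 0 \<longrightarrow> of_nat p * q \<in> \<int>) \<and>
    (\<forall>k. fls_nth L k = \<theta> (1 + of_int k / of_nat p) * \<zeta> powi k)"
proof -
  obtain p' s where ps: "puiseux_series \<theta>" "p' > (0::nat)" "\<And>q. \<theta> q \<noteq> 0 \<Longrightarrow> of_nat p' * q \<in> \<int>"
    "s analytic_on {0}" "s 0 = 0" "deriv s 0 \<noteq> 0"
    and ev: "\<forall>\<^sub>F t in at 0. 1 / (1 / t ^ p) = s t ^ p' \<and>
           (\<lambda>m. \<theta> (of_nat m / of_nat p') * s t ^ m) sums (Y t / (1 / t ^ p))"
    using pe unfolding puiseux_expansion_at_O_def by blast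
  define S where "S = fps_expansion s 0"
  have S: "s has_fps_expansion S" unfolding S_def by (rule analytic_at_imp_has_fps_expansion_0[OF ps(4)])
  have S0: "fps_nth S 0 = 0" "fps_nth S 1 \<noteq> 0" using fps_nth_fps_expansion[OF S] ps(5,6) by auto
  have "subdegree S = 1" by (rule subdegreeI) (use S0 in auto)
  have ev1: "\<forall>\<^sub>F t in nhds 0. s t ^ p' = t ^ p"
    using eventually_conj[OF ev ev] ps(2,5) p
    by (auto simp: eventually_at_filter power_0_left elim!: eventually_mono)
  have "(\<lambda>t. s t ^ p') has_fps_expansion S ^ p'" by (intro fps_expansion_intros S)
  moreover have "(\<lambda>t. t ^ p) has_fps_expansion (fps_X ^ p :: complex fps)" by (intro fps_expansion_intros)
  ultimately have Sp: "S ^ p' = fps_X ^ p"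
    using fps_expansion_unique_complex has_fps_expansion_cong[OF ev1 refl] by blast
  have "subdegree (S ^ p') = p'" using \<open>subdegree S = 1\<close> by (simp add: subdegree_power)
  then have pp: "p' = p" unfolding Sp by (simp add: subdegree_power)
  obtain \<zeta> where z: "\<zeta> \<in> unity_roots p" "S = fps_const \<zeta> * fps_X" using fps_root_of_X_power[OF p] Sp pp by blast
  have zz: "\<zeta> \<noteq> 0" using unity_roots_nz[OF p z(1)] .
  have "(\<lambda>t. \<zeta> * t) has_fps_expansion fps_const \<zeta> * fps_X" by (intro fps_expansion_intros)
  then have "\<forall>\<^sub>F t in nhds 0. s t = \<zeta> * t"
    using S unfolding z(2) has_fps_expansion_def by (auto elim: eventually_elim2)
  then have evs: "\<forall>\<^sub>F t in at 0. s t = \<zeta> * t" by (simp add: eventually_at_filter eventually_mono)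
  define F where "F = Abs_fps (\<lambda>m. \<theta> (of_nat m / of_nat p) * \<zeta> ^ m)"
  have evF: "\<forall>\<^sub>F t in at 0. (\<lambda>m. fps_nth F m * t ^ m) sums (Y t * t ^ p)"
    using ev evs by eventually_elim (simp add: F_def pp power_mult_distrib mult_ac)
  have "\<exists>t. t \<noteq> 0 \<and> (\<lambda>m. fps_nth F m * t ^ m) sums (Y t * t ^ p)"
    using eventually_happens'[OF at_neq_bot eventually_conj[OF evF eventually_neq_at_within[of 0]]] by blast
  then obtain t0 where t0: "t0 \<noteq> 0" "(\<lambda>m. fps_nth F m * t0 ^ m) sums (Y t0 * t0 ^ p)" by blast
  have "ereal (norm t0) \<le> fps_conv_radius F"
    unfolding fps_conv_radius_def by (rule conv_radius_geI) (rule sums_summable[OF t0(2)])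
  then have rad: "fps_conv_radius F > 0" using t0(1) by (metis ereal_less(2) less_le_trans zero_less_norm_iff)
  have A1: "eval_fps F has_laurent_expansion fps_to_fls F"
    by (intro has_laurent_expansion_fps eval_fps_has_fps_expansion rad)
  have A2: "\<forall>\<^sub>F t in at 0. eval_fps F t = Y t * t ^ p"
    using evF by eventually_elim (simp add: eval_fps_def sums_iff)
  have A: "(\<lambda>t. Y t * t ^ p) has_laurent_expansion fps_to_fls F"
    by (rule iffD1[OF has_laurent_expansion_cong[OF A2 refl] A1])
  have B: "(\<lambda>t. Y t * t ^ p) has_laurent_expansion (L * fls_X_intpow (int p))"
    by (intro laurent_expansion_intros L)
  have LF: "L * fls_X_intpow (int p) = fps_to_fls F" by (rule has_laurent_expansion_unique[OF B A])
  have nth: "fls_nth L k = fls_nth (fps_to_fls F) (k + int p)" for k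
    unfolding LF[symmetric] by (simp add: fls_shifted_times_simps)
  have "fls_nth L k = \<theta> (1 + of_int k / of_nat p) * \<zeta> powi k" for k
  proof (cases "k + int p \<ge> 0")
    case False
    then have "(1 + of_int k / of_nat p :: rat) < 0" by (simp only: shifted_exponent(2)[OF p] not_le)
    then have "\<theta> (1 + of_int k / of_nat p) = 0" using ps(1) unfolding puiseux_series_def by (blast dest: less_asym)
    then show ?thesis using False by (simp add: nth)
  next
    case True
    define j where "j = nat (k + int p)"
    have j: "k + int p = int j" using True by (simp add: j_def)
    then have k: "k = int j - int p" by simp
    have "fls_nth L k = \<theta> (of_nat j / of_nat p) * \<zeta> ^ j" unfolding nth j by (simp add: F_def)
    moreover have "(of_nat j / of_nat p :: rat) = 1 + of_int k / of_nat p" using p by (simp add: k field_simps)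
    moreover have "\<zeta> ^ j = \<zeta> powi k"
      unfolding k using zz z(1) by (simp add: power_int_diff unity_roots_def)
    ultimately show ?thesis by simp
  qed
  then show ?thesis using z(1) ps(3) pp by auto
qed

lemma complex_nth_root_exists: "m > 0 \<Longrightarrow> \<exists>z::complex. z ^ m = w"
proof (cases "w = 0")
  case False
  assume m: "m > 0"
  have "exp (Ln w / of_nat m) ^ m = exp (of_nat m * (Ln w / of_nat m))" by (rule exp_of_nat_mult[symmetric])
  also have "\<dots> = w" using m False by simp
  finally show ?thesis by blast
qed (auto simp: power_0_left intro: exI[of _ 0])

section \<open>Closeness of branches to the given series\<close>

context key_data
begin

lemma below_e: "k < e \<longleftrightarrow> 1 + of_int k / of_nat N < r"
proof -
  have N': "(of_nat N :: rat) > 0" using N by simp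
  have "k < e \<longleftrightarrow> (of_int k :: rat) < of_nat N * (r - 1)" unfolding e[symmetric] by simp
  also have "\<dots> \<longleftrightarrow> of_int k / of_nat N < r - 1" using N' by (simp add: divide_less_eq mult.commute)
  finally show ?thesis by linarith
qed

text \<open>
  Passing from \<open>u\<^bsup>1/p\<^esup>\<close> to \<open>u\<^bsup>1/N\<^esup>\<close>, the
  conjugating root of unity has to be replaced by an \<open>m\<close>-th root.
\<close>

lemma conj_close_of_expansion:
  assumes p: "p > 0" "m > 0" "N = p * m" and z: "\<zeta> \<in> unity_roots p"
    and fr: "\<And>q. \<theta>' q \<noteq> 0 \<Longrightarrow> of_nat p * q \<in> \<int>"
    and L: "\<And>k. fls_nth L k = \<theta>' (1 + of_int k / of_nat p) * \<zeta> powi k"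
    and close: "ord_diff_ge \<theta>' \<psi> r"
  shows "conj_close (cp m L)"
proof -
  (* Conjugation of t = u^(1/N) by z induces that of u^(1/p) by the inverse of \<zeta>, which
     undoes the choice of the local parameter in the expansion. *)
  obtain z where zm: "z ^ m = inverse \<zeta>" using complex_nth_root_exists[OF p(2)] by blast
  have "z ^ N = (z ^ m) ^ p" by (simp add: p(3) power_mult[symmetric] mult.commute)
  then have zN: "z \<in> unity_roots N" using z zm by (simp add: unity_roots_def power_inverse)
  have zz: "\<zeta> \<noteq> 0" using unity_roots_nz[OF p(1) z] .
  have pz: "\<theta>' q = \<psi> q" if "q < r" for q using close that unfolding ord_diff_ge_def by (metis eq_iff_diff_eq_0 not_le)
  have "fls_nth (rot z (cp m L)) k = fls_nth \<phi> k" if k: "k < e" for k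
  proof -
    have ph: "fls_nth \<phi> k = \<theta>' (1 + of_int k / of_nat N)" using k pz below_e by (simp add: phi)
    show ?thesis
    proof (cases "int m dvd k")
      case True
      then obtain j where j: "k = int m * j" by auto
      have q: "(1 + of_int k / of_nat N :: rat) = 1 + of_int j / of_nat p" using p by (simp add: j)
      have "z powi k = (inverse \<zeta>) powi j" unfolding j power_int_mult by (simp add: zm)
      moreover have "\<zeta> powi j \<noteq> 0" using zz by simp
      ultimately show ?thesis using p(2) unfolding ph q by (simp add: j fls_nth_compose_power L power_int_inverse mult_ac)
    next
      case False
      have "\<theta>' (1 + of_int k / of_nat N) = 0"
      proof (rule ccontr)
        assume "\<theta>' (1 + of_int k / of_nat N) \<noteq> 0"
        then have "of_nat p * (1 + of_int k / of_nat N :: rat) \<in> \<int>" by (rule fr)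
        then obtain i where i: "of_nat p * (1 + of_int k / of_nat N :: rat) = of_int i" by (rule Ints_cases)
        have i2: "of_nat p * (1 + of_int k / of_nat N :: rat) = of_nat p + of_int k / of_nat m"
          unfolding p(3) using p(1) by (simp add: distrib_left)
        have m0: "(of_nat m :: rat) \<noteq> 0" using p(2) by simp
        have i3: "of_nat p + of_int k / of_nat m = (of_int i :: rat)" by (rule trans[OF i2[symmetric] i])
        have "(of_int (int p * int m + k) :: rat) = of_nat m * (of_nat p + of_int k / of_nat m)"
          using m0 by (simp add: distrib_left mult.commute)
        also have "\<dots> = of_int (int m * i)" unfolding i3 by simp
        finally have "(of_int (int p * int m + k) :: rat) = of_int (int m * i)" .
        then have "int p * int m + k = int m * i" by (simp only: of_int_eq_iff)
        then have "k = int m * (i - int p)" by (simp add: algebra_simps)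
        then show False using False by simp
      qed
      then show ?thesis using False p(2) by (simp add: ph fls_nth_compose_power)
    qed
  qed
  then show ?thesis unfolding conj_close_def close_def using zN by blast
qed

lemma expansion_of_conj_close:
  assumes p: "p > 0" "m > 0" "N = p * m" and conj_close: "conj_close (cp m L)"
  shows "\<exists>\<zeta>\<in>unity_roots p. (\<forall>k. 1 + of_int k / of_nat p < r \<longrightarrow> \<zeta> powi k * fls_nth L k = \<psi> (1 + of_int k / of_nat p))
     \<and> (\<forall>q. q < r \<longrightarrow> of_nat p * q \<notin> \<int> \<longrightarrow> \<psi> q = 0)"
proof -
  obtain z where z: "z \<in> unity_roots N" "close (rot z (cp m L))" using conj_close conj_close_def by blast
  have zp: "z ^ m \<in> unity_roots p" using z(1) by (simp add: unity_roots_def p(3) power_mult[symmetric] mult.commute)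
  have eq: "z powi k * fls_nth (cp m L) k = \<psi> (1 + of_int k / of_nat N)" if "k < e" for k
    using z(2) that by (simp add: close_def phi)
  have "(z ^ m) powi k * fls_nth L k = \<psi> (1 + of_int k / of_nat p)" if k: "1 + of_int k / of_nat p < r" for k
  proof -
    have q: "(1 + of_int (int m * k) / of_nat N :: rat) = 1 + of_int k / of_nat p" using p by simp
    then have "int m * k < e" using k below_e[of "int m * k"] by simp
    from eq[OF this] show ?thesis unfolding q using p(2) by (simp add: fls_nth_compose_power power_int_mult)
  qed
  moreover have "\<psi> q = 0" if q: "q < r" "of_nat p * q \<notin> \<int>" for q
  proof (rule ccontr)
    assume nz: "\<psi> q \<noteq> 0"
    then have "of_nat N * q \<in> \<int>" by (rule psi_frac)
    then obtain i where i: "of_nat N * q = of_int i" by (rule Ints_cases)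
    define k where "k = i - int N"
    have qk: "q = 1 + of_int k / of_nat N" using i N by (simp add: k_def field_simps)
    then have ke: "k < e" using q(1) below_e by simp
    have "int m dvd k"
    proof (rule ccontr)
      assume "\<not> int m dvd k"
      then show False using eq[OF ke] nz p(2) by (simp add: qk fls_nth_compose_power)
    qed
    then obtain j where "k = int m * j" by auto
    then have "of_nat p * q = of_int (int p + j)" using p by (simp add: qk field_simps)
    then show False using q(2) by simp
  qed
  ultimately show ?thesis using zp by blast
qed

end

text \<open>
  On a branch of a monic curve \<open>x\<close> has a pole, since \<open>y\<close> is bounded in
  terms of \<open>x\<close>. If \<open>p\<close> is its order, then \<open>1/x\<close> is a
  \<open>p\<close>-th power of a local parameter \<open>s\<close>, and in terms of
  \<open>s\<close> the branch takes the form \<open>x = s\<^bsup>-p\<^esup>\<close>, \<open>y = Z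
  s\<close>.
\<close>

lemma branch_normal_form:
  assumes b: "branch_at_infinity f X Y" and f: "lead_coeff f = 1" "degree f > 0"
  obtains p s Z L where "p > (0::nat)" "s analytic_on {0}" "s 0 = 0" "deriv s 0 \<noteq> 0"
    "\<forall>\<^sub>F t in at 0. 1 / X t = s t ^ p" "\<forall>\<^sub>F t in at 0. Y t = Z (s t)" "filterlim s (at 0) (at 0)"
    "Z has_laurent_expansion L" "\<forall>\<^sub>F t in at 0. eval2 f (1 / t ^ p) (Z t) = 0" "is_pole X 0"
proof -
  obtain \<epsilon> where mX: "X meromorphic_on {0}" and mY: "Y meromorphic_on {0}" and pole: "is_pole X 0 \<or> is_pole Y 0"
    and eps: "\<epsilon> > 0" "\<And>t. t \<in> ball 0 \<epsilon> - {0} \<Longrightarrow> eval2 f (X t) (Y t) = 0"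
    using b unfolding branch_at_infinity_def by blast
  have evb: "\<forall>\<^sub>F t in at (0::complex). t \<in> ball 0 \<epsilon> - {0}"
    using eps(1) by (simp add: eventually_at) (metis dist_commute)
  have lc: "poly (lead_coeff f) a = 1" for a using f by simp
  have dg: "degree (evx a f) = degree f" for a by (rule degree_evx) (simp add: f)
  have pX: "is_pole X 0"
  proof (rule ccontr)
    assume nX: "\<not> is_pole X 0"
    then have pY: "is_pole Y 0" using pole by simp
    obtain c where c: "(X \<longlongrightarrow> c) (at 0)"
      using mX nX by (auto simp: not_essential_def meromorphic_at_iff)
    define M where "M = (\<lambda>a. 1 + (\<Sum>i<degree f. norm (poly (coeff f i) a)))"
    have "((\<lambda>t. M (X t)) \<longlongrightarrow> M c) (at 0)" unfolding M_def
      by (intro tendsto_intros c)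
    then have "\<forall>\<^sub>F t in at 0. M (X t) < M c + 1" by (rule order_tendstoD) simp
    moreover have "\<forall>\<^sub>F t in at 0. norm (Y t) \<ge> M c + 1"
    proof -
      have "filterlim (\<lambda>t. norm (Y t)) at_top (at 0)"
        using pY unfolding is_pole_def by (rule filterlim_at_infinity_imp_norm_at_top)
      then show ?thesis by (simp add: filterlim_at_top)
    qed
    ultimately have "\<forall>\<^sub>F t in at (0::complex). False" using evb
    proof eventually_elim
      case (elim t)
      have "poly (evx (X t) f) (Y t) = 0" using eps(2)[OF elim(3)] by (simp add: eval2_evx)
      then have "norm (Y t) \<le> M (X t)"
        unfolding M_def using monic_root_bound[of "evx (X t) f" "Y t"] dg[of "X t"] f lc[of "X t"] by (simp add: coeff_evx)
      then show ?case using elim by linarith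
    qed
    then show False by simp
  qed
  obtain FX where FX: "X has_laurent_expansion FX" using mX by (auto simp: meromorphic_on_def)
  obtain FY where FY: "Y has_laurent_expansion FY" using mY by (auto simp: meromorphic_on_def)
  have sd: "fls_subdegree FX < 0" by (rule is_pole_0_imp_neg_fls_subdegree[OF FX pX])
  then have FXnz: "FX \<noteq> 0" by auto
  (* The order of the pole of x on the branch. *)
  define p where "p = nat (- fls_subdegree FX)"
  have p: "p > 0" "fls_subdegree FX = - int p" using sd by (auto simp: p_def)
  define Hf where "Hf = fls_base_factor_to_fps (inverse FX)"
  have IX: "(\<lambda>t. inverse (X t)) has_laurent_expansion inverse FX" by (intro laurent_expansion_intros FX)
  have sdI: "fls_subdegree (inverse FX) = int p" using p FXnz by (simp add: fls_inverse_subdegree')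
  have dec: "inverse FX = fls_X_intpow (int p) * fps_to_fls Hf"
    using fls_conv_base_factor_to_fps_shift_subdegree[of "inverse FX"] sdI p(2) by (simp add: Hf_def fls_shifted_times_simps)
  have H0: "fps_nth Hf 0 \<noteq> 0"
  proof -
    have "inverse FX \<noteq> 0" using FXnz by simp
    then have "fls_nth (inverse FX) (int p) \<noteq> 0" using nth_fls_subdegree_nonzero unfolding sdI[symmetric] by blast
    then show ?thesis using p(2) by (simp add: Hf_def)
  qed
  have "(\<lambda>t. inverse (X t) * t powi (- int p)) has_laurent_expansion (inverse FX * fls_X_intpow (- int p))"
    by (intro laurent_expansion_intros IX)
  also have "inverse FX * fls_X_intpow (- int p) = fps_to_fls Hf"
  proof -
    have "fls_X_intpow (int p) * fls_X_intpow (- int p) = (1 :: complex fls)" unfolding X_intpow_add by simp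
    then show ?thesis unfolding dec by (metis mult.commute mult.left_commute mult_1)
  qed
  finally have HL: "(\<lambda>t. inverse (X t) * t powi (- int p)) has_laurent_expansion fps_to_fls Hf" .
  have rad: "fps_conv_radius Hf > 0" using HL by (simp add: has_laurent_expansion_def)
  define h where "h = eval_fps Hf"
  have hfe: "h has_fps_expansion Hf" unfolding h_def by (rule eval_fps_has_fps_expansion[OF rad])
  have han: "h analytic_on {0}" by (rule has_fps_expansion_imp_analytic_0[OF hfe])
  have h0: "h 0 \<noteq> 0" using H0 by (simp add: h_def eval_fps_at_0)
  have evh: "\<forall>\<^sub>F t in at 0. inverse (X t) = t ^ p * h t"
  proof -
    have "\<forall>\<^sub>F t in at 0. h t = inverse (X t) * t powi (- int p)"
    proof -
      have e1: "h has_laurent_expansion fps_to_fls Hf" by (rule has_laurent_expansion_fps[OF hfe])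
      show ?thesis using e1 HL unfolding has_laurent_expansion_def by (auto elim: eventually_elim2)
    qed
    moreover have "\<forall>\<^sub>F t in at (0::complex). t \<noteq> 0" by (simp add: eventually_at_filter)
    ultimately show ?thesis by eventually_elim (simp add: power_int_minus field_simps)
  qed
  obtain c where c: "c ^ p = h 0" using complex_nth_root_exists[OF p(1)] by blast
  have cz: "c \<noteq> 0" using c h0 p(1) by (auto simp: power_0_left)
  (* A holomorphic p-th root of h near 0; the quotient h t / h 0 is close to 1, where Ln is
     holomorphic. *)
  define w where "w = (\<lambda>t. c * exp (Ln (h t / h 0) / of_nat p))"
  define s where "s = (\<lambda>t. t * w t)"
  have "h 0 / h 0 \<notin> \<real>\<^sub>\<le>\<^sub>0" using h0 by simp
  then have wan: "w analytic_on {0}" unfolding w_def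
    using p(1) h0 by (intro analytic_intros han) auto
  have san: "s analytic_on {0}" unfolding s_def by (intro analytic_intros wan)
  have s0: "s 0 = 0" by (simp add: s_def)
  have w0: "w 0 = c" using h0 by (simp add: w_def)
  have ds: "deriv s 0 \<noteq> 0"
  proof -
    have wd: "w field_differentiable at 0" using wan by (rule analytic_on_imp_differentiable_at) simp
    then have "(w has_field_derivative deriv w 0) (at 0)" by (simp add: field_differentiable_derivI)
    then have "(s has_field_derivative (1 * w 0 + deriv w 0 * 0)) (at 0)" unfolding s_def
      by (intro derivative_eq_intros) auto
    then have "deriv s 0 = w 0" by (simp add: DERIV_imp_deriv)
    then show ?thesis using w0 cz by simp
  qed
  have evnz: "\<forall>\<^sub>F t in at 0. h t \<noteq> 0"
  proof -
    have "isCont h 0" using analytic_at_imp_isCont[OF han] .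
    then show ?thesis using h0 by (metis isContD tendsto_imp_eventually_ne)
  qed
  have evs: "\<forall>\<^sub>F t in at 0. 1 / X t = s t ^ p"
    using evh evnz
  proof eventually_elim
    case (elim t)
    have "w t ^ p = c ^ p * exp (of_nat p * (Ln (h t / h 0) / of_nat p))"
      by (simp only: w_def power_mult_distrib exp_of_nat_mult)
    also have "\<dots> = h t" using p(1) h0 elim(2) c by simp
    finally have "w t ^ p = h t" .
    then show ?case using elim(1) by (simp add: s_def power_mult_distrib inverse_eq_divide)
  qed
  obtain U where U: "open U" "0 \<in> U" "s holomorphic_on U" using san by (auto simp: analytic_at)
  obtain \<rho> where \<rho>: "\<rho> > 0" "ball 0 \<rho> \<subseteq> U" "open (s ` ball 0 \<rho>)" "inj_on s (ball 0 \<rho>)"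
    using has_complex_derivative_locally_invertible[OF U(3,2,1) ds] by blast
  have shol: "s holomorphic_on ball 0 \<rho>" using U(3) \<rho>(2) by (rule holomorphic_on_subset)
  have "\<exists>gi. gi holomorphic_on (s ` ball 0 \<rho>) \<and> (\<forall>z\<in>ball 0 \<rho>. gi (s z) = z)"
  proof (rule holomorphic_has_inverse[OF shol open_ball \<rho>(4)])
    fix h assume "h holomorphic_on (s ` ball 0 \<rho>)" "\<And>z. z \<in> ball 0 \<rho> \<Longrightarrow> h (s z) = z"
    then show ?thesis by (intro exI[of _ h] conjI ballI)
  qed
  then obtain gi where gi: "gi holomorphic_on (s ` ball 0 \<rho>)" "\<forall>z\<in>ball 0 \<rho>. gi (s z) = z"
    by (elim exE conjE)
  have gi3: "gi (s z) = z" if "z \<in> ball 0 \<rho>" for z using gi(2) that by (rule bspec)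
  have gi0: "gi 0 = 0" using gi3[of 0] \<rho>(1) s0 by simp
  have zin: "0 \<in> s ` ball 0 \<rho>" using \<rho>(1) s0 by (intro image_eqI[of 0 s 0]) auto
  have gian: "gi analytic_on {0}" using gi(1) \<rho>(3) zin by (auto simp: analytic_at)
  define Gf where "Gf = fps_expansion gi 0"
  have Gf: "gi has_fps_expansion Gf" unfolding Gf_def by (rule analytic_at_imp_has_fps_expansion_0[OF gian])
  have Gf0: "fps_nth Gf 0 = 0" using fps_nth_fps_expansion[OF Gf, of 0] gi0 by simp
  have evW: "\<forall>\<^sub>F x in at 0. x \<in> s ` ball 0 \<rho>" 
    by (rule eventually_at_in_open'[OF \<rho>(3) zin])
  have sgi: "s (gi x) = x" "gi x \<in> ball 0 \<rho>" if "x \<in> s ` ball 0 \<rho>" for x using that gi3 by auto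
  have ginz: "gi x \<noteq> 0" if "x \<in> s ` ball 0 \<rho>" "x \<noteq> 0" for x using sgi(1)[OF that(1)] that(2) s0 by metis
  have limgi: "filterlim gi (at 0) (at 0)"
    unfolding filterlim_at
  proof
    show "\<forall>\<^sub>F x in at 0. gi x \<in> UNIV \<and> gi x \<noteq> 0"
      using eventually_conj[OF evW eventually_neq_at_within[of 0 0 UNIV]] by eventually_elim (use ginz in auto)
    show "(gi \<longlongrightarrow> 0) (at 0)" using analytic_at_imp_isCont[OF gian] gi0 by (metis isContD)
  qed
  have Gfnz: "Gf \<noteq> 0"
  proof
    assume "Gf = 0"
    then have "\<forall>\<^sub>F x in nhds 0. gi x = 0" using Gf by (simp add: has_fps_expansion_0_iff)
    then have "\<forall>\<^sub>F x in at 0. gi x = 0" by (simp add: eventually_at_filter eventually_mono)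
    moreover have "\<forall>\<^sub>F x in at 0. gi x \<noteq> 0" using limgi by (simp add: filterlim_at)
    ultimately have "\<forall>\<^sub>F x in at (0::complex). False" by eventually_elim simp
    then show False by simp
  qed
  define Z where "Z = Y \<circ> gi"
  have ZL: "Z has_laurent_expansion fls_compose_fps FY Gf"
    unfolding Z_def by (rule has_laurent_expansion_compose[OF FY has_laurent_expansion_fps[OF Gf] Gf0 Gfnz])
  have lims: "filterlim s (at 0) (at 0)"
    unfolding filterlim_at
  proof
    show "(s \<longlongrightarrow> 0) (at 0)" using analytic_at_imp_isCont[OF san] s0 by (metis isContD)
    have "\<forall>\<^sub>F t in at (0::complex). t \<in> ball 0 \<rho> - {0}"
      using \<rho>(1) by (simp add: eventually_at) (metis dist_commute)
    then show "\<forall>\<^sub>F t in at 0. s t \<in> UNIV \<and> s t \<noteq> 0"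
      by eventually_elim (use \<rho>(1,4) s0 in \<open>auto dest: inj_onD[of s _ _ 0]\<close>)
  qed
  have evY: "\<forall>\<^sub>F t in at 0. Y t = Z (s t)"
  proof -
    have "\<forall>\<^sub>F t in at (0::complex). t \<in> ball 0 \<rho> - {0}"
      using \<rho>(1) by (simp add: eventually_at) (metis dist_commute)
    then show ?thesis by eventually_elim (use gi3 in \<open>auto simp: Z_def\<close>)
  qed
  have "\<forall>\<^sub>F x in at 0. 1 / X (gi x) = s (gi x) ^ p \<and> gi x \<in> ball 0 \<epsilon> - {0}"
    by (rule eventually_compose_filterlim[OF eventually_conj[OF evs evb] limgi])
  then have evZ: "\<forall>\<^sub>F x in at 0. eval2 f (1 / x ^ p) (Z x) = 0"
    using evW
  proof eventually_elim
    case (elim x)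
    have "1 / X (gi x) = x ^ p" using elim sgi(1) by simp
    then have "X (gi x) = 1 / x ^ p" by (metis div_by_1 divide_divide_eq_right mult_1)
    moreover have "eval2 f (X (gi x)) (Y (gi x)) = 0" using elim by (intro eps) auto
    ultimately show ?case by (simp add: Z_def)
  qed
  show ?thesis by (rule that[OF p(1) san s0 ds evs evY lims ZL evZ pX])
qed

text \<open>
  Since \<open>\<psi>\<close> has only positive exponents and \<open>r > 0\<close>, agreement with
  \<open>\<psi>\<close> below \<open>r\<close> forces \<open>y/x\<close> to vanish at the point at
  infinity, so the branch passes through \<open>O\<close>.
\<close>

lemma expansion_from_normal_form:
  assumes nf: "p > (0::nat)" "s analytic_on {0}" "s 0 = 0" "deriv s 0 \<noteq> 0"
    "\<forall>\<^sub>F t in at 0. 1 / X t = s t ^ p" "\<forall>\<^sub>F t in at 0. Y t = Z (s t)" "filterlim s (at 0) (at 0)"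
    "Z has_laurent_expansion L" "is_pole X 0"
    and z: "\<zeta> \<in> unity_roots p" and r: "r > 0"
    and psi: "\<And>q. \<psi> q \<noteq> 0 \<Longrightarrow> q > 0"
    and c: "\<And>k. 1 + of_int k / of_nat p < r \<Longrightarrow> \<zeta> powi k * fls_nth L k = \<psi> (1 + of_int k / of_nat p)"
    and c': "\<And>q. q < r \<Longrightarrow> of_nat p * q \<notin> \<int> \<Longrightarrow> \<psi> q = 0"
  shows "meets_at_O X Y \<and> (\<exists>\<theta>. puiseux_expansion_at_O X Y \<theta> \<and> ord_diff_ge \<theta> \<psi> r)"
proof -
  have zz: "\<zeta> \<noteq> 0" using unity_roots_nz[OF nf(1) z] .
  define \<theta> where "\<theta> = (\<lambda>q::rat. if of_nat p * q \<in> \<int> then \<zeta> powi (\<lfloor>of_nat p * q\<rfloor> - int p) * fls_nth L (\<lfloor>of_nat p * q\<rfloor> - int p) else 0)"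
  have th: "\<theta> (1 + of_int k / of_nat p) = \<zeta> powi k * fls_nth L k" for k
  proof -
    have "of_nat p * (1 + of_int k / of_nat p :: rat) = of_int (int p + k)" using nf(1) by (simp add: field_simps)
    then show ?thesis unfolding \<theta>_def by (simp only: Ints_of_int floor_of_int) simp
  qed
  have th_psi: "\<theta> q = \<psi> q" if q: "q < r" for q
  proof (cases "of_nat p * q \<in> \<int>")
    case True
    then obtain i where i: "of_nat p * q = of_int i" by (rule Ints_cases)
    have qk: "q = 1 + of_int (i - int p) / of_nat p" using i nf(1) by (simp add: field_simps)
    show ?thesis using c[of "i - int p"] q th[of "i - int p"] unfolding qk[symmetric] by simp
  next
    case False
    then show ?thesis using c'[OF q] by (simp add: \<theta>_def)
  qed
  have th_pos: "q > 0" if "\<theta> q \<noteq> 0" for q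
  proof (rule ccontr)
    assume n: "\<not> q > 0"
    then have "q < r" using r by simp
    then show False using th_psi psi that n by metis
  qed
  have th_frac: "of_nat p * q \<in> \<int>" if "\<theta> q \<noteq> 0" for q using that by (auto simp: \<theta>_def split: if_splits)
  have ps: "puiseux_series \<theta>" unfolding puiseux_series_def using nf(1) th_pos th_frac by blast
  have od: "ord_diff_ge \<theta> \<psi> r" unfolding ord_diff_ge_def using th_psi by (metis diff_self not_le)
  define F where "F = Abs_fps (\<lambda>m. fls_nth L (int m - int p))"
  have Lneg: "fls_nth L k = 0" if k: "k \<le> - int p" for k
  proof -
    have "(1 + of_int k / of_nat p :: rat) \<le> 0" unfolding shifted_exponent(3)[OF nf(1)] using k by simp
    then have "\<theta> (1 + of_int k / of_nat p) = 0" using th_pos by (metis not_le)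
    then show ?thesis using zz by (simp add: th)
  qed
  have "(\<lambda>x. Z x * x ^ p) has_laurent_expansion (L * fls_X_intpow (int p))" by (intro laurent_expansion_intros nf(8))
  also have "L * fls_X_intpow (int p) = fps_to_fls F"
  proof (rule fls_eqI)
    fix k
    show "fls_nth (L * fls_X_intpow (int p)) k = fls_nth (fps_to_fls F) k"
      using Lneg[of "k - int p"] by (auto simp: F_def fls_shifted_times_simps)
  qed
  finally have FL: "(\<lambda>x. Z x * x ^ p) has_laurent_expansion fps_to_fls F" .
  have rad: "fps_conv_radius F > 0" using FL by (simp add: has_laurent_expansion_def)
  have evF: "\<forall>\<^sub>F x in at 0. eval_fps F x = Z x * x ^ p"
  proof -
    have e1: "eval_fps F has_laurent_expansion fps_to_fls F"
      by (intro has_laurent_expansion_fps eval_fps_has_fps_expansion rad)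
    show ?thesis using e1 FL unfolding has_laurent_expansion_def by (auto elim: eventually_elim2)
  qed
  have evr: "\<forall>\<^sub>F x in at (0::complex). ereal (norm x) < fps_conv_radius F"
  proof -
    have "\<forall>\<^sub>F x in nhds (0::complex). x \<in> eball 0 (fps_conv_radius F)"
      using rad by (intro eventually_nhds_in_open) (auto simp: zero_ereal_def)
    then show ?thesis by (auto simp: eventually_at_filter in_eball_iff elim: eventually_mono)
  qed
  have evc: "\<forall>\<^sub>F t in at 0. eval_fps F (s t) = Z (s t) * s t ^ p \<and> ereal (norm (s t)) < fps_conv_radius F"
    by (rule eventually_compose_filterlim[OF eventually_conj[OF evF evr] nf(7)])
  have YX: "\<forall>\<^sub>F t in at 0. Y t / X t = eval_fps F (s t)"
    using evc nf(5,6)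
  proof eventually_elim
    case (elim t)
    then show ?case by (metis divide_inverse inverse_eq_divide)
  qed
  (* The conjugate expansion is realized by the conjugate local parameter. *)
  define s' where "s' = (\<lambda>t. inverse \<zeta> * s t)"
  have "s field_differentiable at 0" using nf(2) by (rule analytic_on_imp_differentiable_at) simp
  then have ds': "deriv s' 0 \<noteq> 0" unfolding s'_def using nf(4) zz by simp
  have "puiseux_expansion_at_O X Y \<theta>"
    unfolding puiseux_expansion_at_O_def
  proof (intro conjI ps exI[of _ p] exI[of _ s'] allI impI)
    show "s' analytic_on {0}" unfolding s'_def by (intro analytic_intros nf(2))
    show "\<forall>\<^sub>F t in at 0. 1 / X t = s' t ^ p \<and> (\<lambda>m. \<theta> (of_nat m / of_nat p) * s' t ^ m) sums (Y t / X t)"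
      using evc nf(5) YX
    proof eventually_elim
      case (elim t)
      have zp: "\<zeta> ^ p = 1" using z by (simp add: unity_roots_def)
      have "s' t ^ p = s t ^ p" using zp by (simp add: s'_def power_mult_distrib power_inverse)
      moreover have "(\<lambda>m. \<theta> (of_nat m / of_nat p) * s' t ^ m) sums (Y t / X t)"
      proof -
        have "\<theta> (of_nat m / of_nat p) * s' t ^ m = fps_nth F m * s t ^ m" for m
        proof -
          have q: "(of_nat m / of_nat p :: rat) = 1 + of_int (int m - int p) / of_nat p" using nf(1) by (simp add: field_simps)
          have "\<theta> (of_nat m / of_nat p) = \<zeta> ^ m * fls_nth L (int m - int p)"
            unfolding q th using zz zp by (simp add: power_int_diff)
          then show ?thesis using zz by (simp add: s'_def F_def power_mult_distrib power_inverse)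
        qed
        moreover have "(\<lambda>m. fps_nth F m * s t ^ m) sums eval_fps F (s t)" using elim by (intro eval_fps_sums) auto
        ultimately show ?thesis using elim(3) by simp
      qed
      ultimately show ?case using elim(2) by simp
    qed
  qed (use nf ds' th_frac in \<open>auto simp: s'_def\<close>)
  moreover have "meets_at_O X Y"
    unfolding meets_at_O_def
  proof
    have "isCont (eval_fps F) 0"
      using analytic_at_imp_isCont[OF has_fps_expansion_imp_analytic_0[OF eval_fps_has_fps_expansion[OF rad]]] .
    then have "(eval_fps F \<longlongrightarrow> eval_fps F 0) (at 0)" by (rule isContD)
    moreover have "eval_fps F 0 = 0" using Lneg[of "- int p"] by (simp add: eval_fps_at_0 F_def)
    ultimately have "((\<lambda>t. eval_fps F (s t)) \<longlongrightarrow> 0) (at 0)" using filterlim_compose[OF _ nf(7)] by metis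
    then show "((\<lambda>t. Y t / X t) \<longlongrightarrow> 0) (at 0)"
      by (rule Lim_transform_eventually) (use YX in \<open>auto elim: eventually_mono\<close>)
  qed (rule nf(9))
  ultimately show ?thesis using od by blast
qed

section \<open>The equivalence\<close>

theorem theorem4p7:
  fixes \<psi> :: "rat \<Rightarrow> complex" and r :: rat
    and \<delta> :: "ratfun \<Rightarrow> int" and n :: nat and g :: "nat \<Rightarrow> ratfun"
  assumes "puiseux_series \<psi>" and "r > 0"
    and "semidegree \<delta>"
    and "generic_descending_puiseux \<delta> (terms_above (1 - r) (to_descending \<psi>)) (1 - r)"
    and "key_forms \<delta> n g"
  shows "((\<exists>f. nonconstant f \<and> branches_close_to f \<psi> r) \<longleftrightarrow> (\<forall>j\<le>n + 1. g j \<in> poly_ring)) \<and>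
         ((\<forall>j\<le>n + 1. g j \<in> poly_ring) \<longleftrightarrow> g (n + 1) \<in> poly_ring) \<and>
         ((\<exists>f. nonconstant f \<and> branches_close_to f \<psi> r) \<or>
          (\<forall>j\<le>n + 1. g j \<in> poly_ring) \<or> g (n + 1) \<in> poly_ring \<longrightarrow>
          (\<exists>f. to_fract f = g (n + 1) \<and> nonconstant f \<and> branches_close_to f \<psi> r))"
proof -
  obtain Np where Np: "Np > (0::nat)" "\<And>q. \<psi> q \<noteq> 0 \<Longrightarrow> q > 0" "\<And>q. \<psi> q \<noteq> 0 \<Longrightarrow> of_nat Np * q \<in> \<int>"
    using assms(1) unfolding puiseux_series_def by blast
  obtain a b where ab: "quotient_of r = (a, b)" by (cases "quotient_of r")
  then have b: "b > 0" "r = of_int a / of_int b" by (auto simp: quotient_of_denom_pos quotient_of_div)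
  (* A common denominator of r and of the exponents of \<psi>. Every multiple of it serves as
     well; this freedom is needed to accommodate the ramification of f and of the last key form. *)
  define N0 where "N0 = Np * nat b"
  have N0: "N0 > 0" using Np(1) b(1) by (simp add: N0_def)
  have N0r: "\<exists>i. of_nat (N0 * k) * r = of_int i" for k
  proof -
    have "of_nat (nat b) * r = of_int a" using b by simp
    then have "of_nat (N0 * k) * r = of_int (int (Np * k) * a)" by (simp add: N0_def mult_ac)
    then show ?thesis by blast
  qed
  have N0p: "of_nat (N0 * k) * q \<in> \<int>" if "\<psi> q \<noteq> 0" for q k
  proof -
    have "of_nat (N0 * k) * q = of_nat (nat b * k) * (of_nat Np * q)" by (simp add: N0_def mult_ac)
    then show ?thesis using Np(3)[OF that] by (metis Ints_mult Ints_of_nat)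
  qed
  obtain \<nu> where nu: "divisorial_valuation \<nu>" "\<And>z. \<delta> z = - \<nu> z" using assms(3) unfolding semidegree_def by blast
  have val: "\<delta> (x * y) = \<delta> x + \<delta> y" if "x \<noteq> 0" "y \<noteq> 0" for x y
    using nu that unfolding divisorial_valuation_def discrete_valuation_def by simp
  define \<eta> where "\<eta> = (\<lambda>j. \<delta> (g j))"
  let ?step = "\<lambda>\<beta> j \<theta>. \<theta> \<noteq> 0 \<and> g (j + 1) = g j ^ key_alpha \<eta> j - const \<theta> * (\<Prod>i<j. g i powi \<beta> j i)"
  have kf: "(\<forall>j\<le>n + 1. g j \<in> laurent_ring) \<and> g 0 = x_var \<and> g 1 = y_var \<and>
      (\<exists>\<beta>::nat \<Rightarrow> nat \<Rightarrow> int. \<forall>j\<in>{1..n}. \<eta> (j + 1) < int (key_alpha \<eta> j) * \<eta> j \<and>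
         int (key_alpha \<eta> j) * \<eta> j = (\<Sum>i<j. \<beta> j i * \<eta> i) \<and>
         (\<forall>i\<in>{1..<j}. 0 \<le> \<beta> j i \<and> \<beta> j i < int (key_alpha \<eta> i)) \<and> (\<exists>\<theta>. ?step \<beta> j \<theta>)) \<and>
      (\<forall>h\<in>laurent_ring. h \<noteq> 0 \<longrightarrow>
         (\<exists>Z\<in>zpolys (n + 1). zpoly_eval g Z = h \<and> weighted_degree \<eta> Z = \<delta> h) \<and>
         (\<forall>Z\<in>zpolys (n + 1). zpoly_eval g Z = h \<longrightarrow> \<delta> h \<le> weighted_degree \<eta> Z))"
    unfolding \<eta>_def by (rule assms(5)[unfolded key_forms_def Let_def])
  note kf2 = conjunct2[OF kf]
  note kf3 = conjunct2[OF kf2]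
  note kf4 = conjunct2[OF kf3]
  have laur: "g j \<in> laurent_ring" if "j \<le> n + 1" for j using conjunct1[OF kf] that by simp
  have min: "\<exists>Z\<in>zpolys (n + 1). zpoly_eval g Z = h \<and> weighted_degree \<eta> Z = \<delta> h"
    if "h \<in> laurent_ring" "h \<noteq> 0" for h
    by (rule conjunct1[OF mp[OF bspec[OF conjunct2[OF kf4] that(1)] that(2)]])
  obtain \<beta> :: "nat \<Rightarrow> nat \<Rightarrow> int" where kb: "\<forall>j\<in>{1..n}. \<eta> (j + 1) < int (key_alpha \<eta> j) * \<eta> j \<and>
         int (key_alpha \<eta> j) * \<eta> j = (\<Sum>i<j. \<beta> j i * \<eta> i) \<and>
         (\<forall>i\<in>{1..<j}. 0 \<le> \<beta> j i \<and> \<beta> j i < int (key_alpha \<eta> i)) \<and> (\<exists>\<theta>. ?step \<beta> j \<theta>)"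
    using conjunct1[OF kf4] by (rule exE)
  have kd: "\<eta> (j + 1) < int (key_alpha \<eta> j) * \<eta> j" if "j \<in> {1..n}" for j
    using bspec[OF kb that] by (elim conjE)
  have kr: "int (key_alpha \<eta> j) * \<eta> j = (\<Sum>i<j. \<beta> j i * \<eta> i)" if "j \<in> {1..n}" for j
    using bspec[OF kb that] by (elim conjE)
  have kbe: "0 \<le> \<beta> j i \<and> \<beta> j i < int (key_alpha \<eta> i)" if "j \<in> {1..n}" "i \<in> {1..<j}" for i j
  proof -
    have "\<forall>i\<in>{1..<j}. 0 \<le> \<beta> j i \<and> \<beta> j i < int (key_alpha \<eta> i)" using bspec[OF kb that(1)] by (elim conjE)
    then show ?thesis using that(2) by (rule bspec)
  qed
  have "\<forall>j\<in>{1..n}. \<exists>\<theta>. ?step \<beta> j \<theta>"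
  proof
    fix j assume "j \<in> {1..n}"
    from bspec[OF kb this] show "\<exists>\<theta>. ?step \<beta> j \<theta>" by (elim conjE)
  qed
  from bchoice[OF this] obtain \<theta> where th: "\<forall>j\<in>{1..n}. ?step \<beta> j (\<theta> j)" by (rule exE)
  have at_level: "\<exists>\<phi> e. key_data N \<phi> e \<psi> r \<delta> n g \<beta> \<theta> \<eta>" if N: "N = N0 * k" "k > 0" for N k
  proof -
    have Npos: "N > 0" using N N0 by simp
    obtain i where i: "of_nat N * r = of_int i" using N0r N by blast
    define e where "e = i - int N"
    define \<phi> where "\<phi> = Abs_fls (\<lambda>k. if k < e then \<psi> (1 + of_int k / of_nat N) else 0)"
    have phi: "fls_nth \<phi> k = (if k < e then \<psi> (1 + of_int k / of_nat N) else 0)" for k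
      unfolding \<phi>_def
    proof (rule nth_Abs_fls_lower_bound[of "- int N"], intro allI impI)
      fix k assume "k < - int N"
      then have "(of_int k :: rat) < - of_nat N" by (metis of_int_less_iff of_int_minus of_int_of_nat_eq)
      then have "\<not> (1 + of_int k / of_nat N :: rat) > 0" using Npos by (simp add: field_simps)
      then show "(if k < e then \<psi> (1 + of_int k / of_nat N) else 0) = 0" using Np(2) by auto
    qed
    have "key_data N \<phi> e \<psi> r \<delta> n g \<beta> \<theta> \<eta>"
    proof (rule key_data.intro[OF generic.intro[OF Npos] key_data_axioms.intro])
      show "of_int e = of_nat N * (r - 1)" using i by (simp add: e_def algebra_simps)
      show "\<And>q. \<psi> q \<noteq> 0 \<Longrightarrow> of_nat N * q \<in> \<int>" using N0p N by blast
      show "\<eta> = (\<lambda>j. \<delta> (g j))" by (rule \<eta>_def)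
      show "fls_nth \<phi> k = (if k < e then \<psi> (1 + of_int k / of_nat N) else 0)" for k by (rule phi)
      show "q > 0" if "\<psi> q \<noteq> 0" for q using that by (rule Np(2))
      show "generic_descending_puiseux \<delta> (terms_above (1 - r) (to_descending \<psi>)) (1 - r)" by (rule assms(4))
      show "\<delta> (x * y) = \<delta> x + \<delta> y" if "x \<noteq> 0" "y \<noteq> 0" for x y using that by (rule val)
      show "g j \<in> laurent_ring" if "j \<le> n + 1" for j using that by (rule laur)
      show "g 0 = x_var" by (rule conjunct1[OF kf2])
      show "g 1 = y_var" by (rule conjunct1[OF kf3])
      show "\<eta> (j + 1) < int (key_alpha \<eta> j) * \<eta> j" if "j \<in> {1..n}" for j using that by (rule kd)
      show "int (key_alpha \<eta> j) * \<eta> j = (\<Sum>i<j. \<beta> j i * \<eta> i)" if "j \<in> {1..n}" for j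
        using that by (rule kr)
      show "0 \<le> \<beta> j i \<and> \<beta> j i < int (key_alpha \<eta> i)" if "j \<in> {1..n}" "i \<in> {1..<j}" for i j
        using that by (rule kbe)
      show "\<theta> j \<noteq> 0" if "j \<in> {1..n}" for j by (rule conjunct1[OF bspec[OF th that]])
      show "g (j + 1) = g j ^ key_alpha \<eta> j - const (\<theta> j) * (\<Prod>i<j. g i powi \<beta> j i)" if "j \<in> {1..n}" for j
        by (rule conjunct2[OF bspec[OF th that]])
      show "\<exists>Z\<in>zpolys (n + 1). zpoly_eval g Z = h \<and> weighted_degree \<eta> Z = \<delta> h"
        if "h \<in> laurent_ring" "h \<noteq> 0" for h using that by (rule min)
    qed
    then show ?thesis by blast
  qed
  (* A curve as in (1), made monic, and the last key form split over the same field of Laurent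
     series. *)
  have imp12: "\<forall>j\<le>n + 1. g j \<in> poly_ring" if F: "nonconstant F" "branches_close_to F \<psi> r" for F
  proof -
    have "degree F > 0" "degree (lead_coeff F) = 0" using monic_if_branches_close[OF F] by auto
    then obtain c where c: "lead_coeff F = [:c:]" by (metis degree_eq_zeroE)
    have cz: "c \<noteq> 0" using c \<open>degree F > 0\<close> by auto
    define f where "f = smult [:inverse c:] F"
    have fF: "f dvd F"
    proof
      show "F = f * [:[:c:]:]" using cz by (simp add: f_def one_pCons[symmetric])
    qed
    have f: "lead_coeff f = 1" "degree f > 0" using c cz \<open>degree F > 0\<close> by (auto simp: f_def one_pCons)
    then have fz: "f \<noteq> 0" by auto
    obtain N1 where N1: "N1 > 0" "splits f F N1" using splits_all[OF fz fF] by blast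
    obtain q i where qi: "g (n + 1) = to_fract q * x_var powi i" using laur[of "n + 1"] unfolding laurent_ring_def poly_ring_def by blast
    obtain \<phi>1 e1 where k1: "key_data N0 \<phi>1 e1 \<psi> r \<delta> n g \<beta> \<theta> \<eta>" using at_level[of N0 1] by auto
    have "g (n + 1) \<noteq> 0" using key_data.g_nz[OF k1] by simp
    then have qz: "q \<noteq> 0" using qi by auto
    obtain N2 where N2: "N2 > 0" "splits q q N2" using splits_all[OF qz dvd_refl] by blast
    define N where "N = N0 * (N1 * N2)"
    have Npos: "N > 0" using N0 N1 N2 by (simp add: N_def)
    obtain \<phi> e where "key_data N \<phi> e \<psi> r \<delta> n g \<beta> \<theta> \<eta>" using at_level[of N "N1 * N2"] N1 N2 N_def by auto
    then interpret key_data N \<phi> e \<psi> r \<delta> n g \<beta> \<theta> \<eta> .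
    interpret u: rhom "Up N" by (rule rhom_Up[OF Npos])
    have "splits f F N" using splits_mult[OF N1(2,1), of "N0 * N2"] N0 N2 by (simp add: N_def mult_ac)
    then obtain ys where ys: "Up N (embP f) = (\<Prod>y\<leftarrow>ys. [:- y, 1:])" "\<And>y. y \<in> set ys \<Longrightarrow> branch_root F N y"
      unfolding splits_def f(1) emb.one using Npos by auto
    have "splits q q N" using splits_mult[OF N2(2,1), of "N0 * N1"] N0 N1 by (simp add: N_def mult_ac)
    then obtain zs where zs: "Up N (embP q) = smult (cp N (emb (lead_coeff q))) (\<Prod>y\<leftarrow>zs. [:- y, 1:])"
      unfolding splits_def by auto
    have "as_fls (g (n + 1)) (smult (fls_X_intpow (- i)) (embP q))" unfolding qi as_fls_def by blast
    then have Gq: "G (n + 1) = smult (fls_X_intpow (- i)) (embP q)" using as_fls_unique[OF as_fls_G] by blast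
    define d where "d = cp N (fls_X_intpow (- i)) * cp N (emb (lead_coeff q))"
    have UG: "Up N (G (n + 1)) = smult d (\<Prod>y\<leftarrow>zs. [:- y, 1:])"
      unfolding Gq d_def using zs rhom.mp_smult[OF rhom_cp[OF Npos]] by (simp add: Up_def)
    have lp: "lead_coeff (\<Prod>y\<leftarrow>zs. [:- y, 1:]) = (1 :: complex fls)" for zs
      by (induction zs) (simp_all del: mult_pCons_left add: lead_coeff_mult)
    have "lead_coeff (Up N (G (n + 1))) = 1"
      using degree_G_top Npos by (simp add: degree_Up coeff_Up)
    moreover have "lead_coeff (Up N (G (n + 1))) = d" unfolding UG lead_coeff_smult lp by simp
    ultimately have d1: "d = 1" by simp
    have idx: "(\<Prod>y\<leftarrow>xs. [:- y, 1:]) = (\<Prod>i<length xs. [:- (xs ! i), 1:])" for xs :: "complex fls list"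
      by (simp add: prod.list_conv_set_nth atLeast0LessThan)
    have ccy: "conj_close y" if y: "y \<in> set ys" for y
    proof -
      obtain p m Yf L where b: "p > 0" "m > 0" "N = p * m" "Yf has_laurent_expansion L" "y = cp m L"
        "branch_at_infinity F (\<lambda>t. 1 / t ^ p) Yf" using ys(2)[OF y] branch_root_def by auto
      obtain \<theta>' where t: "puiseux_expansion_at_O (\<lambda>t. 1 / t ^ p) Yf \<theta>'" "ord_diff_ge \<theta>' \<psi> r"
        using F(2) b(6) unfolding branches_close_to_def by blast
      obtain \<zeta> where "\<zeta> \<in> unity_roots p" "\<forall>q. \<theta>' q \<noteq> 0 \<longrightarrow> of_nat p * q \<in> \<int>"
        "\<forall>k. fls_nth L k = \<theta>' (1 + of_int k / of_nat p) * \<zeta> powi k" using puiseux_laurent[OF t(1) b(1,4)] by blast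
      then show ?thesis unfolding b(5) using t(2) by (intro conj_close_of_expansion[OF b(1-3)]) auto
    qed
    show ?thesis
    proof (rule key_forms_polynomial)
      show "Up N (embP f) = (\<Prod>i<length ys. [:- (ys ! i), 1:])" unfolding ys(1) idx ..
      show "Up N (G (n + 1)) = (\<Prod>i<length zs. [:- (zs ! i), 1:])" unfolding UG d1 idx by simp
      show "conj_close (ys ! i)" if "i \<in> {..<length ys}" for i using ccy that by simp
    qed (use f in auto)
  qed
  (* The roots of the last key form are conjugate to close ones, and each branch yields such a
     root. *)
  have imp31: "\<exists>f. to_fract f = g (n + 1) \<and> nonconstant f \<and> branches_close_to f \<psi> r" if P: "g (n + 1) \<in> poly_ring"
  proof -
    obtain f where f: "g (n + 1) = to_fract f" using P poly_ring_def by auto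
    obtain \<phi>1 e1 where k1: "key_data N0 \<phi>1 e1 \<psi> r \<delta> n g \<beta> \<theta> \<eta>" using at_level[of N0 1] by auto
    interpret k1: key_data N0 \<phi>1 e1 \<psi> r \<delta> n g \<beta> \<theta> \<eta> by (rule k1)
    have GF: "k1.G (n + 1) = embP f" using as_fls_unique[OF k1.as_fls_G[of "n + 1"]] as_fls_poly[of f] f by simp
    have "emb (lead_coeff f) = emb 1" using k1.degree_G_top(2) unfolding GF degree_embP coeff_embP emb.one .
    then have lf: "lead_coeff f = 1" by (rule emb_inj)
    have df: "degree f > 0" using k1.degree_G_top(1) k1.D_pos[of "n + 1"] unfolding GF degree_embP by simp
    then have fz: "f \<noteq> 0" by auto
    obtain N2 where N2: "N2 > 0" "splits f f N2" using splits_all[OF fz dvd_refl] by blast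
    have nc: "nonconstant f" using df by (auto simp: nonconstant_def)
    have "branches_close_to f \<psi> r"
      unfolding branches_close_to_def
    proof (intro allI impI)
      fix X Y assume br: "branch_at_infinity f X Y"
      obtain p s Z L where nf: "p > (0::nat)" "s analytic_on {0}" "s 0 = 0" "deriv s 0 \<noteq> 0"
        "\<forall>\<^sub>F t in at 0. 1 / X t = s t ^ p" "\<forall>\<^sub>F t in at 0. Y t = Z (s t)" "filterlim s (at 0) (at 0)"
        "Z has_laurent_expansion L" "\<forall>\<^sub>F t in at 0. eval2 f (1 / t ^ p) (Z t) = 0" "is_pole X 0"
        by (rule branch_normal_form[OF br lf df])
      (* A denominator that accommodates the roots of f and the parametrization of the given
         branch. *)
      define m where "m = N0 * N2"
      have m: "m > 0" using N0 N2 by (simp add: m_def)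
      define N where "N = N0 * (N2 * p)"
      have Npm: "N = p * m" by (simp add: N_def m_def mult_ac)
      have Npos: "N > 0" using Npm nf(1) m by simp
      obtain \<phi> e where "key_data N \<phi> e \<psi> r \<delta> n g \<beta> \<theta> \<eta>" using at_level[of N "N2 * p"] N2 nf(1) N_def by auto
      then interpret key_data N \<phi> e \<psi> r \<delta> n g \<beta> \<theta> \<eta> .
      have "splits f f N" using splits_mult[OF N2(2,1), of "N0 * p"] N0 nf(1) by (simp add: N_def mult_ac)
      then obtain ys where ys: "Up N (embP f) = (\<Prod>y\<leftarrow>ys. [:- y, 1:])"
        unfolding splits_def lf emb.one using Npos by auto
      have Gf: "G (n + 1) = embP f" using as_fls_unique[OF as_fls_G[of "n + 1"]] as_fls_poly[of f] f by simp
      have idx: "(\<Prod>y\<leftarrow>ys. [:- y, 1:]) = (\<Prod>i<length ys. [:- (ys ! i), 1:])"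
        by (simp add: prod.list_conv_set_nth atLeast0LessThan)
      have "poly (Up N (embP f)) (cp m L) = 0" unfolding Npm by (rule laurent_root[OF nf(8,1) m nf(9)])
      then obtain i where i: "i < length ys" "cp m L = ys ! i" unfolding ys idx by (auto simp: poly_prod)
      have "conj_close (cp m L)" unfolding i(2)
        by (rule roots_of_last_key[of "{..<length ys}" "\<lambda>i. ys ! i"]) (use i ys idx Gf in auto)
      then obtain \<zeta> where z: "\<zeta> \<in> unity_roots p"
        "\<And>k. 1 + of_int k / of_nat p < r \<Longrightarrow> \<zeta> powi k * fls_nth L k = \<psi> (1 + of_int k / of_nat p)"
        "\<And>q. q < r \<Longrightarrow> of_nat p * q \<notin> \<int> \<Longrightarrow> \<psi> q = 0"
        using expansion_of_conj_close[OF nf(1) m Npm] by blast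
      show "meets_at_O X Y \<and> (\<exists>\<theta>. puiseux_expansion_at_O X Y \<theta> \<and> ord_diff_ge \<theta> \<psi> r)"
        by (rule expansion_from_normal_form[OF nf(1-8,10) z(1) assms(2) Np(2) z(2,3)])
    qed
    then show ?thesis using f nc by auto
  qed
  have imp23: "g (n + 1) \<in> poly_ring" if "\<forall>j\<le>n + 1. g j \<in> poly_ring" using that by blast
  show ?thesis using imp12 imp31 imp23 by blast
qed

end
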